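(* Let $p\ge 5$ be a prime and put $$c_p=\frac{2}{3}\cdot\left(1-\frac{p}{(p-1)^2}\right)\cdot\frac{1}{p+1},$$ so that $0<c_p<1$. Let $\kappa\in\mathcal{B}\setminus\{1\}$ and let $O$ be the ring of integers of the extension of $\mathbb{Q}_p$ generated by the values of $\kappa$. Then $$\frac{E^{\ast}_{\kappa}}{V(E^{\ast}_{\kappa})}\in M_0\bigl(O,\ \ge c_p\cdot\min\{1,v_p(w(\kappa))\}\bigr).$$
   Context: $v_p$ is the $p$-adic valuation on $\mathbb{C}_p$ with $v_p(p)=1$. For a modular form or $q$-expansion, $v_p$ denotes the minimum of the valuations of its $q$-expansion coefficients. $\mathcal{W}$ is the group of continuous characters $\mathbb{Z}_p^\times\to\mathbb{C}_p^\times$. $\mathcal{B}\subseteq\mathcal{W}$ is the subgroup of characters that are trivial on the $(p-1)$st roots of unity. For $\kappa\in\mathcal{W}$ put $w(\kappa)=\kappa(1+p)-1$. For $\kappa\in\mathcal{B}\setminus\{1\}$, $E^\ast_\kappa$ is the $p$-adic Eisenstein series with $q$-expansion $$E^\ast_\kappa=1+\frac{2}{\zeta^\ast(\kappa)}\sum_{n\ge1}\Bigl(\sum_{d\mid n,\ p\nmid d}\kappa(d)d^{-1}\Bigr)q^n,$$ where $\zeta^\ast$ is the $p$-adic zeta function on $\mathcal{W}$. $V$ is the Frobenius operator $q\mapsto q^p$ on $q$-expansions. $E_{k}$ denotes the normalized level-one Eisenstein series of weight $k$. Katz expansions. Let $M_k(R)$ be the level-one modular forms of weight $k$ with coefficients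 in $R$, and let $d_k=\dim M_k(\mathbb{Q}_p)$. For each $i\ge1$ fix a splitting $M_{i(p-1)}(\mathbb{Z}_p)=E_{p-1}M_{(i-1)(p-1)}(\mathbb{Z}_p)\oplus B_i(\mathbb{Z}_p)$. Here $B_i(\mathbb{Z}_p)$ is the free $\mathbb{Z}_p$-module with basis forms $g_{i,j}\in M_{i(p-1)}(\mathbb{Z}_p)$, for $d_{(i-1)(p-1)}\le j\le d_{i(p-1)}-1$, whose $q$-expansion begins $q^j+O(q^{j+1})$. Put $B_0(\mathbb{Z}_p)=\mathbb{Z}_p$ and $B_i(O)=B_i(\mathbb{Z}_p)\otimes O$. For $r\in O$ (with $O$ the ring of integers of a finite extension of $\mathbb{Q}_p$), $M_0(O,r)$ denotes the $r$-overconvergent $p$-adic modular functions of tame level $1$ (weight $0$, holomorphic at $\infty$) over $O$. Each such $f$ has a unique Katz expansion $f=\sum_{i\ge0}b_i/E_{p-1}^i$ with $b_i\in B_i(O)$, $v_p(b_i)\ge i\,v_p(r)$ and $v_p(b_i)-i\,v_p(r)\to\infty$. For rational $\rho\in[0,1]$, $M_0(O,\ge\rho)$ is the set of $f$ lying in some $M_0(O,r)$ whose Katz expansion coefficients satisfy $v_p(b_i)\ge\rho i$ for all $i$. Equivalently, $f\in M_0(O',r')$ for all finite extensions with ring of integers $O'$ and all $r'\in O'$ with $v_p(r')<\rho$. *)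

theory Defs
  imports
    "HOL-Complex_Analysis.Complex_Analysis"
    "HOL-Number_Theory.Modular_Inverse"
    "HOL-Library.FuncSet"
begin

text \<open>
  The field $\mathbf{C}_p$ is the completion of an algebraic closure of $\mathbf{Q}_p$. It is given
  here by the properties that determine it up to isometric isomorphism: a complete, algebraically
  closed field of characteristic 0 whose metric comes from a valuation \<open>v\<close> with \<open>v p = 1\<close>,
  in which the elements algebraic over $\mathbf{Q}_p$ (the closure of the rationals) are dense.
\<close>

definition Qp :: "'a :: {field_char_0, metric_space} set" where
  "Qp = closure \<rat>"

locale Cp =
  fixes p :: nat and v :: "'a :: {alg_closed_field, field_char_0, complete_space} \<Rightarrow> ereal"
  assumes prime_p: "prime p"
    and v_eq_infinity_iff: "v x = \<infinity> \<longleftrightarrow> x = 0"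
    and v_not_minus_infinity: "v x \<noteq> -\<infinity>"
    and v_mult: "v (x * y) = v x + v y"
    and v_add: "min (v x) (v y) \<le> v (x + y)"
    and v_p: "v (of_nat p) = 1"
    and dist_v: "dist x y = (if x = y then 0 else real p powr (- real_of_ereal (v (x - y))))"
    and dense_algebraic:
      "closure {x :: 'a. \<exists>P. P \<noteq> 0 \<and> (\<forall>i. poly.coeff P i \<in> Qp) \<and> poly P x = 0} = UNIV"

definition integers_of :: "('a \<Rightarrow> ereal) \<Rightarrow> 'a set \<Rightarrow> 'a set" where
  "integers_of v K = {x \<in> K. 0 \<le> v x}"

definition Zp :: "('a :: {field_char_0, metric_space} \<Rightarrow> ereal) \<Rightarrow> 'a set" where
  "Zp v = integers_of v Qp"

definition Zp_units :: "('a :: {field_char_0, metric_space} \<Rightarrow> ereal) \<Rightarrow> 'a set" where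
  "Zp_units v = {x \<in> Zp v. v x = 0}"

definition v_fps :: "('a \<Rightarrow> ereal) \<Rightarrow> 'a fps \<Rightarrow> ereal" where
  "v_fps v f = (INF n. v (fps_nth f n))"


subsection \<open>Weights\<close>

definition weights :: "('a :: {field_char_0, metric_space} \<Rightarrow> ereal) \<Rightarrow> ('a \<Rightarrow> 'a) set" where
  "weights v = {\<kappa> \<in> Zp_units v \<rightarrow>\<^sub>E UNIV - {0}.
     (\<forall>x \<in> Zp_units v. \<forall>y \<in> Zp_units v. \<kappa> (x * y) = \<kappa> x * \<kappa> y) \<and>
     continuous_on (Zp_units v) \<kappa>}"

definition trivial_weight :: "('a :: {field_char_0, metric_space} \<Rightarrow> ereal) \<Rightarrow> 'a \<Rightarrow> 'a" where
  "trivial_weight v = (\<lambda>x \<in> Zp_units v. 1)"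

definition weights_B ::
    "nat \<Rightarrow> ('a :: {field_char_0, metric_space} \<Rightarrow> ereal) \<Rightarrow> ('a \<Rightarrow> 'a) set" where
  "weights_B p v = {\<kappa> \<in> weights v. \<forall>x \<in> Zp_units v. x ^ (p - 1) = 1 \<longrightarrow> \<kappa> x = 1}"

definition weight_w :: "nat \<Rightarrow> ('a :: field_char_0 \<Rightarrow> 'a) \<Rightarrow> 'a" where
  "weight_w p \<kappa> = \<kappa> (1 + of_nat p) - 1"

definition is_subfield :: "'a :: field set \<Rightarrow> bool" where
  "is_subfield K \<longleftrightarrow> 1 \<in> K \<and> (\<forall>x \<in> K. \<forall>y \<in> K. x - y \<in> K \<and> x * y \<in> K \<and> x / y \<in> K)"

text \<open>
  The extension of $\mathbf{Q}_p$ generated by the values of a weight, as a closed subfield of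
  $\mathbf{C}_p$. Finite extensions of $\mathbf{Q}_p$ are complete, hence closed, so closedness
  changes nothing when the values generate a finite extension.
\<close>

definition value_field :: "('a :: {field_char_0, metric_space} \<Rightarrow> ereal) \<Rightarrow> ('a \<Rightarrow> 'a) \<Rightarrow> 'a set" where
  "value_field v \<kappa> = \<Inter>{K. is_subfield K \<and> closed K \<and> Qp \<union> \<kappa> ` Zp_units v \<subseteq> K}"


subsection \<open>The \<open>p\<close>-adic zeta function and the \<open>p\<close>-adic Eisenstein series\<close>

text \<open>
  The value on $a + p^n \mathbf{Z}_p$ of the Bernoulli measure
  $E_{1,c}(a + p^n \mathbf{Z}_p) = B_1(\{a/p^n\}) - c\,B_1(\{c^{-1}a/p^n\})$, where $B_1(x) = x - 1/2$
  and $c^{-1}$ is an inverse modulo $p^n$.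
\<close>

definition bernoulli_measure :: "nat \<Rightarrow> nat \<Rightarrow> nat \<Rightarrow> nat \<Rightarrow> rat" where
  "bernoulli_measure p c n a =
     (frac (of_nat a / of_nat (p ^ n)) - 1 / 2) -
     of_nat c * (frac (of_int (modular_inverse (int (p ^ n)) (int c) * int a) / of_nat (p ^ n)) - 1 / 2)"

text \<open>
  $\zeta^*(\kappa) = (\kappa(c)-1)^{-1} \int_{\mathbf{Z}_p^\times} \kappa(a) a^{-1} \, dE_{1,c}(a)$,
  which does not depend on the choice of $c$ prime to $p$ with $\kappa(c) \neq 1$. For
  $\kappa(a) = a^k$ with $k \ge 2$ even this is $(1 - p^{k-1})\zeta(1-k)$. The integral is the limit
  of its Riemann sums.
\<close>

definition zeta_integral :: "nat \<Rightarrow> nat \<Rightarrow> ('a :: {field_char_0, metric_space} \<Rightarrow> 'a) \<Rightarrow> 'a" where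
  "zeta_integral p c \<kappa> =
     lim (\<lambda>n. \<Sum>a | a < p ^ n \<and> \<not> p dvd a.
                \<kappa> (of_nat a) / of_nat a * of_rat (bernoulli_measure p c n a))"

definition zeta_star :: "nat \<Rightarrow> ('a :: {field_char_0, metric_space} \<Rightarrow> 'a) \<Rightarrow> 'a" where
  "zeta_star p \<kappa> =
     (let c = (SOME c :: nat. coprime c p \<and> \<kappa> (of_nat c) \<noteq> 1)
      in zeta_integral p c \<kappa> / (\<kappa> (of_nat c) - 1))"

definition eisenstein_star :: "nat \<Rightarrow> ('a :: {field_char_0, metric_space} \<Rightarrow> 'a) \<Rightarrow> 'a fps" where
  "eisenstein_star p \<kappa> = Abs_fps (\<lambda>n. if n = 0 then 1 else
     2 / zeta_star p \<kappa> * (\<Sum>d | d dvd n \<and> \<not> p dvd d. \<kappa> (of_nat d) / of_nat d))"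

definition frobenius_V :: "nat \<Rightarrow> 'a :: field fps \<Rightarrow> 'a fps" where
  "frobenius_V p f = f oo (fps_X ^ p)"


subsection \<open>Level one modular forms\<close>

text \<open>\<open>a\<close> is the sequence of \<open>q\<close>-expansion coefficients of a holomorphic modular form of weight \<open>k\<close>
  for the full modular group.\<close>

definition modular_qexp :: "nat \<Rightarrow> (nat \<Rightarrow> complex) \<Rightarrow> bool" where
  "modular_qexp k a \<longleftrightarrow> (\<exists>f. f holomorphic_on {z. Im z > 0} \<and>
     (\<forall>A B C D :: int. A * D - B * C = 1 \<longrightarrow> (\<forall>z. Im z > 0 \<longrightarrow>
        f ((of_int A * z + of_int B) / (of_int C * z + of_int D)) =
        (of_int C * z + of_int D) ^ k * f z)) \<and>
     (\<forall>z. Im z > 0 \<longrightarrow>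
        (\<lambda>n. a n * exp (2 * of_real pi * \<i> * of_nat n * z)) sums f z))"

definition span_over :: "'a :: field set \<Rightarrow> 'a fps set \<Rightarrow> 'a fps set" where
  "span_over R S =
     {\<Sum>s\<in>T. fps_const (c s) * s |T c. finite T \<and> T \<subseteq> S \<and> (\<forall>s\<in>T. c s \<in> R)}"

definition indep_over :: "'a :: field set \<Rightarrow> 'a fps set \<Rightarrow> bool" where
  "indep_over R S \<longleftrightarrow> (\<forall>T c. finite T \<and> T \<subseteq> S \<and> (\<forall>s\<in>T. c s \<in> R) \<and>
     (\<Sum>s\<in>T. fps_const (c s) * s) = 0 \<longrightarrow> (\<forall>s\<in>T. c s = 0))"

definition dim_over :: "'a :: field set \<Rightarrow> 'a fps set \<Rightarrow> nat" where
  "dim_over K M = (THE n. \<exists>S. finite S \<and> card S = n \<and> indep_over K S \<and> span_over K S = M)"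

text \<open>$M_k(R) = M_k(\mathbf{Z}) \otimes R$, as a module of \<open>q\<close>-expansions.\<close>

definition modforms :: "nat \<Rightarrow> 'a :: field_char_0 set \<Rightarrow> 'a fps set" where
  "modforms k R = span_over R
     {Abs_fps (\<lambda>n. of_int (a n)) |a :: nat \<Rightarrow> int. modular_qexp k (\<lambda>n. of_int (a n))}"

definition dim_modforms :: "nat \<Rightarrow> 'a :: {field_char_0, metric_space} itself \<Rightarrow> nat" where
  "dim_modforms k (_ :: 'a itself) = dim_over Qp (modforms k (Qp :: 'a set))"

text \<open>Generating function: $X / (e^X - 1) = \sum_k B_k X^k / k!$.\<close>

definition bernoulli_number :: "nat \<Rightarrow> 'a :: field_char_0" where
  "bernoulli_number k = fact k * fps_nth (inverse (Abs_fps (\<lambda>n. 1 / fact (Suc n)))) k"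

definition eisenstein :: "nat \<Rightarrow> 'a :: field_char_0 fps" where
  "eisenstein k = Abs_fps (\<lambda>n. if n = 0 then 1 else
     - (2 * of_nat k / bernoulli_number k) * (\<Sum>d | d dvd n. of_nat d ^ (k - 1)))"


subsection \<open>Katz expansions and overconvergent modular functions\<close>

definition katz_indices :: "nat \<Rightarrow> nat \<Rightarrow> 'a :: {field_char_0, metric_space} itself \<Rightarrow> nat set" where
  "katz_indices p i T = {dim_modforms ((i - 1) * (p - 1)) T ..< dim_modforms (i * (p - 1)) T}"

definition katz_B ::
    "nat \<Rightarrow> (nat \<Rightarrow> nat \<Rightarrow> 'a fps) \<Rightarrow> 'a :: {field_char_0, metric_space} set \<Rightarrow> nat \<Rightarrow> 'a fps set" where
  "katz_B p g R i =
     (if i = 0 then fps_const ` R else span_over R (g i ` katz_indices p i TYPE('a)))"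

text \<open>The admissible choices of the forms $g_{i,j}$. Their linear independence is a consequence of
  the shape of their leading terms.\<close>

definition katz_splitting ::
    "nat \<Rightarrow> ('a :: {field_char_0, metric_space} \<Rightarrow> ereal) \<Rightarrow> (nat \<Rightarrow> nat \<Rightarrow> 'a fps) \<Rightarrow> bool" where
  "katz_splitting p v g \<longleftrightarrow> (\<forall>i\<ge>1.
     (\<forall>j \<in> katz_indices p i TYPE('a).
        g i j \<in> modforms (i * (p - 1)) (Zp v) \<and>
        fps_nth (g i j) j = 1 \<and> (\<forall>m<j. fps_nth (g i j) m = 0)) \<and>
     modforms (i * (p - 1)) (Zp v) =
       {eisenstein (p - 1) * h + b |h b.
          h \<in> modforms ((i - 1) * (p - 1)) (Zp v) \<and> b \<in> katz_B p g (Zp v) i} \<and>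
     (\<lambda>h. eisenstein (p - 1) * h) ` modforms ((i - 1) * (p - 1)) (Zp v) \<inter> katz_B p g (Zp v) i = {0})"

text \<open>
  Convergence of a series of \<open>q\<close>-expansions for the \<open>p\<close>-adic topology of the coefficients (the
  topology on formal power series in the library is the one defined by the powers of \<open>q\<close>).
\<close>

definition qexp_sums :: "(nat \<Rightarrow> 'a :: {field, metric_space} fps) \<Rightarrow> 'a fps \<Rightarrow> bool" where
  "qexp_sums F f \<longleftrightarrow> (\<forall>n. (\<lambda>i. fps_nth (F i) n) sums fps_nth f n)"

text \<open>
  $M_0(R,r)$ by \<open>q\<close>-expansions: with $Y E_{p-1} = r$, the \<open>r\<close>-overconvergent functions
  form the \<open>p\<close>-adic completion of
  $\bigl(\bigoplus_i M_{i(p-1)}(R)\, Y^i\bigr) / (Y E_{p-1} - r)$ (Katz), and $Y$ has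
  \<open>q\<close>-expansion $r / E_{p-1}$.
\<close>

definition overconvergent ::
    "nat \<Rightarrow> ('a :: {field_char_0, metric_space} \<Rightarrow> ereal) \<Rightarrow> 'a set \<Rightarrow> 'a \<Rightarrow> 'a fps set" where
  "overconvergent p v R r = {f. \<exists>a.
     (\<forall>i. a i \<in> modforms (i * (p - 1)) R) \<and>
     (\<lambda>i. v_fps v (a i)) \<longlonglongrightarrow> \<infinity> \<and>
     qexp_sums (\<lambda>i. a i * (fps_const r / eisenstein (p - 1)) ^ i) f}"

definition katz_expansion ::
    "nat \<Rightarrow> ('a :: {field_char_0, metric_space} \<Rightarrow> ereal) \<Rightarrow> (nat \<Rightarrow> nat \<Rightarrow> 'a fps) \<Rightarrow>
     'a set \<Rightarrow> 'a \<Rightarrow> (nat \<Rightarrow> 'a fps) \<Rightarrow> 'a fps \<Rightarrow> bool" where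
  "katz_expansion p v g R r b f \<longleftrightarrow>
     (\<forall>i. b i \<in> katz_B p g R i \<and> ereal (real i) * v r \<le> v_fps v (b i)) \<and>
     (\<lambda>i. v_fps v (b i) - ereal (real i) * v r) \<longlonglongrightarrow> \<infinity> \<and>
     qexp_sums (\<lambda>i. b i / eisenstein (p - 1) ^ i) f"

definition overconvergent_ge ::
    "nat \<Rightarrow> ('a :: {field_char_0, metric_space} \<Rightarrow> ereal) \<Rightarrow> (nat \<Rightarrow> nat \<Rightarrow> 'a fps) \<Rightarrow>
     'a set \<Rightarrow> ereal \<Rightarrow> 'a fps set" where
  "overconvergent_ge p v g R \<rho> = {f. \<exists>r \<in> R. f \<in> overconvergent p v R r \<and>
     (\<exists>b. katz_expansion p v g R r b f \<and> (\<forall>i. \<rho> * ereal (real i) \<le> v_fps v (b i)))}"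

definition c_const :: "nat \<Rightarrow> real" where
  "c_const p = 2 / 3 * (1 - real p / (real p - 1)\<^sup>2) * (1 / (real p + 1))"

end

theory Submission
  imports Defs
begin

text \<open>
  Write \<open>E = E\<^sub>p\<^sub>-\<^sub>1\<close>. Every \<open>q\<close>-expansion has unique coordinates with respect to the functions
  \<open>g\<^sub>i\<^sub>,\<^sub>j / E\<^sup>i\<close>, and overconvergence of rate \<open>\<rho>\<close> means that the coordinates at level \<open>i\<close> have
  valuation at least \<open>\<rho> i\<close>. The trace of a level \<open>p\<close> form shows that \<open>V(h) / E\<^sup>i\<close>, for \<open>h\<close> of weight
  \<open>i (p - 1)\<close>, has coordinates of valuation at least \<open>(l - i p) (p - 1) / p\<close> at level \<open>l\<close>. For the
  classical weights \<open>m (p - 1)\<close> the series \<open>E\<^sup>*\<close> is a combination of \<open>E\<^sub>k\<close> and \<open>V(E\<^sub>k)\<close>; its quotient by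
  \<open>E\<^sup>m\<close> is a sum of binomial coefficients in \<open>m\<close> times finite differences, which are small both
  \<open>p\<close>-adically and at high level, so the rate is bounded independently of \<open>m\<close>. Hence \<open>E\<^sup>* / V(E\<^sup>*)\<close>
  converges at one rate \<open>2 / (3 (p + 1))\<close> for all classical weights. Its coordinates are Iwasawa functions
  of the weight (power series in \<open>w\<close> with integral coefficients, up to approximation), and Newton
  interpolation at the classical weights extends the bound to all weights, at the cost of the factor
  \<open>(p - 1) / p\<close> from the denominators \<open>n!\<close> and of \<open>min {1, v(w)}\<close>.
\<close>

section \<open>Level one modular forms over the complex numbers\<close>

text \<open>A bound for a single classical weight k = m (p - 1) degrades with m: divided by E^m, the
  series E_k has coordinates at all levels up to m. Expanding in binomial coefficients of m repairs
  this, because the n-th difference involves only weights up to n (p - 1): above level n no E_k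
  contributes, and up to level n the divisibility of the difference by p^n is enough. The
  coordinates depend on the q-coefficients through a unipotent triangular matrix with entries in
  Z_p. Hence they exist for every power series, each is a finite integral combination of
  q-coefficients, and each can be interpolated in the weight on its own. The rate 2 / (3 (p + 1)) is
  \<open>sigma / p\<close> with \<open>sigma = 2 p / (3 (p + 1))\<close>: the quotients by E^m have
  rate \<open>sigma\<close>, and V multiplies pole orders by p. Complex analysis enters only through
  integral q-expansions: modularity is proved over the complex numbers and read p-adically, since
  every space of forms is spanned by integral expansions.\<close>

definition nome :: "complex \<Rightarrow> complex" where
  "nome z = exp (2 * of_real pi * \<i> * z)"

text \<open>Convergence on the open unit disc encodes holomorphy on the upper half plane and at the
  cusp together. The expansion itself is the object, so that it can be transported to other
  coefficient rings.\<close>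

definition mform :: "nat \<Rightarrow> complex fps \<Rightarrow> bool" where
  "mform k F \<longleftrightarrow> fps_conv_radius F \<ge> 1 \<and> (\<forall>A B C D :: int. A * D - B * C = 1 \<longrightarrow>
     (\<forall>z. Im z > 0 \<longrightarrow> eval_fps F (nome ((of_int A * z + of_int B) / (of_int C * z + of_int D))) =
        (of_int C * z + of_int D) ^ k * eval_fps F (nome z)))"

lemma norm_nome: "norm (nome z) = exp (- 2 * pi * Im z)"
  by (simp add: nome_def)

lemma norm_nome_less_1: "Im z > 0 \<Longrightarrow> norm (nome z) < 1"
  by (simp add: norm_nome)

lemma nome_power: "nome z ^ n = exp (2 * of_real pi * \<i> * of_nat n * z)"
  by (simp add: nome_def exp_of_nat_mult [symmetric] mult_ac)

lemma nome_add_of_int [simp]: "nome (z + of_int n) = nome z"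
proof -
  have "2 * of_real pi * \<i> * (z + of_int n) = 2 * of_real pi * \<i> * z + 2 * of_int n * of_real pi * \<i>"
    by (simp add: algebra_simps)
  moreover have "exp (2 * of_int n * of_real pi * \<i>) = 1"
    using exp_integer_2pi[of "of_int n"] by (simp add: mult_ac)
  ultimately show ?thesis
    by (simp add: nome_def exp_add)
qed

lemma nome_add_1 [simp]: "nome (z + 1) = nome z"
  using nome_add_of_int[of z 1] by simp

lemma nome_surj:
  assumes "q \<noteq> 0" "norm q < 1"
  obtains z where "Im z > 0" "nome z = q"
proof
  define z where "z = Ln q / (2 * of_real pi * \<i>)"
  show "nome z = q"
    using assms by (simp add: nome_def z_def)
  then have "exp (- 2 * pi * Im z) < 1"
    using assms norm_nome[of z] by simp
  then show "Im z > 0"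
    by (simp add: zero_less_mult_iff)
qed

lemma Im_moebius:
  fixes A B C D :: int
  assumes "A * D - B * C = 1" "Im z > 0"
  shows "Im ((of_int A * z + of_int B) / (of_int C * z + of_int D)) > 0"
    and "(of_int C * z + of_int D :: complex) \<noteq> 0"
proof -
  show nz: "(of_int C * z + of_int D :: complex) \<noteq> 0"
  proof
    assume eq: "(of_int C * z + of_int D :: complex) = 0"
    then have "of_int C * Im z = 0"
      by (metis Im_complex_of_real add.right_neutral complex_Im_of_int  plus_complex.simps(2) times_complex.simps(2) complex_Re_of_int  mult_zero_left zero_complex.simps(2))
    then have "C = 0" using assms by simp
    moreover have "D = 0" using eq \<open>C = 0\<close> by simp
    ultimately show False using assms by simp
  qed
  have "Im ((of_int A * z + of_int B) * cnj (of_int C * z + of_int D)) = of_int (A * D - B * C) * Im z"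
    by (simp add: algebra_simps)
  then have "Im ((of_int A * z + of_int B) / (of_int C * z + of_int D)) =
      Im z / (norm (of_int C * z + of_int D :: complex))\<^sup>2"
    using assms(1)
    by (subst complex_div_cnj) (simp add: Im_divide_of_real flip: of_real_power)
  then show "Im ((of_int A * z + of_int B) / (of_int C * z + of_int D)) > 0"
    using nz assms(2) by simp
qed

text \<open>Euclid's algorithm on the first column. With A = n C + r the transformation is a
  translation by n after the inversion after a matrix with lower left entry r, and |r| < |C|; so
  induction on |C| reduces everything to the two generators.\<close>

lemma SL2_transformation:
  fixes f :: "complex \<Rightarrow> complex" and A B C D :: int
  assumes T: "\<And>z. Im z > 0 \<Longrightarrow> f (z + 1) = f z"
    and S: "\<And>z. Im z > 0 \<Longrightarrow> f (- 1 / z) = z ^ k * f z"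
    and det: "A * D - B * C = 1" and z: "Im z > 0"
  shows "f ((of_int A * z + of_int B) / (of_int C * z + of_int D)) =
     (of_int C * z + of_int D) ^ k * f z"
proof -
  have Tnat: "f (z + of_nat n) = f z" if "Im z > 0" for z n
    using that
  proof (induction n)
    case (Suc n)
    then show ?case
      using T[of "z + of_nat n"] by (simp add: ac_simps)
  qed auto
  have Tint: "f (z + of_int n) = f z" if "Im z > 0" for z n
  proof (cases "n \<ge> 0")
    case True
    then show ?thesis using Tnat[of z "nat n"] that by simp
  next
    case False
    then show ?thesis using Tnat[of "z + of_int n" "nat (- n)"] that by simp
  qed
  \<comment> \<open>Matrices with opposite signs act alike on z. Applying the inversion twice shows
    that the two automorphy factors agree on f; for odd k this forces f = 0.\<close>
  have par: "(- 1) ^ k * f z = f z" if "Im z > 0" for z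
  proof -
    have im: "Im (- 1 / z) > 0"
      using Im_moebius[of 0 0 "-1" 1 z] that by simp
    have "z \<noteq> 0" using that by auto
    have "f (- 1 / (- 1 / z)) = (- 1 / z) ^ k * (z ^ k * f z)"
      using S[OF im] S[OF that] by simp
    also have "\<dots> = ((- 1 / z) * z) ^ k * f z"
      by (simp only: power_mult_distrib mult.assoc)
    also have "(- 1 / z) * z = - 1" using \<open>z \<noteq> 0\<close> by simp
    finally show ?thesis by simp
  qed
  show ?thesis
    using det z
  proof (induction "nat \<bar>C\<bar>" arbitrary: A B C D rule: less_induct)
    case less
    show ?case
    proof (cases "C = 0")
      case True
      then have AD: "A * D = 1" using less.prems by simp
      then have "A = 1 \<and> D = 1 \<or> A = -1 \<and> D = -1"
        by (metis pos_zmult_eq_1_iff_lemma zmult_eq_1_iff)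
      then show ?thesis
        using True Tint[OF z, of B] Tint[OF z, of "-B"] par[OF z] by auto
    next
      case False
      define n where "n = A div C"
      define r where "r = A mod C"
      define s where "s = B - n * D"
      have A: "A = n * C + r" by (simp add: n_def r_def)
      have det': "(- C) * s - (- D) * r = 1"
        using less.prems(1) unfolding A s_def by (simp add: algebra_simps)
      have small: "nat \<bar>r\<bar> < nat \<bar>C\<bar>"
        using False by (simp add: r_def abs_mod_less)
      define w where "w = (of_int (- C) * z + of_int (- D)) / (of_int r * z + of_int s)"
      have IH: "f w = (of_int r * z + of_int s) ^ k * f z"
        unfolding w_def by (rule less.hyps[OF small det' z])
      have imw: "Im w > 0" and nz: "of_int r * z + of_int s \<noteq> 0"
        using Im_moebius[OF det' z] by (auto simp: w_def)
      have nz2: "of_int C * z + of_int D \<noteq> 0"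
        using Im_moebius[OF less.prems] by auto
      have "- 1 / w = (of_int r * z + of_int s) / (of_int C * z + of_int D)"
      proof -
        have "w = - ((of_int C * z + of_int D) / (of_int r * z + of_int s))"
          unfolding w_def minus_divide_left by simp
        then have "- 1 / w = 1 / ((of_int C * z + of_int D) / (of_int r * z + of_int s))"
          by (simp only: divide_minus_left divide_minus_right minus_minus)
        then show ?thesis by simp
      qed
      moreover have "(of_int A * z + of_int B) / (of_int C * z + of_int D) =
          (of_int r * z + of_int s) / (of_int C * z + of_int D) + of_int n"
        using nz2 by (simp add: A s_def divide_simps) (simp add: algebra_simps)
      ultimately have eq: "(of_int A * z + of_int B) / (of_int C * z + of_int D) = - 1 / w + of_int n"
        by simp
      have imw': "Im (- 1 / w) > 0"
        using Im_moebius[of 0 0 "-1" 1 w] imw by simp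
      have "f ((of_int A * z + of_int B) / (of_int C * z + of_int D)) = w ^ k * f w"
        unfolding eq using Tint[OF imw'] S[OF imw] by simp
      also have "\<dots> = (w * (of_int r * z + of_int s)) ^ k * f z"
        by (simp add: IH power_mult_distrib)
      also have "w * (of_int r * z + of_int s) = - (of_int C * z + of_int D)"
        using nz by (simp add: w_def)
      also have "(- (of_int C * z + of_int D)) ^ k * f z = (of_int C * z + of_int D) ^ k * ((-1) ^ k * f z)"
        by (subst power_minus) (simp add: mult_ac)
      finally show ?thesis
        using par[OF z] by simp
    qed
  qed
qed

lemma mformI:
  assumes "fps_conv_radius F \<ge> 1"
    and "\<And>z. Im z > 0 \<Longrightarrow> eval_fps F (nome (- 1 / z)) = z ^ k * eval_fps F (nome z)"
  shows "mform k F"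
  unfolding mform_def
  using assms(1) SL2_transformation[of "\<lambda>z. eval_fps F (nome z)" k, OF _ assms(2)] by auto

lemma mform_conv: "mform k F \<Longrightarrow> norm q < 1 \<Longrightarrow> ereal (norm q) < fps_conv_radius F"
  unfolding mform_def by (meson ereal_less(3) less_le_trans)

lemma mform_moebius:
  fixes A B C D :: int
  assumes "mform k F" "A * D - B * C = 1" "Im z > 0"
  shows "eval_fps F (nome ((of_int A * z + of_int B) / (of_int C * z + of_int D))) =
    (of_int C * z + of_int D) ^ k * eval_fps F (nome z)"
  using assms unfolding mform_def by blast

lemma mform_S: "mform k F \<Longrightarrow> Im z > 0 \<Longrightarrow> eval_fps F (nome (- 1 / z)) = z ^ k * eval_fps F (nome z)"
  using mform_moebius[of k F 0 0 "-1" 1 z] by simp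

lemma mform_mult:
  assumes "mform k F" "mform l G"
  shows "mform (k + l) (F * G)"
proof (rule mformI)
  show "fps_conv_radius (F * G) \<ge> 1"
    using assms fps_conv_radius_mult[of F G] unfolding mform_def by (meson min.boundedI order_trans)
  fix z :: complex assume z: "Im z > 0"
  then have "Im (- 1 / z) > 0"
    using Im_moebius[of 0 0 "-1" 1 z] by simp
  then have "eval_fps (F * G) (nome (- 1 / z)) = eval_fps F (nome (- 1 / z)) * eval_fps G (nome (- 1 / z))"
    using assms by (intro eval_fps_mult) (auto intro!: mform_conv norm_nome_less_1 simp del: divide_minus_left)
  moreover have "eval_fps (F * G) (nome z) = eval_fps F (nome z) * eval_fps G (nome z)"
    using assms z by (intro eval_fps_mult) (auto intro!: mform_conv norm_nome_less_1)
  ultimately show "eval_fps (F * G) (nome (- 1 / z)) = z ^ (k + l) * eval_fps (F * G) (nome z)"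
    using mform_S[OF assms(1) z] mform_S[OF assms(2) z] by (simp add: power_add)
qed

lemma mform_const: "mform 0 (fps_const c)"
  by (rule mformI) auto

text \<open>Every nonzero q in the disc is the nome of a point of the half plane, so convergence of
  the Fourier series there is convergence of the power series on the disc.\<close>

lemma modular_qexp_iff_mform: "modular_qexp k a \<longleftrightarrow> mform k (Abs_fps a)"
proof
  assume "mform k (Abs_fps a)"
  note mf = this
  have hol: "eval_fps (Abs_fps a) holomorphic_on ball 0 1"
    using mform_conv[OF mf] by (intro holomorphic_intros) auto
  have "(eval_fps (Abs_fps a) \<circ> nome) holomorphic_on {z. Im z > 0}"
    using norm_nome_less_1
    by (intro holomorphic_on_compose_gen[OF _ hol]) (auto simp: nome_def [abs_def] intro!: holomorphic_intros)
  then have "(\<lambda>z. eval_fps (Abs_fps a) (nome z)) holomorphic_on {z. Im z > 0}"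
    by (simp add: o_def)
  moreover have "(\<lambda>n. a n * exp (2 * of_real pi * \<i> * of_nat n * z)) sums eval_fps (Abs_fps a) (nome z)"
    if "Im z > 0" for z
    using sums_eval_fps[of "nome z" "Abs_fps a"] mform_conv[OF mf, of "nome z"] norm_nome_less_1[OF that]
    by (simp add: nome_power)
  ultimately show "modular_qexp k a"
    unfolding modular_qexp_def
    using mform_moebius[OF mf] by (intro exI[of _ "\<lambda>z. eval_fps (Abs_fps a) (nome z)"]) blast
next
  assume "modular_qexp k a"
  then obtain f where inv: "\<And>(A :: int) B C D z. A * D - B * C = 1 \<Longrightarrow> Im z > 0 \<Longrightarrow>
        f ((of_int A * z + of_int B) / (of_int C * z + of_int D)) =
        (of_int C * z + of_int D) ^ k * f z"
    and sums: "\<And>z. Im z > 0 \<Longrightarrow> (\<lambda>n. a n * exp (2 * of_real pi * \<i> * of_nat n * z)) sums f z"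
    unfolding modular_qexp_def by blast
  have summ: "summable (\<lambda>n. a n * q ^ n)" if q: "q \<noteq> 0" "norm q < 1" for q
  proof -
    obtain z where "Im z > 0" "nome z = q"
      using nome_surj[OF q] by blast
    then show ?thesis
      using sums[of z] by (simp add: sums_iff flip: nome_power)
  qed
  have rad: "fps_conv_radius (Abs_fps a) \<ge> 1"
    unfolding fps_conv_radius_def
  proof (rule conv_radius_geI_ex)
    fix r :: real assume "0 < r" "ereal r < 1"
    then show "\<exists>z. norm z = r \<and> summable (\<lambda>n. fps_nth (Abs_fps a) n * z ^ n)"
      using summ[of "of_real r"] by (intro exI[of _ "of_real r :: complex"]) auto
  qed
  have f: "f z = eval_fps (Abs_fps a) (nome z)" if "Im z > 0" for z
    using sums[OF that] unfolding eval_fps_def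
    by (simp add: nome_power sums_iff)
  show "mform k (Abs_fps a)"
    unfolding mform_def
  proof (intro conjI allI impI rad)
    fix A B C D :: int and z :: complex
    assume "A * D - B * C = 1" "Im z > 0"
    then show "eval_fps (Abs_fps a) (nome ((of_int A * z + of_int B) / (of_int C * z + of_int D))) =
        (of_int C * z + of_int D) ^ k * eval_fps (Abs_fps a) (nome z)"
      using inv[of A D B C z] Im_moebius(1)[of A D B C z] by (simp only: f)
  qed
qed

text \<open>After a translation to |Re| \<le> 1/2, a point with Im < 1/2 has squared norm at most
  1/2, so the inversion at least doubles its imaginary part. This is weaker than reduction to the
  fundamental domain, but it already confines the nome to a compact disc.\<close>

lemma exists_equivalent_Im_ge_half:
  fixes f :: "complex \<Rightarrow> complex"
  assumes T: "\<And>z. Im z > 0 \<Longrightarrow> f (z + 1) = f z"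
    and S: "\<And>z. Im z > 0 \<Longrightarrow> f (- 1 / z) = f z"
    and z: "Im z > 0"
  obtains z' where "Im z' \<ge> 1/2" "f z' = f z"
proof -
  have Tint: "f (z + of_int n) = f z" if "Im z > 0" for z n
    using SL2_transformation[of f 0 1 1 n 0 z] T S that by simp
  have "\<exists>z'. Im z' \<ge> 1/2 \<and> f z' = f z" if "Im z \<ge> 1 / 2 ^ Suc n" "Im z > 0" for n z
    using that
  proof (induction n arbitrary: z)
    case 0
    then show ?case by auto
  next
    case (Suc n)
    show ?case
    proof (cases "Im z \<ge> 1/2")
      case True
      then show ?thesis by auto
    next
      case False
      define y where "y = z + of_int (- round (Re z))"
      have imy: "Im y = Im z" by (simp add: y_def)
      have "\<bar>Re y\<bar> \<le> 1/2"
        using of_int_round_abs_le[of "Re z"] by (simp add: y_def abs_minus_commute)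
      then have "(Re y)\<^sup>2 \<le> (1/2)\<^sup>2"
        by (metis abs_ge_zero power2_abs power_mono)
      moreover have "(Im y)\<^sup>2 \<le> (1/2)\<^sup>2"
        using False Suc.prems imy by (intro power_mono) auto
      ultimately have small: "(norm y)\<^sup>2 \<le> 1/2"
        unfolding cmod_power2 by (simp add: power_divide)
      have "y \<noteq> 0" using imy Suc.prems by auto
      have "Im (- 1 / y) = Im y / (norm y)\<^sup>2"
        by (simp add: Im_divide cmod_power2)
      also have "\<dots> \<ge> Im y / (1/2)"
        using small \<open>y \<noteq> 0\<close> imy Suc.prems by (intro divide_left_mono) auto
      finally have "Im (- 1 / y) \<ge> 2 * Im z" using imy by simp
      then have "\<exists>z'. Im z' \<ge> 1/2 \<and> f z' = f (- 1 / y)"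
        using Suc.prems by (intro Suc.IH) auto
      then show ?thesis
        using S[of y] imy Suc.prems Tint[of z "- round (Re z)", folded y_def] by simp
    qed
  qed
  note * = this
  obtain n where "1 / 2 ^ n < Im z"
    using real_arch_pow_inv[OF z, of "1/2"] by (auto simp: power_one_over)
  moreover have "1 / 2 ^ Suc n \<le> (1 / 2 ^ n :: real)"
    by (intro divide_left_mono) auto
  ultimately have "1 / 2 ^ Suc n \<le> Im z" by linarith
  from *[OF this z] show ?thesis using that by blast
qed

text \<open>In weight 0 all values are taken on the compact disc of radius exp(-pi), so the modulus
  has a maximum inside the unit disc and the maximum principle applies.\<close>

lemma mform_0_imp_const:
  assumes "mform 0 F"
  shows "F = fps_const (fps_nth F 0)"
proof -
  define K where "K = cball (0 :: complex) (exp (- pi))"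
  have hol: "eval_fps F holomorphic_on ball 0 1"
    using mform_conv[OF assms] by (intro holomorphic_intros) auto
  have K: "K \<subseteq> ball 0 1"
    using exp_less_one_iff[of "- pi"] pi_gt_zero by (auto simp: K_def simp del: exp_less_one_iff)
  have cK: "compact K" "K \<noteq> {}" by (auto simp: K_def)
  have "continuous_on K (\<lambda>q. norm (eval_fps F q))"
    using holomorphic_on_imp_continuous_on[OF hol] K
    by (intro continuous_on_norm) (rule continuous_on_subset)
  then obtain q1 where q1: "q1 \<in> K" "\<And>q. q \<in> K \<Longrightarrow> norm (eval_fps F q) \<le> norm (eval_fps F q1)"
    using continuous_attains_sup[OF cK, of "\<lambda>q. norm (eval_fps F q)"] by blast
  have max: "norm (eval_fps F q) \<le> norm (eval_fps F q1)" if q: "q \<in> ball 0 1" for q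
  proof (cases "q = 0")
    case True
    then show ?thesis using q1(2)[of 0] by (simp add: K_def)
  next
    case False
    then obtain z where z: "Im z > 0" "nome z = q"
      using nome_surj[of q] q by auto
    obtain z' where z': "Im z' \<ge> 1/2" "eval_fps F (nome z') = eval_fps F (nome z)"
      using exists_equivalent_Im_ge_half[of "\<lambda>z. eval_fps F (nome z)" z] mform_S[OF assms] z(1) by auto
    have "nome z' \<in> K"
      using z' by (auto simp: K_def norm_nome)
    then show ?thesis using q1(2)[of "nome z'"] z' z by simp
  qed
  have "eval_fps F constant_on ball 0 1"
    by (rule maximum_modulus_principle[OF hol, of "ball 0 1" q1]) (use max q1 K in auto)
  then obtain c where c: "\<And>q. q \<in> ball 0 1 \<Longrightarrow> eval_fps F q = c"
    unfolding constant_on_def by blast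
  have "F = fps_const c"
  proof (rule eval_fps_eqD)
    show "fps_conv_radius F > 0"
      using mform_conv[OF assms, of 0] by (simp add: zero_ereal_def)
    have "eventually (\<lambda>q. q \<in> ball 0 1) (nhds (0::complex))"
      by (intro eventually_nhds_in_open) auto
    then show "eventually (\<lambda>q. eval_fps F q = eval_fps (fps_const c) q) (nhds 0)"
      by eventually_elim (use c in auto)
  qed auto
  then show ?thesis by simp
qed

section \<open>Polygamma functions, the cotangent and the nome\<close>

lemma Digamma_reflection:
  fixes z :: complex
  assumes "z \<notin> \<int>"
  shows "Digamma z - Digamma (1 - z) = - of_real pi * cot (of_real pi * z)"
proof -
  have z1: "z \<notin> \<int>\<^sub>\<le>\<^sub>0" and z2: "1 - z \<notin> \<int>\<^sub>\<le>\<^sub>0"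
    using assms nonpos_Ints_subset_Ints by (auto dest!: subsetD[OF nonpos_Ints_subset_Ints])
  have sin_nz: "sin (of_real pi * z) \<noteq> 0"
    using assms by (auto simp: sin_eq_0 mult.commute)
  have "((\<lambda>z. Gamma z * Gamma (1 - z)) has_field_derivative
      Gamma z * Digamma z * Gamma (1 - z) - Gamma z * (Gamma (1 - z) * Digamma (1 - z))) (at z)"
    using z1 z2 by (auto intro!: derivative_eq_intros simp: algebra_simps)
  moreover have "((\<lambda>z. of_real pi / sin (of_real pi * z)) has_field_derivative
      - of_real pi * (of_real pi * cos (of_real pi * z)) / sin (of_real pi * z) ^ 2) (at z)"
    using sin_nz by (auto intro!: derivative_eq_intros simp: power2_eq_square)
  moreover have "(\<lambda>z. Gamma z * Gamma (1 - z)) = (\<lambda>z :: complex. of_real pi / sin (of_real pi * z))"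
    by (rule ext) (rule Gamma_reflection_complex)
  ultimately have "Gamma z * Digamma z * Gamma (1 - z) - Gamma z * (Gamma (1 - z) * Digamma (1 - z)) =
      - of_real pi * (of_real pi * cos (of_real pi * z)) / sin (of_real pi * z) ^ 2"
    by (metis DERIV_unique)
  then have "(Gamma z * Gamma (1 - z)) * (Digamma z - Digamma (1 - z)) =
      - of_real pi * (of_real pi * cos (of_real pi * z)) / sin (of_real pi * z) ^ 2"
    by (simp add: algebra_simps)
  then have "of_real pi * (Digamma z - Digamma (1 - z)) / sin (of_real pi * z) =
      of_real pi * (- of_real pi * cot (of_real pi * z)) / sin (of_real pi * z)"
    unfolding Gamma_reflection_complex by (simp add: power2_eq_square cot_def)
  then show ?thesis
    using sin_nz by (simp only: divide_cancel_right mult_cancel_left) simp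
qed

lemma pi_cot_eq_nome:
  assumes "nome z \<noteq> 1"
  shows "of_real pi * cot (of_real pi * z) = of_real pi * \<i> * (nome z + 1) / (nome z - 1)"
proof -
  define e where "e = exp (\<i> * (of_real pi * z))"
  have e: "e \<noteq> 0" by (simp add: e_def)
  have n: "nome z = e * e"
    by (simp add: e_def nome_def exp_add [symmetric] mult_ac)
  have "cos (of_real pi * z) = (e + inverse e) / 2"
    by (simp add: cos_exp_eq e_def exp_minus)
  moreover have "sin (of_real pi * z) = (e - inverse e) / (2 * \<i>)"
    by (simp add: sin_exp_eq e_def exp_minus)
  moreover have "(e + inverse e) / (e - inverse e) = (e * e + 1) / (e * e - 1)"
    using e assms n by (simp add: divide_simps)
  moreover have "inverse \<i> = - \<i>" by simp
  ultimately have "cot (of_real pi * z) = \<i> * ((e * e + 1) / (e * e - 1))"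
    unfolding cot_def divide_inverse by (simp only: inverse_mult_distrib inverse_inverse_eq) (simp add: mult_ac)
  then show ?thesis
    unfolding n by simp
qed

text \<open>The series of n^j q^n, that is (q d/dq)^j applied to q / (1 - q). The constant term is
  set to 0 by hand because 0^0 = 1 would spoil the case j = 0.\<close>

definition pow_fps :: "nat \<Rightarrow> complex fps" where
  "pow_fps j = Abs_fps (\<lambda>n. if n = 0 then 0 else of_nat n ^ j)"

lemma pow_fps_Suc: "pow_fps (Suc j) = fps_X * fps_deriv (pow_fps j)"
  by (rule fps_ext) (auto simp: pow_fps_def fps_X_mult_nth)

lemma fps_conv_radius_pow_fps: "fps_conv_radius (pow_fps j) \<ge> 1"
proof (induction j)
  case 0
  have "summable (\<lambda>n. fps_nth (pow_fps 0) n * z ^ n)" if "norm z < 1" for z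
    using summable_geometric[OF that]
    by (subst summable_Suc_iff [symmetric]) (simp add: pow_fps_def summable_Suc_iff summable_mult flip: power_Suc)
  then show ?case
    unfolding fps_conv_radius_def
    by (intro conv_radius_geI_ex) (metis norm_of_real abs_of_pos ereal_less(3) less_ereal.simps(1) one_ereal_def)
next
  case (Suc j)
  have "1 \<le> fps_conv_radius (fps_deriv (pow_fps j))"
    using Suc fps_conv_radius_deriv[of "pow_fps j"] by (metis order_trans)
  then show ?case
    unfolding pow_fps_Suc using fps_conv_radius_mult[of fps_X "fps_deriv (pow_fps j)"]
    by (auto simp: min_def split: if_splits intro: order_trans)
qed

lemma eval_pow_fps_0: "norm q < 1 \<Longrightarrow> eval_fps (pow_fps 0) q = q / (1 - q)"
proof -
  assume q: "norm q < 1"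
  have "(\<lambda>n. q * q ^ n) sums (q * (1 / (1 - q)))"
    using geometric_sums[OF q] by (intro sums_mult)
  then have "(\<lambda>n. if Suc n = 0 then 0 else q ^ Suc n) sums (q / (1 - q))" by simp
  then have "(\<lambda>n. if n = 0 then 0 else q ^ n) sums (q / (1 - q))"
    by (subst (asm) sums_Suc_iff[of "\<lambda>n. if n = 0 then 0 else q ^ n"]) simp
  then have "(\<lambda>n. fps_nth (pow_fps 0) n * q ^ n) sums (q / (1 - q))"
    by (rule sums_cong[THEN iffD1, rotated]) (auto simp: pow_fps_def)
  then show ?thesis by (simp add: eval_fps_def sums_iff)
qed

lemma has_field_derivative_eval_pow_fps:
  assumes "Im z > 0"
  shows "((\<lambda>z. eval_fps (pow_fps j) (nome z)) has_field_derivative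
     2 * of_real pi * \<i> * eval_fps (pow_fps (Suc j)) (nome z)) (at z)"
proof -
  have r: "ereal (norm (nome z)) < fps_conv_radius (pow_fps j)"
    using norm_nome_less_1[OF assms] fps_conv_radius_pow_fps[of j]
    by (meson ereal_less(3) less_le_trans)
  then have r': "ereal (norm (nome z)) < fps_conv_radius (fps_deriv (pow_fps j))"
    using fps_conv_radius_deriv[of "pow_fps j"] by (meson less_le_trans)
  have "(nome has_field_derivative 2 * of_real pi * \<i> * nome z) (at z)"
    unfolding nome_def [abs_def] by (auto intro!: derivative_eq_intros)
  moreover have "(eval_fps (pow_fps j) has_field_derivative eval_fps (fps_deriv (pow_fps j)) (nome z)) (at (nome z))"
    using r by (rule has_field_derivative_eval_fps)
  ultimately have "((\<lambda>z. eval_fps (pow_fps j) (nome z)) has_field_derivative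
     eval_fps (fps_deriv (pow_fps j)) (nome z) * (2 * of_real pi * \<i> * nome z)) (at z)"
    by (rule DERIV_chain2[rotated])
  moreover have "eval_fps (pow_fps (Suc j)) (nome z) = nome z * eval_fps (fps_deriv (pow_fps j)) (nome z)"
    unfolding pow_fps_Suc using r' by (subst eval_fps_mult) auto
  ultimately show ?thesis by (simp add: mult_ac)
qed

lemma not_Int_of_Im_pos: "Im z > 0 \<Longrightarrow> z \<notin> \<int>" "Im z > 0 \<Longrightarrow> z \<notin> \<int>\<^sub>\<le>\<^sub>0" "Im z > 0 \<Longrightarrow> 1 - z \<notin> \<int>\<^sub>\<le>\<^sub>0"
  by (auto elim!: Ints_cases nonpos_Ints_cases simp: complex_eq_iff)

text \<open>Repeated differentiation of the cotangent formula: d/dz acts on series in the nome as 2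
  pi i times q d/dq, and the constant pi i survives only for j = 0.\<close>

lemma Polygamma_reflection_nome:
  assumes "Im z > 0"
  shows "Polygamma j z - (- 1) ^ j * Polygamma j (1 - z) =
    (if j = 0 then of_real pi * \<i> else 0) + (2 * of_real pi * \<i>) ^ Suc j * eval_fps (pow_fps j) (nome z)"
  using assms
proof (induction j arbitrary: z)
  case 0
  have ne: "norm (nome z) < 1" "nome z \<noteq> 1"
    using norm_nome_less_1[OF 0] by auto
  then have "of_real pi * \<i> + 2 * of_real pi * \<i> * (nome z / (1 - nome z)) =
      - (of_real pi * \<i> * (nome z + 1) / (nome z - 1))"
    by (simp add: divide_simps) (simp add: algebra_simps)
  then show ?case
    using Digamma_reflection[of z] not_Int_of_Im_pos[OF 0] ne
    by (simp add: eval_pow_fps_0 pi_cot_eq_nome)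
next
  case (Suc j)
  let ?L = "\<lambda>z. Polygamma j z - (- 1) ^ j * Polygamma j (1 - z)"
  let ?R = "\<lambda>z. (if j = 0 then of_real pi * \<i> else 0) + (2 * of_real pi * \<i>) ^ Suc j * eval_fps (pow_fps j) (nome z)"
  have "(?L has_field_derivative Polygamma (Suc j) z - (- 1) ^ Suc j * Polygamma (Suc j) (1 - z)) (at z)"
    using not_Int_of_Im_pos[OF Suc.prems] by (auto intro!: derivative_eq_intros)
  moreover have "(?R has_field_derivative (2 * of_real pi * \<i>) ^ Suc j * (2 * of_real pi * \<i> * eval_fps (pow_fps (Suc j)) (nome z))) (at z)"
    by (rule derivative_eq_intros has_field_derivative_eval_pow_fps[OF Suc.prems] refl | simp)+
  then have "(?L has_field_derivative (2 * of_real pi * \<i>) ^ Suc j * (2 * of_real pi * \<i> * eval_fps (pow_fps (Suc j)) (nome z))) (at z)"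
    by (rule has_field_derivative_transform_within_open[of _ _ _ "{z. Im z > 0}"])
      (use Suc in \<open>auto simp: open_halfspace_Im_gt\<close>)
  ultimately show ?case
    using DERIV_unique[of ?L] by (simp add: mult_ac)
qed

text \<open>The sum may run over the whole lattice: for k > 0 the pair (0, 0) contributes 0 because
  \<open>inverse 0 = 0\<close>.\<close>

definition lattice_sum :: "nat \<Rightarrow> complex \<Rightarrow> complex" where
  "lattice_sum k z = (\<Sum>\<^sub>\<infinity>(c, d)\<in>UNIV. inverse (of_int c * z + of_int d) ^ k)"

lemma summable_on_int_power:
  assumes "m \<ge> 2"
  shows "(\<lambda>c :: int. inverse (1 + \<bar>real_of_int c\<bar>) ^ m) summable_on UNIV"
proof -
  have s: "(\<lambda>n :: nat. inverse (1 + real n) ^ m) summable_on UNIV"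
  proof -
    have "summable (\<lambda>n. inverse (real (Suc n)) ^ m)"
      using inverse_power_summable[OF assms, where 'a = real]
      by (subst summable_Suc_iff) (simp add: power_inverse)
    then show ?thesis
      by (intro norm_summable_imp_summable_on) (simp add: add.commute)
  qed
  have "(\<lambda>c :: int. inverse (1 + \<bar>real_of_int c\<bar>) ^ m) summable_on (int ` UNIV)"
    by (subst summable_on_reindex) (use s in \<open>auto simp: o_def\<close>)
  moreover have "(\<lambda>c :: int. inverse (1 + \<bar>real_of_int c\<bar>) ^ m) summable_on ((\<lambda>n. - int n) ` UNIV)"
    by (subst summable_on_reindex) (use s in \<open>auto simp: o_def inj_def\<close>)
  ultimately have "(\<lambda>c :: int. inverse (1 + \<bar>real_of_int c\<bar>) ^ m) summable_on (int ` UNIV \<union> (\<lambda>n. - int n) ` UNIV)"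
    by (rule summable_on_union)
  also have "int ` UNIV \<union> (\<lambda>n. - int n) ` UNIV = UNIV"
    by (auto simp: image_iff) (metis int_cases2)
  finally show ?thesis .
qed

text \<open>The product shape of the lower bound separates c from d, so that the double series is
  dominated by a product of two simple ones.\<close>

lemma lattice_point_bound:
  assumes "Im z > 0"
  obtains \<delta> where "\<delta> > 0"
    "\<And>c d :: int. (c, d) \<noteq> (0, 0) \<Longrightarrow>
       \<delta> * ((1 + \<bar>real_of_int c\<bar>) * (1 + \<bar>real_of_int d\<bar>)) \<le> (norm (of_int c * z + of_int d :: complex))\<^sup>2"
proof -
  define y where "y = Im z"
  define x where "x = Re z"
  \<comment> \<open>Chosen so that \<epsilon> (1 + 2 x^2) \<le> y^2. This absorbs the term 2 C^2 x^2
    that arises when D^2 is estimated through (C x + D)^2.\<close>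
  define \<epsilon> where "\<epsilon> = y\<^sup>2 / (y\<^sup>2 + 2 * x\<^sup>2 + 2)"
  have y: "y > 0" using assms by (simp add: y_def)
  have "0 < y\<^sup>2 + 2 * x\<^sup>2 + 2"
    using zero_le_power2[of x] zero_le_power2[of y] by linarith
  then have e: "\<epsilon> > 0" "\<epsilon> * (y\<^sup>2 + 2 * x\<^sup>2 + 2) = y\<^sup>2" "\<epsilon> \<le> 1"
    using y by (auto simp: \<epsilon>_def field_simps)
  have ge: "\<epsilon> / 4 * ((1 + \<bar>real_of_int c\<bar>) * (1 + \<bar>real_of_int d\<bar>)) \<le> (norm (of_int c * z + of_int d :: complex))\<^sup>2"
    if "(c, d) \<noteq> (0, 0)" for c d :: int
  proof -
    define C where "C = real_of_int c"
    define D where "D = real_of_int d"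
    have n: "(norm (of_int c * z + of_int d :: complex))\<^sup>2 = (C * x + D)\<^sup>2 + C\<^sup>2 * y\<^sup>2"
      by (simp add: cmod_power2 x_def y_def C_def D_def power_mult_distrib)
    have D2: "D\<^sup>2 \<le> 2 * (C * x + D)\<^sup>2 + 2 * C\<^sup>2 * x\<^sup>2"
      using zero_le_power2[of "2 * C * x + D"] by (simp add: power2_eq_square algebra_simps)
    have "\<epsilon> * (C\<^sup>2 + D\<^sup>2) \<le> \<epsilon> * (2 * (C * x + D)\<^sup>2) + C\<^sup>2 * (\<epsilon> * (1 + 2 * x\<^sup>2))"
      using mult_left_mono[OF D2, of \<epsilon>] e by (simp add: algebra_simps)
    also have "\<epsilon> * (1 + 2 * x\<^sup>2) \<le> y\<^sup>2"
      using e y by (subst e(2)[symmetric]) (intro mult_left_mono, auto)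
    finally have "\<epsilon> * (C\<^sup>2 + D\<^sup>2) \<le> \<epsilon> * (2 * (C * x + D)\<^sup>2) + C\<^sup>2 * y\<^sup>2"
      by (simp add: mult_left_mono)
    also have "\<epsilon> * (2 * (C * x + D)\<^sup>2) \<le> 1 * (2 * (C * x + D)\<^sup>2)"
      using e by (intro mult_right_mono) auto
    finally have "\<epsilon> * (C\<^sup>2 + D\<^sup>2) \<le> 2 * (C * x + D)\<^sup>2 + C\<^sup>2 * y\<^sup>2"
      by simp
    moreover have "0 \<le> C\<^sup>2 * y\<^sup>2" by simp
    moreover have "\<epsilon> / 2 * (C\<^sup>2 + D\<^sup>2) = \<epsilon> * (C\<^sup>2 + D\<^sup>2) / 2" by simp
    ultimately have b1: "\<epsilon> / 2 * (C\<^sup>2 + D\<^sup>2) \<le> (norm (of_int c * z + of_int d :: complex))\<^sup>2"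
      unfolding n by linarith
    have "1 \<le> C\<^sup>2 + D\<^sup>2"
    proof -
      have "1 \<le> c\<^sup>2 + d\<^sup>2"
        using that by (smt (verit) prod.inject sum_power2_gt_zero_iff)
      then have "real_of_int 1 \<le> real_of_int (c\<^sup>2 + d\<^sup>2)" by linarith
      then show ?thesis by (simp add: C_def D_def)
    qed
    moreover have "(1 + \<bar>C\<bar>) * (1 + \<bar>D\<bar>) \<le> 1 + (C\<^sup>2 + D\<^sup>2)"
      if "\<bar>C\<bar> = 0 \<and> \<bar>D\<bar> \<ge> 1 \<or> \<bar>D\<bar> = 0 \<and> \<bar>C\<bar> \<ge> 1"
      using that power_mono[of 1 "\<bar>C\<bar>" 2] power_mono[of 1 "\<bar>D\<bar>" 2] self_le_power[of "\<bar>C\<bar>" 2] self_le_power[of "\<bar>D\<bar>" 2] by auto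
    moreover have "(1 + \<bar>C\<bar>) * (1 + \<bar>D\<bar>) \<le> 2 * (C\<^sup>2 + D\<^sup>2)" if "\<bar>C\<bar> \<ge> 1" "\<bar>D\<bar> \<ge> 1"
    proof -
      have "(1 + \<bar>C\<bar>) * (1 + \<bar>D\<bar>) \<le> (2 * \<bar>C\<bar>) * (2 * \<bar>D\<bar>)"
        using that by (intro mult_mono) auto
      also have "\<dots> \<le> 2 * (C\<^sup>2 + D\<^sup>2)"
        using zero_le_power2[of "\<bar>C\<bar> - \<bar>D\<bar>"] by (simp add: power2_eq_square algebra_simps)
      finally show ?thesis .
    qed
    moreover have "C = 0 \<or> \<bar>C\<bar> \<ge> 1" "D = 0 \<or> \<bar>D\<bar> \<ge> 1"
      by (auto simp: C_def D_def)
    ultimately have "(1 + \<bar>C\<bar>) * (1 + \<bar>D\<bar>) \<le> 2 * (C\<^sup>2 + D\<^sup>2)"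
      using that by (auto simp: C_def D_def)
    then have "\<epsilon> / 4 * ((1 + \<bar>C\<bar>) * (1 + \<bar>D\<bar>)) \<le> \<epsilon> / 4 * (2 * (C\<^sup>2 + D\<^sup>2))"
      using e by (intro mult_left_mono) auto
    also have "\<dots> = \<epsilon> / 2 * (C\<^sup>2 + D\<^sup>2)" by simp
    also note b1
    finally show ?thesis by (simp only: C_def D_def)
  qed
  show ?thesis by (rule that[of "\<epsilon> / 4"]) (use e ge in auto)
qed

lemma lattice_sum_abs_summable:
  assumes "Im z > 0" "k \<ge> 4" "even k"
  shows "(\<lambda>x. norm (case x of (c :: int, d :: int) \<Rightarrow> inverse (of_int c * z + of_int d :: complex) ^ k)) summable_on UNIV"
proof -
  obtain m where k: "k = 2 * m" using assms by (auto elim: evenE)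
  have m: "m \<ge> 2" using assms k by simp
  obtain \<delta> where d: "\<delta> > 0" "\<And>c d :: int. (c, d) \<noteq> (0, 0) \<Longrightarrow>
       \<delta> * ((1 + \<bar>real_of_int c\<bar>) * (1 + \<bar>real_of_int d\<bar>)) \<le> (norm (of_int c * z + of_int d :: complex))\<^sup>2"
    using lattice_point_bound[OF assms(1)] by blast
  define h where "h = (\<lambda>c :: int. inverse (1 + \<bar>real_of_int c\<bar>) ^ m)"
  have hs: "h summable_on UNIV" unfolding h_def by (rule summable_on_int_power[OF m])
  have h0: "h c \<ge> 0" for c by (simp add: h_def)
  have "(\<lambda>(c, d). h c * h d) summable_on (UNIV \<times> UNIV)"
    using hs h0 by (intro summable_on_SigmaI[where g = "\<lambda>c. h c * infsum h UNIV"])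
      (auto intro!: has_sum_cmult_right summable_on_cmult_left)
  then have "(\<lambda>x. inverse \<delta> ^ m * (case x of (c, d) \<Rightarrow> h c * h d)) summable_on UNIV"
    by (intro summable_on_cmult_right) auto
  then show ?thesis
  proof (rule summable_on_comparison_test)
    fix x :: "int \<times> int"
    obtain c d where x: "x = (c, d)" by (cases x)
    show "norm (case x of (c, d) \<Rightarrow> inverse (of_int c * z + of_int d) ^ k) \<le> inverse \<delta> ^ m * (case x of (c, d) \<Rightarrow> h c * h d)"
    proof (cases "(c, d) = (0, 0)")
      case True
      moreover have "(0 :: complex) ^ k = 0" using m k by simp
      ultimately show ?thesis using x d(1) h0 by (auto simp del: power_eq_0_iff)
    next
      case False
      let ?n = "norm (of_int c * z + of_int d :: complex)"
      let ?w = "\<delta> * ((1 + \<bar>real_of_int c\<bar>) * (1 + \<bar>real_of_int d\<bar>))"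
      have "?w > 0" using d(1) by (intro mult_pos_pos) auto
      then have "inverse (?n\<^sup>2) \<le> inverse ?w"
        using d(2)[OF False] by (intro le_imp_inverse_le)
      then have "inverse (?n\<^sup>2) ^ m \<le> inverse ?w ^ m"
        by (intro power_mono) auto
      then show ?thesis
        by (simp add: x k h_def norm_power norm_inverse power_mult power_inverse power_mult_distrib mult_ac
              flip: power_mult)
    qed
  qed auto
qed

lemma lattice_sum_S:
  assumes "z \<noteq> 0"
  shows "lattice_sum k (- 1 / z) = z ^ k * lattice_sum k z"
proof -
  have bij: "bij_betw (\<lambda>(c :: int, d :: int). (d, - c)) UNIV UNIV"
    by (rule bij_betw_byWitness[where f' = "\<lambda>(c, d). (- d, c)"]) auto
  have "inverse (of_int c * (- 1 / z) + of_int d) ^ k = z ^ k * inverse (of_int d * z + of_int (- c)) ^ k" for c d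
  proof -
    have "of_int c * (- 1 / z) + of_int d = (of_int d * z + of_int (- c)) / z"
      using assms by (simp add: field_simps)
    then show ?thesis by (simp add: power_mult_distrib divide_inverse)
  qed
  then have "lattice_sum k (- 1 / z) = (\<Sum>\<^sub>\<infinity>(c, d)\<in>UNIV. z ^ k * inverse (of_int d * z + of_int (- c)) ^ k)"
    unfolding lattice_sum_def by (intro infsum_cong) (auto simp del: of_int_minus)
  also have "\<dots> = z ^ k * (\<Sum>\<^sub>\<infinity>(c, d)\<in>UNIV. inverse (of_int d * z + of_int (- c)) ^ k)"
    by (subst infsum_cmult_right' [symmetric]) (simp add: case_prod_unfold)
  also have "(\<Sum>\<^sub>\<infinity>(c, d)\<in>UNIV. inverse (of_int d * z + of_int (- c)) ^ k) = lattice_sum k z"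
    unfolding lattice_sum_def
    using infsum_reindex_bij_betw[OF bij, of "\<lambda>(c, d). inverse (of_int c * z + of_int d) ^ k"]
    by (simp add: case_prod_unfold)
  finally show ?thesis .
qed

section \<open>Modularity of Eisenstein series\<close>

lemma has_sum_Sigma_complex:
  fixes f :: "'b \<times> 'c \<Rightarrow> complex"
  assumes "f summable_on Sigma A B" "\<And>x. x \<in> A \<Longrightarrow> ((\<lambda>y. f (x, y)) has_sum b x) (B x)"
  shows "(b has_sum infsum f (Sigma A B)) A"
  by (rule has_sum_Sigma[OF isUCont_plus has_sum_infsum[OF assms(1)] assms(2)])

definition sigma_fps :: "nat \<Rightarrow> complex fps" where
  "sigma_fps j = Abs_fps (\<lambda>n. if n = 0 then 0 else (\<Sum>d | d dvd n. of_nat d ^ j))"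

text \<open>Both sums are the absolutely convergent double series of n^j q^(c n), grouped once by c
  and once by the product N = c n, where n runs through the divisors of N.\<close>

lemma lambert_series:
  assumes q: "norm q < 1"
  obtains S where "(\<lambda>n. fps_nth (sigma_fps j) n * q ^ n) sums S"
    "((\<lambda>c. eval_fps (pow_fps j) (q ^ c)) has_sum S) {1..}"
proof -
  define r where "r = norm q"
  have r: "r \<ge> 0" "r < 1" using q by (auto simp: r_def)
  define P where "P = {1 :: nat..} \<times> {1 :: nat..}"
  define f where "f = (\<lambda>(c :: nat, n :: nat). of_nat n ^ j * q ^ (c * n))"
  define u where "u = (\<lambda>n :: nat. real n ^ j * r ^ (n - 1))"
  have su: "u summable_on {1..}"
  proof (cases "r = 0")
    case True
    have "u summable_on {1}" by simp
    then show ?thesis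
      by (rule summable_on_cong_neutral[THEN iffD1, rotated -1]) (auto simp: u_def True)
  next
    case False
    have "ereal (norm (of_real r :: complex)) < fps_conv_radius (pow_fps j)"
      using r fps_conv_radius_pow_fps[of j] by (metis ereal_less(3) less_le_trans norm_of_real abs_of_nonneg)
    then have "summable (\<lambda>n. norm (fps_nth (pow_fps j) n * of_real r ^ n))"
      by (rule norm_summable_fps)
    then have "summable (\<lambda>n. norm (fps_nth (pow_fps j) n * of_real r ^ n) * inverse r)"
      by (rule summable_mult2)
    then have "(\<lambda>n. norm (fps_nth (pow_fps j) n * of_real r ^ n) * inverse r) summable_on UNIV"
      using r by (intro norm_summable_imp_summable_on) simp
    then have "(\<lambda>n. norm (fps_nth (pow_fps j) n * of_real r ^ n) * inverse r) summable_on {1..}"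
      by (rule summable_on_subset_banach) auto
    then show ?thesis
    proof (rule summable_on_cong[THEN iffD1, rotated])
      fix n :: nat assume "n \<in> {1..}"
      then obtain m where "n = Suc m" by (cases n) auto
      then show "norm (fps_nth (pow_fps j) n * of_real r ^ n) * inverse r = u n"
        using r False by (simp add: pow_fps_def u_def norm_mult norm_power del: of_nat_Suc)
    qed
  qed
  have sr: "(\<lambda>c. r ^ c) summable_on {1..}"
  proof -
    have "(\<lambda>c. r ^ c) summable_on UNIV"
      using r by (intro norm_summable_imp_summable_on) simp
    then show ?thesis by (rule summable_on_subset_banach) auto
  qed
  have "(\<lambda>(c, n). r ^ c * u n) summable_on P"
    unfolding P_def using su sr r
    by (intro summable_on_SigmaI[where g = "\<lambda>c. r ^ c * infsum u {1..}"])
      (auto intro!: has_sum_cmult_right summable_on_cmult_left simp: u_def)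
  then have "(\<lambda>x. norm (f x)) summable_on P"
  proof (rule summable_on_comparison_test)
    fix x assume "x \<in> P"
    then obtain c n where x: "x = (c, n)" "c \<ge> 1" "n \<ge> 1" by (auto simp: P_def)
    \<comment> \<open>Replacing the product in the exponent by a sum turns the majorant into a
      product of two summable factors.\<close>
    have "c + (n - 1) \<le> c * n"
      using x by (cases n) auto
    then have "r ^ (c * n) \<le> r ^ (c + (n - 1))"
      using r by (intro power_decreasing) auto
    then have "real n ^ j * r ^ (c * n) \<le> real n ^ j * r ^ (c + (n - 1))"
      by (intro mult_left_mono) auto
    then show "norm (f x) \<le> (case x of (c, n) \<Rightarrow> r ^ c * u n)"
      by (simp add: x f_def u_def norm_mult norm_power r_def power_add mult_ac)
  qed auto
  then have sf: "f summable_on P"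
    by (rule Infinite_Sum.abs_summable_summable)
  have ev: "((\<lambda>n. f (c, n)) has_sum eval_fps (pow_fps j) (q ^ c)) {1..}" if c: "c \<ge> 1" for c
  proof -
    have "norm (q ^ c) < 1"
      using q c by (simp add: norm_power power_less_one_iff)
    then have rad: "ereal (norm (q ^ c)) < fps_conv_radius (pow_fps j)"
      using fps_conv_radius_pow_fps[of j] by (meson ereal_less(3) less_le_trans)
    then have "((\<lambda>n. fps_nth (pow_fps j) n * (q ^ c) ^ n) has_sum eval_fps (pow_fps j) (q ^ c)) UNIV"
      by (intro norm_summable_imp_has_sum norm_summable_fps sums_eval_fps)
    then show ?thesis
      by (rule has_sum_cong_neutral[THEN iffD1, rotated -1]) (auto simp: f_def pow_fps_def power_mult)
  qed
  have 1: "((\<lambda>c. eval_fps (pow_fps j) (q ^ c)) has_sum infsum f P) {1..}"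
    using sf ev unfolding P_def by (intro has_sum_Sigma_complex) auto
  define Q where "Q = Sigma {1 :: nat..} (\<lambda>N. {d. d dvd N})"
  define h where "h = (\<lambda>(N :: nat, d :: nat). of_nat d ^ j * q ^ N :: complex)"
  have bij: "bij_betw (\<lambda>(c, n). (c * n, n)) P Q"
    by (rule bij_betw_byWitness[where f' = "\<lambda>(N, d). (N div d, d)"])
      (auto simp: P_def Q_def dvd_div_eq_0_iff Suc_le_eq dvd_pos_nat)
  have hf: "h ((\<lambda>(c, n). (c * n, n)) x) = f x" for x
    by (auto simp: h_def f_def split: prod.splits)
  have sh: "h summable_on Q"
    using summable_on_reindex_bij_betw[OF bij, of h] sf by (simp add: hf)
  have ih: "infsum h Q = infsum f P"
    using infsum_reindex_bij_betw[OF bij, of h] by (simp add: hf)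
  have "((\<lambda>N. \<Sum>d | d dvd N. h (N, d)) has_sum infsum f P) {1..}"
    unfolding ih[symmetric] Q_def
    by (rule has_sum_Sigma_complex) (use sh in \<open>auto simp: Q_def intro!: has_sum_finite\<close>)
  then have "((\<lambda>N. fps_nth (sigma_fps j) N * q ^ N) has_sum infsum f P) UNIV"
    by (rule has_sum_cong_neutral[THEN iffD1, rotated -1])
      (auto simp: sigma_fps_def h_def sum_distrib_right)
  then have 2: "(\<lambda>n. fps_nth (sigma_fps j) n * q ^ n) sums infsum f P"
    by (rule has_sum_imp_sums)
  show ?thesis using that 1 2 by blast
qed

lemma fps_conv_radius_sigma_fps: "fps_conv_radius (sigma_fps j) \<ge> 1"
  unfolding fps_conv_radius_def
proof (rule conv_radius_geI_ex)
  fix r :: real assume r: "0 < r" "ereal r < 1"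
  then have "norm (of_real r :: complex) < 1" by simp
  from lambert_series[OF this, of j]
  obtain S where "(\<lambda>n. fps_nth (sigma_fps j) n * of_real r ^ n) sums S" .
  then show "\<exists>z. norm z = r \<and> summable (\<lambda>n. fps_nth (sigma_fps j) n * z ^ n)"
    using r by (intro exI[of _ "of_real r"]) (auto simp: sums_iff)
qed

lemma has_sum_eval_sigma_fps:
  assumes "norm q < 1"
  shows "((\<lambda>c. eval_fps (pow_fps j) (q ^ c)) has_sum eval_fps (sigma_fps j) q) {1..}"
proof -
  obtain S where "(\<lambda>n. fps_nth (sigma_fps j) n * q ^ n) sums S"
    "((\<lambda>c. eval_fps (pow_fps j) (q ^ c)) has_sum S) {1..}"
    using lambert_series[OF assms, of j] .
  then show ?thesis by (simp add: eval_fps_def sums_iff)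
qed

lemma sums_inverse_power_Polygamma:
  assumes "k \<ge> 2" "even k" "z \<noteq> (0 :: complex)"
  shows "(\<lambda>n. inverse (z + of_nat n) ^ k) sums (Polygamma (k - 1) z / fact (k - 1))"
  using Polygamma_LIMSEQ[of z "k - 1"] assms by (simp add: power_inverse)

lemma range_int_decomp:
  "UNIV = range int \<union> range (\<lambda>n. - int n - 1)" "range int \<inter> range (\<lambda>n. - int n - 1) = {}"
proof -
  show "UNIV = range int \<union> range (\<lambda>n. - int n - 1)"
  proof (intro equalityI subsetI)
    fix x :: int
    show "x \<in> range int \<union> range (\<lambda>n. - int n - 1)"
    proof (cases "x \<ge> 0")
      case True
      then have "x = int (nat x)" by simp
      then show ?thesis by blast
    next
      case False
      then have "x = - int (nat (- x - 1)) - 1" by simp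
      then show ?thesis by blast
    qed
  qed auto
qed auto

text \<open>The sums over d \<ge> 0 and d < 0 are polygamma values at z and at 1 - z. Since k is
  even, k - 1 is odd, and they add up to the combination that the reflection formula
  evaluates.\<close>

lemma lipschitz_formula:
  assumes z: "Im z > 0" and k: "k \<ge> 4" "even k"
  shows "((\<lambda>d :: int. inverse (z + of_int d) ^ k) has_sum
    (2 * of_real pi * \<i>) ^ k / fact (k - 1) * eval_fps (pow_fps (k - 1)) (nome z)) UNIV"
proof -
  let ?f = "\<lambda>d :: int. inverse (z + of_int d) ^ k"
  have "(\<lambda>x. norm (case x of (c :: int, d :: int) \<Rightarrow> inverse (of_int c * z + of_int d :: complex) ^ k)) summable_on ((\<lambda>d. (1, d)) ` UNIV)"
    by (rule summable_on_subset_banach[OF lattice_sum_abs_summable[OF z k]]) auto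
  then have "(\<lambda>d. norm (?f d)) summable_on UNIV"
    by (subst (asm) summable_on_reindex) (auto simp: inj_on_def o_def)
  then have "?f summable_on UNIV"
    by (rule Infinite_Sum.abs_summable_summable)
  then have s: "?f summable_on A" for A
    by (rule summable_on_subset_banach) auto
  have "z \<noteq> 0" "1 - z \<noteq> 0" using z by (auto simp: complex_eq_iff)
  have 1: "(?f has_sum Polygamma (k - 1) z / fact (k - 1)) (range int)"
  proof -
    have "(?f has_sum infsum ?f (range int)) (range int)" using s by (rule has_sum_infsum)
    then have "((\<lambda>n. inverse (z + of_nat n) ^ k) has_sum infsum ?f (range int)) UNIV"
      by (subst (asm) has_sum_reindex) (auto simp: o_def)
    then have "infsum ?f (range int) = Polygamma (k - 1) z / fact (k - 1)"
      using sums_inverse_power_Polygamma[of k z] k \<open>z \<noteq> 0\<close> by (auto dest!: has_sum_imp_sums intro: sums_unique2)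
    then show ?thesis using s[of "range int"] by (metis has_sum_infsum)
  qed
  have 2: "(?f has_sum Polygamma (k - 1) (1 - z) / fact (k - 1)) (range (\<lambda>n. - int n - 1))"
  proof -
    let ?R = "range (\<lambda>n. - int n - 1)"
    have eq: "?f (- int n - 1) = inverse (1 - z + of_nat n) ^ k" for n
    proof -
      have "z + of_int (- int n - 1) = - (1 - z + of_nat n)" by simp
      then show ?thesis using k by (simp only: inverse_minus_eq power_minus_even)
    qed
    have "(?f has_sum infsum ?f ?R) ?R" using s by (rule has_sum_infsum)
    then have "((\<lambda>n. ?f (- int n - 1)) has_sum infsum ?f ?R) UNIV"
      by (subst (asm) has_sum_reindex) (auto simp: o_def inj_on_def)
    then have "infsum ?f ?R = Polygamma (k - 1) (1 - z) / fact (k - 1)"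
      unfolding eq
      using sums_inverse_power_Polygamma[of k "1 - z"] k \<open>1 - z \<noteq> 0\<close> by (auto dest!: has_sum_imp_sums intro: sums_unique2)
    then show ?thesis using s[of ?R] by (metis has_sum_infsum)
  qed
  have odd: "odd (k - 1)" using k by simp
  have "(?f has_sum (Polygamma (k - 1) z / fact (k - 1) + Polygamma (k - 1) (1 - z) / fact (k - 1))) UNIV"
    using has_sum_Un_disjoint[OF 1 2 range_int_decomp(2)] by (simp flip: range_int_decomp(1))
  also have "Polygamma (k - 1) z / fact (k - 1) + Polygamma (k - 1) (1 - z) / fact (k - 1) =
      (Polygamma (k - 1) z - (- 1) ^ (k - 1) * Polygamma (k - 1) (1 - z)) / fact (k - 1)"
    using odd by (simp add: add_divide_distrib)
  also have "\<dots> = (2 * of_real pi * \<i>) ^ k / fact (k - 1) * eval_fps (pow_fps (k - 1)) (nome z)"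
    using Polygamma_reflection_nome[OF z, of "k - 1"] k by simp
  finally show ?thesis .
qed

text \<open>Euler's evaluation of zeta(k), as \<open>Polygamma (k - 1) 1 / fact (k - 1)\<close> is
  zeta(k). The function psi(1 - z) - psi(1 + z) equals pi cot(pi z) - 1/z. Its Taylor coefficients
  at 0 are polygamma values at 1, and written with exp(2 pi i z) - 1 it becomes the generating
  function of the Bernoulli numbers.\<close>

lemma bernoulli_number_Polygamma:
  assumes k: "k \<ge> 2" "even k"
  shows "2 * Polygamma (k - 1) (1 :: complex) / fact (k - 1) =
    - ((2 * of_real pi * \<i>) ^ k * bernoulli_number k / fact k)"
proof -
  define c where "c = 2 * of_real pi * \<i>"
  have c: "c \<noteq> 0" by (simp add: c_def)
  define \<beta> where "\<beta> = (Abs_fps (\<lambda>n. 1 / fact (Suc n)) :: complex fps)"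
  define \<phi> where "\<phi> = (\<lambda>j z. (- 1) ^ j * Polygamma j (1 - z) - Polygamma j (1 + z :: complex))"
  have noint: "1 - z \<notin> \<int>\<^sub>\<le>\<^sub>0" "1 + z \<notin> \<int>\<^sub>\<le>\<^sub>0" if "z \<in> ball 0 1" for z :: complex
  proof -
    have "\<bar>Re z\<bar> < 1" using that abs_Re_le_cmod[of z] by simp
    then show "1 - z \<notin> \<int>\<^sub>\<le>\<^sub>0" "1 + z \<notin> \<int>\<^sub>\<le>\<^sub>0"
      by (auto elim!: nonpos_Ints_cases simp: complex_eq_iff)
  qed
  have der: "(\<phi> j has_field_derivative \<phi> (Suc j) z) (at z)" if "z \<in> ball 0 1" for j z
    unfolding \<phi>_def using noint[OF that] by (auto intro!: derivative_eq_intros)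
  have hd: "(deriv ^^ n) (\<phi> 0) z = \<phi> n z" if "z \<in> ball 0 1" for n z
    using that
  proof (induction n arbitrary: z)
    case (Suc n)
    have "eventually (\<lambda>u. u \<in> ball 0 1) (nhds z)"
      using Suc.prems by (intro eventually_nhds_in_open) auto
    then have "eventually (\<lambda>u. (deriv ^^ n) (\<phi> 0) u = \<phi> n u) (nhds z)"
      by eventually_elim (use Suc.IH in auto)
    then have "deriv ((deriv ^^ n) (\<phi> 0)) z = deriv (\<phi> n) z"
      by (intro deriv_cong_ev refl)
    then show ?case using der[OF Suc.prems] by (simp add: DERIV_imp_deriv)
  qed auto
  have hol: "\<phi> 0 holomorphic_on ball 0 1"
    using der[of _ 0] holomorphic_onI field_differentiable_def
    by (metis field_differentiable_at_within)
  define \<Phi> where "\<Phi> = fps_expansion (\<phi> 0) 0"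
  have exp1: "\<phi> 0 has_fps_expansion \<Phi>"
    unfolding \<Phi>_def using hol by (intro has_fps_expansion_fps_expansion[of "ball 0 1"]) auto
  have coef: "fps_nth \<Phi> (k - 1) = - 2 * Polygamma (k - 1) 1 / fact (k - 1)"
    using fps_nth_fps_expansion[OF exp1, of "k - 1"] hd[of 0 "k - 1"] k by (simp add: \<phi>_def)
  \<comment> \<open>With both denominators cleared the identity also holds at z = 0 and can be read
    as one between power series.\<close>
  have eq: "(z * \<phi> 0 z + 1 - of_real pi * \<i> * z) * (exp (c * z) - 1) = c * z" if zb: "z \<in> ball 0 1" for z
  proof (cases "z = 0")
    case False
    have zi: "z \<notin> \<int>"
    proof
      assume "z \<in> \<int>"
      then obtain n where n: "z = of_int n" by (auto elim: Ints_cases)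
      then have "\<bar>n\<bar> < 1" using zb by simp
      then show False using n False by simp
    qed
    have e: "nome z = exp (c * z)" by (simp add: nome_def c_def)
    have ne: "nome z \<noteq> 1"
    proof
      assume "nome z = 1"
      then obtain n where "2 * pi * Re z = of_int (2 * n) * pi" "Im z = 0"
        by (auto simp: nome_def exp_eq_1)
      then have "z = of_int n" by (simp add: complex_eq_iff)
      then show False using zi by simp
    qed
    have "Digamma (1 + z) = Digamma z + 1 / z"
      using Digamma_plus1[OF False] by (simp add: add.commute)
    then have "\<phi> 0 z = of_real pi * cot (of_real pi * z) - 1 / z"
      using Digamma_reflection[OF zi] by (simp add: \<phi>_def algebra_simps)
    then have "z * \<phi> 0 z + 1 - of_real pi * \<i> * z = z * (of_real pi * cot (of_real pi * z)) - of_real pi * \<i> * z"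
      using False by (simp add: right_diff_distrib)
    also have "\<dots> = c * z / (nome z - 1)"
      unfolding pi_cot_eq_nome[OF ne] c_def using ne by (simp add: divide_simps) (simp add: algebra_simps)
    finally show ?thesis using ne e by simp
  qed auto
  have "(\<lambda>z. (z * \<phi> 0 z + 1 - of_real pi * \<i> * z) * (exp (c * z) - 1)) has_fps_expansion
      (fps_X * \<Phi> + 1 - fps_const (of_real pi * \<i>) * fps_X) * (fps_exp c - 1)"
    by (intro fps_expansion_intros exp1)
  moreover have "(\<lambda>z. (z * \<phi> 0 z + 1 - of_real pi * \<i> * z) * (exp (c * z) - 1)) has_fps_expansion fps_const c * fps_X"
  proof -
    have "eventually (\<lambda>u. u \<in> ball 0 1) (nhds (0 :: complex))"
      by (intro eventually_nhds_in_open) auto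
    then have "eventually (\<lambda>z. (z * \<phi> 0 z + 1 - of_real pi * \<i> * z) * (exp (c * z) - 1) = c * z) (nhds 0)"
      by eventually_elim (rule eq)
    moreover have "(\<lambda>z. c * z) has_fps_expansion fps_const c * fps_X"
      by (intro fps_expansion_intros)
    ultimately show ?thesis
      by (subst has_fps_expansion_cong[OF _ refl]) auto
  qed
  ultimately have fe: "(fps_X * \<Phi> + 1 - fps_const (of_real pi * \<i>) * fps_X) * (fps_exp c - 1) = fps_const c * fps_X"
    by (rule fps_expansion_unique_complex)
  define \<beta>c where "\<beta>c = \<beta> oo (fps_const c * fps_X)"
  have bX: "fps_exp c - 1 = fps_const c * fps_X * \<beta>c"
  proof (rule fps_ext)
    fix n
    show "fps_nth (fps_exp c - 1) n = fps_nth (fps_const c * fps_X * \<beta>c) n"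
      by (cases n) (simp_all add: \<beta>c_def \<beta>_def fps_compose_linear mult.assoc del: fact_Suc)
  qed
  have "fps_const c * fps_X * ((fps_X * \<Phi> + 1 - fps_const (of_real pi * \<i>) * fps_X) * \<beta>c) = fps_const c * fps_X * 1"
    using fe unfolding bX by (simp add: mult_ac)
  then have "(fps_X * \<Phi> + 1 - fps_const (of_real pi * \<i>) * fps_X) * \<beta>c = 1"
    using c by (subst (asm) mult_left_cancel) auto
  then have "fps_X * \<Phi> + 1 - fps_const (of_real pi * \<i>) * fps_X = inverse \<beta>c"
    by (metis fps_inverse_unique mult.commute)
  also have "inverse \<beta>c = inverse \<beta> oo (fps_const c * fps_X)"
    unfolding \<beta>c_def by (rule fps_inverse_compose [symmetric]) (auto simp: \<beta>_def)
  finally have "fps_nth (fps_X * \<Phi> + 1 - fps_const (of_real pi * \<i>) * fps_X) k =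
      c ^ k * fps_nth (inverse \<beta>) k"
    by (simp add: fps_compose_linear)
  moreover have "fps_nth (fps_X * \<Phi> + 1 - fps_const (of_real pi * \<i>) * fps_X) k = fps_nth \<Phi> (k - 1)"
    using k by (simp add: fps_X_nth)
  ultimately have "fps_nth \<Phi> (k - 1) = c ^ k * (bernoulli_number k / fact k)"
    by (simp add: bernoulli_number_def \<beta>_def)
  then show ?thesis using coef by (simp add: c_def)
qed

text \<open>The row c = 0 of the lattice, with value 2 zeta(k). Positivity of the real polygamma
  function of odd index makes it nonzero, and with it the Bernoulli number.\<close>

lemma zeta_lattice_row:
  assumes k: "k \<ge> 4" "even k"
  shows "((\<lambda>d :: int. inverse (of_int d :: complex) ^ k) has_sum
      - ((2 * of_real pi * \<i>) ^ k * bernoulli_number k / fact k)) UNIV"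
    and "Polygamma (k - 1) (1 :: complex) \<noteq> 0"
proof -
  let ?f = "\<lambda>d :: int. inverse (of_int d :: complex) ^ k"
  let ?P = "Polygamma (k - 1) (1 :: complex) / fact (k - 1)"
  have sm: "(\<lambda>n. inverse (1 + of_nat n :: complex) ^ k) sums ?P"
    using sums_inverse_power_Polygamma[of k 1] k by simp
  have "summable (\<lambda>n. norm (inverse (1 + of_nat n :: complex) ^ k))"
  proof -
    have "summable (\<lambda>n. inverse (real (Suc n)) ^ k)"
      using inverse_power_summable[of k, where 'a = real] k
      by (subst summable_Suc_iff) (simp add: power_inverse)
    moreover have "norm (inverse (1 + of_nat n :: complex) ^ k) = inverse (real (Suc n)) ^ k" for n
      by (metis norm_inverse norm_of_nat norm_power of_nat_Suc)
    ultimately show ?thesis by simp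
  qed
  then have h: "((\<lambda>n. inverse (1 + of_nat n :: complex) ^ k) has_sum ?P) UNIV"
    using sm by (rule norm_summable_imp_has_sum)
  have 1: "(?f has_sum ?P) (range (\<lambda>n. int (Suc n)))"
    by (subst has_sum_reindex) (use h in \<open>auto simp: o_def inj_on_def\<close>)
  have e: "?f (- int n - 1) = inverse (1 + of_nat n :: complex) ^ k" for n
  proof -
    have "(of_int (- int n - 1) :: complex) = - (1 + of_nat n)" by simp
    then show ?thesis using k by (simp only: inverse_minus_eq power_minus_even)
  qed
  have 2: "(?f has_sum ?P) (range (\<lambda>n. - int n - 1))"
    by (subst has_sum_reindex) (use h in \<open>auto simp: o_def inj_on_def e simp del: of_int_diff of_int_minus\<close>)
  have disj: "range (\<lambda>n. int (Suc n)) \<inter> range (\<lambda>n. - int n - 1) = {}" by auto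
  have "(?f has_sum ?P + ?P) (range (\<lambda>n. int (Suc n)) \<union> range (\<lambda>n. - int n - 1))"
    using has_sum_Un_disjoint[OF 1 2 disj] .
  then have "(?f has_sum ?P + ?P) UNIV"
  proof (rule has_sum_cong_neutral[THEN iffD1, rotated -1])
    fix x :: int assume "x \<in> UNIV - (range (\<lambda>n. int (Suc n)) \<union> range (\<lambda>n. - int n - 1))"
    moreover have "x = 0 \<or> x = int (Suc (nat (x - 1))) \<or> x = - int (nat (- x - 1)) - 1" by auto
    ultimately have "x = 0" by blast
    then show "?f x = 0" using k by simp
  qed auto
  then show "(?f has_sum - ((2 * of_real pi * \<i>) ^ k * bernoulli_number k / fact k)) UNIV"
    using bernoulli_number_Polygamma[of k] k by simp
  have "Polygamma (k - 1) (1 :: real) > 0"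
    using k by (intro Polygamma_real_odd_pos) auto
  then show "Polygamma (k - 1) (1 :: complex) \<noteq> 0"
    using Polygamma_of_real[of 1 "k - 1", where 'a = complex] by simp
qed

lemma bernoulli_number_nonzero:
  assumes "k \<ge> 4" "even k"
  shows "bernoulli_number k \<noteq> (0 :: complex)"
  using bernoulli_number_Polygamma[of k] zeta_lattice_row(2)[OF assms] assms by auto

text \<open>The lattice is summed row by row: c = 0 gives the zeta value, the other rows are
  Lipschitz sums, and the rows of c and -c agree because k is even. Summing over c produces the
  Lambert series of the divisor sums.\<close>

lemma lattice_sum_qexp:
  assumes z: "Im z > 0" and k: "k \<ge> 4" "even k"
  shows "lattice_sum k z = - ((2 * of_real pi * \<i>) ^ k * bernoulli_number k / fact k) * eval_fps (eisenstein k) (nome z)"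
proof -
  define q where "q = nome z"
  define Z :: complex where "Z = - ((2 * of_real pi * \<i>) ^ k * bernoulli_number k / fact k)"
  define Y :: complex where "Y = (2 * of_real pi * \<i>) ^ k / fact (k - 1)"
  define row where "row = (\<lambda>c :: int. if c = 0 then Z else Y * eval_fps (pow_fps (k - 1)) (q ^ nat \<bar>c\<bar>))"
  have q: "norm q < 1" using norm_nome_less_1[OF z] by (simp add: q_def)
  have row_pos: "((\<lambda>d :: int. inverse (of_int c * z + of_int d) ^ k) has_sum row c) UNIV" if "c > 0" for c
  proof -
    have "Im (of_int c * z) > 0" using that z by simp
    from lipschitz_formula[OF this k] have "((\<lambda>d :: int. inverse (of_int c * z + of_int d) ^ k) has_sum
        Y * eval_fps (pow_fps (k - 1)) (nome (of_int c * z))) UNIV" by (simp add: Y_def)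
    moreover have "nome (of_int c * z) = q ^ nat \<bar>c\<bar>"
      using that by (simp add: q_def nome_power) (simp add: nome_def mult_ac)
    ultimately show ?thesis using that by (simp add: row_def)
  qed
  have row: "((\<lambda>d :: int. inverse (of_int c * z + of_int d) ^ k) has_sum row c) UNIV" for c
  proof -
    consider "c = 0" | "c > 0" | "c < 0" by linarith
    then show ?thesis
    proof cases
      case 1
      then show ?thesis using zeta_lattice_row(1)[OF k] by (simp add: row_def Z_def)
    next
      case 2
      then show ?thesis by (rule row_pos)
    next
      case 3
      have bij: "bij_betw (uminus :: int \<Rightarrow> int) UNIV UNIV"
        by (rule bij_betw_byWitness[where f' = uminus]) auto
      have e: "inverse (of_int (- c) * z + of_int (- d)) ^ k = inverse (of_int c * z + of_int d) ^ k" for d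
      proof -
        have "(of_int (- c) * z + of_int (- d)) = - (of_int c * z + of_int d)" by simp
        then show ?thesis using k by (simp only: inverse_minus_eq power_minus_even)
      qed
      have "((\<lambda>d :: int. inverse (of_int (- c) * z + of_int d) ^ k) has_sum row (- c)) UNIV"
        using 3 by (intro row_pos) auto
      then have "((\<lambda>d :: int. inverse (of_int (- c) * z + of_int (- d)) ^ k) has_sum row (- c)) UNIV"
        by (subst has_sum_reindex_bij_betw[OF bij])
      then show ?thesis unfolding e using 3 by (simp add: row_def)
    qed
  qed
  define f where "f = (\<lambda>x :: int \<times> int. case x of (c, d) \<Rightarrow> inverse (of_int c * z + of_int d :: complex) ^ k)"
  have "f summable_on UNIV \<times> UNIV"
    unfolding f_def using lattice_sum_abs_summable[OF z k] by (simp add: Infinite_Sum.abs_summable_summable)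
  then have "(row has_sum infsum f (UNIV \<times> UNIV)) UNIV"
    by (rule has_sum_Sigma_complex) (use row in \<open>auto simp: f_def\<close>)
  then have tot: "(row has_sum lattice_sum k z) UNIV"
    by (simp add: lattice_sum_def f_def case_prod_unfold)
  let ?e = "eval_fps (sigma_fps (k - 1)) q"
  have "((\<lambda>c. Y * eval_fps (pow_fps (k - 1)) (q ^ c)) has_sum Y * ?e) {1..}"
    by (intro has_sum_cmult_right has_sum_eval_sigma_fps q)
  then have "(row has_sum Y * ?e) (int ` {1..})" "(row has_sum Y * ?e) ((\<lambda>n. - int n) ` {1..})"
    by (subst has_sum_reindex; auto simp: inj_on_def o_def row_def elim!: has_sum_cong[THEN iffD1, rotated])+
  then have "(row has_sum Y * ?e + Y * ?e) (int ` {1..} \<union> (\<lambda>n. - int n) ` {1..})"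
    by (rule has_sum_Un_disjoint) auto
  then have "(row has_sum (row 0 + (Y * ?e + Y * ?e))) (insert 0 (int ` {1..} \<union> (\<lambda>n. - int n) ` {1..}))"
    by (intro has_sum_insert) auto
  also have "insert 0 (int ` {1..} \<union> (\<lambda>n. - int n) ` {1..}) = UNIV"
  proof (intro equalityI subsetI)
    fix x :: int
    have "x = 0 \<or> x = int (nat x) \<and> nat x \<in> {1..} \<or> x = - int (nat (- x)) \<and> nat (- x) \<in> {1..}" by auto
    then show "x \<in> insert 0 (int ` {1..} \<union> (\<lambda>n. - int n) ` {1..})" by blast
  qed auto
  finally have "lattice_sum k z = row 0 + (Y * ?e + Y * ?e)"
    using tot has_sum_unique by blast
  then have ls: "lattice_sum k z = Z + 2 * Y * ?e" by (simp add: row_def)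
  define b :: complex where "b = - (2 * of_nat k / bernoulli_number k)"
  have eis: "eisenstein k = 1 + fps_const b * sigma_fps (k - 1)"
    by (rule fps_ext) (auto simp: eisenstein_def sigma_fps_def b_def)
  have rad: "ereal (norm q) < fps_conv_radius (sigma_fps (k - 1))"
    using q fps_conv_radius_sigma_fps[of "k - 1"] by (meson ereal_less(3) less_le_trans)
  then have rad': "ereal (norm q) < fps_conv_radius (fps_const b * sigma_fps (k - 1))"
    using fps_conv_radius_mult[of "fps_const b" "sigma_fps (k - 1)"] by (auto simp: min_def split: if_splits)
  have ev: "eval_fps (eisenstein k) q = 1 + b * ?e"
    unfolding eis using rad rad' by (subst eval_fps_add) (auto simp: eval_fps_mult)
  have "fact k = of_nat k * (fact (k - 1) :: complex)"
    using k by (subst fact_reduce) auto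
  then have "Z * b = 2 * Y"
    using bernoulli_number_nonzero[OF k] k by (simp add: Z_def b_def Y_def divide_simps)
  then have "Z * (1 + b * ?e) = Z + 2 * Y * ?e"
    by (simp add: algebra_simps)
  then show ?thesis using ls ev by (simp add: Z_def q_def)
qed

lemma mform_eisenstein:
  assumes k: "k \<ge> 4" "even k"
  shows "mform k (eisenstein k)"
proof (rule mformI)
  define b :: complex where "b = - (2 * of_nat k / bernoulli_number k)"
  have eis: "eisenstein k = 1 + fps_const b * sigma_fps (k - 1)"
    by (rule fps_ext) (auto simp: eisenstein_def sigma_fps_def b_def)
  have "1 \<le> fps_conv_radius (fps_const b * sigma_fps (k - 1))"
    using fps_conv_radius_mult[of "fps_const b" "sigma_fps (k - 1)"] fps_conv_radius_sigma_fps[of "k - 1"]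
    by (auto simp: min_def split: if_splits)
  then show "1 \<le> fps_conv_radius (eisenstein k :: complex fps)"
    unfolding eis using fps_conv_radius_add[of 1 "fps_const b * sigma_fps (k - 1)"]
    by (auto simp: min_def split: if_splits)
  fix z :: complex assume z: "Im z > 0"
  define Z :: complex where "Z = - ((2 * of_real pi * \<i>) ^ k * bernoulli_number k / fact k)"
  have Z: "Z \<noteq> 0" using bernoulli_number_nonzero[OF k] by (simp add: Z_def)
  have z': "Im (- 1 / z) > 0" using Im_moebius[of 0 0 "-1" 1 z] z by simp
  have "Z * eval_fps (eisenstein k) (nome (- 1 / z)) = z ^ k * (Z * eval_fps (eisenstein k) (nome z))"
    unfolding Z_def lattice_sum_qexp[OF z' k, symmetric] lattice_sum_qexp[OF z k, symmetric]
    using z by (intro lattice_sum_S) auto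
  then show "eval_fps (eisenstein k) (nome (- 1 / z)) = z ^ k * eval_fps (eisenstein k) (nome z)"
    using Z by simp
qed

section \<open>Frobenius and the trace from level \<open>p\<close>\<close>

text \<open>The substitution of q^p for q, defined on coefficients so that it makes sense over every
  commutative ring: it is applied to integral, complex and p-adic expansions alike.\<close>

definition fps_V :: "nat \<Rightarrow> 'b :: comm_ring_1 fps \<Rightarrow> 'b fps" where
  "fps_V p F = Abs_fps (\<lambda>n. if p dvd n then fps_nth F (n div p) else 0)"

definition fps_U :: "nat \<Rightarrow> 'b :: comm_ring_1 fps \<Rightarrow> 'b fps" where
  "fps_U p F = Abs_fps (\<lambda>n. fps_nth F (p * n))"

text \<open>The bridge between the two fields: one integral expansion is read over the complex
  numbers to be modular and over C_p to be estimated.\<close>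

definition fps_of_ints :: "int fps \<Rightarrow> 'b :: comm_ring_1 fps" where
  "fps_of_ints F = Abs_fps (\<lambda>n. of_int (fps_nth F n))"

lemma fps_V_nth: "fps_nth (fps_V p F) n = (if p dvd n then fps_nth F (n div p) else 0)"
  by (simp add: fps_V_def)

lemma fps_U_nth [simp]: "fps_nth (fps_U p F) n = fps_nth F (p * n)"
  by (simp add: fps_U_def)

lemma fps_of_ints_nth [simp]: "fps_nth (fps_of_ints F) n = of_int (fps_nth F n)"
  by (simp add: fps_of_ints_def)

lemma fps_V_mult:
  assumes "p > 0"
  shows "fps_V p (F * G) = fps_V p F * fps_V p G"
proof (rule fps_ext)
  fix n
  show "fps_nth (fps_V p (F * G)) n = fps_nth (fps_V p F * fps_V p G) n"
  proof (cases "p dvd n")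
    case True
    then obtain m where n: "n = p * m" by auto
    have "(\<Sum>i=0..n. fps_nth (fps_V p F) i * fps_nth (fps_V p G) (n - i)) =
        (\<Sum>i\<in>(\<lambda>i. p * i) ` {0..m}. fps_nth (fps_V p F) i * fps_nth (fps_V p G) (n - i))"
      by (rule sum.mono_neutral_right) (use assms in \<open>auto simp: n fps_V_nth\<close>)
    also have "\<dots> = (\<Sum>i=0..m. fps_nth F i * fps_nth G (m - i))"
      using assms by (subst sum.reindex)
        (auto simp: inj_on_def n fps_V_nth right_diff_distrib' [symmetric] intro!: sum.cong)
    finally show ?thesis using assms by (simp add: fps_V_nth n fps_mult_nth)
  next
    case False
    have "fps_nth (fps_V p F) i * fps_nth (fps_V p G) (n - i) = 0" if "i \<le> n" for i
      using False that by (auto simp: fps_V_nth) (metis dvd_diffD)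
    then show ?thesis using False by (simp add: fps_V_nth fps_mult_nth)
  qed
qed

lemma fps_V_1 [simp]: "p > 0 \<Longrightarrow> fps_V p 1 = 1"
  by (rule fps_ext) (auto simp: fps_V_nth)

lemma fps_V_const [simp]: "p > 0 \<Longrightarrow> fps_V p (fps_const c) = fps_const c"
  by (rule fps_ext) (auto simp: fps_V_nth)

lemma fps_V_power: "p > 0 \<Longrightarrow> fps_V p (F ^ n) = fps_V p F ^ n"
  by (induction n) (simp_all add: fps_V_mult)

lemma fps_V_add: "fps_V p (F + G) = fps_V p F + fps_V p G"
  by (rule fps_ext) (simp add: fps_V_nth)

lemma fps_V_diff: "fps_V p (F - G) = fps_V p F - fps_V p G"
  by (rule fps_ext) (simp add: fps_V_nth)

lemma fps_of_ints_simps [simp]: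
  "fps_of_ints (F + G) = fps_of_ints F + fps_of_ints G"
  "fps_of_ints (F - G) = fps_of_ints F - fps_of_ints G"
  "fps_of_ints (F * G) = fps_of_ints F * fps_of_ints G"
  "fps_of_ints (fps_const c) = fps_const (of_int c)"
  "fps_of_ints 1 = 1"
  "fps_of_ints 0 = 0"
  "fps_of_ints (fps_V p F) = fps_V p (fps_of_ints F)"
  "fps_of_ints (fps_U p F) = fps_U p (fps_of_ints F)"
  by (rule fps_ext; simp add: fps_mult_nth fps_V_nth; fail)+

lemma fps_of_ints_power [simp]: "fps_of_ints (F ^ n) = fps_of_ints F ^ n"
  by (induction n) simp_all

lemma eval_fps_V:
  fixes F :: "complex fps"
  assumes p: "p > 0" and F: "fps_conv_radius F \<ge> 1"
  shows "fps_conv_radius (fps_V p F) \<ge> 1"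
    and "norm q < 1 \<Longrightarrow> eval_fps (fps_V p F) q = eval_fps F (q ^ p)"
proof -
  have sums: "(\<lambda>n. fps_nth (fps_V p F) n * q ^ n) sums eval_fps F (q ^ p)" if q: "norm q < 1" for q
  proof -
    have "norm (q ^ p) < 1" using q p by (simp add: norm_power power_less_one_iff)
    then have "ereal (norm (q ^ p)) < fps_conv_radius F"
      using F by (meson ereal_less(3) less_le_trans)
    then have "(\<lambda>n. fps_nth F n * (q ^ p) ^ n) sums eval_fps F (q ^ p)"
      by (rule sums_eval_fps)
    then have "(\<lambda>n. (\<lambda>n. fps_nth (fps_V p F) n * q ^ n) (p * n)) sums eval_fps F (q ^ p)"
      using p by (simp add: fps_V_nth power_mult)
    then show ?thesis
      using p by (subst (asm) sums_mono_reindex) (auto simp: strict_mono_def fps_V_nth)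
  qed
  show "fps_conv_radius (fps_V p F) \<ge> 1"
    unfolding fps_conv_radius_def
  proof (rule conv_radius_geI_ex)
    fix r :: real assume r: "0 < r" "ereal r < 1"
    then show "\<exists>z. norm z = r \<and> summable (\<lambda>n. fps_nth (fps_V p F) n * z ^ n)"
      using sums[of "of_real r"] by (intro exI[of _ "of_real r"]) (auto simp: sums_iff)
  qed
  show "norm q < 1 \<Longrightarrow> eval_fps (fps_V p F) q = eval_fps F (q ^ p)"
    using sums[of q] by (simp add: eval_fps_def sums_iff)
qed

lemma sum_roots_of_unity_power:
  assumes p: "p > 0"
  shows "(\<Sum>b<p. exp (2 * of_real pi * \<i> * of_nat n * of_nat b / of_nat p)) = (if p dvd n then of_nat p else 0)"
proof -
  define \<zeta> where "\<zeta> = exp (2 * of_real pi * \<i> * of_nat n / of_nat p)"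
  have z: "exp (2 * of_real pi * \<i> * of_nat n * of_nat b / of_nat p) = \<zeta> ^ b" for b
    by (simp add: \<zeta>_def exp_of_nat_mult [symmetric] mult_ac)
  have zp: "\<zeta> ^ p = 1"
  proof -
    have "\<zeta> ^ p = exp (2 * of_real pi * \<i> * of_nat n)"
      using p by (simp add: \<zeta>_def exp_of_nat_mult [symmetric])
    also have "\<dots> = nome 0 ^ n" by (simp add: nome_def) (metis exp_2pi_1_int mult.assoc mult.commute of_int_of_nat_eq)
    finally show ?thesis by (simp add: nome_def)
  qed
  have z1: "\<zeta> = 1 \<longleftrightarrow> p dvd n"
  proof
    assume "\<zeta> = 1"
    then obtain k :: int where "2 * pi * real n / real p = of_int (2 * k) * pi"
      by (auto simp: \<zeta>_def exp_eq_1)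
    then have "real n = of_int k * real p" using p by (simp add: field_simps)
    then have "int n = k * int p" by (metis of_int_eq_iff of_int_mult of_int_of_nat_eq)
    then show "p dvd n" by (metis dvd_triv_right int_dvd_int_iff)
  next
    assume "p dvd n"
    then obtain m where "n = p * m" by auto
    then have "\<zeta> = exp (2 * of_real pi * \<i> * of_nat m)" using p by (simp add: \<zeta>_def mult_ac)
    then show "\<zeta> = 1" using nome_add_of_int[of 0 "int m"] by (simp add: nome_def)
  qed
  show ?thesis
  proof (cases "p dvd n")
    case True
    then show ?thesis unfolding z using z1 by simp
  next
    case False
    then show ?thesis unfolding z using z1 zp by (simp add: geometric_sum)
  qed
qed

text \<open>The nomes of the points (z + b) / p differ by p-th roots of unity; by orthogonality
  their average kills all exponents not divisible by p.\<close>

lemma eval_fps_U: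
  fixes F :: "complex fps"
  assumes p: "p > 0" and F: "fps_conv_radius F \<ge> 1"
  shows "fps_conv_radius (fps_U p F) \<ge> 1"
    and "Im z > 0 \<Longrightarrow> (\<Sum>b<p. eval_fps F (nome ((z + of_nat b) / of_nat p))) = of_nat p * eval_fps (fps_U p F) (nome z)"
proof -
  have sums: "(\<lambda>n. of_nat p * (fps_nth (fps_U p F) n * nome z ^ n)) sums (\<Sum>b<p. eval_fps F (nome ((z + of_nat b) / of_nat p)))"
    if z: "Im z > 0" for z
  proof -
    define y where "y = nome (z / of_nat p)"
    have yb: "nome ((z + of_nat b) / of_nat p) ^ n = y ^ n * exp (2 * of_real pi * \<i> * of_nat n * of_nat b / of_nat p)" for b n
      by (simp add: y_def nome_power exp_add [symmetric] add_divide_distrib algebra_simps)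
    have yp: "y ^ (p * n) = nome z ^ n" for n
      using p by (simp add: y_def nome_power mult_ac)
    have "(\<lambda>n. fps_nth F n * nome ((z + of_nat b) / of_nat p) ^ n) sums eval_fps F (nome ((z + of_nat b) / of_nat p))" for b
    proof -
      have "Im ((z + of_nat b) / of_nat p) > 0" using z p by simp
      then have "ereal (norm (nome ((z + of_nat b) / of_nat p))) < fps_conv_radius F"
        using F norm_nome_less_1 by (meson ereal_less(3) less_le_trans)
      then show ?thesis by (rule sums_eval_fps)
    qed
    then have "(\<lambda>n. \<Sum>b<p. fps_nth F n * nome ((z + of_nat b) / of_nat p) ^ n) sums (\<Sum>b<p. eval_fps F (nome ((z + of_nat b) / of_nat p)))"
      by (intro sums_sum)
    also have "(\<lambda>n. \<Sum>b<p. fps_nth F n * nome ((z + of_nat b) / of_nat p) ^ n) =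
        (\<lambda>n. fps_nth F n * y ^ n * (if p dvd n then of_nat p else 0))"
      by (rule ext) (simp only: yb sum_roots_of_unity_power[OF p, symmetric] sum_distrib_left mult.assoc)
    finally have s: "(\<lambda>n. fps_nth F n * y ^ n * (if p dvd n then of_nat p else 0)) sums (\<Sum>b<p. eval_fps F (nome ((z + of_nat b) / of_nat p)))" .
    have "(\<lambda>n. fps_nth F (p * n) * y ^ (p * n) * (if p dvd (p * n) then of_nat p else 0)) sums (\<Sum>b<p. eval_fps F (nome ((z + of_nat b) / of_nat p)))"
      using p s by (subst sums_mono_reindex[of "\<lambda>n. p * n" "\<lambda>n. fps_nth F n * y ^ n * (if p dvd n then of_nat p else 0)"])
        (auto simp: strict_mono_def)
    then show ?thesis unfolding yp by (simp add: mult_ac)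
  qed
  have sm: "summable (\<lambda>n. fps_nth (fps_U p F) n * nome z ^ n)" if "Im z > 0" for z
  proof -
    have "summable (\<lambda>n. of_nat p * (fps_nth (fps_U p F) n * nome z ^ n))"
      using sums[OF that] by (auto simp: sums_iff)
    then show ?thesis using p by (subst (asm) summable_cmult_iff) auto
  qed
  show "fps_conv_radius (fps_U p F) \<ge> 1"
    unfolding fps_conv_radius_def
  proof (rule conv_radius_geI_ex)
    fix r :: real assume r: "0 < r" "ereal r < 1"
    then have "norm (of_real r :: complex) < 1" "of_real r \<noteq> (0 :: complex)" by auto
    then obtain z where "Im z > 0" "nome z = of_real r" using nome_surj by blast
    then show "\<exists>z. norm z = r \<and> summable (\<lambda>n. fps_nth (fps_U p F) n * z ^ n)"
      using sm[of z] r by (intro exI[of _ "of_real r"]) auto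
  qed
  show "(\<Sum>b<p. eval_fps F (nome ((z + of_nat b) / of_nat p))) = of_nat p * eval_fps (fps_U p F) (nome z)" if z: "Im z > 0"
    using sums[OF z] sm[OF z] unfolding eval_fps_def[of "fps_U p F"]
    by (metis sums_unique suminf_mult)
qed

text \<open>The inversion z to -1/z permutes the cosets belonging to nonzero residues b by b b' = -1
  mod p, whence the sign.\<close>

lemma neg_inverse_mod_prime:
  assumes "prime p" "b \<in> {1..<p}"
  shows "\<exists>!b'. b' \<in> {1..<p} \<and> p dvd b * b' + (1 :: nat)"
proof -
  have cop: "coprime b p"
  proof -
    have "\<not> p dvd b" using assms(2) by (auto dest: nat_dvd_not_less)
    then show ?thesis using assms(1) by (metis coprime_commute prime_imp_coprime)
  qed
  obtain x where x: "[b * x = 1] (mod p)"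
    using cong_solve_coprime_nat[OF cop] by auto
  define b' where "b' = p - x mod p"
  have p: "p > 1" using assms prime_gt_1_nat by auto
  have x0: "x mod p \<noteq> 0"
  proof
    assume "x mod p = 0"
    then have "p dvd b * x" by auto
    then have "p dvd 1" using x by (metis cong_dvd_iff)
    then show False using p by simp
  qed
  have "[b * b' + b * (x mod p) = 0] (mod p)"
    using p by (simp add: b'_def cong_0_iff flip: distrib_left)
  moreover have "[b * (x mod p) = 1] (mod p)"
    using x by (simp add: cong_def mod_mult_right_eq)
  ultimately have "[b * b' + 1 = 0] (mod p)"
    by (metis (no_types, lifting) cong_add_lcancel_nat cong_sym cong_trans)
  then have ex: "b' \<in> {1..<p} \<and> p dvd b * b' + 1"
    using x0 p by (auto simp: b'_def cong_0_iff Suc_le_eq)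
  show ?thesis
  proof (rule ex1I[of _ b'])
    show "b' \<in> {1..<p} \<and> p dvd b * b' + 1" by (rule ex)
    fix c assume c: "c \<in> {1..<p} \<and> p dvd b * c + 1"
    then have "[b * c + 1 = b * b' + 1] (mod p)"
      using ex by (meson cong_0_iff cong_sym cong_trans)
    then have "[b * c = b * b'] (mod p)" by (simp only: cong_add_rcancel_nat)
    then have "[c = b'] (mod p)" using cop by (simp add: cong_mult_lcancel_nat)
    then show "c = b'" using c ex by (simp add: cong_less_modulus_unique_nat)
  qed
qed

text \<open>The trace from level \<open>p\<close> to level one of
  \<open>h(pz) (E(z) - p\<^sup>a E(pz))\<^sup>N\<close>; the summands of the \<open>U\<close>-part are its translates under the
  coset representatives \<open>S T\<^sup>b\<close>.\<close>

lemma mform_trace: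
  fixes h E :: "complex fps"
  assumes p: "prime p" and h: "mform k h" and E: "mform a E"
  shows "mform (k + N * a) (fps_V p h * (E - fps_const (of_nat p ^ a) * fps_V p E) ^ N
     + fps_const (of_nat p / of_nat p ^ k) * fps_U p (h * (fps_V p E - E) ^ N))"
    (is "mform _ ?T")
proof (rule mformI)
  have p0: "p > 0" using p by (simp add: prime_gt_0_nat)
  have rh: "fps_conv_radius h \<ge> 1" and rE: "fps_conv_radius E \<ge> 1"
    using h E by (auto simp: mform_def)
  note rV = eval_fps_V(1)[OF p0]
  have rm: "fps_conv_radius (F * G) \<ge> 1" if "fps_conv_radius F \<ge> 1" "fps_conv_radius G \<ge> 1" for F G :: "complex fps"
    using that fps_conv_radius_mult[of F G] by (meson min.boundedI order_trans)
  have rd: "fps_conv_radius (F - G) \<ge> 1" if "fps_conv_radius F \<ge> 1" "fps_conv_radius G \<ge> 1" for F G :: "complex fps"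
    using that fps_conv_radius_diff[of F G] by (meson min.boundedI order_trans)
  have ra: "fps_conv_radius (F + G) \<ge> 1" if "fps_conv_radius F \<ge> 1" "fps_conv_radius G \<ge> 1" for F G :: "complex fps"
    using that fps_conv_radius_add[of F G] by (meson min.boundedI order_trans)
  have rp: "fps_conv_radius (F ^ n) \<ge> 1" if "fps_conv_radius F \<ge> 1" for F :: "complex fps" and n
    using that fps_conv_radius_power[of F n] by (meson order_trans)
  have rc: "fps_conv_radius (fps_const c :: complex fps) \<ge> 1" for c by simp
  note r_intros = rm rd ra rp rc rh rE rV eval_fps_U(1)[OF p0]
  show "fps_conv_radius ?T \<ge> 1" by (intro r_intros)
  have lt: "ereal (norm (nome z)) < fps_conv_radius F" if "Im z > 0" "fps_conv_radius F \<ge> 1" for z and F :: "complex fps"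
    using that norm_nome_less_1 by (meson ereal_less(3) less_le_trans)
  define H where "H = (\<lambda>z. eval_fps h (nome z))"
  define e where "e = (\<lambda>z. eval_fps E (nome z))"
  have nomep: "nome z ^ p = nome (of_nat p * z)" for z by (simp add: nome_power) (simp add: nome_def mult_ac)
  have V: "eval_fps (fps_V p F) (nome z) = eval_fps F (nome (of_nat p * z))"
    if "Im z > 0" "fps_conv_radius F \<ge> 1" for z F
    using eval_fps_V(2)[OF p0 that(2) norm_nome_less_1[OF that(1)]] by (simp add: nomep)
  have e_int: "e (z + of_nat b) = e z" for z b
    using nome_add_of_int[of z "int b"] by (simp add: e_def)
  define t where "t = (\<lambda>b z. H ((z + of_nat b) / of_nat p) * (e z - e ((z + of_nat b) / of_nat p)) ^ N)"
  define f where "f = (\<lambda>z. H (of_nat p * z) * (e z - of_nat p ^ a * e (of_nat p * z)) ^ N)"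
  have ev: "eval_fps ?T (nome z) = f z + (\<Sum>b<p. t b z) / of_nat p ^ k" if z: "Im z > 0" for z
  proof -
    have "eval_fps ?T (nome z) = eval_fps (fps_V p h) (nome z) * (e z - of_nat p ^ a * eval_fps (fps_V p E) (nome z)) ^ N
        + (of_nat p / of_nat p ^ k) * eval_fps (fps_U p (h * (fps_V p E - E) ^ N)) (nome z)"
      using z unfolding e_def
      by (subst eval_fps_add eval_fps_mult eval_fps_power eval_fps_diff eval_fps_const; (intro lt r_intros z)?)+ simp
    also have "eval_fps (fps_V p h) (nome z) = H (of_nat p * z)"
      using V[OF z rh] by (simp add: H_def)
    also have "eval_fps (fps_V p E) (nome z) = e (of_nat p * z)"
      using V[OF z rE] by (simp add: e_def)
    also have "(of_nat p / of_nat p ^ k) * eval_fps (fps_U p (h * (fps_V p E - E) ^ N)) (nome z) =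
        (\<Sum>b<p. eval_fps (h * (fps_V p E - E) ^ N) (nome ((z + of_nat b) / of_nat p))) / of_nat p ^ k"
      by (subst eval_fps_U(2)[OF p0 _ z]) (auto intro!: r_intros)
    also have "(\<Sum>b<p. eval_fps (h * (fps_V p E - E) ^ N) (nome ((z + of_nat b) / of_nat p))) = (\<Sum>b<p. t b z)"
    proof (rule sum.cong [OF refl])
      fix b
      have y: "Im ((z + of_nat b) / of_nat p) > 0" using z p0 by simp
      have "eval_fps (h * (fps_V p E - E) ^ N) (nome ((z + of_nat b) / of_nat p)) =
          H ((z + of_nat b) / of_nat p) * (eval_fps (fps_V p E) (nome ((z + of_nat b) / of_nat p)) - e ((z + of_nat b) / of_nat p)) ^ N"
        unfolding H_def e_def
        by (subst eval_fps_mult eval_fps_power eval_fps_diff; (intro lt r_intros y)?)+ simp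
      also have "eval_fps (fps_V p E) (nome ((z + of_nat b) / of_nat p)) = e (z + of_nat b)"
        using V[OF y rE] p0 by (simp add: e_def)
      finally show "eval_fps (h * (fps_V p E - E) ^ N) (nome ((z + of_nat b) / of_nat p)) = t b z"
        by (simp add: t_def e_int)
    qed
    finally show ?thesis by (simp add: f_def)
  qed
  fix z :: complex assume z: "Im z > 0"
  have z0: "z \<noteq> 0" using z by auto
  have pz: "(of_nat p :: complex) \<noteq> 0" using p0 by simp
  have z': "Im (- 1 / z) > 0" using Im_moebius[of 0 0 "-1" 1 z] z by simp
  have HS: "H (- 1 / y) = y ^ k * H y" and eS: "e (- 1 / y) = y ^ a * e y" if "Im y > 0" for y
    using mform_S[OF h that] mform_S[OF E that] by (simp_all add: H_def e_def)
  \<comment> \<open>The inversion exchanges the identity coset with the coset of b = 0.\<close>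
  have f1: "f (- 1 / z) = z ^ (k + N * a) * (t 0 z / of_nat p ^ k)"
  proof -
    have y: "Im (z / of_nat p) > 0" using z p0 by simp
    have eq: "of_nat p * (- 1 / z) = - 1 / (z / of_nat p)" using pz z0 by simp
    have "f (- 1 / z) = (z / of_nat p) ^ k * H (z / of_nat p) *
        (z ^ a * e z - of_nat p ^ a * ((z / of_nat p) ^ a * e (z / of_nat p))) ^ N"
      unfolding f_def eq HS[OF y] eS[OF y] eS[OF z] ..
    also have "z ^ a * e z - of_nat p ^ a * ((z / of_nat p) ^ a * e (z / of_nat p)) = z ^ a * (e z - e (z / of_nat p))"
      using pz by (simp add: power_divide right_diff_distrib)
    finally show ?thesis using pz
      by (simp add: t_def power_divide power_mult_distrib power_add mult.commute[of N] flip: power_mult)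
  qed
  have t0: "t 0 (- 1 / z) / of_nat p ^ k = z ^ (k + N * a) * f z"
  proof -
    have y: "Im (of_nat p * z) > 0" using z p0 by simp
    have eq: "(- 1 / z + of_nat 0) / of_nat p = - 1 / (of_nat p * z)" using pz z0 by simp
    have "t 0 (- 1 / z) = (of_nat p * z) ^ k * H (of_nat p * z) *
        (z ^ a * e z - (of_nat p * z) ^ a * e (of_nat p * z)) ^ N"
      unfolding t_def eq HS[OF y] eS[OF y] eS[OF z] ..
    also have "z ^ a * e z - (of_nat p * z) ^ a * e (of_nat p * z) = z ^ a * (e z - of_nat p ^ a * e (of_nat p * z))"
      by (simp add: power_mult_distrib right_diff_distrib)
    finally show ?thesis using pz
      by (simp add: f_def power_mult_distrib power_add mult.commute[of N] flip: power_mult)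
  qed
  define r where "r = (\<lambda>b. THE b'. b' \<in> {1..<p} \<and> p dvd b * b' + 1)"
  have r: "r b \<in> {1..<p}" "p dvd b * r b + 1" if "b \<in> {1..<p}" for b
    using theI'[OF neg_inverse_mod_prime[OF p that]] by (auto simp: r_def)
  have rr: "r (r b) = b" if "b \<in> {1..<p}" for b
  proof -
    have "b \<in> {1..<p} \<and> p dvd r b * b + 1" using r[OF that] that by (simp add: mult.commute)
    then show ?thesis
      using the1_equality[OF neg_inverse_mod_prime[OF p r(1)[OF that]]] by (simp add: r_def)
  qed
  \<comment> \<open>With b b' + 1 = p m, the point (-1/z + b) / p is the image of (z + b') / p under
    an element of SL2(Z) whose automorphy factor at that point is z.\<close>
  have tb: "t b (- 1 / z) = z ^ (k + N * a) * t (r b) z" if b: "b \<in> {1..<p}" for b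
  proof -
    obtain m where m: "b * r b + 1 = p * m" using r[OF b] by auto
    define y where "y = (z + of_nat (r b)) / of_nat p"
    have y: "Im y > 0" using z p0 by (simp add: y_def)
    have det: "int b * (- int (r b)) - (- int m) * int p = 1"
      using m by (metis (no_types, lifting) add.commute add_diff_cancel_left' diff_minus_eq_add minus_mult_left mult.commute mult_minus_right of_nat_1 of_nat_add of_nat_mult uminus_add_conv_diff)
    have den: "of_int (int p) * y + of_int (- int (r b)) = z"
      using pz by (simp add: y_def)
    have "(of_nat b * of_nat (r b) + 1 :: complex) = of_nat p * of_nat m"
      using m by (metis of_nat_1 of_nat_add of_nat_mult)
    then have "of_nat p * (of_int (int b) * y + of_int (- int m)) = of_nat b * z - 1"
      using pz by (simp add: y_def right_diff_distrib) (simp add: algebra_simps)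
    then have num: "of_int (int b) * y + of_int (- int m) = (of_nat b * z - 1) / of_nat p"
      using pz by (simp add: field_simps)
    have eq: "(- 1 / z + of_nat b) / of_nat p =
        (of_int (int b) * y + of_int (- int m)) / (of_int (int p) * y + of_int (- int (r b)))"
      unfolding den num using z0 pz by (simp add: divide_simps)
    have "H ((- 1 / z + of_nat b) / of_nat p) = z ^ k * H y"
      unfolding eq H_def using mform_moebius[OF h det y] unfolding den .
    moreover have "e ((- 1 / z + of_nat b) / of_nat p) = z ^ a * e y"
      unfolding eq e_def using mform_moebius[OF E det y] unfolding den .
    ultimately have "t b (- 1 / z) = z ^ k * H y * (z ^ a * (e z - e y)) ^ N"
      using eS[OF z] by (simp add: t_def right_diff_distrib)
    then show ?thesis
      by (simp add: t_def y_def power_mult_distrib power_add mult.commute[of N] flip: power_mult)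
  qed
  have split: "(\<Sum>b<p. u b) = u 0 + (\<Sum>b\<in>{1..<p}. u b)" for u :: "nat \<Rightarrow> complex"
    using p0 by (simp add: lessThan_atLeast0 sum.atLeast_Suc_lessThan)
  have "(\<Sum>b\<in>{1..<p}. t b (- 1 / z)) = (\<Sum>b\<in>{1..<p}. z ^ (k + N * a) * t (r b) z)"
    using tb by (intro sum.cong) auto
  also have "\<dots> = (\<Sum>b\<in>{1..<p}. z ^ (k + N * a) * t b z)"
    by (rule sum.reindex_bij_witness[of _ r r]) (use r rr in auto)
  finally have "(\<Sum>b\<in>{1..<p}. t b (- 1 / z)) = z ^ (k + N * a) * (\<Sum>b\<in>{1..<p}. t b z)"
    by (simp add: sum_distrib_left)
  then show "eval_fps ?T (nome (- 1 / z)) = z ^ (k + N * a) * eval_fps ?T (nome z)"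
    unfolding ev[OF z] ev[OF z'] split add_divide_distrib f1 t0
    by (simp add: algebra_simps)
qed

text \<open>If F is constant modulo p, then V(F) - F is divisible by p, and its N-th power beats the
  denominator p^(k-1) of the U-part. The trace becomes integral and differs from its first term by a
  multiple of p^(N+1-k).\<close>

lemma mform_trace_int:
  fixes h F Y :: "int fps"
  assumes p: "prime p" and h: "mform k (fps_of_ints h)" and F: "mform a (fps_of_ints F)"
    and FY: "F = fps_const D + fps_const (int p) * Y" and N: "k \<le> N + 1"
  shows "mform (k + N * a) (fps_of_ints (fps_V p h * (F - fps_const (int p ^ a) * fps_V p F) ^ N
     + fps_const (int p ^ (N + 1 - k)) * fps_U p (h * (fps_V p Y - Y) ^ N)))"
proof -
  have p0: "p > 0" using p by (simp add: prime_gt_0_nat)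
  have VF: "fps_V p F - F = fps_const (int p) * (fps_V p Y - Y)"
    using p0 by (simp add: FY fps_V_add fps_V_mult right_diff_distrib)
  have "fps_const (of_nat p / of_nat p ^ k) * fps_U p (fps_of_ints h * (fps_V p (fps_of_ints F) - fps_of_ints F) ^ N) =
     fps_const (of_nat p ^ (N + 1 - k)) * fps_U p (fps_of_ints h * (fps_V p (fps_of_ints Y) - fps_of_ints Y) ^ N :: complex fps)"
  proof -
    have "fps_V p (fps_of_ints F) - fps_of_ints F = (fps_of_ints (fps_const (int p) * (fps_V p Y - Y)) :: complex fps)"
      using VF by (metis fps_of_ints_simps(2,7))
    then have e1: "fps_of_ints h * (fps_V p (fps_of_ints F) - fps_of_ints F) ^ N =
        fps_const (of_nat p ^ N) * (fps_of_ints h * (fps_V p (fps_of_ints Y) - fps_of_ints Y) ^ N :: complex fps)"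
      by (simp add: power_mult_distrib fps_const_power mult_ac)
    have e2: "fps_U p (fps_const c * G) = fps_const c * fps_U p G" for c :: complex and G
      by (rule fps_ext) simp
    have e3: "of_nat p / of_nat p ^ k * of_nat p ^ N = (of_nat p ^ (N + 1 - k) :: complex)"
      using N p0 by (simp add: power_diff field_simps)
    show ?thesis
      unfolding e1 e2 e3 [symmetric] fps_const_mult [symmetric] by (simp only: mult.assoc)
  qed
  then show ?thesis
    using mform_trace[OF p h F, of N] by simp
qed

section \<open>Valuations\<close>

text \<open>Sorts the terms by what controls their valuation: the middle ones carry a factor p w^2,
  and w^p is the only nonconstant term without p.\<close>

lemma binomial_prime_expansion:
  fixes w :: "'b :: comm_ring_1"
  assumes "prime p"
  shows "(1 + w) ^ p = 1 + of_nat p * w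
    + of_nat p * w\<^sup>2 * (\<Sum>j = 2..<p. of_nat ((p choose j) div p) * w ^ (j - 2)) + w ^ p"
proof -
  have p: "p \<ge> 2" using assms by (rule prime_ge_2_nat)
  have "(1 + w) ^ p = (\<Sum>j\<le>p. of_nat (p choose j) * w ^ j)"
    using binomial_ring[of w 1 p] by (simp add: add.commute)
  also have "{..p} = insert 0 (insert 1 (insert p {2..<p}))" using p by auto
  also have "(\<Sum>j\<in>insert 0 (insert 1 (insert p {2..<p})). of_nat (p choose j) * w ^ j) =
      1 + of_nat p * w + (\<Sum>j = 2..<p. of_nat (p choose j) * w ^ j) + w ^ p"
    using p by (simp add: algebra_simps)
  also have "(\<Sum>j = 2..<p. of_nat (p choose j) * w ^ j) =
      (\<Sum>j = 2..<p. of_nat p * w\<^sup>2 * (of_nat ((p choose j) div p) * w ^ (j - 2)))"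
  proof (rule sum.cong [OF refl])
    fix j assume j: "j \<in> {2..<p}"
    then have "p dvd (p choose j)" using assms by (intro dvd_choose_prime) auto
    then have "(of_nat (p choose j) :: 'b) = of_nat p * of_nat ((p choose j) div p)"
      by (simp flip: of_nat_mult)
    moreover have "w ^ j = w\<^sup>2 * w ^ (j - 2)"
      using j by (metis atLeastLessThan_iff le_add_diff_inverse power_add)
    ultimately show "of_nat (p choose j) * w ^ j = of_nat p * w\<^sup>2 * (of_nat ((p choose j) div p) * w ^ (j - 2))"
      by (simp add: mult_ac)
  qed
  finally show ?thesis by (simp add: sum_distrib_left)
qed

lemma one_plus_prime_power_cong:
  assumes "prime p" "p \<ge> 3"
  shows "[(1 + int p) ^ (p ^ k) = 1 + int p ^ (k + 1)] (mod int p ^ (k + 2))"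
proof (induction k)
  case (Suc k)
  define P where "P = int p"
  have "P ^ (k + 2) dvd (1 + P) ^ (p ^ k) - (1 + P ^ (k + 1))"
    using Suc by (simp only: P_def cong_iff_dvd_diff)
  then obtain c where "(1 + P) ^ (p ^ k) - (1 + P ^ (k + 1)) = P ^ (k + 2) * c" by blast
  then have c: "(1 + P) ^ (p ^ k) = 1 + P ^ (k + 1) + P ^ (k + 2) * c" by simp
  define w where "w = P ^ (k + 1) * (1 + P * c)"
  define z where "z = (\<Sum>j = 2..<p. of_nat ((p choose j) div p) * w ^ (j - 2))"
  have z: "(1 + w) ^ p = 1 + P * w + P * w\<^sup>2 * z + w ^ p"
    unfolding z_def P_def by (rule binomial_prime_expansion[OF assms(1)])
  have "(1 + P) ^ (p ^ Suc k) = (1 + w) ^ p"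
  proof -
    have "1 + w = (1 + P) ^ (p ^ k)" unfolding c w_def by (simp add: algebra_simps)
    then show ?thesis by (simp add: mult.commute flip: power_mult)
  qed
  also note z
  also have "1 + P * w + P * w\<^sup>2 * z + w ^ p =
      1 + P ^ (Suc k + 1) + P ^ (Suc k + 2) * (c + P ^ k * (1 + P * c)\<^sup>2 * z) + w ^ p"
    by (simp add: w_def power2_eq_square algebra_simps power_add)
  finally have eq: "(1 + P) ^ (p ^ Suc k) - (1 + P ^ (Suc k + 1)) =
      P ^ (Suc k + 2) * (c + P ^ k * (1 + P * c)\<^sup>2 * z) + w ^ p" by simp
  \<comment> \<open>Here p \<ge> 3 enters: w is divisible by p^(k+1), and w^p must be divisible by
    p^(k+3).\<close>
  have "P ^ (Suc k + 2) dvd P ^ ((k + 1) * p)"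
  proof (rule le_imp_power_dvd)
    have "Suc k + 2 \<le> (k + 1) * 3" by simp
    also have "\<dots> \<le> (k + 1) * p" using assms by (intro mult_left_mono) auto
    finally show "Suc k + 2 \<le> (k + 1) * p" .
  qed
  then have "P ^ (Suc k + 2) dvd w ^ p"
    unfolding w_def power_mult_distrib power_mult [symmetric] by (rule dvd_mult2)
  then have "P ^ (Suc k + 2) dvd (1 + P) ^ (p ^ Suc k) - (1 + P ^ (Suc k + 1))"
    unfolding eq by simp
  then show ?case by (simp add: cong_iff_dvd_diff P_def)
qed auto

text \<open>1 + p topologically generates the units congruent to 1 mod p. The exponent is found
  digit by digit: (1 + p)^(p^(m-1)) is 1 + p^m up to p^(m+1), so a suitable power of it corrects the
  digit at p^m.\<close>

lemma one_plus_prime_generates: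
  fixes X :: int
  assumes p: "prime p" "p \<ge> 3" and X: "[X = 1] (mod int p ^ (n + 1))"
  shows "\<exists>t. [(1 + int p) ^ (p ^ n * t) = X] (mod int p ^ (n + 1 + R))"
proof (induction R)
  case 0
  show ?case using X by (intro exI[of _ 0]) (simp add: cong_sym)
next
  case (Suc R)
  define P where "P = int p"
  define m where "m = n + 1 + R"
  obtain t where t: "[(1 + P) ^ (p ^ n * t) = X] (mod P ^ m)"
    using Suc by (auto simp: P_def m_def)
  then have "P ^ m dvd X - (1 + P) ^ (p ^ n * t)"
    using cong_sym[OF t] by (simp only: cong_iff_dvd_diff)
  then obtain s where "X - (1 + P) ^ (p ^ n * t) = P ^ m * s" by blast
  then have s: "X = (1 + P) ^ (p ^ n * t) + P ^ m * s" by simp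
  define \<tau> where "\<tau> = nat (s mod P)"
  have P: "P > 0" using p by (simp add: P_def)
  have \<tau>: "[int \<tau> = s] (mod P)" using P by (simp add: \<tau>_def cong_def)
  have "m - 1 + 1 = m" "m - 1 + 2 = m + 1" by (simp_all add: m_def)
  then have "[(1 + P) ^ (p ^ (m - 1)) = 1 + P ^ m] (mod P ^ (m + 1))"
    using one_plus_prime_power_cong[OF p, of "m - 1"] by (simp only: P_def)
  then have "[((1 + P) ^ (p ^ (m - 1))) ^ \<tau> = (1 + P ^ m) ^ \<tau>] (mod P ^ (m + 1))"
    by (rule cong_pow)
  moreover have "[(1 + P ^ m) ^ \<tau> = 1 + P ^ m * int \<tau>] (mod P ^ (m + 1))"
  proof (induction \<tau>)
    case (Suc \<tau>)
    have "[(1 + P ^ m) * (1 + P ^ m) ^ \<tau> = (1 + P ^ m) * (1 + P ^ m * int \<tau>)] (mod P ^ (m + 1))"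
      using Suc by (intro cong_mult cong_refl)
    also have "(1 + P ^ m) * (1 + P ^ m * int \<tau>) = 1 + P ^ m * int (Suc \<tau>) + P ^ (2 * m) * int \<tau>"
      unfolding mult_2 power_add by (simp add: algebra_simps)
    also have "[1 + P ^ m * int (Suc \<tau>) + P ^ (2 * m) * int \<tau> = 1 + P ^ m * int (Suc \<tau>) + 0] (mod P ^ (m + 1))"
      by (intro cong_add cong_refl) (simp add: cong_0_iff le_imp_power_dvd m_def dvd_mult2)
    finally show ?case by simp
  qed auto
  ultimately have "[((1 + P) ^ (p ^ (m - 1))) ^ \<tau> = 1 + P ^ m * int \<tau>] (mod P ^ (m + 1))"
    by (rule cong_trans)
  then have "[(1 + P) ^ (p ^ n * t) * ((1 + P) ^ (p ^ (m - 1))) ^ \<tau> = (1 + P) ^ (p ^ n * t) * (1 + P ^ m * int \<tau>)] (mod P ^ (m + 1))"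
    by (intro cong_mult cong_refl)
  also have "(1 + P) ^ (p ^ n * t) * (1 + P ^ m * int \<tau>) = (1 + P) ^ (p ^ n * t) + P ^ m * ((1 + P) ^ (p ^ n * t) * int \<tau>)"
    by (simp add: algebra_simps)
  also have "[\<dots> = (1 + P) ^ (p ^ n * t) + P ^ m * s] (mod P ^ (m + 1))"
  proof -
    have "[1 + P = 1] (mod P)" by (simp add: cong_def)
    then have "[(1 + P) ^ (p ^ n * t) * int \<tau> = 1 ^ (p ^ n * t) * s] (mod P)"
      using \<tau> by (intro cong_mult cong_pow)
    then have "P * P ^ m dvd ((1 + P) ^ (p ^ n * t) * int \<tau> - s) * P ^ m"
      by (intro mult_dvd_mono) (auto simp: cong_iff_dvd_diff)
    then show ?thesis by (simp add: cong_iff_dvd_diff algebra_simps)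
  qed
  also have "(1 + P) ^ (p ^ n * t) * ((1 + P) ^ (p ^ (m - 1))) ^ \<tau> = (1 + P) ^ (p ^ n * (t + p ^ R * \<tau>))"
    by (simp add: m_def power_add [symmetric] power_mult [symmetric] distrib_left ac_simps)
  finally show ?case
    unfolding s[symmetric] by (intro exI[of _ "t + p ^ R * \<tau>"]) (simp add: P_def m_def)
qed

text \<open>a^p - b^p is a - b times a sum that is congruent to p b^(p-1) modulo p, hence divisible
  by p.\<close>

lemma prime_power_cong_lift:
  fixes a b :: int
  assumes "[a = b] (mod int p ^ k)" "k \<ge> 1"
  shows "[a ^ p = b ^ p] (mod int p ^ (k + 1))"
proof -
  have ab: "[a = b] (mod int p)"
    using assms by (metis cong_dvd_modulus dvd_power less_eq_Suc_le One_nat_def)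
  have "[(\<Sum>i<p. b ^ (p - Suc i) * a ^ i) = (\<Sum>i<p. b ^ (p - Suc i) * b ^ i)] (mod int p)"
    by (intro cong_sum cong_mult cong_pow cong_refl ab)
  also have "(\<Sum>i<p. b ^ (p - Suc i) * b ^ i) = int p * b ^ (p - 1)"
    by (simp flip: power_add)
  finally have "[(\<Sum>i<p. b ^ (p - Suc i) * a ^ i) = int p * b ^ (p - 1)] (mod int p)" .
  from cong_dvd_iff[OF this] have "int p dvd (\<Sum>i<p. b ^ (p - Suc i) * a ^ i)" by simp
  then have "int p ^ k * int p dvd (a - b) * (\<Sum>i<p. b ^ (p - Suc i) * a ^ i)"
    using assms by (intro mult_dvd_mono) (auto simp: cong_iff_dvd_diff)
  then show ?thesis
    by (simp add: cong_iff_dvd_diff power_diff_sumr2 mult.commute)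
qed

section \<open>Valuations on C_p, and Q_p and Z_p inside it\<close>

context Cp
begin

text \<open>Lower bounds by real numbers keep infinity out of the arithmetic; 0 satisfies all of
  them.\<close>

definition vge :: "real \<Rightarrow> 'a \<Rightarrow> bool" where
  "vge M x \<longleftrightarrow> ereal M \<le> v x"

lemma p_gt_0: "p > 0" and p_gt_1: "p > 1" and p_ge_2: "p \<ge> 2"
  using prime_p prime_gt_0_nat prime_gt_1_nat prime_ge_2_nat by auto

lemma v_zero [simp]: "v 0 = \<infinity>"
  using v_eq_infinity_iff by blast

lemma v_finite:
  assumes "x \<noteq> 0"
  obtains r where "v x = ereal r"
  using assms v_eq_infinity_iff[of x] v_not_minus_infinity[of x] by (cases "v x") auto

lemma v_one [simp]: "v 1 = 0"
proof -
  obtain r where r: "v 1 = ereal r" using v_finite[of 1] by auto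
  have "v (1 * 1) = v 1 + v 1" by (rule v_mult)
  then have "r = 0" using r by simp
  then show ?thesis using r by (simp add: zero_ereal_def)
qed

lemma v_uminus [simp]: "v (- x) = v x"
proof -
  obtain r where r: "v (- 1) = ereal r" using v_finite[of "- 1"] by auto
  have "v ((- 1) * (- 1)) = v (- 1) + v (- 1)" by (rule v_mult)
  then have "r = 0" using r by (simp add: zero_ereal_def)
  then have "v (- 1) = 0" using r by (simp add: zero_ereal_def)
  moreover have "v ((- 1) * x) = v (- 1) + v x" by (rule v_mult)
  ultimately show ?thesis by simp
qed

lemma v_diff_commute: "v (x - y) = v (y - x)"
  using v_uminus[of "x - y"] by simp

lemma v_inverse: "v x = ereal r \<Longrightarrow> v (inverse x) = ereal (- r)"
proof -
  assume r: "v x = ereal r"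
  then have "x \<noteq> 0" by auto
  then obtain s where s: "v (inverse x) = ereal s" using v_finite[of "inverse x"] by auto
  have "v (x * inverse x) = v x + v (inverse x)" by (rule v_mult)
  then have "r + s = 0" using r s \<open>x \<noteq> 0\<close> by (simp add: zero_ereal_def)
  then show ?thesis using s by (simp add: eq_neg_iff_add_eq_0 add.commute)
qed

lemma vge_0 [simp]: "vge M 0"
  by (simp add: vge_def)

lemma vge_mono: "vge M x \<Longrightarrow> N \<le> M \<Longrightarrow> vge N x"
  unfolding vge_def by (meson ereal_less_eq(3) order_trans)

lemma vge_add: "vge M x \<Longrightarrow> vge M y \<Longrightarrow> vge M (x + y)"
  unfolding vge_def using v_add[of x y] by (meson min.boundedI order_trans)

lemma vge_uminus [simp]: "vge M (- x) \<longleftrightarrow> vge M x"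
  by (simp add: vge_def)

lemma vge_diff: "vge M x \<Longrightarrow> vge M y \<Longrightarrow> vge M (x - y)"
  using vge_add[of M x "- y"] by simp

lemma vge_diff_commute: "vge M (x - y) \<longleftrightarrow> vge M (y - x)"
  by (simp add: vge_def v_diff_commute)

lemma vge_trans: "vge M (x - y) \<Longrightarrow> vge M (y - z) \<Longrightarrow> vge M (x - z)"
  using vge_add[of M "x - y" "y - z"] by simp

lemma vge_mult: "vge M x \<Longrightarrow> vge N y \<Longrightarrow> vge (M + N) (x * y)"
  unfolding vge_def v_mult by (metis add_mono plus_ereal.simps(1))

lemma vge_mult0: "vge M x \<Longrightarrow> vge 0 y \<Longrightarrow> vge M (x * y)" "vge 0 x \<Longrightarrow> vge M y \<Longrightarrow> vge M (x * y)"
  using vge_mult[of M x 0 y] vge_mult[of 0 x M y] by auto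

lemma vge_1 [simp]: "vge 0 1" "M \<le> 0 \<Longrightarrow> vge M 1"
  by (simp_all add: vge_def zero_ereal_def [symmetric])

lemma vge_power: "vge M x \<Longrightarrow> vge (real n * M) (x ^ n)"
proof (induction n)
  case (Suc n)
  then show ?case using vge_mult[of M x "real n * M" "x ^ n"] by (simp add: algebra_simps)
qed auto

lemma vge_0_power: "vge 0 x \<Longrightarrow> vge 0 (x ^ n)"
  using vge_power[of 0 x n] by simp

lemma vge_sum: "(\<And>i. i \<in> A \<Longrightarrow> vge M (f i)) \<Longrightarrow> vge M (sum f A)"
  by (induction A rule: infinite_finite_induct) (auto intro: vge_add)

lemma vge_of_nat [simp]: "vge 0 (of_nat n)"
  by (induction n) (auto intro: vge_add)

lemma vge_of_int [simp]: "vge 0 (of_int n)"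
  by (cases n rule: int_cases2) auto

lemma vge_p_power: "vge (real n) (of_nat p ^ n)"
  using vge_power[of 1 "of_nat p" n] v_p by (simp add: vge_def one_ereal_def)

lemma vge_of_int_dvd:
  assumes "int p ^ n dvd k"
  shows "vge (real n) (of_int k)"
proof -
  obtain j where "k = int p ^ n * j" using assms by auto
  then show ?thesis using vge_mult0(1)[OF vge_p_power[of n], of "of_int j"] by simp
qed

lemma vge_of_int_cong:
  assumes "[a = b] (mod int p ^ n)"
  shows "vge (real n) (of_int a - of_int b)"
  using vge_of_int_dvd[of n "a - b"] assms by (simp add: cong_iff_dvd_diff)

lemma vge_all_imp_0:
  assumes "\<And>n :: nat. vge (real n) x"
  shows "x = 0"
proof (rule ccontr)
  assume "x \<noteq> 0"
  then obtain r where "v x = ereal r" using v_finite by blast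
  moreover obtain n where "r < real n" using reals_Archimedean2 by blast
  ultimately show False using assms[of n] by (simp add: vge_def)
qed

lemma v_add_unit: "v x = 0 \<Longrightarrow> M > 0 \<Longrightarrow> vge M y \<Longrightarrow> v (x + y) = 0"
proof -
  assume x: "v x = 0" and M: "M > 0" and y: "vge M y"
  have "0 \<le> v (x + y)"
    using vge_add[of 0 x y] x vge_mono[OF y, of 0] M by (simp add: vge_def zero_ereal_def)
  moreover have "v (x + y) \<le> 0"
  proof (rule ccontr)
    assume n: "\<not> v (x + y) \<le> 0"
    have "min (v (x + y)) (v (- y)) \<le> v (x + y + (- y))" by (rule v_add)
    then have "min (v (x + y)) (v y) \<le> 0" using x by simp
    moreover have "v y > 0" using y M unfolding vge_def
      by (metis ereal_less(2) less_le_trans)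
    ultimately show False using n by (auto simp: min_def split: if_splits)
  qed
  ultimately show ?thesis by (rule antisym[rotated])
qed

lemma v_of_int_unit:
  assumes "\<not> int p dvd k"
  shows "v (of_int k) = 0"
proof -
  have "coprime k (int p)"
    using assms prime_p by (metis coprime_commute prime_imp_coprime prime_nat_int_transfer)
  then obtain j where "[k * j = 1] (mod int p)" using cong_solve_coprime_int by blast
  then have "vge 1 (of_int (k * j) - of_int 1)"
    using vge_of_int_cong[of "k * j" 1 1] by simp
  then have "v (1 + (of_int (k * j) - 1)) = 0"
    by (intro v_add_unit[of 1 1]) auto
  then have "v (of_int k) + v (of_int j) = 0" by (simp flip: v_mult)
  moreover have "0 \<le> v (of_int k)" "0 \<le> v (of_int j)"
    using vge_of_int by (auto simp: vge_def zero_ereal_def)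
  ultimately show ?thesis by (metis add_nonneg_eq_0_iff)
qed

lemma v_of_nat_unit: "\<not> p dvd k \<Longrightarrow> v (of_nat k) = 0"
  using v_of_int_unit[of "int k"] by (simp add: int_dvd_int_iff)

lemma v_unit_inverse: "v x = 0 \<Longrightarrow> v (inverse x) = 0"
  using v_inverse[of x 0] by (simp add: zero_ereal_def)

lemma v_divide_unit: "v u = 0 \<Longrightarrow> v (x / u) = v x"
  by (simp add: divide_inverse v_mult v_unit_inverse)

lemma vge_divide_unit: "v u = 0 \<Longrightarrow> vge M (x / u) \<longleftrightarrow> vge M x"
  by (simp add: vge_def v_divide_unit)

lemma vge_mult_unit: "v u = 0 \<Longrightarrow> vge M (u * x) \<longleftrightarrow> vge M x"
  by (simp add: vge_def v_mult)

lemma v_power: "v x = 0 \<Longrightarrow> v (x ^ n) = 0"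
  by (induction n) (simp_all add: v_mult)

lemma ex_vge_lower: "\<exists>C :: nat. vge (- real C) x"
proof (cases "x = 0")
  case False
  then obtain r where r: "v x = ereal r" using v_finite by blast
  obtain C :: nat where "- r \<le> real C" using real_arch_simple by blast
  then show ?thesis using r by (intro exI[of _ C]) (simp add: vge_def)
qed auto

lemma vge_mult_p_iff: "vge (M + real n) (of_nat p ^ n * x) \<longleftrightarrow> vge M x"
proof -
  have "v (of_nat p ^ n) = ereal (real n)"
    by (induction n) (simp_all add: v_mult v_p one_ereal_def add.commute)
  then show ?thesis
    unfolding vge_def v_mult by (cases "v x") auto
qed

lemma dist_le_iff: "dist x y \<le> real p powr (- M) \<longleftrightarrow> vge M (x - y)"
proof (cases "x = y")
  case False
  then obtain r where r: "v (x - y) = ereal r" using v_finite[of "x - y"] by auto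
  then show ?thesis using p_gt_1 False by (simp add: dist_v vge_def powr_le_cancel_iff)
qed auto

lemma ex_dist_less:
  assumes "e > 0"
  shows "\<exists>n :: nat. \<forall>x y. vge (real n) (x - y) \<longrightarrow> dist x y < e"
proof -
  obtain n where n: "1 / real p ^ n < e"
    using real_arch_pow_inv[OF assms, of "1 / real p"] p_gt_1 by (auto simp: power_one_over)
  have "dist x y < e" if "vge (real n) (x - y)" for x y
  proof -
    have "dist x y \<le> real p powr (- real n)" using that by (simp add: dist_le_iff)
    also have "\<dots> = 1 / real p ^ n" using p_gt_0 by (simp add: powr_minus powr_realpow divide_inverse)
    finally show ?thesis using n by simp
  qed
  then show ?thesis by blast
qed

lemma tendsto_iff_vge: "X \<longlonglongrightarrow> L \<longleftrightarrow> (\<forall>n :: nat. \<forall>\<^sub>F i in sequentially. vge (real n) (X i - L))"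
proof
  assume L: "X \<longlonglongrightarrow> L"
  show "\<forall>n :: nat. \<forall>\<^sub>F i in sequentially. vge (real n) (X i - L)"
  proof
    fix n :: nat
    have "real p powr (- real n) > 0" using p_gt_0 by simp
    then have "\<forall>\<^sub>F i in sequentially. dist (X i) L < real p powr (- real n)"
      using L tendstoD by blast
    then show "\<forall>\<^sub>F i in sequentially. vge (real n) (X i - L)"
      by eventually_elim (simp flip: dist_le_iff)
  qed
next
  assume *: "\<forall>n :: nat. \<forall>\<^sub>F i in sequentially. vge (real n) (X i - L)"
  show "X \<longlonglongrightarrow> L"
  proof (rule tendstoI)
    fix e :: real assume "e > 0"
    then obtain n :: nat where n: "\<forall>x y. vge (real n) (x - y) \<longrightarrow> dist x y < e"
      using ex_dist_less by blast
    show "\<forall>\<^sub>F i in sequentially. dist (X i) L < e"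
      using *[rule_format, of n] by eventually_elim (use n in blast)
  qed
qed

lemma vge_limit:
  assumes "X \<longlonglongrightarrow> L" "\<forall>\<^sub>F i in sequentially. vge M (X i - y)"
  shows "vge M (L - y)"
proof -
  obtain n :: nat where n: "M \<le> real n" using real_arch_simple by blast
  have "\<forall>\<^sub>F i in sequentially. vge (real n) (X i - L) \<and> vge M (X i - y)"
    using assms tendsto_iff_vge by (intro eventually_conj) blast+
  then obtain i where i: "vge (real n) (X i - L)" "vge M (X i - y)"
    using eventually_happens'[OF sequentially_bot] by blast
  then have "vge M (L - X i)" using vge_mono[OF i(1) n] vge_diff_commute by blast
  then show ?thesis using i(2) vge_trans by blast
qed

text \<open>By the ultrametric inequality small consecutive steps already make a Cauchy sequence,
  and the limit is as close to the n-th term as the bound on the n-th step.\<close>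

lemma convergent_of_steps:
  assumes r: "r > 0" and X: "\<And>n :: nat. vge (r * real n) (X (Suc n) - X n)"
  obtains L where "X \<longlonglongrightarrow> L" "\<And>n. vge (r * real n) (L - X n)"
proof -
  have d: "vge (r * real n) (X (n + k) - X n)" for n k
  proof (induction k)
    case (Suc k)
    have "vge (r * real n) (X (Suc (n + k)) - X (n + k))"
      using X[of "n + k"] by (rule vge_mono) (use r in auto)
    then show ?case using Suc vge_trans by fastforce
  qed auto
  have "Cauchy X"
  proof (rule CauchyI')
    fix e :: real assume "e > 0"
    then obtain n :: nat where n: "\<forall>x y. vge (real n) (x - y) \<longrightarrow> dist x y < e"
      using ex_dist_less by blast
    obtain M :: nat where M: "real n / r \<le> real M" using real_arch_simple by blast
    show "\<exists>M. \<forall>m\<ge>M. \<forall>k>m. dist (X m) (X k) < e"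
    proof (intro exI allI impI)
      fix m k assume mk: "M \<le> m" "m < k"
      have "real n \<le> r * real m"
        using M mk r by (simp add: field_simps) (meson mult_left_mono of_nat_le_iff order_trans less_imp_le)
      then have "vge (real n) (X k - X m)"
        using d[of m "k - m"] mk vge_mono by fastforce
      then show "dist (X m) (X k) < e" using n vge_diff_commute by blast
    qed
  qed
  then obtain L where L: "X \<longlonglongrightarrow> L" using Cauchy_convergent convergent_def by blast
  have "vge (r * real n) (L - X n)" for n
  proof (rule vge_limit[OF L])
    show "\<forall>\<^sub>F i in sequentially. vge (r * real n) (X i - X n)"
      using d[of n] by (auto simp: eventually_at_top_linorder le_iff_add intro!: exI[of _ n])
  qed
  then show ?thesis using that L by blast
qed

lemma in_closure_iff: "x \<in> closure S \<longleftrightarrow> (\<forall>n :: nat. \<exists>y\<in>S. vge (real n) (x - y))"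
proof
  assume x: "x \<in> closure S"
  show "\<forall>n :: nat. \<exists>y\<in>S. vge (real n) (x - y)"
  proof
    fix n :: nat
    have "real p powr (- real n) > 0" using p_gt_0 by simp
    then obtain y where "y \<in> S" "dist y x < real p powr (- real n)"
      using x closure_approachable by blast
    then show "\<exists>y\<in>S. vge (real n) (x - y)"
      using dist_le_iff[of x y "real n"] by (auto simp: dist_commute)
  qed
next
  assume *: "\<forall>n :: nat. \<exists>y\<in>S. vge (real n) (x - y)"
  show "x \<in> closure S"
    unfolding closure_approachable
  proof (intro allI impI)
    fix e :: real assume "e > 0"
    then obtain n :: nat where n: "\<forall>x y. vge (real n) (x - y) \<longrightarrow> dist x y < e"
      using ex_dist_less by blast
    then show "\<exists>y\<in>S. dist y x < e" using * dist_commute by metis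
  qed
qed

lemma Qp_approx: "x \<in> Qp \<Longrightarrow> \<exists>q. vge (real n) (x - of_rat q)"
  using in_closure_iff[of x \<rat>] by (auto simp: Qp_def Rats_def)

lemma QpI: "(\<And>n :: nat. \<exists>q. vge (real n) (x - of_rat q)) \<Longrightarrow> x \<in> Qp"
  using in_closure_iff[of x \<rat>] by (auto simp: Qp_def Rats_def)

lemma closed_Qp: "closed (Qp :: 'a set)"
  by (simp add: Qp_def)

lemma of_rat_Qp [simp]: "of_rat q \<in> (Qp :: 'a set)"
  by (rule QpI) (auto intro: exI[of _ q])

lemma of_int_Qp [simp]: "of_int n \<in> (Qp :: 'a set)"
  using of_rat_Qp[of "of_int n"] by simp

lemma of_nat_Qp [simp]: "of_nat n \<in> (Qp :: 'a set)"
  using of_rat_Qp[of "of_nat n"] by simp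

lemma Qp_add: "x \<in> Qp \<Longrightarrow> y \<in> Qp \<Longrightarrow> x + y \<in> (Qp :: 'a set)"
proof (rule QpI)
  fix n assume "x \<in> Qp" "y \<in> (Qp :: 'a set)"
  then obtain q r where "vge (real n) (x - of_rat q)" "vge (real n) (y - of_rat r)"
    using Qp_approx by meson
  then have "vge (real n) ((x - of_rat q) + (y - of_rat r))" by (rule vge_add)
  then show "\<exists>q. vge (real n) (x + y - of_rat q)"
    by (intro exI[of _ "q + r"]) (simp add: of_rat_add algebra_simps)
qed

lemma Qp_mult: "x \<in> Qp \<Longrightarrow> y \<in> Qp \<Longrightarrow> x * y \<in> (Qp :: 'a set)"
proof (rule QpI)
  fix n assume x: "x \<in> Qp" and y: "y \<in> (Qp :: 'a set)"
  obtain C where C: "vge (- real C) x" using ex_vge_lower by blast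
  obtain r where r: "vge (real (n + C)) (y - of_rat r)" using Qp_approx[OF y] by blast
  obtain D where D: "vge (- real D) (of_rat r)" using ex_vge_lower by blast
  obtain q where q: "vge (real (n + D)) (x - of_rat q)" using Qp_approx[OF x] by blast
  have "vge (real n) (x * (y - of_rat r))" using vge_mult[OF C r] by (rule vge_mono) simp
  moreover have "vge (real n) ((x - of_rat q) * of_rat r)" using vge_mult[OF q D] by (rule vge_mono) simp
  ultimately have "vge (real n) (x * (y - of_rat r) + (x - of_rat q) * of_rat r)" by (rule vge_add)
  then show "\<exists>q. vge (real n) (x * y - of_rat q)"
    by (intro exI[of _ "q * r"]) (simp add: of_rat_mult algebra_simps)
qed

lemma Qp_inverse: "x \<in> Qp \<Longrightarrow> inverse x \<in> (Qp :: 'a set)"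
proof (cases "x = 0")
  case True
  then show "x \<in> Qp \<Longrightarrow> inverse x \<in> (Qp :: 'a set)" by simp
next
  case False
  assume x: "x \<in> Qp"
  obtain s where s: "v x = ereal s" using v_finite[OF False] by blast
  show "inverse x \<in> (Qp :: 'a set)"
  proof (rule QpI)
    fix n
    \<comment> \<open>Inversion multiplies the error by x^(-2), which costs 2 s digits; the second
      condition keeps the rational approximation nonzero.\<close>
    obtain k :: nat where k: "real n + 2 * s \<le> real k" "s < real k"
      using real_arch_simple[of "max (real n + 2 * s) (s + 1)"] by auto
    obtain q where q: "vge (real k) (x - of_rat q)" using Qp_approx[OF x] by blast
    have q0: "of_rat q \<noteq> (0 :: 'a)"
    proof
      assume "of_rat q = (0 :: 'a)"
      then show False using q s k(2) by (simp add: vge_def)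
    qed
    define y :: 'a where "y = of_rat q / x"
    have ix: "v (inverse x) = ereal (- s)" by (rule v_inverse[OF s])
    have "vge (real k - s) ((x - of_rat q) * inverse x)"
      using vge_mult[OF q, of "- s" "inverse x"] ix by (simp add: vge_def)
    then have "vge (real k - s) (1 - y)"
      using False by (simp add: y_def divide_inverse left_diff_distrib)
    then have "v (1 + - (1 - y)) = 0"
      using k(2) by (intro v_add_unit[of 1 "real k - s"]) (simp_all del: minus_diff_eq)
    then have vy: "v y = 0" by simp
    have "inverse x - of_rat (inverse q) = - (1 - y) * inverse x / y"
      unfolding of_rat_inverse using False q0 by (simp add: y_def field_simps)
    moreover have "vge (real k - s + - s) (- (1 - y) * inverse x)"
      using \<open>vge (real k - s) (1 - y)\<close> ix by (intro vge_mult) (auto simp: vge_def simp del: minus_diff_eq)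
    ultimately have "vge (real k - 2 * s) (inverse x - of_rat (inverse q))"
      using vy by (simp add: vge_divide_unit)
    then show "\<exists>q. vge (real n) (inverse x - of_rat q)"
      using k(1) vge_mono by (intro exI[of _ "inverse q"]) fastforce
  qed
qed

lemma Qp_uminus: "x \<in> Qp \<Longrightarrow> - x \<in> (Qp :: 'a set)"
  using Qp_mult[of "of_int (- 1)" x] by (simp only: of_int_Qp) simp

lemma Qp_diff: "x \<in> Qp \<Longrightarrow> y \<in> Qp \<Longrightarrow> x - y \<in> (Qp :: 'a set)"
  using Qp_add[of x "- y"] Qp_uminus[of y] by simp

lemma Qp_divide: "x \<in> Qp \<Longrightarrow> y \<in> Qp \<Longrightarrow> x / y \<in> (Qp :: 'a set)"
  using Qp_mult[of x "inverse y"] Qp_inverse[of y] by (simp add: divide_inverse)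

lemma is_subfield_Qp: "is_subfield (Qp :: 'a set)"
  unfolding is_subfield_def using Qp_diff Qp_mult Qp_divide of_int_Qp[of 1] by auto

lemma Zp_iff: "x \<in> Zp v \<longleftrightarrow> x \<in> Qp \<and> vge 0 x"
  by (simp add: Zp_def integers_of_def vge_def zero_ereal_def)

lemma Zp_units_iff: "x \<in> Zp_units v \<longleftrightarrow> x \<in> Qp \<and> v x = 0"
  by (auto simp: Zp_units_def Zp_def integers_of_def)

lemma of_nat_Zp_units: "\<not> p dvd d \<Longrightarrow> of_nat d \<in> Zp_units v"
  by (simp add: Zp_units_iff v_of_nat_unit)

lemma Zp_units_mult: "x \<in> Zp_units v \<Longrightarrow> y \<in> Zp_units v \<Longrightarrow> x * y \<in> Zp_units v"
  by (simp add: Zp_units_iff Qp_mult v_mult)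

lemma Zp_units_inverse: "x \<in> Zp_units v \<Longrightarrow> inverse x \<in> Zp_units v"
  by (simp add: Zp_units_iff Qp_inverse v_unit_inverse)

lemma Zp_units_1: "1 \<in> Zp_units v"
  using of_int_Qp[of 1] by (simp add: Zp_units_iff)

lemma Zp_units_power: "x \<in> Zp_units v \<Longrightarrow> x ^ n \<in> Zp_units v"
  by (induction n) (auto intro: Zp_units_mult Zp_units_1)

lemma one_plus_p_Zp_units: "1 + of_nat p \<in> Zp_units v"
proof -
  have "p dvd (1 + p) \<longleftrightarrow> p dvd 1" by (rule dvd_add_left_iff) simp
  then have "\<not> p dvd (1 + p)" using p_gt_1 by simp
  then show ?thesis using of_nat_Zp_units[of "1 + p"] by simp
qed

lemma rat_integral_denominator:
  assumes "vge 0 (of_rat q)"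
  shows "\<not> int p dvd snd (quotient_of q)"
proof
  assume d: "int p dvd snd (quotient_of q)"
  obtain a b where ab: "quotient_of q = (a, b)" by force
  have b: "b > 0" "coprime a b" and q: "q = of_int a / of_int b"
    using quotient_of_denom_pos[OF ab] quotient_of_coprime[OF ab] quotient_of_div[OF ab] by auto
  have "\<not> int p dvd a"
    using b d ab p_gt_1 by (auto dest: coprime_common_divisor)
  then have "v (of_int a) = 0" by (rule v_of_int_unit)
  moreover have "vge 1 (of_int b)" using vge_of_int_dvd[of 1 b] d ab by simp
  moreover have "of_int a = (of_rat q * of_int b :: 'a)"
    using b by (simp add: q of_rat_divide)
  then have "vge 1 (of_int a)"
    using vge_mult0(2)[OF assms \<open>vge 1 (of_int b)\<close>] by simp
  ultimately show False by (simp add: vge_def zero_ereal_def)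
qed

lemma Zp_approx_int:
  assumes "x \<in> Zp v"
  shows "\<exists>k :: int. vge (real n) (x - of_int k)"
proof -
  have x: "x \<in> Qp" "vge 0 x" using assms by (auto simp: Zp_iff)
  obtain q where q: "vge (real n) (x - of_rat q)" using Qp_approx[OF x(1)] by blast
  have "vge 0 (of_rat q)"
    using vge_diff[OF x(2) vge_mono[OF q, of 0]] by simp
  then have nd: "\<not> int p dvd snd (quotient_of q)" by (rule rat_integral_denominator)
  obtain a b where ab: "quotient_of q = (a, b)" by force
  have b: "b > 0" and qq: "q = of_int a / of_int b"
    using quotient_of_denom_pos[OF ab] quotient_of_div[OF ab] by auto
  have nb: "\<not> int p dvd b" using nd ab by simp
  then have vb: "v (of_int b) = 0" by (rule v_of_int_unit)
  have "coprime b (int p ^ n)"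
    using nb prime_p by (metis coprime_commute coprime_power_right_iff prime_imp_coprime prime_nat_int_transfer)
  then obtain j where j: "[b * j = 1] (mod int p ^ n)" using cong_solve_coprime_int by blast
  have "[a * (b * j) = a * 1] (mod int p ^ n)" using j by (intro cong_mult cong_refl)
  then have "vge (real n) (of_int (a * (b * j)) - of_int (a * 1))" by (rule vge_of_int_cong)
  then have "vge (real n) ((of_int a - of_int b * of_int (a * j)) / of_int b)"
    using vb by (simp add: vge_divide_unit vge_diff_commute algebra_simps)
  moreover have "(of_int a - of_int b * of_int (a * j)) / of_int b = of_rat q - (of_int (a * j) :: 'a)"
    using b by (simp add: qq of_rat_divide diff_divide_distrib)
  ultimately show ?thesis using q vge_trans by metis
qed

end

section \<open>Weights\<close>

locale Cp5 = Cp + assumes p_ge_5: "p \<ge> 5"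
begin

lemma v_of_int_eq:
  assumes "k \<noteq> 0"
  shows "v (of_int k) = ereal (real (multiplicity (int p) k))"
proof -
  have "\<not> is_unit (int p)" using p_gt_1 by simp
  then obtain u where u: "k = int p ^ multiplicity (int p) k * u" "\<not> int p dvd u"
    using multiplicity_decompose'[OF assms] by metis
  have "v (of_nat p ^ n) = ereal (real n)" for n
    by (induction n) (simp_all add: v_mult v_p one_ereal_def add.commute)
  then have "v (of_int (int p ^ multiplicity (int p) k * u)) = ereal (real (multiplicity (int p) k))"
    using v_of_int_unit[OF u(2)] by (simp add: v_mult)
  then show ?thesis using u(1) by simp
qed

lemma vge_of_int_iff: "vge (real n) (of_int k) \<longleftrightarrow> int p ^ n dvd k"
proof (cases "k = 0")
  case False
  have "\<not> is_unit (int p)" using p_gt_1 by simp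
  then show ?thesis
    using False by (simp add: vge_def v_of_int_eq power_dvd_iff_le_multiplicity)
qed auto

text \<open>Lifting the exponent. The exact value matters: the divided differences at the classical
  weights need an upper bound for the valuation of their denominators.\<close>

lemma multiplicity_one_plus_p_power:
  assumes "k > 0"
  shows "multiplicity (int p) ((1 + int p) ^ k - 1) = Suc (multiplicity (int p) (int k))"
proof -
  define P where "P = int p"
  have nu: "\<not> is_unit P" using p_gt_1 by (simp add: P_def)
  define s where "s = multiplicity P (int k)"
  obtain k' where k': "int k = P ^ s * k'" "\<not> P dvd k'"
    using multiplicity_decompose'[of "int k" P] assms nu unfolding s_def by auto
  have "k' > 0" using k' assms by (metis P_def of_nat_0_le_iff of_nat_0_less_iff zero_less_mult_pos zero_less_power p_gt_0)
  define t where "t = nat k'"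
  have t: "k' = int t" using \<open>k' > 0\<close> by (simp add: t_def)
  have "int k = int (p ^ s * t)" using k'(1) t by (simp add: P_def)
  then have k: "k = p ^ s * t" by (simp only: of_nat_eq_iff)
  have c0: "[(1 + P) ^ (p ^ s) = 1 + P ^ (s + 1)] (mod P ^ (s + 2))"
    unfolding P_def using prime_p p_ge_5 by (intro one_plus_prime_power_cong) auto
  have "[((1 + P) ^ (p ^ s)) ^ t = 1 + P ^ (s + 1) * int t] (mod P ^ (s + 2))"
  proof (induction t)
    case (Suc t)
    have "[(1 + P) ^ (p ^ s) * ((1 + P) ^ (p ^ s)) ^ t = (1 + P ^ (s + 1)) * (1 + P ^ (s + 1) * int t)] (mod P ^ (s + 2))"
      using Suc c0 by (intro cong_mult)
    also have "(1 + P ^ (s + 1)) * (1 + P ^ (s + 1) * int t) = 1 + P ^ (s + 1) * int (Suc t) + P ^ (2 * s + 2) * int t"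
      unfolding mult_2 power_add by (simp add: algebra_simps power2_eq_square)
    also have "[1 + P ^ (s + 1) * int (Suc t) + P ^ (2 * s + 2) * int t = 1 + P ^ (s + 1) * int (Suc t) + 0] (mod P ^ (s + 2))"
      by (intro cong_add cong_refl) (simp add: cong_0_iff le_imp_power_dvd dvd_mult2)
    finally show ?case by simp
  qed auto
  then have "[(1 + P) ^ k = 1 + P ^ (s + 1) * int t] (mod P ^ (s + 2))"
    by (simp add: k power_mult)
  then have "P ^ (s + 2) dvd (1 + P) ^ k - (1 + P ^ (s + 1) * int t)"
    by (simp only: cong_iff_dvd_diff)
  then obtain c where "(1 + P) ^ k - (1 + P ^ (s + 1) * int t) = P ^ (s + 2) * c" by blast
  then have c: "(1 + P) ^ k = 1 + P ^ (s + 1) * int t + P ^ (s + 2) * c" by simp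
  have eq: "(1 + P) ^ k - 1 = P ^ Suc s * (int t + P * c)"
    unfolding c by (simp add: algebra_simps)
  have nd: "\<not> P dvd (int t + P * c)"
    using k'(2) t by (simp add: dvd_add_left_iff)
  have "multiplicity P ((1 + P) ^ k - 1) = Suc s"
  proof (rule multiplicity_eqI)
    show "P ^ Suc s dvd (1 + P) ^ k - 1" unfolding eq by simp
    show "\<not> P ^ Suc (Suc s) dvd (1 + P) ^ k - 1"
      unfolding eq using nd p_gt_0 by (subst power_Suc2) (simp add: P_def del: power_Suc)
  qed
  then show ?thesis by (simp add: P_def s_def)
qed

lemma weightB_D:
  assumes "\<kappa> \<in> weights_B p v"
  shows kappa_mult: "x \<in> Zp_units v \<Longrightarrow> y \<in> Zp_units v \<Longrightarrow> \<kappa> (x * y) = \<kappa> x * \<kappa> y"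
    and kappa_nonzero: "x \<in> Zp_units v \<Longrightarrow> \<kappa> x \<noteq> 0"
    and kappa_cont: "continuous_on (Zp_units v) \<kappa>"
    and kappa_torsion: "x \<in> Zp_units v \<Longrightarrow> x ^ (p - 1) = 1 \<Longrightarrow> \<kappa> x = 1"
  using assms by (auto simp: weights_B_def weights_def PiE_iff)

lemma kappa_one: "\<kappa> \<in> weights_B p v \<Longrightarrow> \<kappa> 1 = 1"
  using kappa_torsion[of \<kappa> 1] Zp_units_1 by simp

lemma kappa_power: "\<kappa> \<in> weights_B p v \<Longrightarrow> x \<in> Zp_units v \<Longrightarrow> \<kappa> (x ^ n) = \<kappa> x ^ n"
  by (induction n) (simp_all add: kappa_one kappa_mult Zp_units_power)

lemma kappa_tendsto:
  assumes "\<kappa> \<in> weights_B p v" "X \<longlonglongrightarrow> x" "x \<in> Zp_units v" "\<And>i. X i \<in> Zp_units v"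
  shows "(\<lambda>i. \<kappa> (X i)) \<longlonglongrightarrow> \<kappa> x"
  using assms kappa_cont[OF assms(1)] by (intro continuous_on_tendsto_compose[of "Zp_units v" \<kappa>]) auto

lemma vge_one_plus_p_power: "vge (real (n + 1)) ((1 + of_nat p) ^ (p ^ n) - 1)"
proof -
  have "[(1 + int p) ^ (p ^ n) = 1 + int p ^ (n + 1)] (mod int p ^ (n + 1))"
    by (rule cong_dvd_modulus[OF one_plus_prime_power_cong]) (use prime_p p_ge_5 in \<open>auto intro: le_imp_power_dvd\<close>)
  also have "[1 + int p ^ (n + 1) = 1] (mod int p ^ (n + 1))" by (simp add: cong_def)
  finally have "vge (real (n + 1)) (of_int ((1 + int p) ^ (p ^ n)) - of_int 1)"
    by (rule vge_of_int_cong)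
  then show ?thesis by simp
qed

lemma vge_prime_expansion_rest:
  assumes "vge 0 w"
  shows "vge 0 (\<Sum>j = 2..<p. of_nat ((p choose j) div p) * w ^ (j - 2))"
  using assms by (intro vge_sum vge_mult0 vge_of_nat vge_0_power)

text \<open>Continuity makes z^(p^n) tend to 1 for z = kappa(1 + p), so z is a unit. If z - 1 were a
  unit as well, all z^(p^n) - 1 would be units, since p-th powers are additive modulo elements of
  positive valuation.\<close>

lemma weight_w_pos:
  assumes K: "\<kappa> \<in> weights_B p v"
  shows "v (weight_w p \<kappa>) > 0"
proof -
  define z where "z = \<kappa> (1 + of_nat p)"
  have lim: "(\<lambda>n. (1 + of_nat p) ^ (p ^ n)) \<longlonglongrightarrow> (1 :: 'a)"
    unfolding tendsto_iff_vge eventually_at_top_linorder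
  proof (intro allI exI impI)
    fix n i :: nat assume "n \<le> i"
    then show "vge (real n) ((1 + of_nat p) ^ (p ^ i) - 1)"
      using vge_one_plus_p_power[of i] vge_mono by fastforce
  qed
  have "(\<lambda>n. \<kappa> ((1 + of_nat p) ^ (p ^ n))) \<longlonglongrightarrow> \<kappa> 1"
    by (rule kappa_tendsto[OF K lim Zp_units_1]) (intro Zp_units_power one_plus_p_Zp_units)
  then have "(\<lambda>n. z ^ (p ^ n)) \<longlonglongrightarrow> 1"
    using K by (simp add: kappa_power one_plus_p_Zp_units kappa_one z_def)
  then have "\<forall>n :: nat. \<forall>\<^sub>F i in sequentially. vge (real n) (z ^ (p ^ i) - 1)"
    unfolding tendsto_iff_vge .
  then have "\<forall>\<^sub>F i in sequentially. vge (real 1) (z ^ (p ^ i) - 1)" by (rule spec)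
  then obtain n where n: "vge 1 (z ^ (p ^ n) - 1)"
    using eventually_happens'[OF sequentially_bot] by force
  have "v (1 + (z ^ (p ^ n) - 1)) = 0" using n by (intro v_add_unit[of 1 1]) auto
  then have vzp: "v (z ^ (p ^ n)) = 0" by simp
  have vz: "v z = 0"
  proof -
    have "z \<noteq> 0" using vzp p_gt_0 by (auto simp: power_0_left)
    then obtain r where r: "v z = ereal r" using v_finite by blast
    have "v (z ^ k) = ereal (real k * r)" for k
      by (induction k) (simp_all add: v_mult r algebra_simps zero_ereal_def)
    then have "real (p ^ n) * r = 0" using vzp by (simp add: zero_ereal_def)
    then show ?thesis using r p_gt_0 by (simp add: zero_ereal_def)
  qed
  have w0: "vge 0 (z - 1)" using vz by (intro vge_diff) (auto simp: vge_def zero_ereal_def)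
  have "v (z - 1) \<noteq> 0"
  proof
    assume w: "v (z - 1) = 0"
    have "v (z ^ (p ^ i) - 1) = 0" for i
    proof (induction i)
      case (Suc i)
      define y where "y = z ^ (p ^ i) - 1"
      have y: "v y = 0" "vge 0 y" using Suc by (auto simp: y_def vge_def zero_ereal_def)
      define r where "r = (\<Sum>j = 2..<p. of_nat ((p choose j) div p) * y ^ (j - 2))"
      have r: "vge 0 r" unfolding r_def by (rule vge_prime_expansion_rest[OF y(2)])
      have "z ^ (p ^ Suc i) - 1 = (1 + y) ^ p - 1"
        by (simp add: y_def mult.commute flip: power_mult)
      also have "\<dots> = y ^ p + of_nat p * (y + y\<^sup>2 * r)"
        unfolding binomial_prime_expansion[OF prime_p] r_def[symmetric] by (simp add: algebra_simps)
      also have "v \<dots> = 0"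
      proof (rule v_add_unit[OF v_power[OF y(1)], of 1])
        show "vge 1 (of_nat p * (y + y\<^sup>2 * r))"
          using vge_p_power[of 1] y r by (intro vge_mult0 vge_add vge_0_power) auto
      qed simp
      finally show ?case .
    qed (use w in simp)
    then show False using n by (simp add: vge_def zero_ereal_def)
  qed
  moreover have "0 \<le> v (z - 1)" using w0 by (simp add: vge_def zero_ereal_def)
  ultimately show ?thesis by (simp add: weight_w_def z_def order_less_le)
qed

text \<open>The quantity min {1, v(w)} of the theorem as a real number. The cap at 1 keeps it finite
  for w = 0 and ensures that p, like w, has valuation at least \<open>mu\<close>.\<close>

definition mu :: "('a \<Rightarrow> 'a) \<Rightarrow> real" where
  "mu \<kappa> = real_of_ereal (min 1 (v (weight_w p \<kappa>)))"

lemma mu_props: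
  assumes K: "\<kappa> \<in> weights_B p v"
  shows ereal_mu: "ereal (mu \<kappa>) = min 1 (v (weight_w p \<kappa>))"
    and mu_pos: "0 < mu \<kappa>" and mu_le_1: "mu \<kappa> \<le> 1" and vge_w: "vge (mu \<kappa>) (weight_w p \<kappa>)"
proof -
  have "v (weight_w p \<kappa>) > 0" by (rule weight_w_pos[OF K])
  then show e: "ereal (mu \<kappa>) = min 1 (v (weight_w p \<kappa>))"
    unfolding mu_def by (cases "v (weight_w p \<kappa>)") (auto simp: min_def one_ereal_def)
  show "0 < mu \<kappa>" "mu \<kappa> \<le> 1" "vge (mu \<kappa>) (weight_w p \<kappa>)"
    using \<open>v (weight_w p \<kappa>) > 0\<close> e
    by (cases "v (weight_w p \<kappa>)"; auto simp: vge_def min_def one_ereal_def split: if_splits)+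
qed

text \<open>Each p-th power gains at least m: in the terms with a factor p because m \<le> 1, in the
  remaining term y^p because the valuation is multiplied by p \<ge> 2.\<close>

lemma vge_one_plus_power:
  assumes "0 < m" "m \<le> 1" "vge m w"
  shows "vge (real (n + 1) * m) ((1 + w) ^ (p ^ n) - 1)"
proof (induction n)
  case (Suc n)
  define y where "y = (1 + w) ^ (p ^ n) - 1"
  have y: "vge (real (n + 1) * m) y" using Suc by (simp add: y_def)
  then have y0: "vge 0 y" by (rule vge_mono) (use assms in auto)
  define r where "r = (\<Sum>j = 2..<p. of_nat ((p choose j) div p) * y ^ (j - 2))"
  have r: "vge 0 r" unfolding r_def by (rule vge_prime_expansion_rest[OF y0])
  have "(1 + w) ^ (p ^ Suc n) - 1 = (1 + y) ^ p - 1"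
    by (simp add: y_def mult.commute flip: power_mult)
  also have "\<dots> = y ^ p + of_nat p * (y * (1 + y * r))"
    unfolding binomial_prime_expansion[OF prime_p] r_def[symmetric]
    by (simp add: algebra_simps power2_eq_square)
  finally have eq: "(1 + w) ^ (p ^ Suc n) - 1 = y ^ p + of_nat p * (y * (1 + y * r))" .
  have "vge (1 + real (n + 1) * m) (of_nat p * (y * (1 + y * r)))"
    using vge_p_power[of 1] y y0 r by (intro vge_mult vge_mult0(1) vge_add) (auto intro: vge_mult0)
  then have 1: "vge (real (Suc n + 1) * m) (of_nat p * (y * (1 + y * r)))"
    by (rule vge_mono) (use assms in \<open>simp add: algebra_simps\<close>)
  have "real (Suc n + 1) \<le> real p * real (n + 1)"
    using mult_right_mono[of 2 "real p" "real (n + 1)"] p_ge_2 by simp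
  then have "real (Suc n + 1) * m \<le> real p * (real (n + 1) * m)"
    using assms mult_right_mono[of "real (Suc n + 1)" "real p * real (n + 1)" m] by (simp add: mult.assoc)
  then have 2: "vge (real (Suc n + 1) * m) (y ^ p)"
    using vge_power[OF y, of p] vge_mono by blast
  show ?case unfolding eq using 1 2 by (rule vge_add[rotated])
qed (use assms in simp)

lemma vge_power_minus_1:
  assumes "vge M (y - 1)" "M \<ge> 0"
  shows "vge M (y ^ t - 1)"
proof -
  have "vge 0 y" using vge_add[OF vge_mono[OF assms(1), of 0], of 1] assms(2) by simp
  then show ?thesis
    unfolding power_diff_1_eq using assms(1) by (intro vge_mult0(1) vge_sum vge_0_power)
qed

lemma Zp_unit_approx:
  assumes x: "x \<in> Zp_units v" "vge (real (n + 1)) (x - 1)"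
  shows "\<exists>t. vge (real (n + 1 + R)) (x - (1 + of_nat p) ^ (p ^ n * t))"
proof -
  have "x \<in> Zp v" using x by (auto simp: Zp_units_def)
  then obtain X where X: "vge (real (n + 1 + R)) (x - of_int X)" using Zp_approx_int by blast
  have "vge (real (n + 1)) (of_int X - x)"
    using X vge_diff_commute vge_mono[of "real (n + 1 + R)" _ "real (n + 1)"] by force
  then have "vge (real (n + 1)) (of_int (X - 1))"
    using vge_trans[OF _ x(2)] by simp
  then have "[X = 1] (mod int p ^ (n + 1))"
    unfolding vge_of_int_iff by (simp add: cong_iff_dvd_diff)
  then obtain t where "[(1 + int p) ^ (p ^ n * t) = X] (mod int p ^ (n + 1 + R))"
    using one_plus_prime_generates[OF prime_p] p_ge_5 by fastforce
  then have "vge (real (n + 1 + R)) (of_int X - of_int ((1 + int p) ^ (p ^ n * t)))"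
    using vge_of_int_cong vge_diff_commute by blast
  then show ?thesis using vge_trans[OF X] by fastforce
qed

text \<open>Since 1 + p generates, kappa(x) is a limit of powers of 1 + w, and each p-adic digit in
  which x agrees with 1 is worth at least \<open>mu\<close>.\<close>

lemma kappa_close_1:
  assumes K: "\<kappa> \<in> weights_B p v" and x: "x \<in> Zp_units v" "vge (real (n + 1)) (x - 1)"
  shows "vge (real (n + 1) * mu \<kappa>) (\<kappa> x - 1)"
proof -
  have "\<forall>R. \<exists>t. vge (real (n + 1 + R)) (x - (1 + of_nat p) ^ (p ^ n * t))"
    using Zp_unit_approx[OF x] by blast
  then obtain t where t: "\<And>R. vge (real (n + 1 + R)) (x - (1 + of_nat p) ^ (p ^ n * t R))" by metis
  define X where "X = (\<lambda>R. (1 + of_nat p) ^ (p ^ n * t R) :: 'a)"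
  have Xlim: "X \<longlonglongrightarrow> x"
    unfolding tendsto_iff_vge eventually_at_top_linorder
  proof (intro allI exI impI)
    fix k i :: nat assume "k \<le> i"
    then show "vge (real k) (X i - x)"
      using t[of i] vge_mono[of "real (n + 1 + i)" _ "real k"] vge_diff_commute unfolding X_def by fastforce
  qed
  have lim: "(\<lambda>R. \<kappa> (X R)) \<longlonglongrightarrow> \<kappa> x"
    by (rule kappa_tendsto[OF K Xlim x(1)]) (unfold X_def, intro Zp_units_power one_plus_p_Zp_units)
  have "vge (real (n + 1) * mu \<kappa>) (\<kappa> (X R) - 1)" for R
  proof -
    have "\<kappa> (X R) = ((1 + weight_w p \<kappa>) ^ (p ^ n)) ^ t R"
      using K by (simp add: X_def kappa_power one_plus_p_Zp_units weight_w_def flip: power_mult)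
    moreover have "vge (real (n + 1) * mu \<kappa>) (((1 + weight_w p \<kappa>) ^ (p ^ n)) ^ t R - 1)"
      using mu_pos[OF K]
      by (intro vge_power_minus_1 vge_one_plus_power[OF mu_pos[OF K] mu_le_1[OF K] vge_w[OF K]]) simp
    ultimately show ?thesis by (simp only:)
  qed
  then show ?thesis using vge_limit[OF lim] by (simp add: eventually_sequentially)
qed

lemma nat_approx_Zp_unit:
  assumes "x \<in> Zp_units v" "n \<ge> 1"
  obtains d :: nat where "\<not> p dvd d" "vge (real n) (x - of_nat d)"
proof -
  have "x \<in> Zp v" using assms by (auto simp: Zp_units_def)
  then obtain k where k: "vge (real n) (x - of_int k)" using Zp_approx_int by blast
  define d where "d = nat (k mod int p ^ n)"
  have d: "int d = k mod int p ^ n" using p_gt_0 by (simp add: d_def)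
  have "[k = int d] (mod int p ^ n)" by (simp add: d cong_def)
  then have "vge (real n) (of_int k - of_int (int d))" by (rule vge_of_int_cong)
  then have xd: "vge (real n) (x - of_nat d)" using vge_trans[OF k] by simp
  have "\<not> p dvd d"
  proof
    assume "p dvd d"
    then have "vge 1 (of_nat d)" using vge_of_int_iff[of 1 "int d"] by simp
    then have "vge 1 (x - of_nat d + of_nat d)" using vge_mono[OF xd, of 1] assms by (intro vge_add) auto
    then show False using assms by (simp add: Zp_units_iff vge_def zero_ereal_def)
  qed
  then show ?thesis using that xd by blast
qed

lemma fermat_int:
  assumes "\<not> p dvd d"
  shows "[int d ^ (p - 1) = 1] (mod int p)"
proof -
  have "[int d ^ p = int d] (mod int p)"
  proof (induction d)
    case (Suc d)
    define w where "w = int d"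
    define z where "z = (\<Sum>j = 2..<p. of_nat ((p choose j) div p) * w ^ (j - 2))"
    have "(1 + w) ^ p = (1 + w ^ p) + int p * (w + w\<^sup>2 * z)"
      using binomial_prime_expansion[OF prime_p, of w] by (simp add: z_def algebra_simps)
    moreover have "[(1 + w ^ p) + int p * (w + w\<^sup>2 * z) = 1 + w] (mod int p)"
    proof -
      have "[1 + w ^ p = 1 + w] (mod int p)" using Suc by (intro cong_add cong_refl) (simp only: w_def)
      moreover have "[int p * (w + w\<^sup>2 * z) = 0] (mod int p)" by (simp add: cong_0_iff)
      ultimately have "[(1 + w ^ p) + int p * (w + w\<^sup>2 * z) = (1 + w) + 0] (mod int p)" by (rule cong_add)
      then show ?thesis by simp
    qed
    ultimately show ?case by (simp add: w_def)
  qed (simp add: zero_power p_gt_0)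
  then have "[int d * int d ^ (p - 1) = int d * 1] (mod int p)"
    using p_gt_0 by (simp add: power_eq_if)
  moreover have "coprime (int d) (int p)"
    using prime_imp_coprime[OF prime_p assms] by (simp add: coprime_commute)
  ultimately show ?thesis by (simp only: cong_mult_lcancel)
qed

text \<open>x^(p-1) is 1 mod p, so kappa(x)^(p-1) is close to 1 and has valuation 0.\<close>

lemma v_kappa_unit:
  assumes K: "\<kappa> \<in> weights_B p v" and x: "x \<in> Zp_units v"
  shows "v (\<kappa> x) = 0"
proof -
  obtain d where d: "\<not> p dvd d" "vge (real 1) (x - of_nat d)"
    using nat_approx_Zp_unit[OF x, of 1] by auto
  have x0: "vge 0 x" using x by (simp add: Zp_units_iff vge_def zero_ereal_def)
  have "vge 1 ((x - of_nat d) * (\<Sum>i<p - 1. of_nat d ^ (p - 1 - Suc i) * x ^ i))"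
    using d x0 by (intro vge_mult0(1) vge_sum vge_mult0(2)[of _ 0] vge_0_power vge_of_nat) auto
  then have "vge 1 (x ^ (p - 1) - of_nat d ^ (p - 1))"
    by (simp add: power_diff_sumr2)
  moreover have "vge (real 1) (of_int (int d ^ (p - 1)) - of_int 1)"
    using fermat_int[OF d(1)] by (intro vge_of_int_cong) simp
  ultimately have "vge 1 (x ^ (p - 1) - 1)" using vge_trans by fastforce
  then have "vge (real (0 + 1) * mu \<kappa>) (\<kappa> (x ^ (p - 1)) - 1)"
    using K x by (intro kappa_close_1) (auto intro: Zp_units_power)
  then have "v (1 + (\<kappa> x ^ (p - 1) - 1)) = 0"
    using K x mu_pos[OF K] by (intro v_add_unit[of 1 "mu \<kappa>"]) (auto simp: kappa_power)
  then have vp: "v (\<kappa> x ^ (p - 1)) = 0" by simp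
  obtain r where r: "v (\<kappa> x) = ereal r" using v_finite[OF kappa_nonzero[OF K x]] by blast
  have "v (\<kappa> x ^ k) = ereal (real k * r)" for k
    by (induction k) (simp_all add: v_mult r algebra_simps zero_ereal_def)
  then have "real (p - 1) * r = 0" using vp by (simp add: zero_ereal_def)
  then show ?thesis using r p_gt_1 by (simp add: zero_ereal_def)
qed

lemma kappa_close:
  assumes K: "\<kappa> \<in> weights_B p v" and x: "x \<in> Zp_units v" and y: "y \<in> Zp_units v"
    and xy: "vge (real n) (x - y)"
  shows "vge (real n * mu \<kappa>) (\<kappa> x - \<kappa> y)"
proof (cases n)
  case 0
  have "vge 0 (\<kappa> x)" "vge 0 (\<kappa> y)"
    using v_kappa_unit[OF K x] v_kappa_unit[OF K y] by (simp_all add: vge_def zero_ereal_def)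
  then show ?thesis using 0 by (simp add: vge_diff)
next
  case (Suc k)
  have y0: "y \<noteq> 0" "v y = 0" using y by (auto simp: Zp_units_iff)
  have u: "x * inverse y \<in> Zp_units v" using x y by (intro Zp_units_mult Zp_units_inverse)
  have "vge (real n) ((x - y) / y)" using xy y0 by (simp add: vge_divide_unit)
  moreover have "(x - y) / y = x * inverse y - 1" using y0 by (simp add: field_simps)
  ultimately have "vge (real n * mu \<kappa>) (\<kappa> (x * inverse y) - 1)"
    using kappa_close_1[OF K u, of k] Suc by simp
  then have "vge (real n * mu \<kappa>) (\<kappa> y * (\<kappa> (x * inverse y) - 1))"
    using v_kappa_unit[OF K y] by (simp add: vge_mult_unit)
  moreover have "\<kappa> y * \<kappa> (x * inverse y) = \<kappa> x"
    using kappa_mult[OF K y u] y0 by (simp add: mult.left_commute)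
  ultimately show ?thesis by (simp add: right_diff_distrib)
qed

text \<open>The Teichmueller representative of d is the limit of d^(p^k).\<close>

lemma teichmueller:
  assumes d: "\<not> p dvd d"
  obtains \<omega> where "\<omega> \<in> Zp_units v" "\<omega> ^ (p - 1) = 1" "vge 1 (of_nat d - \<omega>)"
proof -
  define X where "X = (\<lambda>k. of_nat d ^ (p ^ k) :: 'a)"
  have "[int d ^ (p ^ Suc k) = int d ^ (p ^ k)] (mod int p ^ (k + 1))" for k
  proof (induction k)
    case 0
    have "[int d * int d ^ (p - 1) = int d * 1] (mod int p)"
      using fermat_int[OF d] by (intro cong_mult cong_refl)
    then show ?case using p_gt_0 by (simp add: power_eq_if)
  next
    case (Suc k)
    then show ?case
      using prime_power_cong_lift[OF Suc] by (simp add: mult.commute flip: power_mult)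
  qed
  then have "vge (real (k + 1)) (of_int (int d ^ (p ^ Suc k)) - of_int (int d ^ (p ^ k)))" for k
    by (rule vge_of_int_cong)
  then have step: "vge (real (k + 1)) (X (Suc k) - X k)" for k
    unfolding X_def by simp
  have "vge (1 * real k) (X (Suc k) - X k)" for k
    using step[of k] vge_mono by fastforce
  then obtain \<omega> where lim: "X \<longlonglongrightarrow> \<omega>" and app: "\<And>n. vge (1 * real n) (\<omega> - X n)"
    using convergent_of_steps[of 1 X] by auto
  have 1: "vge 1 (of_nat d - \<omega>)"
  proof -
    have "vge 1 (X 1 - X 0)" using step[of 0] by simp
    then show ?thesis
      using vge_trans[of 1 \<omega> "X 1" "X 0"] app[of 1] vge_diff_commute by (simp add: X_def)
  qed
  have "v (of_nat d + - (of_nat d - \<omega>)) = 0"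
    using 1 v_of_nat_unit[OF d] by (intro v_add_unit[of _ 1]) (auto simp del: minus_diff_eq)
  then have v\<omega>: "v \<omega> = 0" by simp
  then have \<omega>0: "vge 0 \<omega>" "\<omega> \<noteq> 0" by (auto simp: vge_def zero_ereal_def)
  have "X n \<in> Qp" for n
    unfolding X_def using of_nat_Qp[of "d ^ (p ^ n)"] by simp
  then have "\<omega> \<in> Qp" using closed_Qp lim closed_sequentially by blast
  then have unit: "\<omega> \<in> Zp_units v" using v\<omega> by (simp add: Zp_units_iff)
  have "\<omega> ^ p - \<omega> = 0"
  proof (rule vge_all_imp_0)
    fix n :: nat
    have "vge 0 (X n)" unfolding X_def by (intro vge_0_power vge_of_nat)
    then have "vge (real n) ((\<omega> - X n) * (\<Sum>i<p. X n ^ (p - Suc i) * \<omega> ^ i))"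
      using app[of n] \<omega>0 by (intro vge_mult0(1) vge_sum vge_mult0(2)[of _ 0] vge_0_power) auto
    then have "vge (real n) (\<omega> ^ p - X n ^ p)"
      by (simp add: power_diff_sumr2)
    moreover have "X n ^ p = X (Suc n)" by (simp add: X_def mult.commute flip: power_mult)
    moreover have "vge (real n) (X (Suc n) - \<omega>)"
      using app[of "Suc n"] vge_diff_commute vge_mono[of "real (Suc n)" _ "real n"] by auto
    ultimately show "vge (real n) (\<omega> ^ p - \<omega>)" using vge_trans by metis
  qed
  then have "\<omega> * \<omega> ^ (p - 1) = \<omega> * 1" using p_gt_0 by (simp add: power_eq_if)
  then have "\<omega> ^ (p - 1) = 1" using \<omega>0 by simp
  then show ?thesis using that unit 1 by blast
qed

text \<open>The point is that e does not depend on kappa: every character in B kills the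
  Teichmueller factor of d, and the remaining factor is close to a power of 1 + p. This uniformity
  makes kappa(d) an Iwasawa function.\<close>

lemma kappa_approx_power:
  assumes d: "\<not> p dvd d"
  shows "\<exists>e. \<forall>\<kappa>\<in>weights_B p v. vge (real N * mu \<kappa>) (\<kappa> (of_nat d) - (1 + weight_w p \<kappa>) ^ e)"
proof -
  obtain \<omega> where \<omega>: "\<omega> \<in> Zp_units v" "\<omega> ^ (p - 1) = 1" "vge 1 (of_nat d - \<omega>)"
    using teichmueller[OF d] by blast
  define x where "x = of_nat d * inverse \<omega>"
  have \<omega>0: "\<omega> \<noteq> 0" "v \<omega> = 0" using \<omega> by (auto simp: Zp_units_iff)
  have x: "x \<in> Zp_units v"
    unfolding x_def using \<omega> d by (intro Zp_units_mult Zp_units_inverse of_nat_Zp_units)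
  have dx: "of_nat d = \<omega> * x" using \<omega>0 by (simp add: x_def)
  have "vge 1 ((of_nat d - \<omega>) / \<omega>)" using \<omega> \<omega>0 by (simp add: vge_divide_unit)
  moreover have "(of_nat d - \<omega>) / \<omega> = x - 1" using \<omega>0 by (simp add: x_def field_simps)
  ultimately have x1: "vge (real (0 + 1)) (x - 1)" by simp
  obtain e where "vge (real (0 + 1 + N)) (x - (1 + of_nat p) ^ (p ^ 0 * e))"
    using Zp_unit_approx[OF x x1] by blast
  then have e: "vge (real N) (x - (1 + of_nat p) ^ e)" using vge_mono by fastforce
  have "vge (real N * mu \<kappa>) (\<kappa> (of_nat d) - (1 + weight_w p \<kappa>) ^ e)" if K: "\<kappa> \<in> weights_B p v" for \<kappa>
  proof -
    have "\<kappa> (of_nat d) = \<kappa> x"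
      unfolding dx using kappa_mult[OF K \<omega>(1) x] kappa_torsion[OF K \<omega>(1,2)] by simp
    moreover have "\<kappa> ((1 + of_nat p) ^ e) = (1 + weight_w p \<kappa>) ^ e"
      using K by (simp add: kappa_power one_plus_p_Zp_units weight_w_def)
    moreover have "vge (real N * mu \<kappa>) (\<kappa> x - \<kappa> ((1 + of_nat p) ^ e))"
      by (rule kappa_close[OF K x _ e]) (intro Zp_units_power one_plus_p_Zp_units)
    ultimately show ?thesis by simp
  qed
  then show ?thesis by blast
qed

text \<open>If w = 0, then \<open>mu\<close> is 1 and all powers of 1 + w are 1, so kappa is 1 on
  the dense set of integers prime to p.\<close>

lemma weight_w_nonzero:
  assumes K: "\<kappa> \<in> weights_B p v" and nt: "\<kappa> \<noteq> trivial_weight v"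
  shows "weight_w p \<kappa> \<noteq> 0"
proof
  assume w: "weight_w p \<kappa> = 0"
  have mu: "mu \<kappa> = 1" by (simp add: mu_def w)
  have nat1: "\<kappa> (of_nat d) = 1" if d: "\<not> p dvd d" for d
  proof -
    have "\<kappa> (of_nat d) - 1 = 0"
    proof (rule vge_all_imp_0)
      fix n
      show "vge (real n) (\<kappa> (of_nat d) - 1)"
        using kappa_approx_power[OF d, of n] K w mu by auto
    qed
    then show ?thesis by simp
  qed
  have "\<kappa> x = 1" if x: "x \<in> Zp_units v" for x
  proof -
    have "\<kappa> x - 1 = 0"
    proof (rule vge_all_imp_0)
      fix n :: nat
      obtain d where d: "\<not> p dvd d" "vge (real (Suc n)) (x - of_nat d)"
        using nat_approx_Zp_unit[OF x, of "Suc n"] by auto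
      have "vge (real (Suc n) * mu \<kappa>) (\<kappa> x - \<kappa> (of_nat d))"
        by (rule kappa_close[OF K x of_nat_Zp_units[OF d(1)] d(2)])
      then show "vge (real n) (\<kappa> x - 1)" using nat1[OF d(1)] mu vge_mono by fastforce
    qed
    then show ?thesis by simp
  qed
  then have "\<kappa> = trivial_weight v"
    using K by (auto simp: trivial_weight_def weights_B_def weights_def PiE_iff extensional_def restrict_def fun_eq_iff)
  then show False using nt by simp
qed

definition pow_weight :: "nat \<Rightarrow> 'a \<Rightarrow> 'a" where
  "pow_weight k = (\<lambda>x\<in>Zp_units v. x ^ k)"

lemma pow_weight_in_B:
  assumes "(p - 1) dvd k"
  shows "pow_weight k \<in> weights_B p v"
proof -
  have "continuous_on (Zp_units v) (pow_weight k)"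
    unfolding continuous_on_iff
  proof (intro ballI allI impI)
    fix x e assume x: "x \<in> Zp_units v" and e: "(0 :: real) < e"
    obtain n where n: "\<forall>x y. vge (real n) (x - y) \<longrightarrow> dist x y < e"
      using ex_dist_less[OF e] by blast
    show "\<exists>d>0. \<forall>x'\<in>Zp_units v. dist x' x < d \<longrightarrow> dist (pow_weight k x') (pow_weight k x) < e"
    proof (intro exI[of _ "real p powr (- real n)"] conjI ballI impI)
      show "0 < real p powr - real n" using p_gt_0 by simp
      fix y assume y: "y \<in> Zp_units v" "dist y x < real p powr - real n"
      then have yx: "vge (real n) (y - x)" by (simp flip: dist_le_iff)
      have "vge 0 y" "vge 0 x" using x y by (auto simp: Zp_units_iff vge_def zero_ereal_def)
      then have "vge (real n) ((y - x) * (\<Sum>i<k. x ^ (k - Suc i) * y ^ i))"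
        using yx by (intro vge_mult0(1) vge_sum vge_mult0(2)[of _ 0] vge_0_power) auto
      then have "vge (real n) (y ^ k - x ^ k)" by (simp add: power_diff_sumr2)
      then show "dist (pow_weight k y) (pow_weight k x) < e"
        using n x y by (simp add: pow_weight_def)
    qed
  qed
  moreover have "x ^ k = 1" if "x ^ (p - 1) = 1" for x :: 'a
    using assms that by (auto simp: power_mult)
  moreover have "x \<noteq> 0" if "x \<in> Zp_units v" for x using that by (auto simp: Zp_units_iff)
  ultimately show ?thesis
    by (auto simp: weights_B_def weights_def pow_weight_def power_mult_distrib Zp_units_mult)
qed

lemma pow_weight_nat: "\<not> p dvd d \<Longrightarrow> pow_weight k (of_nat d) = of_nat d ^ k"
  by (simp add: pow_weight_def of_nat_Zp_units)

lemma weight_w_pow: "weight_w p (pow_weight k) = (1 + of_nat p) ^ k - 1"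
  by (simp add: weight_w_def pow_weight_def one_plus_p_Zp_units)

lemma vge_weight_w_pow: "vge 1 (weight_w p (pow_weight k))"
proof -
  have "vge 1 ((1 + of_nat p) - (1 :: 'a))" using vge_p_power[of 1] by simp
  then show ?thesis unfolding weight_w_pow by (rule vge_power_minus_1) simp
qed

lemma mu_pow_weight: "mu (pow_weight k) = 1"
proof -
  have "1 \<le> v (weight_w p (pow_weight k))"
    using vge_weight_w_pow[of k] by (simp add: vge_def one_ereal_def)
  then show ?thesis by (simp add: mu_def min_absorb1)
qed

end

section \<open>Iwasawa functions on weight space\<close>

lemma leading_coeff_prod_linear:
  fixes x :: "nat \<Rightarrow> 'b :: field"
  assumes "finite A"
  shows "degree (\<Prod>i\<in>A. [:- x i, 1:]) = card A" "poly.coeff (\<Prod>i\<in>A. [:- x i, 1:]) (card A) = 1"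
proof -
  show d: "degree (\<Prod>i\<in>A. [:- x i, 1:]) = card A"
    by (subst degree_prod_eq_sum_degree) auto
  have "lead_coeff (\<Prod>i\<in>A. [:- x i, 1:]) = 1"
    by (subst lead_coeff_prod) simp
  then show "poly.coeff (\<Prod>i\<in>A. [:- x i, 1:]) (card A) = 1"
    using d by simp
qed

text \<open>Newton's and Lagrange's forms of the interpolation polynomial have degree at most n and
  agree at n + 1 points; their coefficients at degree n are the two sides.\<close>

lemma divided_difference:
  fixes x C :: "nat \<Rightarrow> 'b :: field"
  assumes inj: "inj_on x {..n}"
    and y: "\<And>m. m \<le> n \<Longrightarrow> y m = (\<Sum>j\<le>n. C j * (\<Prod>i<j. x m - x i))"
  shows "C n = (\<Sum>m\<le>n. y m / (\<Prod>l\<in>{..n} - {m}. x m - x l))"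
proof -
  define R where "R = (\<Sum>j\<le>n. smult (C j) (\<Prod>i<j. [:- x i, 1:]))"
  define L where "L = (\<Sum>m\<le>n. smult (y m / (\<Prod>l\<in>{..n} - {m}. x m - x l)) (\<Prod>l\<in>{..n} - {m}. [:- x l, 1:]))"
  have ca: "card ({..n} - {m}) = n" if "m \<le> n" for m
    using that by simp
  have dR: "degree R \<le> n"
    unfolding R_def
    by (intro degree_sum_le) (auto intro!: order_trans[OF degree_smult_le] simp: leading_coeff_prod_linear)
  have dL: "degree L \<le> n"
    unfolding L_def
    by (intro degree_sum_le) (auto intro!: order_trans[OF degree_smult_le] simp: leading_coeff_prod_linear ca)
  have cR: "poly.coeff R n = C n"
  proof -
    have "poly.coeff R n = (\<Sum>j\<le>n. C j * poly.coeff (\<Prod>i<j. [:- x i, 1:]) n)"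
      by (simp add: R_def coeff_sum)
    also have "\<dots> = (\<Sum>j\<in>{n}. C j * poly.coeff (\<Prod>i<j. [:- x i, 1:]) n)"
      by (rule sum.mono_neutral_right) (auto intro!: coeff_eq_0 simp: leading_coeff_prod_linear)
    finally show ?thesis using leading_coeff_prod_linear(2)[of "{..<n}" x] by simp
  qed
  have cL: "poly.coeff L n = (\<Sum>m\<le>n. y m / (\<Prod>l\<in>{..n} - {m}. x m - x l))"
  proof -
    have "poly.coeff (\<Prod>l\<in>{..n} - {m}. [:- x l, 1:]) n = 1" if "m \<le> n" for m
      using leading_coeff_prod_linear(2)[of "{..n} - {m}" x] ca[OF that] by simp
    then show ?thesis unfolding L_def coeff_sum by (intro sum.cong) auto
  qed
  have eq: "poly R (x k) = poly L (x k)" if k: "k \<le> n" for k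
  proof -
    have "poly R (x k) = y k" using y[OF k] by (simp add: R_def poly_sum poly_prod)
    moreover have "poly L (x k) = (\<Sum>m\<in>{k}. y m / (\<Prod>l\<in>{..n} - {m}. x m - x l) * (\<Prod>l\<in>{..n} - {m}. x k - x l))"
      unfolding L_def poly_sum poly_smult poly_prod
      by (subst sum.mono_neutral_right[of "{..n}" "{k}"]) (use k in \<open>auto intro!: prod_zero\<close>)
    moreover have "(\<Prod>l\<in>{..n} - {k}. x k - x l) \<noteq> 0"
      using inj k by (auto simp: inj_on_def)
    ultimately show ?thesis by simp
  qed
  have "R - L = 0"
  proof (rule ccontr)
    assume nz: "R - L \<noteq> 0"
    have "x ` {..n} \<subseteq> {z. poly (R - L) z = 0}" using eq by auto
    then have "card (x ` {..n}) \<le> card {z. poly (R - L) z = 0}"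
      using poly_roots_finite[OF nz] by (intro card_mono) auto
    also have "\<dots> \<le> degree (R - L)" using nz by (rule card_poly_roots_bound)
    also have "\<dots> \<le> n" using dR dL by (rule degree_diff_le)
    finally show False using card_image[OF inj] by simp
  qed
  then show ?thesis using cR cL by simp
qed

section \<open>The algebra of Iwasawa functions and interpolation at the classical weights\<close>

context Cp5
begin

text \<open>Stands for evaluation of a power series in w with integral coefficients: w^N has
  valuation at least N \<open>mu\<close>, so a truncation at degree N meets the condition. Asking
  only for uniform polynomial approximation makes the class closed under limits.\<close>

definition iwasawa :: "(('a \<Rightarrow> 'a) \<Rightarrow> 'a) \<Rightarrow> bool" where
  "iwasawa \<phi> \<longleftrightarrow> (\<forall>N :: nat. \<exists>Q. (\<forall>i. vge 0 (poly.coeff Q i)) \<and>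
     (\<forall>\<kappa>\<in>weights_B p v. vge (real N * mu \<kappa>) (\<phi> \<kappa> - poly Q (weight_w p \<kappa>))))"

lemma vge_poly:
  assumes "\<And>i. vge 0 (poly.coeff Q i)" "vge 0 x"
  shows "vge 0 (poly Q x)"
  unfolding poly_altdef using assms by (intro vge_sum vge_mult0 vge_0_power)

lemma vge0_w: "\<kappa> \<in> weights_B p v \<Longrightarrow> vge 0 (weight_w p \<kappa>)"
  using vge_w[of \<kappa>] mu_pos[of \<kappa>] vge_mono by fastforce

lemma iwasawa_vge0:
  assumes "iwasawa \<phi>" "\<kappa> \<in> weights_B p v"
  shows "vge 0 (\<phi> \<kappa>)"
proof -
  obtain Q where Q: "\<And>i. vge 0 (poly.coeff Q i)" "vge (real 0 * mu \<kappa>) (\<phi> \<kappa> - poly Q (weight_w p \<kappa>))"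
    using assms unfolding iwasawa_def by meson
  have "vge 0 (\<phi> \<kappa> - poly Q (weight_w p \<kappa>) + poly Q (weight_w p \<kappa>))"
    using Q vge0_w[OF assms(2)] by (intro vge_add vge_poly) auto
  then show ?thesis by simp
qed

lemma iwasawa_const: "vge 0 c \<Longrightarrow> iwasawa (\<lambda>\<kappa>. c)"
  unfolding iwasawa_def by (intro allI exI[of _ "[:c:]"]) (auto simp: coeff_pCons split: nat.splits)

lemma iwasawa_w: "iwasawa (weight_w p)"
  unfolding iwasawa_def by (intro allI exI[of _ "[:0, 1:]"]) (auto simp: coeff_pCons split: nat.splits)

lemma iwasawa_add:
  assumes "iwasawa \<phi>" "iwasawa \<psi>"
  shows "iwasawa (\<lambda>\<kappa>. \<phi> \<kappa> + \<psi> \<kappa>)"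
  unfolding iwasawa_def
proof
  fix N :: nat
  obtain Q where Q: "\<And>i. vge 0 (poly.coeff Q i)" "\<And>\<kappa>. \<kappa> \<in> weights_B p v \<Longrightarrow> vge (real N * mu \<kappa>) (\<phi> \<kappa> - poly Q (weight_w p \<kappa>))"
    using assms(1) unfolding iwasawa_def by meson
  obtain R where R: "\<And>i. vge 0 (poly.coeff R i)" "\<And>\<kappa>. \<kappa> \<in> weights_B p v \<Longrightarrow> vge (real N * mu \<kappa>) (\<psi> \<kappa> - poly R (weight_w p \<kappa>))"
    using assms(2) unfolding iwasawa_def by meson
  show "\<exists>Q. (\<forall>i. vge 0 (poly.coeff Q i)) \<and> (\<forall>\<kappa>\<in>weights_B p v. vge (real N * mu \<kappa>) (\<phi> \<kappa> + \<psi> \<kappa> - poly Q (weight_w p \<kappa>)))"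
  proof (intro exI[of _ "Q + R"] conjI allI ballI)
    fix \<kappa> assume K: "\<kappa> \<in> weights_B p v"
    show "vge (real N * mu \<kappa>) (\<phi> \<kappa> + \<psi> \<kappa> - poly (Q + R) (weight_w p \<kappa>))"
      using vge_add[OF Q(2)[OF K] R(2)[OF K]] by (simp add: algebra_simps)
  qed (use Q R in \<open>auto intro: vge_add\<close>)
qed

lemma iwasawa_mult:
  assumes "iwasawa \<phi>" "iwasawa \<psi>"
  shows "iwasawa (\<lambda>\<kappa>. \<phi> \<kappa> * \<psi> \<kappa>)"
  unfolding iwasawa_def
proof
  fix N :: nat
  obtain Q where Q: "\<And>i. vge 0 (poly.coeff Q i)" "\<And>\<kappa>. \<kappa> \<in> weights_B p v \<Longrightarrow> vge (real N * mu \<kappa>) (\<phi> \<kappa> - poly Q (weight_w p \<kappa>))"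
    using assms(1) unfolding iwasawa_def by meson
  obtain R where R: "\<And>i. vge 0 (poly.coeff R i)" "\<And>\<kappa>. \<kappa> \<in> weights_B p v \<Longrightarrow> vge (real N * mu \<kappa>) (\<psi> \<kappa> - poly R (weight_w p \<kappa>))"
    using assms(2) unfolding iwasawa_def by meson
  show "\<exists>Q. (\<forall>i. vge 0 (poly.coeff Q i)) \<and> (\<forall>\<kappa>\<in>weights_B p v. vge (real N * mu \<kappa>) (\<phi> \<kappa> * \<psi> \<kappa> - poly Q (weight_w p \<kappa>)))"
  proof (intro exI[of _ "Q * R"] conjI allI ballI)
    fix \<kappa> assume K: "\<kappa> \<in> weights_B p v"
    have "vge (real N * mu \<kappa>) ((\<phi> \<kappa> - poly Q (weight_w p \<kappa>)) * \<psi> \<kappa> + poly Q (weight_w p \<kappa>) * (\<psi> \<kappa> - poly R (weight_w p \<kappa>)))"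
      using Q R K iwasawa_vge0[OF assms(2) K] vge0_w[OF K]
      by (intro vge_add vge_mult0(1)[of "real N * mu \<kappa>"] vge_mult0(2)[of _ "real N * mu \<kappa>"] vge_poly) auto
    then show "vge (real N * mu \<kappa>) (\<phi> \<kappa> * \<psi> \<kappa> - poly (Q * R) (weight_w p \<kappa>))"
      by (simp add: algebra_simps)
  qed (use Q R in \<open>auto simp: coeff_mult intro!: vge_sum vge_mult0\<close>)
qed

lemma iwasawa_sum: "(\<And>i. i \<in> A \<Longrightarrow> iwasawa (f i)) \<Longrightarrow> iwasawa (\<lambda>\<kappa>. \<Sum>i\<in>A. f i \<kappa>)"
  by (induction A rule: infinite_finite_induct) (auto intro: iwasawa_add iwasawa_const)

lemma iwasawa_power: "iwasawa \<phi> \<Longrightarrow> iwasawa (\<lambda>\<kappa>. \<phi> \<kappa> ^ n)"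
  by (induction n) (auto intro: iwasawa_mult iwasawa_const)

lemma iwasawa_uminus: "iwasawa \<phi> \<Longrightarrow> iwasawa (\<lambda>\<kappa>. - \<phi> \<kappa>)"
  using iwasawa_mult[OF iwasawa_const[of "- 1"], of \<phi>] by simp

lemma iwasawa_diff: "iwasawa \<phi> \<Longrightarrow> iwasawa \<psi> \<Longrightarrow> iwasawa (\<lambda>\<kappa>. \<phi> \<kappa> - \<psi> \<kappa>)"
  using iwasawa_add[OF _ iwasawa_uminus, of \<phi> \<psi>] by simp

lemma iwasawa_approx:
  assumes "\<And>N :: nat. \<exists>\<psi>. iwasawa \<psi> \<and> (\<forall>\<kappa>\<in>weights_B p v. vge (real N * mu \<kappa>) (\<phi> \<kappa> - \<psi> \<kappa>))"
  shows "iwasawa \<phi>"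
  unfolding iwasawa_def
proof
  fix N :: nat
  obtain \<psi> where \<psi>: "iwasawa \<psi>" "\<And>\<kappa>. \<kappa> \<in> weights_B p v \<Longrightarrow> vge (real N * mu \<kappa>) (\<phi> \<kappa> - \<psi> \<kappa>)"
    using assms by meson
  obtain Q where Q: "\<And>i. vge 0 (poly.coeff Q i)" "\<And>\<kappa>. \<kappa> \<in> weights_B p v \<Longrightarrow> vge (real N * mu \<kappa>) (\<psi> \<kappa> - poly Q (weight_w p \<kappa>))"
    using \<psi>(1) unfolding iwasawa_def by meson
  show "\<exists>Q. (\<forall>i. vge 0 (poly.coeff Q i)) \<and> (\<forall>\<kappa>\<in>weights_B p v. vge (real N * mu \<kappa>) (\<phi> \<kappa> - poly Q (weight_w p \<kappa>)))"
    using Q \<psi>(2) vge_trans by blast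
qed

lemma iwasawa_kappa:
  assumes "\<not> p dvd d"
  shows "iwasawa (\<lambda>\<kappa>. \<kappa> (of_nat d))"
proof (rule iwasawa_approx)
  fix N :: nat
  obtain e where "\<forall>\<kappa>\<in>weights_B p v. vge (real N * mu \<kappa>) (\<kappa> (of_nat d) - (1 + weight_w p \<kappa>) ^ e)"
    using kappa_approx_power[OF assms] by blast
  moreover have "iwasawa (\<lambda>\<kappa>. (1 + weight_w p \<kappa>) ^ e)"
    by (intro iwasawa_power iwasawa_add iwasawa_w iwasawa_const) simp
  ultimately show "\<exists>\<psi>. iwasawa \<psi> \<and> (\<forall>\<kappa>\<in>weights_B p v. vge (real N * mu \<kappa>) (\<kappa> (of_nat d) - \<psi> \<kappa>))"
    by blast
qed

lemma iwasawa_inverse: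
  assumes "iwasawa \<phi>" "\<And>\<kappa>. \<kappa> \<in> weights_B p v \<Longrightarrow> vge (mu \<kappa>) (\<phi> \<kappa> - 1)"
  shows "iwasawa (\<lambda>\<kappa>. inverse (\<phi> \<kappa>))" and "\<kappa> \<in> weights_B p v \<Longrightarrow> v (\<phi> \<kappa>) = 0"
proof -
  have unit: "v (\<phi> \<kappa>) = 0" if K: "\<kappa> \<in> weights_B p v" for \<kappa>
    using v_add_unit[OF v_one mu_pos[OF K] assms(2)[OF K]] by simp
  show "\<kappa> \<in> weights_B p v \<Longrightarrow> v (\<phi> \<kappa>) = 0" by (rule unit)
  show "iwasawa (\<lambda>\<kappa>. inverse (\<phi> \<kappa>))"
  proof (rule iwasawa_approx)
    fix N :: nat
    have "iwasawa (\<lambda>\<kappa>. \<Sum>r<N. (1 - \<phi> \<kappa>) ^ r)"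
      using assms by (intro iwasawa_sum iwasawa_power iwasawa_diff iwasawa_const) auto
    moreover have "vge (real N * mu \<kappa>) (inverse (\<phi> \<kappa>) - (\<Sum>r<N. (1 - \<phi> \<kappa>) ^ r))" if K: "\<kappa> \<in> weights_B p v" for \<kappa>
    proof -
      have nz: "\<phi> \<kappa> \<noteq> 0" using unit[OF K] by auto
      have "(1 - (1 - \<phi> \<kappa>)) * (\<Sum>r<N. (1 - \<phi> \<kappa>) ^ r) = 1 - (1 - \<phi> \<kappa>) ^ N"
        using one_diff_power_eq by metis
      then have "inverse (\<phi> \<kappa>) - (\<Sum>r<N. (1 - \<phi> \<kappa>) ^ r) = (1 - \<phi> \<kappa>) ^ N / \<phi> \<kappa>"
        using nz by (simp add: field_simps)
      moreover have "vge (real N * mu \<kappa>) ((1 - \<phi> \<kappa>) ^ N)"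
        using assms(2)[OF K] vge_diff_commute by (intro vge_power) blast
      ultimately show ?thesis using unit[OF K] by (simp add: vge_divide_unit)
    qed
    ultimately show "\<exists>\<psi>. iwasawa \<psi> \<and> (\<forall>\<kappa>\<in>weights_B p v. vge (real N * mu \<kappa>) (inverse (\<phi> \<kappa>) - \<psi> \<kappa>))"
      by blast
  qed
qed

text \<open>Repeated synthetic division by the nodes; as the nodes are integral, the coefficients
  stay integral.\<close>

lemma newton_expansion:
  assumes "\<And>i. vge 0 (poly.coeff Q i)" "\<And>i. vge 0 (x i)"
  shows "\<exists>C. (\<forall>n. vge 0 (C n)) \<and> (\<forall>n > degree Q. C n = 0) \<and>
    (\<forall>y. poly Q y = (\<Sum>n\<le>degree Q. C n * (\<Prod>i<n. y - x i)))"
  using assms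
proof (induction "degree Q" arbitrary: Q x)
  case 0
  then obtain c where c: "Q = [:c:]" by (metis degree_eq_zeroE)
  have "vge 0 c" using 0(2)[of 0] c by simp
  then show ?case using c by (intro exI[of _ "\<lambda>n. if n = 0 then c else 0"]) auto
next
  case (Suc D)
  define S where "S = synthetic_div Q (x 0)"
  have dS: "degree S = D" using Suc(2) by (simp add: S_def degree_synthetic_div)
  have Si: "vge 0 (poly.coeff S i)" for i
    unfolding S_def using Suc(3)
  proof (induction Q arbitrary: i)
    case (pCons a Q)
    have Q: "vge 0 (poly.coeff Q j)" for j using pCons.prems[of "Suc j"] by simp
    show ?case
      using pCons.IH Q vge_poly[OF Q Suc(4)] by (cases i) auto
  qed auto
  have "\<exists>C. (\<forall>n. vge 0 (C n)) \<and> (\<forall>n > degree S. C n = 0) \<and>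
      (\<forall>y. poly S y = (\<Sum>n\<le>degree S. C n * (\<Prod>i<n. y - x (Suc i))))"
    by (rule Suc(1)) (use Suc(4) Si dS in auto)
  then obtain C where C: "\<And>n. vge 0 (C n)" "\<And>n. n > D \<Longrightarrow> C n = 0"
    "\<And>y. poly S y = (\<Sum>n\<le>D. C n * (\<Prod>i<n. y - x (Suc i)))"
    unfolding dS by blast
  define C' where "C' = (\<lambda>n. case n of 0 \<Rightarrow> poly Q (x 0) | Suc n \<Rightarrow> C n)"
  have "poly Q y = (\<Sum>n\<le>Suc D. C' n * (\<Prod>i<n. y - x i))" for y
  proof -
    have "poly Q y = (y - x 0) * poly S y + poly Q (x 0)"
      using arg_cong[OF synthetic_div_correct'[of "x 0" Q], of "\<lambda>P. poly P y"] by (simp add: S_def algebra_simps)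
    also have "(y - x 0) * poly S y = (\<Sum>n\<le>D. C' (Suc n) * (\<Prod>i<Suc n. y - x i))"
      unfolding C(3) sum_distrib_left
      by (intro sum.cong refl) (simp add: C'_def prod.lessThan_Suc_shift mult_ac del: prod.lessThan_Suc)
    finally show ?thesis by (simp add: sum.atMost_Suc_shift C'_def del: sum.atMost_Suc prod.lessThan_Suc)
  qed
  moreover have "vge 0 (C' n)" for n
    using C(1) vge_poly[OF Suc(3) Suc(4)] by (auto simp: C'_def split: nat.splits)
  moreover have "C' n = 0" if "n > Suc D" for n
    using that C(2) by (auto simp: C'_def split: nat.splits)
  ultimately show ?case unfolding Suc(2)[symmetric] by blast
qed

lemma v_fact_block: "r < p \<Longrightarrow> v (of_nat (fact (p * q + r))) = v (of_nat (fact (p * q)))"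
proof (induction r)
  case (Suc r)
  have "\<not> p dvd (p * q + Suc r)"
    using Suc.prems by (metis dvd_add_right_iff dvd_imp_le dvd_triv_left not_le zero_less_Suc)
  then have "v (of_nat (p * q + Suc r)) = 0" by (rule v_of_nat_unit)
  moreover have "of_nat (fact (p * q + Suc r)) = (of_nat (p * q + Suc r) * of_nat (fact (p * q + r)) :: 'a)"
    by (metis add_Suc_right fact_Suc of_nat_id of_nat_mult)
  ultimately show ?case using Suc by (simp only: v_mult) simp
qed simp

text \<open>Legendre's argument: v((p q)!) = q + v(q!), and the factors prime to p contribute
  nothing.\<close>

lemma v_fact_le: "v (of_nat (fact n)) \<le> ereal (real n / (real p - 1))"
proof -
  have fp: "v (of_nat (fact (p * q))) = ereal (real q) + v (of_nat (fact q))" for q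
  proof (induction q)
    case (Suc q)
    from v_fact_block[of "p - 1" q] have "v (of_nat (fact (p * q + (p - 1)))) = v (of_nat (fact (p * q)))"
      using p_gt_0 by simp
    moreover have "p * Suc q = Suc (p * q + (p - 1))" using p_gt_0 by simp
    then have "fact (p * Suc q) = p * Suc q * (fact (p * q + (p - 1)) :: nat)"
      by (metis fact_Suc of_nat_id)
    ultimately have "v (of_nat (fact (p * Suc q))) = v (of_nat p) + v (of_nat (Suc q)) + (ereal (real q) + v (of_nat (fact q)))"
      using Suc by (simp add: v_mult del: of_nat_Suc fact_Suc mult_Suc_right)
    moreover have "v (of_nat (fact (Suc q))) = v (of_nat (Suc q)) + v (of_nat (fact q))"
      by (simp only: fact_Suc of_nat_mult v_mult of_nat_id)
    moreover have "ereal (real (Suc q)) = ereal (real q) + 1" by (simp add: one_ereal_def)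
    ultimately show ?case by (simp only: v_p ac_simps)
  qed auto
  show ?thesis
  proof (induction n rule: less_induct)
    case (less n)
    show ?case
    proof (cases "n = 0")
      case False
      define q where "q = n div p"
      define r where "r = n mod p"
      have n: "n = p * q + r" "r < p" using p_gt_0 by (auto simp: q_def r_def)
      have "v (of_nat (fact (p * q + r))) = v (of_nat (fact (p * q)))"
        by (rule v_fact_block[OF n(2)])
      then have "v (of_nat (fact n)) = ereal (real q) + v (of_nat (fact q))"
        using n fp by simp
      also have "\<dots> \<le> ereal (real q) + ereal (real q / (real p - 1))"
        using False p_gt_1 by (intro add_left_mono less) (simp add: q_def)
      also have "\<dots> = ereal (real p * real q / (real p - 1))"
        using p_gt_1 by (simp add: field_simps)
      also have "\<dots> \<le> ereal (real n / (real p - 1))"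
        using p_gt_1 n(1) by (simp add: divide_right_mono flip: of_nat_mult)
      finally show ?thesis .
    qed auto
  qed
qed

lemma v_node:
  assumes "j > 0"
  shows "v (((1 + of_nat p) ^ (p - 1)) ^ j - 1) = 1 + v (of_nat j)"
proof -
  have nz: "(1 + int p) ^ ((p - 1) * j) - 1 \<noteq> 0"
  proof -
    have "1 < (1 + int p) ^ ((p - 1) * j)" using assms p_gt_1 by (intro one_less_power) auto
    then show ?thesis by simp
  qed
  have "v (of_int ((1 + int p) ^ ((p - 1) * j) - 1)) = ereal (real (Suc (multiplicity (int p) (int ((p - 1) * j)))))"
    using v_of_int_eq[OF nz] multiplicity_one_plus_p_power[of "(p - 1) * j"] assms p_gt_1 by simp
  also have "\<dots> = 1 + v (of_int (int ((p - 1) * j)))"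
    using v_of_int_eq[of "int ((p - 1) * j)"] assms p_gt_1 by (simp add: one_ereal_def del: of_nat_mult)
  also have "v (of_int (int ((p - 1) * j))) = v (of_nat j)"
  proof -
    have "\<not> p dvd (p - 1)" using p_gt_1 by (auto dest: dvd_imp_le)
    then show ?thesis using v_of_nat_unit[of "p - 1"] by (simp add: v_mult)
  qed
  finally show ?thesis by (simp add: power_mult)
qed

lemma v_node_prod:
  "v (\<Prod>j<m. ((1 + of_nat p) ^ (p - 1)) ^ Suc j - 1) \<le> ereal (real m + real m / (real p - 1))"
proof -
  have "v (\<Prod>j<m. ((1 + of_nat p) ^ (p - 1)) ^ Suc j - 1) = ereal (real m) + v (of_nat (fact m))"
  proof (induction m)
    case (Suc m)
    have e: "v (of_nat (fact (Suc m))) = v (of_nat (Suc m)) + v (of_nat (fact m))"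
      by (simp only: fact_Suc of_nat_mult v_mult of_nat_id)
    have e': "ereal (real (Suc m)) = ereal (real m) + 1" by (simp add: one_ereal_def)
    have n: "v (((1 + of_nat p) ^ (p - 1)) ^ Suc m - 1) = 1 + v (of_nat (Suc m))"
      by (rule v_node) simp
    show ?case
      unfolding prod.lessThan_Suc v_mult Suc e e' n by (simp only: ac_simps)
  qed auto
  also have "\<dots> \<le> ereal (real m) + ereal (real m / (real p - 1))"
    by (intro add_left_mono v_fact_le)
  finally show ?thesis by simp
qed

lemma vge_divide:
  assumes "vge M x" "v y \<le> ereal r"
  shows "vge (M - r) (x / y)"
proof (cases "y = 0")
  case False
  then obtain s where s: "v y = ereal s" using v_finite by blast
  have "v (inverse y) = ereal (- s)" by (rule v_inverse[OF s])
  then have "vge (- r) (inverse y)" using assms(2) s by (simp add: vge_def)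
  then show ?thesis using vge_mult[OF assms(1), of "- r" "inverse y"] by (simp add: divide_inverse)
qed auto

text \<open>The nodes \<open>(1 + p)\<^sup>(\<^sup>p\<^sup>-\<^sup>1\<^sup>)\<^sup>m - 1\<close> are the values of \<open>w\<close> at the classical weights; the denominators
  of the Newton coefficients at these nodes cost the factor \<open>(p - 1) / p\<close>.\<close>

lemma iwasawa_bound:
  assumes \<phi>: "iwasawa \<phi>" and M: "M \<ge> 0"
    and nodes: "\<And>m. m \<ge> 1 \<Longrightarrow> vge M (\<phi> (pow_weight ((p - 1) * m)))"
    and K: "\<kappa> \<in> weights_B p v"
  shows "vge (M * (real p - 1) / real p * mu \<kappa>) (\<phi> \<kappa>)"
proof -
  define u :: 'a where "u = (1 + of_nat p) ^ (p - 1)"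
  define x where "x = (\<lambda>i. u ^ Suc i - 1)"
  \<comment> \<open>s solves s + s / (p - 1) = M: it is the degree at which the bound M - n - n / (p
    - 1) for the n-th Newton coefficient reaches 0.\<close>
  define s where "s = M * (real p - 1) / real p"
  have s: "s \<ge> 0" "M = s + s / (real p - 1)" "s \<le> M"
    using M p_gt_1 mult_left_mono[of 1 "real p" M] by (auto simp: s_def field_simps)
  have xw: "x i = weight_w p (pow_weight ((p - 1) * Suc i))" for i
    unfolding weight_w_pow x_def u_def by (simp only: power_mult)
  have x1: "vge 1 (x i)" for i unfolding xw by (rule vge_weight_w_pow)
  then have x0: "vge 0 (x i)" for i using vge_mono[of 1 _ 0] by simp
  have vu: "v u = 0"
    unfolding u_def using one_plus_p_Zp_units by (intro v_power) (auto simp: Zp_units_iff)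
  obtain N :: nat where N: "M \<le> real N" using real_arch_simple by blast
  obtain Q where Q: "\<And>i. vge 0 (poly.coeff Q i)" "\<And>\<kappa>. \<kappa> \<in> weights_B p v \<Longrightarrow> vge (real N * mu \<kappa>) (\<phi> \<kappa> - poly Q (weight_w p \<kappa>))"
    using \<phi> unfolding iwasawa_def by meson
  have Qx: "vge M (poly Q (x i))" for i
  proof -
    have "vge (real N) (\<phi> (pow_weight ((p - 1) * Suc i)) - poly Q (x i))"
      using Q(2)[OF pow_weight_in_B[of "(p - 1) * Suc i"]] by (simp add: mu_pow_weight xw del: mult_Suc_right)
    then have "vge M (\<phi> (pow_weight ((p - 1) * Suc i)) - poly Q (x i))"
      using N vge_mono by blast
    moreover have "vge M (\<phi> (pow_weight ((p - 1) * Suc i)))" by (rule nodes) simp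
    ultimately have "vge M (\<phi> (pow_weight ((p - 1) * Suc i)) - (\<phi> (pow_weight ((p - 1) * Suc i)) - poly Q (x i)))"
      by (rule vge_diff[rotated])
    then show ?thesis by (simp only: diff_diff_eq2 add_diff_cancel_left')
  qed
  obtain C where C: "\<And>n. vge 0 (C n)" "\<And>n. n > degree Q \<Longrightarrow> C n = 0"
    "\<And>y. poly Q y = (\<Sum>n\<le>degree Q. C n * (\<Prod>i<n. y - x i))"
    using newton_expansion[of Q x, OF Q(1) x0] by blast
  have unz: "u ^ j \<noteq> 1" if "j > 0" for j
  proof
    assume "u ^ j = 1"
    then have "1 + v (of_nat j) = \<infinity>" using v_node[OF that] by (simp add: u_def)
    moreover obtain r where "v (of_nat j) = ereal r" using v_finite[of "of_nat j"] \<open>j > 0\<close> by auto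
    ultimately show False by (simp add: one_ereal_def)
  qed
  have inj: "inj x"
  proof (rule linorder_injI)
    fix i j :: nat assume "i < j"
    show "x i \<noteq> x j"
    proof
      assume "x i = x j"
      then have "u ^ Suc i = u ^ Suc j" by (simp add: x_def del: power_Suc)
      moreover have "u ^ Suc j = u ^ Suc i * u ^ (j - i)"
        using \<open>i < j\<close> by (subst power_add [symmetric]) simp
      ultimately have "u ^ Suc i * u ^ (j - i) = u ^ Suc i * 1" by (metis mult_1_right)
      then show False using unz[of "j - i"] \<open>i < j\<close> vu by auto
    qed
  qed
  have vprod: "v (\<Prod>l\<in>{..n} - {m}. x m - x l) \<le> ereal (real n + real n / (real p - 1))" if m: "m \<le> n" for n m
  proof -
    \<comment> \<open>The nodes on either side of m: up to a unit, x m - x l is u^j - 1 with j = |m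
      - l|, so both halves are products as in \<open>v_node_prod\<close>.\<close>
    have "{..n} - {m} = {..<m} \<union> (\<lambda>j. Suc (m + j)) ` {..<n - m}"
    proof (intro equalityI subsetI)
      fix l assume l: "l \<in> {..n} - {m}"
      show "l \<in> {..<m} \<union> (\<lambda>j. Suc (m + j)) ` {..<n - m}"
      proof (cases "l < m")
        case False
        then have "l = Suc (m + (l - Suc m))" "l - Suc m < n - m" using l by auto
        then show ?thesis by blast
      qed auto
    qed (use m in auto)
    then have "(\<Prod>l\<in>{..n} - {m}. x m - x l) = (\<Prod>l<m. x m - x l) * (\<Prod>l\<in>(\<lambda>j. Suc (m + j)) ` {..<n - m}. x m - x l)"
      by (simp only:) (rule prod.union_disjoint, auto)
    also have "(\<Prod>l<m. x m - x l) = (\<Prod>l<m. u ^ Suc l * (u ^ Suc (m - Suc l) - 1))"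
      by (intro prod.cong refl) (auto simp: x_def right_diff_distrib simp flip: power_add power_Suc)
    also have "\<dots> = (\<Prod>l<m. u ^ Suc l) * (\<Prod>l<m. u ^ Suc l - 1)"
      unfolding prod.distrib by (subst prod.nat_diff_reindex[of "\<lambda>i. u ^ Suc i - 1" m]) simp
    also have "(\<Prod>l\<in>(\<lambda>j. Suc (m + j)) ` {..<n - m}. x m - x l) = (\<Prod>j<n - m. x m - x (Suc (m + j)))"
      by (subst prod.reindex) (auto simp: inj_on_def)
    also have "\<dots> = (\<Prod>j<n - m. (- (u ^ Suc m)) * (u ^ Suc j - 1))"
      by (intro prod.cong refl) (auto simp: x_def algebra_simps power_add)
    also have "\<dots> = (\<Prod>j<n - m. - (u ^ Suc m)) * (\<Prod>j<n - m. u ^ Suc j - 1)"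
      by (rule prod.distrib)
    finally have eq: "(\<Prod>l\<in>{..n} - {m}. x m - x l) =
        (\<Prod>l<m. u ^ Suc l) * (\<Prod>l<m. u ^ Suc l - 1) * ((\<Prod>j<n - m. - (u ^ Suc m)) * (\<Prod>j<n - m. u ^ Suc j - 1))" .
    have "v (\<Prod>l<m. u ^ Suc l) = 0"
      by (induction m) (simp_all add: v_mult v_power[OF vu] vu)
    moreover have "v (\<Prod>j<n - m. - (u ^ Suc m)) = 0"
      using v_power[OF v_uminus[of "u ^ Suc m", unfolded v_power[OF vu]], of "n - m"] by (simp del: power_Suc)
    ultimately have "v (\<Prod>l\<in>{..n} - {m}. x m - x l) = v (\<Prod>l<m. u ^ Suc l - 1) + v (\<Prod>j<n - m. u ^ Suc j - 1)"
      unfolding eq v_mult by simp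
    also have "\<dots> \<le> ereal (real m + real m / (real p - 1)) + ereal (real (n - m) + real (n - m) / (real p - 1))"
      unfolding u_def by (intro add_mono v_node_prod)
    also have "\<dots> = ereal (real n + real n / (real p - 1))"
      using m by (simp add: of_nat_diff add_divide_distrib diff_divide_distrib)
    finally show ?thesis .
  qed
  have Cn: "vge (M - (real n + real n / (real p - 1))) (C n)" for n
  proof (cases "n \<le> degree Q")
    case True
    have "poly Q (x m) = (\<Sum>j\<le>n. C j * (\<Prod>i<j. x m - x i))" if m: "m \<le> n" for m
      unfolding C(3) by (rule sum.mono_neutral_right) (use True m in \<open>auto intro!: prod_zero\<close>)
    then have "C n = (\<Sum>m\<le>n. poly Q (x m) / (\<Prod>l\<in>{..n} - {m}. x m - x l))"
      using inj by (intro divided_difference) (auto intro: inj_on_subset)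
    then show ?thesis using Qx vprod by (simp only:) (intro vge_sum vge_divide, auto)
  qed (use C in auto)
  let ?w = "weight_w p \<kappa>"
  have "vge (s * mu \<kappa>) (poly Q ?w)"
    unfolding C(3)
  proof (rule vge_sum)
    fix n
    have "vge (mu \<kappa>) (?w - x i)" for i
      using vge_w[OF K] vge_mono[OF x1 mu_le_1[OF K]] by (intro vge_diff) auto
    then have P: "vge (real n * mu \<kappa>) (\<Prod>i<n. ?w - x i)"
    proof (induction n)
      case (Suc n)
      then show ?case using vge_mult[of "real n * mu \<kappa>" "\<Prod>i<n. ?w - x i" "mu \<kappa>" "?w - x n"]
        by (simp add: algebra_simps)
    qed auto
    show "vge (s * mu \<kappa>) (C n * (\<Prod>i<n. ?w - x i))"
    \<comment> \<open>From degree s on, the n factors of valuation at least \<open>mu\<close>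
      suffice with an integral coefficient. Below s the coefficient has valuation at least s - n,
      hence at least (s - n) \<open>mu\<close>, which makes up the difference.\<close>
    proof (cases "s \<le> real n")
      case True
      then have "s * mu \<kappa> \<le> 0 + real n * mu \<kappa>" using mu_pos[OF K] by (simp add: mult_right_mono)
      then show ?thesis using vge_mult[OF C(1) P] vge_mono by blast
    next
      case False
      then have "real n / (real p - 1) \<le> s / (real p - 1)"
        using p_gt_1 by (intro divide_right_mono) auto
      moreover have "(s - real n) * mu \<kappa> \<le> (s - real n) * 1"
        using False mu_le_1[OF K] by (intro mult_left_mono) auto
      ultimately have "s * mu \<kappa> \<le> (M - (real n + real n / (real p - 1))) + real n * mu \<kappa>"
        using s(2) by (simp add: algebra_simps)
      then show ?thesis using vge_mult[OF Cn P] vge_mono by blast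
    qed
  qed
  moreover have "vge (s * mu \<kappa>) (\<phi> \<kappa> - poly Q ?w)"
    using Q(2)[OF K] by (rule vge_mono) (use s N mu_pos[OF K] in \<open>auto intro!: mult_right_mono\<close>)
  ultimately have "vge (s * mu \<kappa>) (\<phi> \<kappa> - poly Q ?w + poly Q ?w)" by (intro vge_add)
  then show ?thesis by (simp add: s_def)
qed

text \<open>Vanishing at the nodes makes \<open>iwasawa_bound\<close> available for every M, and M
  is chosen to reach any prescribed precision.\<close>

lemma iwasawa_eq_0:
  assumes \<phi>: "iwasawa \<phi>"
    and nodes: "\<And>m. m \<ge> 1 \<Longrightarrow> \<phi> (pow_weight ((p - 1) * m)) = 0"
    and K: "\<kappa> \<in> weights_B p v"
  shows "\<phi> \<kappa> = 0"
proof (rule vge_all_imp_0)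
  fix n :: nat
  define M where "M = real n * real p / ((real p - 1) * mu \<kappa>)"
  have M: "M \<ge> 0" using p_gt_1 mu_pos[OF K] by (simp add: M_def)
  have "vge (M * (real p - 1) / real p * mu \<kappa>) (\<phi> \<kappa>)"
    by (rule iwasawa_bound[OF \<phi> M _ K]) (simp only: nodes vge_0)
  moreover have "M * (real p - 1) / real p * mu \<kappa> = real n"
    using p_gt_1 mu_pos[OF K] by (simp add: M_def field_simps)
  ultimately show "vge (real n) (\<phi> \<kappa>)" by simp
qed

end

section \<open>The \<open>p\<close>-adic zeta function\<close>

lemma frac_of_int_divide:
  assumes "m > 0"
  shows "frac (of_int x / of_nat m :: rat) = of_int (x mod int m) / of_nat m"
proof -
  have "\<lfloor>of_int x / of_int (int m) :: rat\<rfloor> = x div int m" by (rule floor_divide_of_int_eq)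
  moreover have "(of_int x :: rat) = of_int (x div int m) * of_nat m + of_int (x mod int m)"
    using div_mult_mod_eq[of x "int m"] by (metis of_int_add of_int_mult of_int_of_nat_eq)
  ultimately show ?thesis using assms by (simp add: frac_def field_simps)
qed

lemma binomial_second_order: "\<exists>r :: nat. (a + x) ^ k = a ^ k + k * a ^ (k - 1) * x + x\<^sup>2 * r"
proof (induction k)
  case (Suc k)
  then obtain r where r: "(a + x) ^ k = a ^ k + k * a ^ (k - 1) * x + x\<^sup>2 * r" by blast
  have "(a + x) ^ Suc k = (a + x) * (a ^ k + k * a ^ (k - 1) * x + x\<^sup>2 * r)" by (simp add: r)
  also have "\<dots> = a * a ^ k + (k * (a * a ^ (k - 1)) + a ^ k) * x + x\<^sup>2 * (k * a ^ (k - 1) + a * r + x * r)"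
    by (simp add: algebra_simps power2_eq_square)
  also have "k * (a * a ^ (k - 1)) = k * a ^ k" by (cases k) auto
  finally have "(a + x) ^ Suc k = a ^ Suc k + Suc k * a ^ (Suc k - 1) * x + x\<^sup>2 * (k * a ^ (k - 1) + a * r + x * r)"
    by (simp add: algebra_simps)
  then show ?case by blast
qed auto

text \<open>The coefficient of X^k in (exp(M X) - 1) / (exp X - 1), computed as a geometric sum and
  as X / (exp X - 1) times (exp(M X) - 1) / X.\<close>

lemma faulhaber:
  "(\<Sum>a<M. of_nat a ^ k :: 'b :: field_char_0) =
     (\<Sum>j\<le>k. of_nat (k choose j) * bernoulli_number j * of_nat M ^ (k + 1 - j) / of_nat (k + 1 - j))"
proof -
  define \<beta> :: "'b fps" where "\<beta> = Abs_fps (\<lambda>n. 1 / fact (Suc n))"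
  define \<gamma> :: "'b fps" where "\<gamma> = Abs_fps (\<lambda>n. of_nat M ^ Suc n / fact (Suc n))"
  have b0: "fps_nth \<beta> 0 \<noteq> 0" by (simp add: \<beta>_def)
  have b: "fps_X * \<beta> = fps_exp 1 - 1"
    by (rule fps_ext) (simp add: \<beta>_def fps_X_mult_nth del: fact_Suc)
  have g: "fps_X * \<gamma> = fps_exp (of_nat M) - 1"
    by (rule fps_ext) (simp add: \<gamma>_def fps_X_mult_nth del: fact_Suc power_Suc)
  have "(fps_exp 1 - 1) * (\<Sum>a<M. fps_exp (of_nat a)) = fps_exp (of_nat M) - (1 :: 'b fps)"
  proof (induction M)
    case (Suc M)
    have "fps_exp (of_nat (Suc M)) = fps_exp 1 * fps_exp (of_nat M :: 'b)"
      by (simp add: fps_exp_add_mult [symmetric])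
    then show ?case using Suc by (simp add: algebra_simps)
  qed auto
  then have "fps_X * (\<beta> * (\<Sum>a<M. fps_exp (of_nat a))) = fps_X * \<gamma>"
    unfolding g b[symmetric] by (simp add: mult.assoc)
  then have "\<beta> * (\<Sum>a<M. fps_exp (of_nat a)) = \<gamma>"
    by (simp only: mult_cancel_left) simp
  then have "(\<Sum>a<M. fps_exp (of_nat a)) = inverse \<beta> * \<gamma>"
    using inverse_mult_eq_1[OF b0] by (metis mult.assoc mult_1)
  then have "fps_nth (\<Sum>a<M. fps_exp (of_nat a)) k = fps_nth (inverse \<beta> * \<gamma>) k" by simp
  then have "(\<Sum>a<M. of_nat a ^ k / fact k) = (\<Sum>j=0..k. fps_nth (inverse \<beta>) j * fps_nth \<gamma> (k - j))"
    by (simp add: fps_sum_nth fps_mult_nth)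
  then have "(\<Sum>a<M. of_nat a ^ k) = fact k * (\<Sum>j=0..k. fps_nth (inverse \<beta>) j * fps_nth \<gamma> (k - j))"
    by (simp add: sum_divide_distrib [symmetric] field_simps)
  also have "\<dots> = (\<Sum>j\<le>k. of_nat (k choose j) * bernoulli_number j * of_nat M ^ (k + 1 - j) / of_nat (k + 1 - j))"
    unfolding sum_distrib_left atLeast0AtMost
  proof (rule sum.cong [OF refl])
    fix j assume "j \<in> {..k}"
    then have j: "j \<le> k" by simp
    then have e: "Suc k - j = Suc (k - j)" by simp
    have "(fact k :: 'b) = of_nat (k choose j) * fact j * fact (k - j)"
      using binomial_fact[OF j, where 'a = 'b] by simp
    moreover have "(bernoulli_number j :: 'b) = fact j * fps_nth (inverse \<beta>) j"
      by (simp add: bernoulli_number_def \<beta>_def)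
    moreover have "fps_nth \<gamma> (k - j) = of_nat M ^ Suc (k - j) / (of_nat (Suc (k - j)) * fact (k - j))"
      by (simp add: \<gamma>_def)
    ultimately show "fact k * (fps_nth (inverse \<beta>) j * fps_nth \<gamma> (k - j)) =
        of_nat (k choose j) * bernoulli_number j * of_nat M ^ (k + 1 - j) / of_nat (k + 1 - j)"
      by (simp add: e del: of_nat_Suc power_Suc)
  qed
  finally show ?thesis .
qed

section \<open>The Bernoulli measure, its Riemann sums and their values at the classical
  weights\<close>

context Cp5
begin

lemma v_2 [simp]: "v 2 = 0"
proof -
  have "\<not> p dvd 2" using p_ge_5 by (auto dest: dvd_imp_le)
  then show ?thesis using v_of_nat_unit[of 2] by simp
qed

definition inv_mod :: "nat \<Rightarrow> nat \<Rightarrow> nat \<Rightarrow> nat" where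
  "inv_mod c n a = nat ((modular_inverse (int (p ^ n)) (int c) * int a) mod int (p ^ n))"

lemma inv_mod_less: "inv_mod c n a < p ^ n"
  using p_gt_0 by (simp add: inv_mod_def nat_less_iff)

lemma inv_mod_cong:
  assumes "coprime c p"
  shows "[c * inv_mod c n a = a] (mod p ^ n)"
proof -
  have cop: "coprime (int c) (int (p ^ n))" using assms by simp
  have "int (inv_mod c n a) = (modular_inverse (int (p ^ n)) (int c) * int a) mod int (p ^ n)"
    using p_gt_0 by (simp add: inv_mod_def)
  then have "[int c * int (inv_mod c n a) = int c * (modular_inverse (int (p ^ n)) (int c) * int a)] (mod int (p ^ n))"
    by (simp add: cong_def mod_mult_right_eq)
  also have "int c * (modular_inverse (int (p ^ n)) (int c) * int a) = int c * modular_inverse (int (p ^ n)) (int c) * int a"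
    by simp
  also have "[\<dots> = 1 * int a] (mod int (p ^ n))"
    by (intro cong_mult cong_refl cong_modular_inverse1 cop)
  finally have "[int (c * inv_mod c n a) = int a] (mod int (p ^ n))" by simp
  then show ?thesis by (simp only: cong_int_iff)
qed

lemma inv_mod_mult:
  assumes "coprime c p" "a < p ^ n"
  shows "(c * inv_mod c n a) mod p ^ n = a"
  using inv_mod_cong[OF assms(1), of n a] assms(2) by (simp add: cong_def)

lemma inv_mod_unique:
  assumes "coprime c p" "y < p ^ n"
  shows "inv_mod c n ((c * y) mod p ^ n) = y"
proof -
  have "[c * inv_mod c n ((c * y) mod p ^ n) = (c * y) mod p ^ n] (mod p ^ n)"
    by (rule inv_mod_cong[OF assms(1)])
  then have "[c * inv_mod c n ((c * y) mod p ^ n) = c * y] (mod p ^ n)"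
    by (simp add: cong_def)
  then have "[inv_mod c n ((c * y) mod p ^ n) = y] (mod p ^ n)"
    using assms(1) by (simp add: cong_mult_lcancel_nat)
  then show ?thesis using inv_mod_less assms(2) cong_less_modulus_unique_nat by blast
qed

lemma sum_inv_mod:
  assumes "coprime c p"
  shows "(\<Sum>a<p ^ n. G a (inv_mod c n a)) = (\<Sum>y<p ^ n. G ((c * y) mod p ^ n) y)"
proof (rule sum.reindex_bij_witness[of _ "\<lambda>y. (c * y) mod p ^ n" "inv_mod c n"])
  fix a assume "a \<in> {..<p ^ n}"
  then have a: "(c * inv_mod c n a) mod p ^ n = a" using inv_mod_mult[OF assms] by simp
  show "(c * inv_mod c n a) mod p ^ n = a" by (rule a)
  show "inv_mod c n a \<in> {..<p ^ n}" by (simp only: inv_mod_less lessThan_iff)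
  show "G ((c * inv_mod c n a) mod p ^ n) (inv_mod c n a) = G a (inv_mod c n a)" by (simp only: a)
next
  fix y assume "y \<in> {..<p ^ n}"
  then show "inv_mod c n ((c * y) mod p ^ n) = y" using inv_mod_unique[OF assms] by simp
  show "(c * y) mod p ^ n \<in> {..<p ^ n}" using p_gt_0 by simp
qed

lemma of_rat_bernoulli_measure:
  assumes "a < p ^ n"
  shows "of_rat (bernoulli_measure p c n a) =
    (of_nat a / of_nat (p ^ n) - 1 / 2) - of_nat c * (of_nat (inv_mod c n a) / of_nat (p ^ n) - (1 / 2 :: 'a))"
proof -
  have m: "p ^ n > 0" using p_gt_0 by simp
  have 1: "frac (of_nat a / of_nat (p ^ n) :: rat) = of_nat a / of_nat (p ^ n)"
    using frac_of_int_divide[OF m, of "int a"] assms by (simp del: of_nat_power)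
  have "(modular_inverse (int (p ^ n)) (int c) * int a) mod int (p ^ n) = int (inv_mod c n a)"
    using p_gt_0 by (simp add: inv_mod_def)
  then have 2: "frac (of_int (modular_inverse (int (p ^ n)) (int c) * int a) / of_nat (p ^ n) :: rat) =
      of_nat (inv_mod c n a) / of_nat (p ^ n)"
    using frac_of_int_divide[OF m, of "modular_inverse (int (p ^ n)) (int c) * int a"]
    by (simp del: of_nat_power of_int_mult)
  show ?thesis
    unfolding bernoulli_measure_def 1 2
    by (simp add: of_rat_diff of_rat_mult of_rat_divide del: of_nat_power)
qed

text \<open>Multiplying the inverse residue by c returns a plus a carry times p^n; the fractional
  parts cancel and only the carry remains. This is why the measure is p-integral although B_1(a /
  p^n) is not.\<close>

lemma bernoulli_measure_carry:
  assumes c: "coprime c p" and a: "a < p ^ n"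
  shows "of_rat (bernoulli_measure p c n a) =
    (of_nat c - 1) / 2 - (of_nat (c * inv_mod c n a div p ^ n) :: 'a)"
proof -
  define y where "y = inv_mod c n a"
  have m: "(of_nat (p ^ n) :: 'a) \<noteq> 0" using p_gt_0 by simp
  have "c * y = p ^ n * (c * y div p ^ n) + a"
    using inv_mod_mult[OF c a] by (metis mult_div_mod_eq y_def)
  then have "of_nat c * of_nat y = of_nat (p ^ n) * of_nat (c * y div p ^ n) + (of_nat a :: 'a)"
    by (metis of_nat_add of_nat_mult)
  then have "of_nat a / of_nat (p ^ n) - of_nat c * (of_nat y / of_nat (p ^ n)) = - (of_nat (c * y div p ^ n) :: 'a)"
    using m by (simp add: diff_divide_eq_iff divide_eq_eq flip: diff_divide_distrib del: of_nat_power of_nat_mult)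
  then show ?thesis
    unfolding of_rat_bernoulli_measure[OF a] y_def[symmetric]
    by (simp add: right_diff_distrib diff_divide_distrib del: of_nat_power of_nat_mult)
qed

lemma vge_bernoulli_measure:
  assumes "coprime c p" "a < p ^ n"
  shows "vge 0 (of_rat (bernoulli_measure p c n a))"
  unfolding bernoulli_measure_carry[OF assms]
  by (intro vge_diff vge_of_nat) (simp add: vge_divide_unit vge_diff)

definition msum :: "nat \<Rightarrow> nat \<Rightarrow> (nat \<Rightarrow> 'a) \<Rightarrow> 'a" where
  "msum c n G = (\<Sum>a<p ^ n. G a * of_rat (bernoulli_measure p c n a))"

lemma msum_eq:
  assumes "coprime c p"
  shows "msum c n G = (\<Sum>a<p ^ n. G a * (of_nat a / of_nat (p ^ n) - 1 / 2)) -
     of_nat c * (\<Sum>y<p ^ n. G ((c * y) mod p ^ n) * (of_nat y / of_nat (p ^ n) - 1 / 2))"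
proof -
  have "msum c n G = (\<Sum>a<p ^ n. G a * (of_nat a / of_nat (p ^ n) - 1 / 2)) -
      of_nat c * (\<Sum>a<p ^ n. G a * (of_nat (inv_mod c n a) / of_nat (p ^ n) - 1 / 2))"
    unfolding msum_def sum_distrib_left sum_subtractf [symmetric]
    by (intro sum.cong refl) (simp add: of_rat_bernoulli_measure right_diff_distrib mult_ac del: of_nat_power)
  then show ?thesis
    using sum_inv_mod[OF assms, of "\<lambda>a y. G a * (of_nat y / of_nat (p ^ n) - 1 / 2)" n] by simp
qed

text \<open>The distribution relation of B_1: the values at (x + s) / p for s < p add up to the
  value at x.\<close>

lemma bernoulli_distribution:
  assumes m: "m > 0"
  shows "(\<Sum>a<p * m. F (a mod m) * (of_nat a / of_nat (p * m) - 1 / 2)) =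
    (\<Sum>a<m. F a * (of_nat a / of_nat m - (1 / 2 :: 'a)))"
proof -
  have "(\<Sum>a<p * m. F (a mod m) * (of_nat a / of_nat (p * m) - 1 / 2)) =
      (\<Sum>s<p. \<Sum>a\<in>{s * m..<s * m + m}. F (a mod m) * (of_nat a / of_nat (p * m) - 1 / 2))"
    by (rule sum.nat_group [symmetric])
  also have "\<dots> = (\<Sum>s<p. \<Sum>a<m. F a * (of_nat (a + s * m) / of_nat (p * m) - 1 / 2))"
  proof (rule sum.cong [OF refl])
    fix s
    show "(\<Sum>a\<in>{s * m..<s * m + m}. F (a mod m) * (of_nat a / of_nat (p * m) - 1 / 2)) =
        (\<Sum>a<m. F a * (of_nat (a + s * m) / of_nat (p * m) - 1 / 2))"
    proof (rule sum.reindex_bij_witness[of _ "\<lambda>a. a + s * m" "\<lambda>a. a - s * m"])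
      fix a assume a: "a \<in> {s * m..<s * m + m}"
      have "a mod m = ((a - s * m) + s * m) mod m" using a by simp
      also have "\<dots> = (a - s * m) mod m" by (rule mod_mult_self1)
      also have "\<dots> = a - s * m" using a by (intro mod_less) auto
      finally have "a mod m = a - s * m" .
      then show "F (a - s * m) * (of_nat (a - s * m + s * m) / of_nat (p * m) - 1 / 2) = F (a mod m) * (of_nat a / of_nat (p * m) - 1 / 2)"
        using a by simp
    qed auto
  qed
  also have "\<dots> = (\<Sum>a<m. F a * (\<Sum>s<p. of_nat (a + s * m) / of_nat (p * m) - 1 / 2))"
    unfolding sum_distrib_left by (rule sum.swap)
  also have "\<dots> = (\<Sum>a<m. F a * (of_nat a / of_nat m - 1 / 2))"
  proof (rule sum.cong [OF refl])
    fix a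
    have pm: "(of_nat p :: 'a) \<noteq> 0" "(of_nat m :: 'a) \<noteq> 0" using p_gt_0 m by auto
    have g: "(\<Sum>s<k. of_nat s :: 'a) = of_nat k * (of_nat k - 1) / 2" for k
      by (induction k) (auto simp: field_simps)
    have "(\<Sum>s<p. of_nat (a + s * m) / of_nat (p * m) - 1 / 2 :: 'a) =
        of_nat p * (of_nat a / of_nat (p * m)) + (\<Sum>s<p. of_nat s) / of_nat p - of_nat p / 2"
      using pm by (simp add: sum_subtractf sum.distrib add_divide_distrib sum_divide_distrib)
    also have "\<dots> = of_nat a / of_nat m - 1 / 2"
      unfolding g using pm by (simp add: field_simps)
    finally show "F a * (\<Sum>s<p. of_nat (a + s * m) / of_nat (p * m) - 1 / 2) = F a * (of_nat a / of_nat m - 1 / 2)"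
      by simp
  qed
  finally show ?thesis .
qed

lemma msum_Suc:
  assumes c: "coprime c p"
  shows "msum c (Suc n) (\<lambda>a. G (a mod p ^ n)) = msum c n G"
proof -
  have m: "p ^ n > 0" using p_gt_0 by simp
  have "(\<lambda>y. G ((c * y) mod p ^ Suc n mod p ^ n)) = (\<lambda>y. G ((c * (y mod p ^ n)) mod p ^ n))"
    by (rule ext) (simp add: mod_mod_cancel mod_mult_right_eq)
  then show ?thesis
    unfolding msum_eq[OF c] power_Suc
    using bernoulli_distribution[OF m, of G] bernoulli_distribution[OF m, of "\<lambda>y. G ((c * y) mod p ^ n)"]
    by (simp add: fun_eq_iff)
qed

definition zeta_term :: "('a \<Rightarrow> 'a) \<Rightarrow> nat \<Rightarrow> 'a" where
  "zeta_term \<kappa> a = (if p dvd a then 0 else \<kappa> (of_nat a) / of_nat a)"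

lemma zeta_integral_alt: "zeta_integral p c \<kappa> = lim (\<lambda>n. msum c n (zeta_term \<kappa>))"
proof -
  have "(\<Sum>a | a < p ^ n \<and> \<not> p dvd a. \<kappa> (of_nat a) / of_nat a * of_rat (bernoulli_measure p c n a)) =
      msum c n (zeta_term \<kappa>)" for n
    unfolding msum_def zeta_term_def
    by (rule sum.mono_neutral_cong_left) auto
  then show ?thesis by (simp add: zeta_integral_def)
qed

lemma vge_zeta_term: "\<kappa> \<in> weights_B p v \<Longrightarrow> vge 0 (zeta_term \<kappa> a)"
  using v_kappa_unit[of \<kappa> "of_nat a"] of_nat_Zp_units[of a] v_of_nat_unit[of a]
  by (auto simp: zeta_term_def vge_divide_unit) (simp add: vge_def zero_ereal_def)

lemma vge_msum:
  assumes "coprime c p" "\<And>a. a < p ^ n \<Longrightarrow> vge M (G a)"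
  shows "vge M (msum c n G)"
  unfolding msum_def using assms vge_bernoulli_measure by (intro vge_sum vge_mult0(1)) auto

lemma vge_zeta_term_diff:
  assumes K: "\<kappa> \<in> weights_B p v"
  shows "vge (mu \<kappa> * real n) (zeta_term \<kappa> a - zeta_term \<kappa> (a mod p ^ n))"
proof (cases "n = 0")
  case True
  then show ?thesis using vge_zeta_term[OF K] by (auto intro: vge_diff)
next
  case False
  define b where "b = a mod p ^ n"
  have pdvd: "p dvd b \<longleftrightarrow> p dvd a"
    using False by (simp add: b_def dvd_mod_iff)
  show ?thesis
  proof (cases "p dvd a")
    case True
    then show ?thesis using pdvd by (simp add: zeta_term_def b_def)
  next
    case na: False
    then have nb: "\<not> p dvd b" using pdvd by simp
    have va: "v (of_nat a) = 0" "v (of_nat b) = 0" using na nb v_of_nat_unit by auto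
    have "[int a = int b] (mod int p ^ n)"
      by (simp add: b_def cong_def zmod_int)
    then have ab: "vge (real n) (of_nat a - of_nat b)" using vge_of_int_cong by fastforce
    have k: "vge (real n * mu \<kappa>) (\<kappa> (of_nat a) - \<kappa> (of_nat b))"
      by (rule kappa_close[OF K of_nat_Zp_units[OF na] of_nat_Zp_units[OF nb] ab])
    have kb: "vge 0 (\<kappa> (of_nat b))"
      using v_kappa_unit[OF K of_nat_Zp_units[OF nb]] by (simp add: vge_def zero_ereal_def)
    have nz: "(of_nat a :: 'a) \<noteq> 0" "(of_nat b :: 'a) \<noteq> 0" using na nb by (metis dvd_0_right of_nat_eq_0_iff)+
    have eq: "zeta_term \<kappa> a - zeta_term \<kappa> b =
        (\<kappa> (of_nat a) - \<kappa> (of_nat b)) / of_nat a - \<kappa> (of_nat b) * ((of_nat a - of_nat b) / of_nat a / of_nat b)"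
      using na nb nz by (simp add: zeta_term_def field_simps)
    have "vge (mu \<kappa> * real n) (of_nat a - of_nat b)"
      using ab by (rule vge_mono) (use mu_le_1[OF K] in \<open>simp add: mult_left_le_one_le mu_pos[OF K] less_imp_le\<close>)
    then have 1: "vge (mu \<kappa> * real n) ((of_nat a - of_nat b) / of_nat a / of_nat b)"
      by (simp only: vge_divide_unit[OF va(1)] vge_divide_unit[OF va(2)])
    have "vge (mu \<kappa> * real n) ((\<kappa> (of_nat a) - \<kappa> (of_nat b)) / of_nat a)"
      using k by (simp only: vge_divide_unit[OF va(1)] mult.commute)
    from vge_diff[OF this vge_mult0(2)[OF kb 1]] show ?thesis
      unfolding b_def[symmetric] eq .
  qed
qed

text \<open>The measure is additive and integral, so refining the level changes a Riemann sum only
  by the oscillation of the integrand on residue classes mod p^n.\<close>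

lemma zeta_integral_limit:
  assumes c: "coprime c p" and K: "\<kappa> \<in> weights_B p v"
  shows "vge (mu \<kappa> * real n) (zeta_integral p c \<kappa> - msum c n (zeta_term \<kappa>))"
proof -
  have "vge (mu \<kappa> * real n) (msum c (Suc n) (zeta_term \<kappa>) - msum c n (zeta_term \<kappa>))" for n
  proof -
    have "msum c (Suc n) (zeta_term \<kappa>) - msum c n (zeta_term \<kappa>) =
        msum c (Suc n) (\<lambda>a. zeta_term \<kappa> a - zeta_term \<kappa> (a mod p ^ n))"
      unfolding msum_Suc[OF c, of n "zeta_term \<kappa>", symmetric]
      by (simp only: msum_def left_diff_distrib sum_subtractf)
    then show ?thesis using vge_zeta_term_diff[OF K] by (simp add: vge_msum[OF c])
  qed
  then obtain L where L: "(\<lambda>n. msum c n (zeta_term \<kappa>)) \<longlonglongrightarrow> L" "\<And>n. vge (mu \<kappa> * real n) (L - msum c n (zeta_term \<kappa>))"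
    using convergent_of_steps[OF mu_pos[OF K], of "\<lambda>n. msum c n (zeta_term \<kappa>)"] by blast
  then show ?thesis using limI[OF L(1)] by (simp add: zeta_integral_alt)
qed

lemma iwasawa_zeta_integral:
  assumes c: "coprime c p"
  shows "iwasawa (zeta_integral p c)"
proof (rule iwasawa_approx)
  fix N :: nat
  have "iwasawa (\<lambda>\<kappa>. zeta_term \<kappa> a)" for a
  proof (cases "p dvd a")
    case False
    have "vge 0 (inverse (of_nat a))"
      using v_unit_inverse[OF v_of_nat_unit[OF False]] by (simp add: vge_def zero_ereal_def)
    then show ?thesis
      using iwasawa_mult[OF iwasawa_kappa[OF False] iwasawa_const] False
      by (simp add: zeta_term_def divide_inverse)
  qed (simp add: zeta_term_def iwasawa_const)
  then have "iwasawa (\<lambda>\<kappa>. msum c N (zeta_term \<kappa>))"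
    unfolding msum_def using vge_bernoulli_measure[OF c]
    by (intro iwasawa_sum iwasawa_mult iwasawa_const) auto
  then show "\<exists>\<psi>. iwasawa \<psi> \<and> (\<forall>\<kappa>\<in>weights_B p v. vge (real N * mu \<kappa>) (zeta_integral p c \<kappa> - \<psi> \<kappa>))"
    using zeta_integral_limit[OF c, of _ N] by (auto simp: mult.commute)
qed

lemma vge_kappa_minus_1:
  assumes K: "\<kappa> \<in> weights_B p v" and d: "\<not> p dvd d"
  shows "vge (mu \<kappa>) (\<kappa> (of_nat d) - 1)"
proof -
  obtain e where e: "vge (real 1 * mu \<kappa>) (\<kappa> (of_nat d) - (1 + weight_w p \<kappa>) ^ e)"
    using kappa_approx_power[OF d, of 1] K by blast
  have "vge (mu \<kappa>) ((1 + weight_w p \<kappa>) ^ e - 1)"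
    using vge_w[OF K] mu_pos[OF K] by (intro vge_power_minus_1) auto
  then show ?thesis using e vge_trans by fastforce
qed

lemma coprime_Suc_p: "coprime (1 + p) p"
  using coprime_Suc_left_nat[of p] by simp

text \<open>The choice c = 1 + p makes level 1 explicit: c acts trivially mod p, the carry of a is
  a, and the measure is p/2 - a. Hence each of the p - 1 terms with a \<noteq> 0 is close to -1, and
  the sum is close to 1 - p.\<close>

lemma zeta_integral_unit:
  assumes K: "\<kappa> \<in> weights_B p v"
  shows "vge (mu \<kappa>) (zeta_integral p (1 + p) \<kappa> - 1)"
proof -
  define S where "S = msum (1 + p) 1 (zeta_term \<kappa>)"
  have 1: "vge (mu \<kappa>) (zeta_integral p (1 + p) \<kappa> - S)"
    using zeta_integral_limit[OF coprime_Suc_p K, of 1] by (simp add: S_def)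
  have iv: "inv_mod (1 + p) 1 a = a" if "a < p" for a
  proof -
    have "((1 + p) * a) mod p ^ 1 = a" using that by simp
    then show ?thesis using inv_mod_unique[OF coprime_Suc_p, of a 1] that by simp
  qed
  have m: "of_rat (bernoulli_measure p (1 + p) 1 a) = of_nat p / 2 - (of_nat a :: 'a)" if "a < p" for a
  proof -
    have "(1 + p) * a div p = a" using that p_gt_0 by simp
    then show ?thesis
      using bernoulli_measure_carry[OF coprime_Suc_p, of a 1] iv[OF that] that by simp
  qed
  have trm: "vge (mu \<kappa>) (zeta_term \<kappa> a * of_rat (bernoulli_measure p (1 + p) 1 a) - (if a = 0 then 0 else - 1))"
    if a: "a < p" for a
  proof (cases "a = 0")
    case False
    then have na: "\<not> p dvd a" using a by (auto dest: dvd_imp_le)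
    then have va: "v (of_nat a) = 0" by (rule v_of_nat_unit)
    have nz: "(of_nat a :: 'a) \<noteq> 0" using False by simp
    have "zeta_term \<kappa> a * of_rat (bernoulli_measure p (1 + p) 1 a) - (- 1) =
        of_nat p * (zeta_term \<kappa> a / 2) - (\<kappa> (of_nat a) - 1)"
      unfolding m[OF a] using na nz by (simp add: zeta_term_def field_simps)
    moreover have "vge 1 (of_nat p * (zeta_term \<kappa> a / 2))"
      using vge_p_power[of 1] vge_zeta_term[OF K] by (intro vge_mult0(1)) (simp_all add: vge_divide_unit)
    then have "vge (mu \<kappa>) (of_nat p * (zeta_term \<kappa> a / 2))" using mu_le_1[OF K] vge_mono by blast
    ultimately show ?thesis
      using vge_kappa_minus_1[OF K na] False by (simp only: if_False) (rule vge_diff)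
  qed (simp add: zeta_term_def)
  have "S - (\<Sum>a<p. if a = 0 then 0 else - 1) =
      (\<Sum>a<p. zeta_term \<kappa> a * of_rat (bernoulli_measure p (1 + p) 1 a) - (if a = 0 then 0 else - 1))"
    by (simp add: S_def msum_def sum_subtractf)
  also have "vge (mu \<kappa>) \<dots>" using trm by (intro vge_sum) auto
  finally have "vge (mu \<kappa>) (S - (\<Sum>a<p. if a = 0 then 0 else - 1))" .
  moreover have "(\<Sum>a<p. if a = 0 then 0 else - 1 :: 'a) = 1 - of_nat p"
  proof -
    have "(\<Sum>a<p. if a = 0 then 0 else - 1 :: 'a) = (\<Sum>a\<in>{1..<p}. - 1)"
      by (rule sum.mono_neutral_cong_right) auto
    then show ?thesis using p_gt_0 by (simp add: of_nat_diff)
  qed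
  ultimately have "vge (mu \<kappa>) (S - 1 + of_nat p)" by (simp add: algebra_simps)
  moreover have "vge (mu \<kappa>) (of_nat p)"
    using vge_p_power[of 1] mu_le_1[OF K] vge_mono by fastforce
  ultimately have "vge (mu \<kappa>) (S - 1)" using vge_diff by fastforce
  then show ?thesis using 1 vge_trans by blast
qed

text \<open>In Faulhaber's formula, divided by p^n, every term except the Bernoulli number keeps a
  factor p^n, up to a denominator that does not depend on n.\<close>

lemma power_sum_padic: "\<exists>C. \<forall>n. vge (real n - C) ((\<Sum>a<p ^ n. of_nat a ^ k) / of_nat p ^ n - bernoulli_number k)"
proof -
  define x :: "nat \<Rightarrow> 'a" where "x = (\<lambda>j. of_nat (k choose j) * bernoulli_number j / of_nat (k + 1 - j))"
  have "\<forall>j. \<exists>D :: nat. vge (- real D) (x j)" using ex_vge_lower by blast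
  then have "\<exists>D. \<forall>j. vge (- real (D j :: nat)) (x j)" by (rule choice)
  then obtain D :: "nat \<Rightarrow> nat" where D: "\<And>j. vge (- real (D j)) (x j)" by blast
  define C where "C = (\<Sum>j\<le>k. D j)"
  have "vge (real n - real C) ((\<Sum>a<p ^ n. of_nat a ^ k) / of_nat p ^ n - bernoulli_number k)" for n
  proof -
    define M :: 'a where "M = of_nat p ^ n"
    have M: "M \<noteq> 0" using p_gt_0 by (simp add: M_def)
    have "(\<Sum>a<p ^ n. of_nat a ^ k) = (\<Sum>j\<le>k. x j * M ^ (k + 1 - j))"
      unfolding faulhaber by (simp add: x_def M_def)
    also have "\<dots> = (\<Sum>j<k. x j * M ^ (k + 1 - j)) + x k * M"
      by (simp add: lessThan_Suc_atMost [symmetric])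
    also have "(\<Sum>j<k. x j * M ^ (k + 1 - j)) = M * (\<Sum>j<k. x j * M ^ (k - j))"
      unfolding sum_distrib_left by (intro sum.cong refl) (simp add: Suc_diff_le mult_ac)
    finally have "(\<Sum>a<p ^ n. of_nat a ^ k) / M - bernoulli_number k = (\<Sum>j<k. x j * M ^ (k - j))"
      using M by (simp add: x_def add_divide_distrib)
    moreover have "vge (real n - real C) (\<Sum>j<k. x j * M ^ (k - j))"
    proof (rule vge_sum)
      fix j assume j: "j \<in> {..<k}"
      have Mn: "vge (real n) M" unfolding M_def by (rule vge_p_power)
      have "vge (real n) (M * M ^ (k - j - 1))"
        using Mn by (intro vge_mult0(1) vge_0_power vge_mono[OF Mn]) auto
      moreover have "M ^ (k - j) = M * M ^ (k - j - 1)" using j by (cases "k - j") auto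
      ultimately have "vge (- real (D j) + real n) (x j * M ^ (k - j))" using vge_mult[OF D] by simp
      moreover have "D j \<le> C" unfolding C_def using j by (intro member_le_sum) auto
      ultimately show "vge (real n - real C) (x j * M ^ (k - j))" using vge_mono by fastforce
    qed
    ultimately show ?thesis by (simp add: M_def)
  qed
  then show ?thesis by blast
qed

definition psum :: "nat \<Rightarrow> nat \<Rightarrow> 'a" where
  "psum k n = (\<Sum>a<p ^ n. if p dvd a then 0 else of_nat a ^ k)"

lemma psum_padic:
  assumes k: "k \<ge> 1"
  shows "\<exists>C. \<forall>n\<ge>1. vge (real n - C) (psum k n / of_nat p ^ n - (1 - of_nat p ^ (k - 1)) * bernoulli_number k)"
proof -
  obtain C where C: "\<And>n. vge (real n - C) ((\<Sum>a<p ^ n. of_nat a ^ k) / of_nat p ^ n - bernoulli_number k)"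
    using power_sum_padic by blast
  define T where "T = (\<lambda>n. (\<Sum>a<p ^ n. of_nat a ^ k :: 'a))"
  have "vge (real n - (C + 1)) (psum k n / of_nat p ^ n - (1 - of_nat p ^ (k - 1)) * bernoulli_number k)" if n: "n \<ge> 1" for n
  proof -
    obtain m where m: "n = Suc m" using n by (cases n) auto
    have "psum k n = T n - (\<Sum>a<p ^ n. if p dvd a then of_nat a ^ k else 0)"
      unfolding psum_def T_def sum_subtractf [symmetric] by (intro sum.cong) auto
    also have "(\<Sum>a<p ^ n. if p dvd a then of_nat a ^ k else 0 :: 'a) = (\<Sum>a\<in>(\<lambda>b. p * b) ` {..<p ^ m}. of_nat a ^ k)"
      using p_gt_0 by (intro sum.mono_neutral_cong_right) (auto simp: m)
    also have "\<dots> = of_nat p ^ k * T m"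
      using p_gt_0 by (subst sum.reindex) (auto simp: inj_on_def T_def sum_distrib_left power_mult_distrib)
    finally have ps: "psum k n = T n - of_nat p ^ k * T m" .
    have pn: "(of_nat p :: 'a) \<noteq> 0" using p_gt_0 by simp
    have pk: "(of_nat p ^ k :: 'a) = of_nat p * of_nat p ^ (k - 1)" using k by (simp add: power_eq_if)
    have e: "of_nat p ^ k * T m / of_nat p ^ n = of_nat p ^ (k - 1) * (T m / of_nat p ^ m)"
      unfolding pk m using pn by simp
    have "psum k n / of_nat p ^ n - (1 - of_nat p ^ (k - 1)) * bernoulli_number k =
        (T n / of_nat p ^ n - bernoulli_number k) - of_nat p ^ (k - 1) * (T m / of_nat p ^ m - bernoulli_number k)"
      unfolding ps diff_divide_distrib e by (simp add: algebra_simps)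
    moreover have "vge (real n - (C + 1)) (T n / of_nat p ^ n - bernoulli_number k)"
      using C[of n] vge_mono by (fastforce simp: T_def)
    moreover have "vge (real n - (C + 1)) (of_nat p ^ (k - 1) * (T m / of_nat p ^ m - bernoulli_number k))"
      using C[of m] m by (intro vge_mult0(2) vge_0_power vge_of_nat) (simp add: T_def)
    ultimately show ?thesis using vge_diff by simp
  qed
  then show ?thesis by blast
qed

text \<open>Let y be the inverse residue and c y = a + p^n t. As y runs through the same units as a,
  the sum of (c y)^k is c^k times the power sum, and expanding (a + p^n t)^k modulo p^(2 n) leaves
  the term linear in t.\<close>

lemma psum_scale:
  assumes c: "coprime c p" and n: "n \<ge> 1"
  shows "vge (2 * real n) (of_nat c ^ k * psum k n - psum k n
     - of_nat k * of_nat p ^ n * (\<Sum>a<p ^ n. if p dvd a then 0 else of_nat a ^ (k - 1) * of_nat (c * inv_mod c n a div p ^ n)))"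
proof -
  define t where "t = (\<lambda>a. c * inv_mod c n a div p ^ n)"
  have dv: "p dvd (c * y) mod p ^ n \<longleftrightarrow> p dvd y" for y
    using n c prime_p by (simp add: dvd_mod_iff prime_dvd_mult_iff) (metis coprime_absorb_left coprime_commute not_prime_unit)
  have "(\<Sum>a<p ^ n. if p dvd a then 0 else of_nat (inv_mod c n a) ^ k :: 'a) = psum k n"
    using sum_inv_mod[OF c, of "\<lambda>a y. if p dvd a then 0 else of_nat y ^ k :: 'a" n] by (simp add: dv psum_def)
  then have "of_nat c ^ k * psum k n = of_nat c ^ k * (\<Sum>a<p ^ n. if p dvd a then 0 else of_nat (inv_mod c n a) ^ k)"
    by simp
  also have "\<dots> = (\<Sum>a<p ^ n. if p dvd a then 0 else of_nat (c * inv_mod c n a) ^ k)"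
    unfolding sum_distrib_left by (intro sum.cong refl) (auto simp: power_mult_distrib)
  finally have cs: "of_nat c ^ k * psum k n = (\<Sum>a<p ^ n. if p dvd a then 0 else of_nat (c * inv_mod c n a) ^ k)" .
  have "of_nat c ^ k * psum k n - psum k n
     - of_nat k * of_nat p ^ n * (\<Sum>a<p ^ n. if p dvd a then 0 else of_nat a ^ (k - 1) * of_nat (t a)) =
     (\<Sum>a<p ^ n. if p dvd a then 0 else of_nat (c * inv_mod c n a) ^ k - of_nat a ^ k - of_nat k * of_nat p ^ n * (of_nat a ^ (k - 1) * of_nat (t a)))"
    unfolding cs unfolding psum_def sum_distrib_left sum_subtractf [symmetric]
    by (intro sum.cong refl) auto
  also have "vge (2 * real n) \<dots>"
  proof (rule vge_sum)
    fix a assume a: "a \<in> {..<p ^ n}"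
    have cy: "c * inv_mod c n a = a + p ^ n * t a"
      using inv_mod_mult[OF c, of a n] a unfolding t_def by (metis add.commute lessThan_iff mult_div_mod_eq)
    obtain r where r: "(a + p ^ n * t a) ^ k = a ^ k + k * a ^ (k - 1) * (p ^ n * t a) + (p ^ n * t a)\<^sup>2 * r"
      using binomial_second_order by blast
    have "(of_nat (c * inv_mod c n a) ^ k :: 'a) = of_nat (a ^ k + k * a ^ (k - 1) * (p ^ n * t a) + (p ^ n * t a)\<^sup>2 * r)"
      unfolding cy r[symmetric] by simp
    then have eq: "of_nat (c * inv_mod c n a) ^ k - of_nat a ^ k - of_nat k * of_nat p ^ n * (of_nat a ^ (k - 1) * of_nat (t a)) =
        (of_nat p ^ (2 * n) * (of_nat ((t a)\<^sup>2 * r)) :: 'a)"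
      by (simp add: algebra_simps power_mult_distrib flip: power_mult)
    show "vge (2 * real n) (if p dvd a then 0 else of_nat (c * inv_mod c n a) ^ k - of_nat a ^ k - of_nat k * of_nat p ^ n * (of_nat a ^ (k - 1) * of_nat (t a)))"
      unfolding eq using vge_mult0(1)[OF vge_p_power[of "2 * n"] vge_of_nat[of "(t a)\<^sup>2 * r"]] by simp
  qed
  finally show ?thesis unfolding t_def .
qed

text \<open>Dividing \<open>psum_scale\<close> by p^n turns its linear term into the carry part of
  the Riemann sum. The remaining part (c - 1)/2 times the power sum of exponent k - 1 tends to 0,
  because that sum divided by p^n converges.\<close>

lemma zeta_integral_pow_weight:
  assumes c: "coprime c p" and k: "(p - 1) dvd k" "k > 0"
  shows "of_nat k * zeta_integral p c (pow_weight k) =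
    - (of_nat c ^ k - 1) * ((1 - of_nat p ^ (k - 1)) * bernoulli_number k)"
proof -
  define I where "I = zeta_integral p c (pow_weight k)"
  define X :: 'a where "X = (1 - of_nat p ^ (k - 1)) * bernoulli_number k"
  have K: "pow_weight k \<in> weights_B p v" using k by (intro pow_weight_in_B)
  have "p - 1 \<le> k" using k by (intro dvd_imp_le)
  then have k2: "k \<ge> 2" using p_ge_5 by simp
  obtain C where C: "\<And>n. n \<ge> 1 \<Longrightarrow> vge (real n - C) (psum k n / of_nat p ^ n - X)"
    using psum_padic[of k] k2 by (auto simp: X_def)
  have "k - 1 \<ge> 1" using k2 by simp
  from psum_padic[OF this] obtain C' where C': "\<And>n. n \<ge> 1 \<Longrightarrow> vge (real n - C') (psum (k - 1) n / of_nat p ^ n - (1 - of_nat p ^ (k - 1 - 1)) * bernoulli_number (k - 1))"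
    by blast
  obtain D :: nat where D: "vge (- real D) ((1 - of_nat p ^ (k - 1 - 1)) * bernoulli_number (k - 1) :: 'a)"
    using ex_vge_lower by blast
  \<comment> \<open>E collects the denominators that do not depend on n; every error term below has
    valuation at least n - E.\<close>
  define E where "E = max 0 (max C (max C' (real D)))"
  have main: "vge (real n - E) (of_nat k * I + (of_nat c ^ k - 1) * X)" if n: "n \<ge> 1" for n
  proof -
    define W where "W = (\<Sum>a<p ^ n. if p dvd a then 0 else of_nat a ^ (k - 1) * of_nat (c * inv_mod c n a div p ^ n) :: 'a)"
    have pn: "(of_nat p :: 'a) ^ n \<noteq> 0" using p_gt_0 by simp
    have S: "msum c n (zeta_term (pow_weight k)) = (of_nat c - 1) / 2 * psum (k - 1) n - W"
    proof -
      have aux: "x * (d - t) = d * x - x * t" for x d t :: 'a by (simp add: algebra_simps)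
      have "zeta_term (pow_weight k) a = (if p dvd a then 0 else of_nat a ^ (k - 1))" for a
        using k by (auto simp: zeta_term_def pow_weight_nat power_eq_if)
      then have "msum c n (zeta_term (pow_weight k)) =
          (\<Sum>a<p ^ n. (if p dvd a then 0 else of_nat a ^ (k - 1)) * ((of_nat c - 1) / 2 - of_nat (c * inv_mod c n a div p ^ n)))"
        unfolding msum_def by (intro sum.cong refl) (simp add: bernoulli_measure_carry[OF c])
      also have "\<dots> = (of_nat c - 1) / 2 * psum (k - 1) n - W"
        unfolding psum_def W_def sum_distrib_left sum_subtractf [symmetric]
        by (intro sum.cong refl) (simp add: aux)
      finally show ?thesis .
    qed
    have 1: "vge (real n) (I - msum c n (zeta_term (pow_weight k)))"
      using zeta_integral_limit[OF c K, of n] by (simp add: I_def mu_pow_weight)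
    have a: "vge (2 * real n) ((of_nat c ^ k - 1) * psum k n - of_nat k * of_nat p ^ n * W)"
      using psum_scale[OF c n, of k] by (simp add: W_def left_diff_distrib)
    have e: "(of_nat c ^ k - 1) * psum k n - of_nat k * of_nat p ^ n * W =
        of_nat p ^ n * ((of_nat c ^ k - 1) * (psum k n / of_nat p ^ n) - of_nat k * W)"
      using pn by (simp add: right_diff_distrib)
    have 2: "vge (real n) ((of_nat c ^ k - 1) * (psum k n / of_nat p ^ n) - of_nat k * W)"
      using a unfolding e mult_2 vge_mult_p_iff .
    have 3: "vge (real n - E) (psum (k - 1) n)"
    proof -
      have "vge (min (real n - C') (- real D)) (psum (k - 1) n / of_nat p ^ n - (1 - of_nat p ^ (k - 1 - 1)) * bernoulli_number (k - 1) + (1 - of_nat p ^ (k - 1 - 1)) * bernoulli_number (k - 1))"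
        by (intro vge_add vge_mono[OF C'[OF n]] vge_mono[OF D]) auto
      then have "vge (min (real n - C') (- real D)) (psum (k - 1) n / of_nat p ^ n)" by simp
      then have "vge (min (real n - C') (- real D) + real n) (of_nat p ^ n * (psum (k - 1) n / of_nat p ^ n))"
        unfolding vge_mult_p_iff .
      then have "vge (min (real n - C') (- real D) + real n) (psum (k - 1) n)" using p_gt_0 by simp
      then show ?thesis by (rule vge_mono) (auto simp: E_def)
    qed
    have eq: "of_nat k * I + (of_nat c ^ k - 1) * X =
        of_nat k * (I - msum c n (zeta_term (pow_weight k)))
        + ((of_nat c ^ k - 1) * (psum k n / of_nat p ^ n) - of_nat k * W)
        - (of_nat c ^ k - 1) * (psum k n / of_nat p ^ n - X)
        + of_nat k * ((of_nat c - 1) / 2 * psum (k - 1) n)"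
      unfolding S by (simp add: algebra_simps)
    have t1: "vge (real n - E) (of_nat k * (I - msum c n (zeta_term (pow_weight k))))"
      using vge_mono[OF 1, of "real n - E"] by (intro vge_mult0(2)) (auto simp: E_def)
    have t2: "vge (real n - E) ((of_nat c ^ k - 1) * (psum k n / of_nat p ^ n) - of_nat k * W)"
      using 2 by (rule vge_mono) (auto simp: E_def)
    have t3: "vge (real n - E) ((of_nat c ^ k - 1) * (psum k n / of_nat p ^ n - X))"
      by (rule vge_mult0(2)[OF _ vge_mono[OF C[OF n]]]) (auto simp: E_def intro!: vge_diff vge_0_power)
    have t4: "vge (real n - E) (of_nat k * ((of_nat c - 1) / 2 * psum (k - 1) n))"
      using 3 by (intro vge_mult0(2)) (auto simp: vge_divide_unit intro: vge_diff)
    show ?thesis unfolding eq by (rule vge_add[OF vge_diff[OF vge_add[OF t1 t2] t3] t4])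
  qed
  have "of_nat k * I + (of_nat c ^ k - 1) * X = 0"
  proof (rule vge_all_imp_0)
    fix m :: nat
    obtain n :: nat where n: "real m + E \<le> real n" using real_arch_simple by blast
    have "vge (real (Suc n) - E) (of_nat k * I + (of_nat c ^ k - 1) * X)" by (rule main) simp
    then show "vge (real m) (of_nat k * I + (of_nat c ^ k - 1) * X)"
      by (rule vge_mono) (use n in auto)
  qed
  then have "of_nat k * I = - ((of_nat c ^ k - 1) * X)" by (rule eq_neg_iff_add_eq_0[THEN iffD2])
  then show ?thesis unfolding I_def X_def minus_mult_left .
qed

text \<open>The factor 2 / zeta* with c = 1 + p, for which kappa(c) - 1 = w. In this form it is
  defined at every weight in B, the trivial one included, where it vanishes.\<close>

definition zeta_inv :: "('a \<Rightarrow> 'a) \<Rightarrow> 'a" where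
  "zeta_inv \<kappa> = 2 * weight_w p \<kappa> * inverse (zeta_integral p (1 + p) \<kappa>)"

text \<open>Independence of c: the cross-multiplied difference is an Iwasawa function that vanishes
  at the classical weights, hence everywhere. The nontrivial weight makes 1 + p an admissible
  choice.\<close>

lemma zeta_star_eq:
  assumes K: "\<kappa> \<in> weights_B p v" and nt: "\<kappa> \<noteq> trivial_weight v"
  shows "2 / zeta_star p \<kappa> = zeta_inv \<kappa>"
proof -
  define c where "c = (SOME c :: nat. coprime c p \<and> \<kappa> (of_nat c) \<noteq> 1)"
  have w0: "weight_w p \<kappa> \<noteq> 0" by (rule weight_w_nonzero[OF K nt])
  then have "coprime (1 + p) p \<and> \<kappa> (of_nat (1 + p)) \<noteq> 1"
    using coprime_Suc_p by (simp add: weight_w_def)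
  then have c: "coprime c p" "\<kappa> (of_nat c) \<noteq> 1"
    unfolding c_def using someI_ex[of "\<lambda>c :: nat. coprime c p \<and> \<kappa> (of_nat c) \<noteq> 1"] by blast+
  have ncp: "\<not> p dvd c"
    using c(1) p_gt_1 by (metis coprime_absorb_right coprime_commute not_prime_unit prime_p)
  define \<phi> :: "('a \<Rightarrow> 'a) \<Rightarrow> 'a" where "\<phi> = (\<lambda>\<kappa>. (\<kappa> (of_nat c) - 1) * zeta_integral p (1 + p) \<kappa> - weight_w p \<kappa> * zeta_integral p c \<kappa>)"
  have "iwasawa \<phi>"
    unfolding \<phi>_def using c coprime_Suc_p
    by (intro iwasawa_diff iwasawa_mult iwasawa_kappa[OF ncp] iwasawa_const iwasawa_w iwasawa_zeta_integral) auto
  moreover have "\<phi> (pow_weight ((p - 1) * m)) = 0" if m: "m \<ge> 1" for m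
  proof -
    define k where "k = (p - 1) * m"
    have k: "(p - 1) dvd k" "k > 0" using m p_gt_1 by (auto simp: k_def)
    have "of_nat k * \<phi> (pow_weight k) =
        (of_nat c ^ k - 1) * (of_nat k * zeta_integral p (1 + p) (pow_weight k))
        - ((1 + of_nat p) ^ k - 1) * (of_nat k * zeta_integral p c (pow_weight k))"
      by (simp add: \<phi>_def pow_weight_nat[OF ncp] weight_w_pow algebra_simps)
    also have "\<dots> = 0"
      unfolding zeta_integral_pow_weight[OF coprime_Suc_p k] zeta_integral_pow_weight[OF c(1) k] by (simp add: algebra_simps)
    finally show ?thesis using k by (simp add: k_def)
  qed
  ultimately have "\<phi> \<kappa> = 0" using K by (rule iwasawa_eq_0)
  then have eq: "(\<kappa> (of_nat c) - 1) * zeta_integral p (1 + p) \<kappa> = weight_w p \<kappa> * zeta_integral p c \<kappa>"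
    by (simp add: \<phi>_def)
  have "v (zeta_integral p (1 + p) \<kappa>) = 0"
    using iwasawa_inverse(2)[OF iwasawa_zeta_integral[OF coprime_Suc_p] zeta_integral_unit K] .
  then have nz: "zeta_integral p (1 + p) \<kappa> \<noteq> 0" by auto
  then have nz2: "zeta_integral p c \<kappa> \<noteq> 0" using eq c(2) by auto
  have "zeta_star p \<kappa> = zeta_integral p c \<kappa> / (\<kappa> (of_nat c) - 1)"
    by (simp add: zeta_star_def c_def Let_def)
  then have "2 / zeta_star p \<kappa> = 2 * ((\<kappa> (of_nat c) - 1) / zeta_integral p c \<kappa>)" by simp
  also have "(\<kappa> (of_nat c) - 1) / zeta_integral p c \<kappa> = weight_w p \<kappa> / zeta_integral p (1 + p) \<kappa>"
    using frac_eq_eq[OF nz2 nz] eq by blast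
  finally show ?thesis by (simp add: zeta_inv_def divide_inverse mult.assoc)
qed

lemma iwasawa_zeta_inv: "iwasawa zeta_inv"
  unfolding zeta_inv_def [abs_def]
  using iwasawa_inverse(1)[OF iwasawa_zeta_integral[OF coprime_Suc_p] zeta_integral_unit] vge_of_nat[of 2]
  by (intro iwasawa_mult iwasawa_const iwasawa_w) auto

section \<open>The Eisenstein family over all of B\<close>

definition eis_family :: "('a \<Rightarrow> 'a) \<Rightarrow> 'a fps" where
  "eis_family \<kappa> = Abs_fps (\<lambda>n. if n = 0 then 1 else
     zeta_inv \<kappa> * (\<Sum>d | d dvd n \<and> \<not> p dvd d. \<kappa> (of_nat d) / of_nat d))"

lemma eisenstein_star_eq_family:
  assumes "\<kappa> \<in> weights_B p v" "\<kappa> \<noteq> trivial_weight v"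
  shows "eisenstein_star p \<kappa> = eis_family \<kappa>"
  by (rule fps_ext) (simp add: eisenstein_star_def eis_family_def zeta_star_eq[OF assms])

lemma iwasawa_eis_family: "iwasawa (\<lambda>\<kappa>. fps_nth (eis_family \<kappa>) n)"
proof (cases "n = 0")
  case False
  have "iwasawa (\<lambda>\<kappa>. \<Sum>d | d dvd n \<and> \<not> p dvd d. \<kappa> (of_nat d) / of_nat d)"
  proof (rule iwasawa_sum)
    fix d assume "d \<in> {d. d dvd n \<and> \<not> p dvd d}"
    then have d: "\<not> p dvd d" by simp
    have "vge 0 (inverse (of_nat d))"
      using v_unit_inverse[OF v_of_nat_unit[OF d]] by (simp add: vge_def zero_ereal_def)
    then show "iwasawa (\<lambda>\<kappa>. \<kappa> (of_nat d) / of_nat d)"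
      using iwasawa_mult[OF iwasawa_kappa[OF d] iwasawa_const] by (simp add: divide_inverse)
  qed
  then show ?thesis using iwasawa_mult[OF iwasawa_zeta_inv] False by (simp add: eis_family_def)
qed (simp add: eis_family_def iwasawa_const)

lemma eis_family_0: "eis_family (pow_weight 0) = 1"
  by (rule fps_ext) (simp add: eis_family_def zeta_inv_def weight_w_pow)

text \<open>The integral for c = 1 + p is a unit and w is divisible by p. Together with the special
  value formula this yields both that B_k is nonzero and that p divides 2 k / B_k.\<close>

lemma zeta_inv_pow_weight:
  assumes k: "(p - 1) dvd k" "k > 0"
  shows "bernoulli_number k \<noteq> (0 :: 'a)"
    and "(1 - of_nat p ^ (k - 1)) * zeta_inv (pow_weight k) = - (2 * of_nat k / bernoulli_number k)"
    and "vge 1 (2 * of_nat k / bernoulli_number k :: 'a)"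
proof -
  define I where "I = zeta_integral p (1 + p) (pow_weight k)"
  define w :: 'a where "w = (1 + of_nat p) ^ k - 1"
  define P :: 'a where "P = 1 - of_nat p ^ (k - 1)"
  have K: "pow_weight k \<in> weights_B p v" using k by (intro pow_weight_in_B)
  have "v I = 0"
    unfolding I_def using iwasawa_inverse(2)[OF iwasawa_zeta_integral[OF coprime_Suc_p] zeta_integral_unit K] .
  then have I0: "I \<noteq> 0" "vge 0 (inverse I)" using v_unit_inverse[of I] by (auto simp: vge_def zero_ereal_def)
  have eq: "of_nat k * I = - w * (P * bernoulli_number k)"
    using zeta_integral_pow_weight[OF coprime_Suc_p k] by (simp add: I_def w_def P_def)
  have nz: "of_nat k * I \<noteq> 0" using I0 k by simp
  then show b: "bernoulli_number k \<noteq> (0 :: 'a)" using eq by auto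
  have wP: "w \<noteq> 0" "P \<noteq> 0" using nz eq by auto
  have Z: "zeta_inv (pow_weight k) = 2 * w * inverse I"
    by (simp add: zeta_inv_def weight_w_pow w_def I_def)
  have "P * (2 * w * inverse I) * bernoulli_number k = - (2 * of_nat k)"
  proof -
    have "P * (2 * w * inverse I) * bernoulli_number k * I = - 2 * (- w * (P * bernoulli_number k))"
      using I0 by simp
    also have "\<dots> = - (2 * of_nat k) * I" unfolding eq[symmetric] by simp
    finally show ?thesis using mult_right_cancel[OF I0(1)] by blast
  qed
  then have "P * (2 * w * inverse I) = - (2 * of_nat k) / bernoulli_number k"
    using b by (simp add: field_simps)
  then show *: "(1 - of_nat p ^ (k - 1)) * zeta_inv (pow_weight k) = - (2 * of_nat k / bernoulli_number k)"
    unfolding Z P_def by simp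
  have "vge 1 (w * (P * (2 * inverse I)))"
    using vge_weight_w_pow[of k] I0
    by (intro vge_mult0(1)) (auto simp: w_def weight_w_pow P_def intro!: vge_mult0 vge_diff vge_0_power vge_of_nat[of 2, simplified])
  moreover have "w * (P * (2 * inverse I)) = (1 - of_nat p ^ (k - 1)) * zeta_inv (pow_weight k)"
    unfolding Z P_def by (simp add: mult_ac)
  ultimately show "vge 1 (2 * of_nat k / bernoulli_number k :: 'a)" unfolding * by simp
qed

text \<open>The p-stabilisation: the divisors of n that are multiples of p are p times the divisors
  of n / p, and subtracting them removes the Euler factor at p.\<close>

lemma eis_family_pow_weight:
  assumes k: "(p - 1) dvd k" "k > 0"
  shows "fps_const (1 - of_nat p ^ (k - 1)) * eis_family (pow_weight k) =
     eisenstein k - fps_const (of_nat p ^ (k - 1)) * fps_V p (eisenstein k)"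
proof (rule fps_ext)
  fix n
  define b :: 'a where "b = 2 * of_nat k / bernoulli_number k"
  show "fps_nth (fps_const (1 - of_nat p ^ (k - 1)) * eis_family (pow_weight k)) n =
     fps_nth (eisenstein k - fps_const (of_nat p ^ (k - 1)) * fps_V p (eisenstein k)) n"
  proof (cases "n = 0")
    case True
    then show ?thesis by (simp add: eis_family_def eisenstein_def fps_V_nth)
  next
    case False
    have fin: "finite {d. d dvd n}" using False by simp
    have "(\<Sum>d | d dvd n \<and> \<not> p dvd d. pow_weight k (of_nat d) / of_nat d) = (\<Sum>d | d dvd n \<and> \<not> p dvd d. of_nat d ^ (k - 1) :: 'a)"
    proof (rule sum.cong [OF refl])
      fix d assume d: "d \<in> {d. d dvd n \<and> \<not> p dvd d}"
      then have "d > 0" using False by (auto simp: dvd_def)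
      then show "pow_weight k (of_nat d) / of_nat d = (of_nat d ^ (k - 1) :: 'a)"
        using d k by (simp add: pow_weight_nat power_eq_if)
    qed
    moreover have "(\<Sum>d | d dvd n. of_nat d ^ (k - 1)) = (\<Sum>d | d dvd n \<and> \<not> p dvd d. of_nat d ^ (k - 1)) + (\<Sum>d | d dvd n \<and> p dvd d. of_nat d ^ (k - 1) :: 'a)"
      by (subst sum.union_disjoint [symmetric]) (use fin in \<open>auto intro!: sum.cong\<close>)
    moreover have "(\<Sum>d | d dvd n \<and> p dvd d. of_nat d ^ (k - 1) :: 'a) =
        (if p dvd n then of_nat p ^ (k - 1) * (\<Sum>d | d dvd n div p. of_nat d ^ (k - 1)) else 0)"
    proof (cases "p dvd n")
      case True
      then obtain m where m: "n = p * m" by auto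
      have "{d. d dvd n \<and> p dvd d} = (\<lambda>d. p * d) ` {d. d dvd m}"
        using p_gt_0 by (auto simp: m)
      then have "(\<Sum>d | d dvd n \<and> p dvd d. of_nat d ^ (k - 1) :: 'a) = (\<Sum>d | d dvd m. of_nat (p * d) ^ (k - 1))"
        using p_gt_0 by (simp add: sum.reindex inj_on_def)
      then show ?thesis using m p_gt_0 by (simp add: power_mult_distrib sum_distrib_left)
    next
      case nd: False
      then have "{d. d dvd n \<and> p dvd d} = {}" using dvd_trans by blast
      then show ?thesis using nd by (simp only: sum.empty if_False)
    qed
    moreover have "n div p = 0 \<longleftrightarrow> \<not> p dvd n" if "p dvd n"
      using that False by (auto simp: dvd_div_eq_0_iff)
    moreover have "fps_nth (fps_const (1 - of_nat p ^ (k - 1)) * eis_family (pow_weight k)) n =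
        - b * (\<Sum>d | d dvd n \<and> \<not> p dvd d. pow_weight k (of_nat d) / of_nat d)"
      using False zeta_inv_pow_weight(2)[OF k] by (simp add: eis_family_def b_def mult.assoc [symmetric])
    ultimately show ?thesis
      using False by (auto simp: eisenstein_def fps_V_nth b_def algebra_simps)
  qed
qed

end

section \<open>Modular forms with \<open>p\<close>-adic coefficients\<close>

definition subring_set :: "'b :: ring_1 set \<Rightarrow> bool" where
  "subring_set R \<longleftrightarrow> 1 \<in> R \<and> (\<forall>x\<in>R. \<forall>y\<in>R. x - y \<in> R \<and> x * y \<in> R)"

lemma subring_setD:
  assumes "subring_set R"
  shows "0 \<in> R" "1 \<in> R" "x \<in> R \<Longrightarrow> y \<in> R \<Longrightarrow> x + y \<in> R" "x \<in> R \<Longrightarrow> - x \<in> R"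
    "x \<in> R \<Longrightarrow> y \<in> R \<Longrightarrow> x - y \<in> R" "x \<in> R \<Longrightarrow> y \<in> R \<Longrightarrow> x * y \<in> R"
proof -
  show 1: "1 \<in> R" and d: "\<And>x y. x \<in> R \<Longrightarrow> y \<in> R \<Longrightarrow> x - y \<in> R" and "x \<in> R \<Longrightarrow> y \<in> R \<Longrightarrow> x * y \<in> R"
    using assms by (auto simp: subring_set_def)
  show 0: "0 \<in> R" using d[OF 1 1] by simp
  show u: "\<And>x. x \<in> R \<Longrightarrow> - x \<in> R" using d[OF 0] by simp
  show "x \<in> R \<Longrightarrow> y \<in> R \<Longrightarrow> x + y \<in> R" using d[of x "- y"] u by simp
qed

lemma subring_set_sum: "subring_set R \<Longrightarrow> (\<And>i. i \<in> A \<Longrightarrow> f i \<in> R) \<Longrightarrow> sum f A \<in> R"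
  by (induction A rule: infinite_finite_induct) (auto simp: subring_setD)

lemma subring_set_power: "subring_set R \<Longrightarrow> x \<in> R \<Longrightarrow> x ^ n \<in> R"
  by (induction n) (auto simp: subring_setD)

lemma subring_set_of_int: "subring_set R \<Longrightarrow> of_int n \<in> R"
proof -
  assume R: "subring_set R"
  have "of_nat m \<in> R" for m by (induction m) (auto simp: subring_setD[OF R])
  then show ?thesis using subring_setD(4)[OF R] by (cases n rule: int_cases2) auto
qed

lemma subring_set_fps: "subring_set R \<Longrightarrow> subring_set {f. \<forall>n. fps_nth f n \<in> R}"
  unfolding subring_set_def[of "{f. \<forall>n. fps_nth f n \<in> R}"]
  by (auto simp: fps_mult_nth subring_setD intro!: subring_set_sum)

lemma subring_set_fps_inverse:
  fixes f :: "'b :: field fps"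
  assumes R: "subring_set R" and f: "\<And>n. fps_nth f n \<in> R" "fps_nth f 0 = 1"
  shows "fps_nth (inverse f) n \<in> R"
proof (induction n rule: less_induct)
  case (less n)
  have i: "inverse f * f = 1" using f by (intro inverse_mult_eq_1) simp
  have "fps_nth (inverse f * f) n = (\<Sum>i=0..n. fps_nth (inverse f) i * fps_nth f (n - i))"
    by (simp add: fps_mult_nth)
  also have "\<dots> = (\<Sum>i<n. fps_nth (inverse f) i * fps_nth f (n - i)) + fps_nth (inverse f) n"
    using f(2) by (simp add: atLeast0AtMost lessThan_Suc_atMost [symmetric])
  finally have eq: "fps_nth (inverse f) n = fps_nth 1 n - (\<Sum>i<n. fps_nth (inverse f) i * fps_nth f (n - i))"
    using i by simp
  have "fps_nth (1 :: 'b fps) n \<in> R" using subring_setD[OF R] by simp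
  moreover have "(\<Sum>i<n. fps_nth (inverse f) i * fps_nth f (n - i)) \<in> R"
    using less f(1) subring_setD(6)[OF R] by (intro subring_set_sum[OF R]) auto
  ultimately show ?case using subring_setD(5)[OF R] by (simp only: eq)
qed

lemma span_over_induct [consumes 1, case_names 0 add scale]:
  assumes "x \<in> span_over R S" "P 0" "\<And>x y. P x \<Longrightarrow> P y \<Longrightarrow> P (x + y)"
    "\<And>c s. c \<in> R \<Longrightarrow> s \<in> S \<Longrightarrow> P (fps_const c * s)"
  shows "P x"
proof -
  obtain T c where T: "finite T" "T \<subseteq> S" "\<forall>s\<in>T. c s \<in> R" "x = (\<Sum>s\<in>T. fps_const (c s) * s)"
    using assms(1) unfolding span_over_def by blast
  from T(1-3) have "P (\<Sum>s\<in>T. fps_const (c s) * s)"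
    by (induction T rule: finite_induct) (use assms in auto)
  then show ?thesis using T(4) by simp
qed

context
  fixes R :: "'b :: field set" and S :: "'b fps set"
  assumes R: "subring_set R"
begin

lemma span_over_0: "0 \<in> span_over R S"
  unfolding span_over_def by (rule CollectI, rule exI[of _ "{}"]) auto

lemma span_over_scale_base:
  assumes "c \<in> R" "s \<in> S"
  shows "fps_const c * s \<in> span_over R S"
  unfolding span_over_def
  by (rule CollectI, rule exI[of _ "{s}"], rule exI[of _ "\<lambda>_. c"]) (use assms in auto)

lemma span_over_base: "s \<in> S \<Longrightarrow> s \<in> span_over R S"
  using span_over_scale_base[of 1 s] subring_setD[OF R] by simp

lemma span_over_add:
  assumes "x \<in> span_over R S" "y \<in> span_over R S"
  shows "x + y \<in> span_over R S"
proof -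
  obtain T c where T: "finite T" "T \<subseteq> S" "\<forall>s\<in>T. c s \<in> R" "x = (\<Sum>s\<in>T. fps_const (c s) * s)"
    using assms(1) unfolding span_over_def by blast
  obtain U d where U: "finite U" "U \<subseteq> S" "\<forall>s\<in>U. d s \<in> R" "y = (\<Sum>s\<in>U. fps_const (d s) * s)"
    using assms(2) unfolding span_over_def by blast
  define c' where "c' = (\<lambda>s. if s \<in> T then c s else 0)"
  define d' where "d' = (\<lambda>s. if s \<in> U then d s else 0)"
  have x: "x = (\<Sum>s\<in>T \<union> U. fps_const (c' s) * s)"
    unfolding T(4) by (rule sum.mono_neutral_cong_left) (use T U in \<open>auto simp: c'_def\<close>)
  have y: "y = (\<Sum>s\<in>T \<union> U. fps_const (d' s) * s)"
    unfolding U(4) by (rule sum.mono_neutral_cong_left) (use T U in \<open>auto simp: d'_def\<close>)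
  have "x + y = (\<Sum>s\<in>T \<union> U. fps_const (c' s + d' s) * s)"
    unfolding x y sum.distrib [symmetric] by (simp add: distrib_right flip: fps_const_add)
  moreover have "\<forall>s\<in>T \<union> U. c' s + d' s \<in> R"
    using T U subring_setD[OF R] by (auto simp: c'_def d'_def)
  moreover have "finite (T \<union> U)" "T \<union> U \<subseteq> S" using T U by auto
  ultimately show ?thesis
    unfolding span_over_def by (intro CollectI exI[of _ "T \<union> U"] exI[of _ "\<lambda>s. c' s + d' s"] conjI)
qed

lemma span_over_scale: "c \<in> R \<Longrightarrow> x \<in> span_over R S \<Longrightarrow> fps_const c * x \<in> span_over R S"
proof (rotate_tac, induction x rule: span_over_induct)
  case 0
  then show ?case using span_over_0 by simp
next
  case (add x y)
  then show ?case using span_over_add by (simp add: distrib_left)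
next
  case (scale d s)
  then show ?case
    using span_over_scale_base[of "c * d" s] subring_setD[OF R] by (simp add: mult.assoc [symmetric])
qed

lemma span_over_sum:
  assumes "\<And>i. i \<in> A \<Longrightarrow> f i \<in> span_over R S"
  shows "sum f A \<in> span_over R S"
  using assms
proof (induction A rule: infinite_finite_induct)
  case (insert x F)
  then have "f x \<in> span_over R S" "sum f F \<in> span_over R S" by blast+
  then show ?case using insert.hyps span_over_add by simp
qed (simp_all add: span_over_0)

end

text \<open>Gaussian elimination with more unknowns than equations, keeping all coefficients in the
  set K: a pivot t clears one equation, and its own coefficient is solved for at the end.\<close>

lemma linear_dependence:
  fixes x :: "'s \<Rightarrow> nat \<Rightarrow> 'b :: field"
  assumes K: "is_subfield K" and S: "finite S" "card S > n" and x: "\<And>s j. s \<in> S \<Longrightarrow> x s j \<in> K"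
  shows "\<exists>c. (\<forall>s\<in>S. c s \<in> K) \<and> (\<exists>s\<in>S. c s \<noteq> 0) \<and> (\<forall>j<n. (\<Sum>s\<in>S. c s * x s j) = 0)"
  using S x
proof (induction n arbitrary: S x)
  case 0
  have "1 \<in> K" using K by (simp add: is_subfield_def)
  moreover have "S \<noteq> {}" using 0 by auto
  ultimately show ?case by (intro exI[of _ "\<lambda>_. 1"]) auto
next
  case (Suc n)
  have sub: "subring_set K" using K by (auto simp: is_subfield_def subring_set_def)
  have div: "a / b \<in> K" if "a \<in> K" "b \<in> K" for a b using K that by (simp add: is_subfield_def)
  show ?case
  proof (cases "\<forall>s\<in>S. x s n = 0")
    case True
    obtain c where "\<forall>s\<in>S. c s \<in> K" "\<exists>s\<in>S. c s \<noteq> 0" "\<forall>j<n. (\<Sum>s\<in>S. c s * x s j) = 0"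
      using Suc.IH[of S x] Suc.prems by auto
    then show ?thesis using True by (intro exI[of _ c]) (auto simp: less_Suc_eq)
  next
    case False
    then obtain t where t: "t \<in> S" "x t n \<noteq> 0" by auto
    define S' where "S' = S - {t}"
    define x' where "x' = (\<lambda>s j. x s j - x s n / x t n * x t j)"
    have S': "finite S'" "card S' > n" using Suc.prems t by (auto simp: S'_def)
    have "x' s j \<in> K" if "s \<in> S'" for s j
      unfolding x'_def using that t Suc.prems(3) by (intro subring_setD[OF sub] div) (auto simp: S'_def)
    then obtain c where c: "\<forall>s\<in>S'. c s \<in> K" "\<exists>s\<in>S'. c s \<noteq> 0" "\<forall>j<n. (\<Sum>s\<in>S'. c s * x' s j) = 0"
      using Suc.IH[OF S', of x'] by blast
    define c' where "c' = (\<lambda>s. if s = t then - (\<Sum>s\<in>S'. c s * (x s n / x t n)) else c s)"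
    have ins: "S = insert t S'" "t \<notin> S'" using t by (auto simp: S'_def)
    have sm: "(\<Sum>s\<in>S. c' s * x s j) = (\<Sum>s\<in>S'. c s * x' s j)" for j
    proof -
      have "(\<Sum>s\<in>S. c' s * x s j) = c' t * x t j + (\<Sum>s\<in>S'. c' s * x s j)"
        using ins S' by simp
      also have "(\<Sum>s\<in>S'. c' s * x s j) = (\<Sum>s\<in>S'. c s * x s j)"
        using ins by (intro sum.cong) (auto simp: c'_def)
      also have "c' t * x t j = - (\<Sum>s\<in>S'. c s * (x s n / x t n) * x t j)"
        by (simp add: c'_def sum_distrib_right)
      finally show ?thesis
        by (simp add: x'_def right_diff_distrib sum_subtractf mult.assoc)
    qed
    have "(\<Sum>s\<in>S'. c s * x' s n) = 0" using t by (simp add: x'_def)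
    then have "\<forall>j<Suc n. (\<Sum>s\<in>S. c' s * x s j) = 0" using sm c(3) by (auto simp: less_Suc_eq)
    moreover have "c' s \<in> K" if "s \<in> S" for s
      unfolding c'_def using c(1) that Suc.prems(3) t ins
      by (auto intro!: subring_setD[OF sub] subring_set_sum[OF sub] div)
    moreover have "\<exists>s\<in>S. c' s \<noteq> 0" using c(2) ins by (auto simp: c'_def)
    ultimately show ?thesis by blast
  qed
qed

text \<open>Used in both directions to show that all finite bases have the same size, so that the
  definite description in \<open>dim_over\<close> has a value.\<close>

lemma steinitz_card_le:
  fixes S B :: "'b :: field fps set"
  assumes K: "is_subfield K" and B: "finite B" and S: "finite S" "S \<subseteq> span_over K B" "indep_over K S"
  shows "card S \<le> card B"
proof (rule ccontr)
  assume "\<not> card S \<le> card B"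
  then have lt: "card S > card B" by simp
  have sub: "subring_set K" using K by (auto simp: is_subfield_def subring_set_def)
  obtain b where b: "bij_betw b {..<card B} B"
    using B by (metis atLeast0LessThan ex_bij_betw_nat_finite)
  have "\<exists>x. (\<forall>j. x j \<in> K) \<and> s = (\<Sum>j<card B. fps_const (x j) * b j)" if "s \<in> span_over K B" for s
    using that
  proof (induction rule: span_over_induct)
    case 0
    then show ?case using subring_setD[OF sub] by (intro exI[of _ "\<lambda>_. 0"]) auto
  next
    case (add s t)
    then obtain x y where "\<forall>j. x j \<in> K" "s = (\<Sum>j<card B. fps_const (x j) * b j)"
      "\<forall>j. y j \<in> K" "t = (\<Sum>j<card B. fps_const (y j) * b j)" by blast
    then show ?case using subring_setD[OF sub]
      by (intro exI[of _ "\<lambda>j. x j + y j"]) (auto simp: sum.distrib distrib_right simp flip: fps_const_add)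
  next
    case (scale c s)
    then obtain i where i: "i < card B" "s = b i" using b by (auto simp: bij_betw_def)
    have "fps_const c * s = (\<Sum>j<card B. fps_const (if j = i then c else 0) * b j)"
    proof -
      have "(\<Sum>j<card B. fps_const (if j = i then c else 0) * b j) = (\<Sum>j<card B. if j = i then fps_const c * b j else 0)"
        by (intro sum.cong) auto
      then show ?thesis using i by simp
    qed
    then show ?case using scale subring_setD[OF sub]
      by (intro exI[of _ "\<lambda>j. if j = i then c else 0"]) auto
  qed
  then have "\<forall>s\<in>S. \<exists>x. (\<forall>j. x j \<in> K) \<and> s = (\<Sum>j<card B. fps_const (x j) * b j)"
    using S(2) by blast
  then obtain x where x: "\<And>s j. s \<in> S \<Longrightarrow> x s j \<in> K" "\<And>s. s \<in> S \<Longrightarrow> s = (\<Sum>j<card B. fps_const (x s j) * b j)"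
    by metis
  obtain c where c: "\<forall>s\<in>S. c s \<in> K" "\<exists>s\<in>S. c s \<noteq> 0" "\<forall>j<card B. (\<Sum>s\<in>S. c s * x s j) = 0"
    using linear_dependence[OF K S(1) lt, of x] x(1) by blast
  have fs: "fps_const (sum h A) = (\<Sum>s\<in>A. fps_const (h s))" for h :: "'b fps \<Rightarrow> 'b" and A
    by (induction A rule: infinite_finite_induct) (simp_all flip: fps_const_add)
  have "(\<Sum>s\<in>S. fps_const (c s) * s) = (\<Sum>s\<in>S. \<Sum>j<card B. fps_const (c s * x s j) * b j)"
  proof (rule sum.cong [OF refl])
    fix s assume s: "s \<in> S"
    have "fps_const (c s) * s = fps_const (c s) * (\<Sum>j<card B. fps_const (x s j) * b j)"
      using x(2)[OF s] by simp
    then show "fps_const (c s) * s = (\<Sum>j<card B. fps_const (c s * x s j) * b j)"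
      by (simp add: sum_distrib_left mult.assoc [symmetric])
  qed
  also have "\<dots> = (\<Sum>j<card B. fps_const (\<Sum>s\<in>S. c s * x s j) * b j)"
    by (subst sum.swap) (simp add: sum_distrib_right fs)
  also have "\<dots> = 0" using c(3) by simp
  finally have "(\<Sum>s\<in>S. fps_const (c s) * s) = 0" .
  then show False using S(1,3) c unfolding indep_over_def by blast
qed

lemma dim_over_eq:
  assumes K: "is_subfield K" and B: "finite B" "indep_over K B" "span_over K B = M"
  shows "dim_over K M = card B"
  unfolding dim_over_def
proof (rule the_equality)
  show "\<exists>S. finite S \<and> card S = card B \<and> indep_over K S \<and> span_over K S = M"
    using B by blast
  fix n assume "\<exists>S. finite S \<and> card S = n \<and> indep_over K S \<and> span_over K S = M"
  then obtain S where S: "finite S" "card S = n" "indep_over K S" "span_over K S = M" by blast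
  have sub: "subring_set K" using K by (auto simp: is_subfield_def subring_set_def)
  have "card S \<le> card B"
    using S B span_over_base[OF sub, of _ S] by (intro steinitz_card_le[OF K]) auto
  moreover have "card B \<le> card S"
    using S B span_over_base[OF sub, of _ B] by (intro steinitz_card_le[OF K]) auto
  ultimately show "n = card B" using S by simp
qed

lemma modforms_alt:
  fixes R :: "'b :: field_char_0 set"
  shows "modforms k R = span_over R (fps_of_ints ` {F. mform k (fps_of_ints F :: complex fps)})"
proof -
  have "{Abs_fps (\<lambda>n. of_int (a n)) |a :: nat \<Rightarrow> int. modular_qexp k (\<lambda>n. of_int (a n))} =
      (fps_of_ints ` {F. mform k (fps_of_ints F :: complex fps)} :: 'b fps set)" (is "?A = ?B")
  proof (intro equalityI subsetI)
    fix x assume "x \<in> ?A"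
    then obtain a :: "nat \<Rightarrow> int" where a: "x = Abs_fps (\<lambda>n. of_int (a n))" "modular_qexp k (\<lambda>n. of_int (a n))" by blast
    then have "x = fps_of_ints (Abs_fps a)" "mform k (fps_of_ints (Abs_fps a) :: complex fps)"
      by (simp_all add: fps_of_ints_def modular_qexp_iff_mform)
    then show "x \<in> ?B" by blast
  next
    fix x assume "x \<in> ?B"
    then obtain F where F: "x = fps_of_ints F" "mform k (fps_of_ints F :: complex fps)" by blast
    then have "x = Abs_fps (\<lambda>n. of_int (fps_nth F n))" "modular_qexp k (\<lambda>n. of_int (fps_nth F n))"
      by (simp_all add: fps_of_ints_def modular_qexp_iff_mform)
    then show "x \<in> ?A" by blast
  qed
  then show ?thesis unfolding modforms_def by simp
qed

lemma modforms_mono: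
  assumes "R \<subseteq> R'"
  shows "modforms k R \<subseteq> modforms k R'"
proof -
  have "span_over R S \<subseteq> span_over R' S" for S :: "'a fps set"
    unfolding span_over_def using assms by (intro Collect_mono) (metis (no_types, lifting) subsetD)
  then show ?thesis by (simp add: modforms_def)
qed

context
  fixes R :: "'b :: field_char_0 set"
  assumes R: "subring_set R"
begin

lemma modforms_int: "mform k (fps_of_ints F :: complex fps) \<Longrightarrow> fps_of_ints F \<in> modforms k R"
  unfolding modforms_alt by (rule span_over_base[OF R]) auto

lemma modforms_0: "0 \<in> modforms k R"
  unfolding modforms_alt by (rule span_over_0[OF R])

lemma modforms_add: "f \<in> modforms k R \<Longrightarrow> g \<in> modforms k R \<Longrightarrow> f + g \<in> modforms k R"
  unfolding modforms_alt by (rule span_over_add[OF R])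

lemma modforms_scale: "c \<in> R \<Longrightarrow> f \<in> modforms k R \<Longrightarrow> fps_const c * f \<in> modforms k R"
  unfolding modforms_alt by (rule span_over_scale[OF R])

lemma modforms_sum: "(\<And>i. i \<in> A \<Longrightarrow> f i \<in> modforms k R) \<Longrightarrow> sum f A \<in> modforms k R"
  unfolding modforms_alt by (rule span_over_sum[OF R])

lemma modforms_1: "1 \<in> modforms 0 R"
  using modforms_int[of 0 1] mform_const[of 1] by simp

lemma modforms_mult:
  assumes "f \<in> modforms k R" "g \<in> modforms l R"
  shows "f * g \<in> modforms (k + l) R"
  using assms(1) unfolding modforms_alt[of k]
proof (induction rule: span_over_induct)
  case 0
  then show ?case using modforms_0 by simp
next
  case (add x y)
  then show ?case using modforms_add by (simp add: distrib_right)
next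
  case (scale c s)
  then obtain F where F: "s = fps_of_ints F" "mform k (fps_of_ints F :: complex fps)" by auto
  have "s * g \<in> modforms (k + l) R"
    using assms(2) unfolding modforms_alt[of l]
  proof (induction rule: span_over_induct)
    case 0
    then show ?case using modforms_0 by simp
  next
    case (add x y)
    then show ?case using modforms_add by (simp add: distrib_left)
  next
    case (scale d t)
    then obtain G where G: "t = fps_of_ints G" "mform l (fps_of_ints G :: complex fps)" by auto
    have "fps_of_ints (F * G) \<in> modforms (k + l) R"
      using mform_mult[OF F(2) G(2)] by (intro modforms_int) simp
    then have "fps_const d * fps_of_ints (F * G) \<in> modforms (k + l) R"
      using scale by (intro modforms_scale)
    then show ?case by (simp add: F G mult_ac)
  qed
  then show ?case using modforms_scale[OF scale(1)] by (simp add: mult.assoc)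
qed

lemma modforms_power: "f \<in> modforms k R \<Longrightarrow> f ^ n \<in> modforms (n * k) R"
  by (induction n) (use modforms_1 modforms_mult in auto)

lemma modforms_coeff: "f \<in> modforms k R \<Longrightarrow> fps_nth f n \<in> R"
  unfolding modforms_alt
proof (induction rule: span_over_induct)
  case (scale c s)
  then show ?case using subring_setD[OF R] subring_set_of_int[OF R] by auto
qed (use subring_setD[OF R] in auto)

lemma modforms_weight_0: "modforms 0 R = fps_const ` R"
proof (intro equalityI subsetI)
  fix f assume "f \<in> modforms 0 R"
  then show "f \<in> fps_const ` R"
    unfolding modforms_alt
  proof (induction rule: span_over_induct)
    case 0
    then show ?case using subring_setD[OF R] by (auto intro: image_eqI[of _ _ 0])
  next
    case (add x y)
    then show ?case using subring_setD[OF R] by (auto intro!: imageI)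
  next
    case (scale c s)
    then obtain F where F: "s = fps_of_ints F" "mform 0 (fps_of_ints F :: complex fps)" by auto
    have "fps_nth (fps_of_ints F :: complex fps) n = 0" if "n > 0" for n
      using mform_0_imp_const[OF F(2)] that by (metis fps_nth_fps_const less_numeral_extra(3))
    then have "s = fps_const (of_int (fps_nth F 0))"
      unfolding F(1) by (intro fps_ext) auto
    then show ?case
      using scale(1) subring_setD[OF R] subring_set_of_int[OF R] by (auto intro!: imageI)
  qed
next
  fix f assume "f \<in> fps_const ` R"
  then obtain c where "c \<in> R" "f = fps_const c" by blast
  then show "f \<in> modforms 0 R" using modforms_scale[OF _ modforms_1, of c] by simp
qed

end

text \<open>The complex and the p-adic Eisenstein series are images of one rational series;
  divisibility found p-adically and modularity found over the complex numbers thus concern the same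
  coefficients.\<close>

lemma bernoulli_number_of_rat: "(bernoulli_number k :: 'b :: field_char_0) = of_rat (bernoulli_number k)"
proof -
  define \<beta> :: "rat fps" where "\<beta> = Abs_fps (\<lambda>n. 1 / fact (Suc n))"
  define \<beta>' :: "'b fps" where "\<beta>' = Abs_fps (\<lambda>n. 1 / fact (Suc n))"
  define G :: "'b fps" where "G = Abs_fps (\<lambda>n. of_rat (fps_nth (inverse \<beta>) n))"
  have fact: "of_rat (fact n) = (fact n :: 'b)" for n
    by (metis of_nat_fact of_rat_of_nat_eq)
  have b: "fps_nth \<beta>' n = of_rat (fps_nth \<beta> n)" for n
    by (simp add: \<beta>_def \<beta>'_def of_rat_divide fact del: fact_Suc)
  have "\<beta>' * G = 1"
  proof (rule fps_ext)
    fix n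
    have "fps_nth (\<beta>' * G) n = of_rat (fps_nth (\<beta> * inverse \<beta>) n)"
      by (simp add: fps_mult_nth b G_def of_rat_sum of_rat_mult)
    also have "\<beta> * inverse \<beta> = 1"
      using inverse_mult_eq_1[of \<beta>] by (simp add: \<beta>_def mult.commute)
    finally show "fps_nth (\<beta>' * G) n = fps_nth 1 n" by simp
  qed
  then have "inverse \<beta>' = G" by (metis fps_inverse_unique)
  then have "fps_nth (inverse \<beta>') k = of_rat (fps_nth (inverse \<beta>) k)" by (simp add: G_def)
  then show ?thesis
    by (simp add: bernoulli_number_def \<beta>_def \<beta>'_def of_rat_mult fact)
qed

lemma eisenstein_factor_of_rat:
  "- (2 * of_nat k / (bernoulli_number k :: 'b :: field_char_0)) = of_rat (- (2 * of_nat k / bernoulli_number k))"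
  unfolding bernoulli_number_of_rat[of k, where 'b = 'b]
  by (simp add: of_rat_minus of_rat_divide of_rat_mult)

text \<open>The shape D + m Y is kept because m = p exhibits the multiple of E_k as constant modulo
  p, as the integral trace requires.\<close>

lemma eisenstein_clear_denominator:
  assumes q: "- (2 * of_nat k / bernoulli_number k) = (of_int (m * b) / of_int D :: rat)" and D: "D \<noteq> 0"
  shows "fps_of_ints (fps_const D + fps_const m * Abs_fps (\<lambda>n. if n = 0 then 0 else b * (\<Sum>d | d dvd n. int d ^ (k - 1)))) =
    fps_const (of_int D) * (eisenstein k :: 'b :: field_char_0 fps)"
proof (rule fps_ext)
  fix n
  have "of_int D * - (2 * of_nat k / (bernoulli_number k :: 'b)) = of_int (m * b)"
    unfolding eisenstein_factor_of_rat[of k, where 'b = 'b] q using D by (simp add: of_rat_divide of_rat_mult)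
  then have "(of_int m * (of_int b * s) :: 'b) = of_int D * (- (2 * of_nat k / bernoulli_number k) * s)" for s
    by (simp only: mult.assoc [symmetric] of_int_mult)
  then show "fps_nth (fps_of_ints (fps_const D + fps_const m * Abs_fps (\<lambda>n. if n = 0 then 0 else b * (\<Sum>d | d dvd n. int d ^ (k - 1))))) n =
      fps_nth (fps_const (of_int D) * (eisenstein k :: 'b fps)) n"
    by (cases "n = 0") (simp_all add: eisenstein_def del: mult_minus_left)
qed

section \<open>The Gauss valuation of q-expansions and p-integral Eisenstein series\<close>

context Cp5
begin

definition vf :: "real \<Rightarrow> 'a fps \<Rightarrow> bool" where
  "vf M f \<longleftrightarrow> (\<forall>n. vge M (fps_nth f n))"

lemma vf_v_fps: "ereal M \<le> v_fps v f \<longleftrightarrow> vf M f"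
  by (auto simp: v_fps_def vf_def vge_def le_INF_iff)

lemma vf_0 [simp]: "vf M 0" by (simp add: vf_def)

lemma vf_1: "vf 0 1" by (simp add: vf_def)

lemma vf_mono: "vf M f \<Longrightarrow> N \<le> M \<Longrightarrow> vf N f"
  unfolding vf_def using vge_mono by blast

lemma vf_add: "vf M f \<Longrightarrow> vf M g \<Longrightarrow> vf M (f + g)"
  unfolding vf_def using vge_add by simp

lemma vf_diff: "vf M f \<Longrightarrow> vf M g \<Longrightarrow> vf M (f - g)"
  unfolding vf_def using vge_diff by simp

lemma vf_uminus: "vf M f \<Longrightarrow> vf M (- f)"
  unfolding vf_def by simp

lemma vf_mult: "vf M f \<Longrightarrow> vf N g \<Longrightarrow> vf (M + N) (f * g)"
  unfolding vf_def fps_mult_nth by (intro allI vge_sum vge_mult) auto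

lemma vf_mult0: "vf M f \<Longrightarrow> vf 0 g \<Longrightarrow> vf M (f * g)" "vf 0 f \<Longrightarrow> vf M g \<Longrightarrow> vf M (f * g)"
  using vf_mult[of M f 0 g] vf_mult[of 0 f M g] by auto

lemma vf_power: "vf M f \<Longrightarrow> vf (real n * M) (f ^ n)"
proof (induction n)
  case (Suc n)
  then show ?case using vf_mult[of M f "real n * M" "f ^ n"] by (simp add: algebra_simps)
qed (simp add: vf_1)

lemma vf_power0: "vf 0 f \<Longrightarrow> vf 0 (f ^ n)"
  using vf_power[of 0 f n] by simp

lemma vf_const: "vge M c \<Longrightarrow> vf M (fps_const c)"
  by (simp add: vf_def)

lemma vf_sum: "(\<And>i. i \<in> A \<Longrightarrow> vf M (f i)) \<Longrightarrow> vf M (sum f A)"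
  unfolding vf_def by (simp add: fps_sum_nth vge_sum)

lemma vf_V: "vf M f \<Longrightarrow> vf M (fps_V p f)"
  unfolding vf_def by (simp add: fps_V_nth)

lemma vf_of_ints: "vf 0 (fps_of_ints F)"
  by (simp add: vf_def)

lemma subring_vge_0: "subring_set {x. vge 0 x}"
  unfolding subring_set_def using vge_diff vge_mult0 by auto

lemma vf_inverse: "vf 0 f \<Longrightarrow> fps_nth f 0 = 1 \<Longrightarrow> vf 0 (inverse f)"
  using subring_set_fps_inverse[OF subring_vge_0, of f] by (simp add: vf_def)

lemma subring_Zp: "subring_set (Zp v)"
  unfolding subring_set_def
  using Qp_diff Qp_mult vge_diff vge_mult0(1) of_int_Qp[of 1] by (auto simp: Zp_iff)

lemma subring_Qp: "subring_set (Qp :: 'a set)"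
  using is_subfield_Qp by (auto simp: is_subfield_def subring_set_def)

lemma Zp_subset_Qp: "Zp v \<subseteq> Qp"
  by (auto simp: Zp_iff)

lemma inverse_unit_int_Zp: "\<not> int p dvd D \<Longrightarrow> inverse (of_int D) \<in> Zp v"
  using v_unit_inverse[OF v_of_int_unit] by (simp add: Zp_iff Qp_inverse vge_def zero_ereal_def)

lemma vf_modforms: "f \<in> modforms k (Zp v) \<Longrightarrow> vf 0 f"
  using modforms_coeff[OF subring_Zp] by (auto simp: vf_def Zp_iff)

text \<open>The divisibility of 2 k / B_k by p is known in C_p from the zeta integral. The quotient
  is rational, so p divides its numerator and not its denominator D, and one integral series serves
  for both fields.\<close>

lemma eisenstein_int:
  assumes k: "(p - 1) dvd k" "k > 0"
  obtains D Y where "\<not> int p dvd D"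
    "mform k (fps_of_ints (fps_const D + fps_const (int p) * Y) :: complex fps)"
    "fps_of_ints (fps_const D + fps_const (int p) * Y) = fps_const (of_int D) * (eisenstein k :: 'a fps)"
proof -
  define q :: rat where "q = - (2 * of_nat k / bernoulli_number k)"
  have odd: "odd p" using prime_odd_nat[OF prime_p] p_ge_5 by simp
  have "even (p - 1)" using odd by simp
  then have ev: "even k" using k(1) dvd_trans by blast
  have "p - 1 \<le> k" using k by (intro dvd_imp_le)
  then have k4: "k \<ge> 4" using p_ge_5 by simp
  have vq: "vge 1 (of_rat q)"
    unfolding q_def eisenstein_factor_of_rat[where 'b = 'a, symmetric] vge_uminus by (rule zeta_inv_pow_weight(3)[OF k])
  have nd: "\<not> int p dvd snd (quotient_of q)"
    by (rule rat_integral_denominator) (rule vge_mono[OF vq], simp)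
  obtain a D where aD: "quotient_of q = (a, D)" by force
  have D: "D > 0" and qd: "q = of_int a / of_int D"
    using quotient_of_denom_pos[OF aD] quotient_of_div[OF aD] by auto
  have "of_int a = (of_rat q * of_int D :: 'a)" using D by (simp add: qd of_rat_divide)
  then have "vge (real 1) (of_int a)" using vge_mult0(1)[OF vq vge_of_int[of D]] by simp
  then obtain b where b: "a = int p * b" unfolding vge_of_int_iff by auto
  define Y where "Y = Abs_fps (\<lambda>n. if n = 0 then 0 else b * (\<Sum>d | d dvd n. int d ^ (k - 1)))"
  have qb: "- (2 * of_nat k / bernoulli_number k) = (of_int (int p * b) / of_int D :: rat)"
    using qd b by (simp add: q_def)
  have eq: "fps_of_ints (fps_const D + fps_const (int p) * Y) = fps_const (of_int D) * (eisenstein k :: complex fps)"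
    and eq': "fps_of_ints (fps_const D + fps_const (int p) * Y) = fps_const (of_int D) * (eisenstein k :: 'a fps)"
    unfolding Y_def using D by (intro eisenstein_clear_denominator[OF qb]; simp)+
  have "mform k (fps_const (of_int D) * (eisenstein k :: complex fps))"
    using mform_mult[OF mform_const mform_eisenstein[OF k4 ev], of "of_int D"] by simp
  then have "mform k (fps_of_ints (fps_const D + fps_const (int p) * Y) :: complex fps)"
    unfolding eq .
  then show ?thesis using that[of D Y] nd aD eq' by simp
qed

lemma eisenstein_modforms:
  assumes k: "(p - 1) dvd k" "k > 0"
  shows "eisenstein k \<in> modforms k (Zp v)" and "vf 1 (eisenstein k - 1)"
proof -
  obtain D Y where D: "\<not> int p dvd D"
    and m: "mform k (fps_of_ints (fps_const D + fps_const (int p) * Y) :: complex fps)"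
    and e: "fps_of_ints (fps_const D + fps_const (int p) * Y) = fps_const (of_int D) * (eisenstein k :: 'a fps)"
    using eisenstein_int[OF k] by blast
  have D0: "(of_int D :: 'a) \<noteq> 0" using v_of_int_unit[OF D] by auto
  have "fps_const (inverse (of_int D)) * fps_of_ints (fps_const D + fps_const (int p) * Y) \<in> modforms k (Zp v)"
    using m by (intro modforms_scale[OF subring_Zp] modforms_int[OF subring_Zp] inverse_unit_int_Zp D)
  then show "eisenstein k \<in> modforms k (Zp v)"
    unfolding e using D0 by (simp add: mult.assoc [symmetric])
  have "vge 1 (fps_nth (eisenstein k :: 'a fps) n)" if "n > 0" for n
  proof -
    have "fps_nth (eisenstein k :: 'a fps) n = - (2 * of_nat k / bernoulli_number k) * of_nat (\<Sum>d | d dvd n. d ^ (k - 1))"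
      using that by (simp add: eisenstein_def)
    moreover have "vge 1 (- (2 * of_nat k / bernoulli_number k) * of_nat (\<Sum>d | d dvd n. d ^ (k - 1)))"
      using zeta_inv_pow_weight(3)[OF k] by (intro vge_mult0(1) vge_of_nat) (simp only: vge_uminus)
    ultimately show ?thesis by simp
  qed
  then show "vf 1 (eisenstein k - 1)"
    by (auto simp: vf_def eisenstein_def)
qed

definition EE :: "'a fps" where "EE = eisenstein (p - 1)"

lemma EE_props: "EE \<in> modforms (p - 1) (Zp v)" "vf 1 (EE - 1)" "vf 0 EE" "fps_nth EE 0 = 1" "EE \<noteq> 0"
proof -
  have k: "(p - 1) dvd (p - 1)" "p - 1 > 0" using p_gt_1 by auto
  show "EE \<in> modforms (p - 1) (Zp v)" "vf 1 (EE - 1)" unfolding EE_def by (rule eisenstein_modforms[OF k])+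
  then show "vf 0 EE" using vf_modforms by blast
  show e: "fps_nth EE 0 = 1" by (simp add: EE_def eisenstein_def)
  show "EE \<noteq> 0" using e by force
qed

text \<open>The identity summand of the trace is a level one form up to p^(N+1-k), because the
  U-part has that divisibility. Linearity reduces to integral h, and the N-th power of the unit 1/D
  undoes the clearing of denominators.\<close>

lemma trace_padic:
  assumes h: "h \<in> modforms k (Zp v)" and N: "k \<le> N + 1"
  shows "\<exists>T. T \<in> modforms (k + N * (p - 1)) (Zp v) \<and>
    vf (real (N + 1 - k)) (fps_V p h * (EE - fps_const (of_nat p ^ (p - 1)) * fps_V p EE) ^ N - T)"
proof -
  have ka: "(p - 1) dvd (p - 1)" "p - 1 > 0" using p_gt_1 by auto
  obtain D Y where D: "\<not> int p dvd D"
    and m: "mform (p - 1) (fps_of_ints (fps_const D + fps_const (int p) * Y) :: complex fps)"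
    and e: "fps_of_ints (fps_const D + fps_const (int p) * Y) = fps_const (of_int D) * EE"
    using eisenstein_int[OF ka] unfolding EE_def by blast
  define F where "F = fps_const D + fps_const (int p) * Y"
  have D0: "(of_int D :: 'a) \<noteq> 0" using v_of_int_unit[OF D] by auto
  show ?thesis
    using h unfolding modforms_alt[of k]
  proof (induction rule: span_over_induct)
    case 0
    have "fps_V p 0 = (0 :: 'a fps)" by (rule fps_ext) (simp add: fps_V_nth)
    then show ?case using modforms_0[OF subring_Zp] by (intro exI[of _ 0]) simp
  next
    case (add x y)
    then obtain T U where "T \<in> modforms (k + N * (p - 1)) (Zp v)"
      "vf (real (N + 1 - k)) (fps_V p x * (EE - fps_const (of_nat p ^ (p - 1)) * fps_V p EE) ^ N - T)"
      "U \<in> modforms (k + N * (p - 1)) (Zp v)"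
      "vf (real (N + 1 - k)) (fps_V p y * (EE - fps_const (of_nat p ^ (p - 1)) * fps_V p EE) ^ N - U)" by blast
    then show ?case
      using modforms_add[OF subring_Zp, of T _ U] vf_add
      by (intro exI[of _ "T + U"] conjI) (auto simp: fps_V_add algebra_simps dest: vf_add)
  next
    case (scale c s)
    then obtain H where H: "s = fps_of_ints H" "mform k (fps_of_ints H :: complex fps)" by auto
    define W where "W = fps_V p H * (F - fps_const (int p ^ (p - 1)) * fps_V p F) ^ N"
    define Z where "Z = fps_U p (H * (fps_V p Y - Y) ^ N)"
    define T where "T = W + fps_const (int p ^ (N + 1 - k)) * Z"
    define u where "u = inverse (of_int D :: 'a) ^ N"
    have uZ: "u \<in> Zp v" unfolding u_def by (intro subring_set_power[OF subring_Zp] inverse_unit_int_Zp D)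
    have cZ: "c * u \<in> Zp v" by (rule subring_setD(6)[OF subring_Zp scale(1) uZ])
    have "mform (k + N * (p - 1)) (fps_of_ints T :: complex fps)"
      unfolding T_def W_def Z_def
      by (rule mform_trace_int[OF prime_p H(2) _ F_def N]) (use m in \<open>simp only: F_def\<close>)
    then have T: "fps_const (c * u) * fps_of_ints T \<in> modforms (k + N * (p - 1)) (Zp v)"
      by (intro modforms_scale[OF subring_Zp] modforms_int[OF subring_Zp] cZ)
    have "fps_of_ints F = fps_const (of_int D) * EE" using e by (simp only: F_def)
    then have "fps_of_ints W = fps_V p s * (fps_const (of_int D) * (EE - fps_const (of_nat p ^ (p - 1)) * fps_V p EE)) ^ N"
      using p_gt_0 by (simp add: W_def H fps_V_mult algebra_simps)
    also have "\<dots> = fps_const (of_int D ^ N) * (fps_V p s * (EE - fps_const (of_nat p ^ (p - 1)) * fps_V p EE) ^ N)"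
      by (simp add: power_mult_distrib fps_const_power mult_ac)
    finally have "fps_const (c * u) * fps_of_ints W = fps_const (c * u * of_int D ^ N) * (fps_V p s * (EE - fps_const (of_nat p ^ (p - 1)) * fps_V p EE) ^ N)"
      by (simp only: mult.assoc [symmetric] fps_const_mult)
    also have "c * u * of_int D ^ N = c"
      using D0 by (simp add: u_def power_inverse)
    finally have W: "fps_const (c * u) * fps_of_ints W = fps_V p (fps_const c * s) * (EE - fps_const (of_nat p ^ (p - 1)) * fps_V p EE) ^ N"
      using p_gt_0 by (simp add: fps_V_mult mult.assoc)
    have "vf (real (N + 1 - k)) (fps_const (of_nat p ^ (N + 1 - k)) * (fps_const (c * u) * fps_of_ints Z))"
      using cZ by (intro vf_mult0(1) vf_const vge_p_power vf_mult0(2) vf_of_ints) (auto simp: Zp_iff)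
    moreover have "fps_V p (fps_const c * s) * (EE - fps_const (of_nat p ^ (p - 1)) * fps_V p EE) ^ N - fps_const (c * u) * fps_of_ints T =
        - (fps_const (of_nat p ^ (N + 1 - k)) * (fps_const (c * u) * fps_of_ints Z))"
      unfolding W[symmetric] T_def by (simp add: algebra_simps)
    ultimately show ?case using T vf_uminus by (intro exI[of _ "fps_const (c * u) * fps_of_ints T"]) simp
  qed
qed

end

section \<open>Katz coordinates\<close>

locale Katz = Cp5 p v for p :: nat and v :: "'a :: {alg_closed_field, field_char_0, complete_space} \<Rightarrow> ereal" +
  fixes g :: "nat \<Rightarrow> nat \<Rightarrow> 'a fps"
  assumes splitting: "katz_splitting p v g"
begin

definition dimk :: "nat \<Rightarrow> nat" where
  "dimk i = dim_modforms (i * (p - 1)) TYPE('a)"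

text \<open>A basis with leading terms q^j at each level: the forms of the previous level are
  multiplied by E, whose constant term 1 preserves leading terms, and the new indices are filled by
  the g of the splitting.\<close>

primrec Bs :: "nat \<Rightarrow> nat \<Rightarrow> 'a fps" where
  "Bs 0 j = 1"
| "Bs (Suc i) j = (if j < dimk i then EE * Bs i j else g (Suc i) j)"

definition echelon :: "nat \<Rightarrow> nat \<Rightarrow> (nat \<Rightarrow> 'a fps) \<Rightarrow> bool" where
  "echelon k n B \<longleftrightarrow> (\<forall>j<n. B j \<in> modforms k (Zp v) \<and> fps_nth (B j) j = 1 \<and> (\<forall>m<j. fps_nth (B j) m = 0)) \<and>
     (\<forall>f\<in>modforms k (Zp v). \<exists>c. (\<forall>j. c j \<in> Zp v) \<and> f = (\<Sum>j<n. fps_const (c j) * B j))"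

lemma triangular_zero:
  assumes B: "\<And>j. j < n \<Longrightarrow> fps_nth (B j) j = (1 :: 'a) \<and> (\<forall>m<j. fps_nth (B j) m = 0)"
    and z: "\<And>m. m < M \<Longrightarrow> fps_nth (\<Sum>j<n. fps_const (c j) * B j) m = 0"
    and j: "j < n" "j < M"
  shows "c j = 0"
  using j
proof (induction j rule: less_induct)
  case (less j)
  have "0 = (\<Sum>i<n. c i * fps_nth (B i) j)" using z[of j] less.prems by (simp add: fps_sum_nth)
  also have "\<dots> = (\<Sum>i\<in>{j}. c i * fps_nth (B i) j)"
  proof (rule sum.mono_neutral_right)
    show "\<forall>i\<in>{..<n} - {j}. c i * fps_nth (B i) j = 0"
    proof
      fix i assume i: "i \<in> {..<n} - {j}"
      show "c i * fps_nth (B i) j = 0"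
        using less.IH[of i] less.prems B[of i] i by (cases "i < j") auto
    qed
  qed (use less.prems in auto)
  finally show ?case using B[of j] less.prems by simp
qed

text \<open>The leading terms give independence, and spanning the integral forms gives spanning over
  Q_p; this evaluates the definite description of the dimension.\<close>

lemma echelon_dim:
  assumes ech: "echelon k n B"
  shows "dim_over Qp (modforms k (Qp :: 'a set)) = n"
proof -
  have B: "B j \<in> modforms k (Zp v)" "fps_nth (B j) j = 1" "\<And>m. m < j \<Longrightarrow> fps_nth (B j) m = 0" if "j < n" for j
    using ech that by (auto simp: echelon_def)
  have inj: "inj_on B {..<n}"
  proof (rule linorder_inj_onI)
    fix i j assume "i < j" "i \<in> {..<n}" "j \<in> {..<n}"
    then show "B i \<noteq> B j" using B(2)[of i] B(3)[of j i] by auto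
  qed auto
  have ind: "indep_over Qp (B ` {..<n})"
    unfolding indep_over_def
  proof (intro allI impI)
    fix T and c :: "'a fps \<Rightarrow> 'a"
    assume T: "finite T \<and> T \<subseteq> B ` {..<n} \<and> (\<forall>s\<in>T. c s \<in> Qp) \<and> (\<Sum>s\<in>T. fps_const (c s) * s) = 0"
    define c' where "c' = (\<lambda>j. if B j \<in> T then c (B j) else 0)"
    have "(\<Sum>j<n. fps_const (c' j) * B j) = (\<Sum>s\<in>B ` {..<n}. fps_const (if s \<in> T then c s else 0) * s)"
      using inj by (simp add: sum.reindex c'_def)
    also have "\<dots> = (\<Sum>s\<in>T. fps_const (c s) * s)"
      by (rule sum.mono_neutral_cong_right) (use T in auto)
    finally have "(\<Sum>j<n. fps_const (c' j) * B j) = 0" using T by simp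
    then have z: "c' j = 0" if "j < n" for j
      using triangular_zero[of n B n c' j] B that by auto
    show "\<forall>s\<in>T. c s = 0"
    proof
      fix s assume s: "s \<in> T"
      then obtain j where "j < n" "s = B j" using T by auto
      then show "c s = 0" using z[of j] s by (simp add: c'_def)
    qed
  qed
  have "span_over Qp (B ` {..<n}) = modforms k (Qp :: 'a set)"
  proof (intro equalityI subsetI)
    fix f assume "f \<in> span_over Qp (B ` {..<n})"
    then show "f \<in> modforms k (Qp :: 'a set)"
    proof (induction rule: span_over_induct)
      case (scale c s)
      then show ?case using B(1) modforms_mono[OF Zp_subset_Qp] modforms_scale[OF subring_Qp] by blast
    qed (use modforms_0[OF subring_Qp] modforms_add[OF subring_Qp] in auto)
  next
    fix f assume "f \<in> modforms k (Qp :: 'a set)"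
    then show "f \<in> span_over Qp (B ` {..<n})"
      unfolding modforms_alt
    proof (induction rule: span_over_induct)
      case (scale c s)
      then obtain F where F: "s = fps_of_ints F" "mform k (fps_of_ints F :: complex fps)" by auto
      then have "s \<in> modforms k (Zp v)" using modforms_int[OF subring_Zp] by auto
      then obtain b where b: "\<forall>j. b j \<in> Zp v" "s = (\<Sum>j<n. fps_const (b j) * B j)"
        using ech by (auto simp: echelon_def)
      have "fps_const (b j) * B j \<in> span_over Qp (B ` {..<n})" if "j < n" for j
        using b(1) Zp_subset_Qp that by (intro span_over_scale_base[OF subring_Qp]) auto
      then have "s \<in> span_over Qp (B ` {..<n})"
        unfolding b(2) by (intro span_over_sum[OF subring_Qp]) auto
      then show ?case using scale(1) by (intro span_over_scale[OF subring_Qp])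
    qed (use span_over_0[OF subring_Qp] span_over_add[OF subring_Qp] in auto)
  qed
  from dim_over_eq[OF is_subfield_Qp _ ind this] show ?thesis
    using card_image[OF inj] by simp
qed

lemma dimk_0: "dimk 0 = 1" and echelon_0: "echelon 0 1 (Bs 0)"
proof -
  show e: "echelon 0 1 (Bs 0)"
    unfolding echelon_def
  proof (intro conjI ballI)
    show "\<forall>j<1. Bs 0 j \<in> modforms 0 (Zp v) \<and> fps_nth (Bs 0 j) j = 1 \<and> (\<forall>m<j. fps_nth (Bs 0 j) m = 0)"
      using modforms_1[OF subring_Zp] by auto
    fix f assume "f \<in> modforms 0 (Zp v)"
    then obtain a where "a \<in> Zp v" "f = fps_const a"
      unfolding modforms_weight_0[OF subring_Zp] by blast
    then show "\<exists>c. (\<forall>j. c j \<in> Zp v) \<and> f = (\<Sum>j<1. fps_const (c j) * Bs 0 j)"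
      by (intro exI[of _ "\<lambda>_. a"]) auto
  qed
  show "dimk 0 = 1" using echelon_dim[OF e] by (simp add: dimk_def dim_modforms_def)
qed

lemma leading_EE_mult:
  assumes "fps_nth f j = 1" "\<forall>m<j. fps_nth f m = 0"
  shows "fps_nth (EE * f) j = 1 \<and> (\<forall>m<j. fps_nth (EE * f) m = 0)"
proof -
  have "fps_nth (EE * f) m = (if m = j then 1 else 0)" if "m \<le> j" for m
  proof -
    have "fps_nth (EE * f) m = (\<Sum>i=0..m. fps_nth EE i * fps_nth f (m - i))" by (simp add: fps_mult_nth)
    also have "\<dots> = (\<Sum>i\<in>{0}. fps_nth EE i * fps_nth f (m - i))"
      by (rule sum.mono_neutral_right) (use assms that in auto)
    finally show ?thesis using assms that EE_props(4) by auto
  qed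
  then show ?thesis by auto
qed

lemma echelon_Suc:
  assumes ech: "echelon (i * (p - 1)) (dimk i) (Bs i)"
  shows "echelon (Suc i * (p - 1)) (dimk (Suc i)) (Bs (Suc i)) \<and> dimk i \<le> dimk (Suc i)"
proof -
  \<comment> \<open>That \<open>dimk\<close> grows is not yet known. With the maximum an echelon
    basis of length n exists in either case, and \<open>echelon_dim\<close> then gives n =
    \<open>dimk (Suc i)\<close>.\<close>
  define n where "n = max (dimk i) (dimk (Suc i))"
  have ki: "katz_indices p (Suc i) TYPE('a) = {dimk i..<dimk (Suc i)}"
    by (simp add: katz_indices_def dimk_def)
  have "1 \<le> Suc i" by simp
  note sp0 = splitting[unfolded katz_splitting_def, THEN spec, THEN mp, OF this, unfolded diff_Suc_1 EE_def [symmetric]]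
  note sp = sp0[THEN conjunct1] sp0[THEN conjunct2, THEN conjunct1]
  have e: "echelon (Suc i * (p - 1)) n (Bs (Suc i))"
    unfolding echelon_def
  proof (intro conjI ballI)
    show "\<forall>j<n. Bs (Suc i) j \<in> modforms (Suc i * (p - 1)) (Zp v) \<and> fps_nth (Bs (Suc i) j) j = 1 \<and> (\<forall>m<j. fps_nth (Bs (Suc i) j) m = 0)"
    proof (intro allI impI)
      fix j assume j: "j < n"
      show "Bs (Suc i) j \<in> modforms (Suc i * (p - 1)) (Zp v) \<and> fps_nth (Bs (Suc i) j) j = 1 \<and> (\<forall>m<j. fps_nth (Bs (Suc i) j) m = 0)"
      proof (cases "j < dimk i")
        case True
        then have b: "Bs i j \<in> modforms (i * (p - 1)) (Zp v)" "fps_nth (Bs i j) j = 1" "\<forall>m<j. fps_nth (Bs i j) m = 0"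
          using ech by (auto simp: echelon_def)
        have "EE * Bs i j \<in> modforms (p - 1 + i * (p - 1)) (Zp v)"
          by (rule modforms_mult[OF subring_Zp EE_props(1) b(1)])
        then show ?thesis using leading_EE_mult[OF b(2,3)] True by simp
      next
        case False
        then have "j \<in> katz_indices p (Suc i) TYPE('a)" using j unfolding ki n_def by auto
        then show ?thesis using sp(1) False by auto
      qed
    qed
    fix f assume "f \<in> modforms (Suc i * (p - 1)) (Zp v)"
    then obtain h b where hb: "f = EE * h + b" "h \<in> modforms (i * (p - 1)) (Zp v)" "b \<in> katz_B p g (Zp v) (Suc i)"
      unfolding sp(2) by blast
    obtain c where c: "\<forall>j. c j \<in> Zp v" "h = (\<Sum>j<dimk i. fps_const (c j) * Bs i j)"
      using ech hb(2) by (auto simp: echelon_def)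
    have "b \<in> span_over (Zp v) (g (Suc i) ` {dimk i..<dimk (Suc i)})"
      using hb(3) unfolding katz_B_def ki by simp
    then have "\<exists>c'. (\<forall>j. c' j \<in> Zp v) \<and> b = (\<Sum>j\<in>{dimk i..<n}. fps_const (c' j) * g (Suc i) j)"
    proof (induction rule: span_over_induct)
      case 0
      then show ?case using subring_setD[OF subring_Zp] by (intro exI[of _ "\<lambda>_. 0"]) auto
    next
      case (add s t)
      then obtain x y where "\<forall>j. x j \<in> Zp v" "s = (\<Sum>j\<in>{dimk i..<n}. fps_const (x j) * g (Suc i) j)"
        "\<forall>j. y j \<in> Zp v" "t = (\<Sum>j\<in>{dimk i..<n}. fps_const (y j) * g (Suc i) j)" by blast
      then show ?case using subring_setD[OF subring_Zp]
        by (intro exI[of _ "\<lambda>j. x j + y j"]) (auto simp: sum.distrib distrib_right simp flip: fps_const_add)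
    next
      case (scale a s)
      then obtain l where l: "l \<in> {dimk i..<n}" "s = g (Suc i) l" by (auto simp: n_def)
      have "fps_const a * s = (\<Sum>j\<in>{dimk i..<n}. if j = l then fps_const a * g (Suc i) j else 0)"
        using l by (subst sum.delta) auto
      also have "\<dots> = (\<Sum>j\<in>{dimk i..<n}. fps_const (if j = l then a else 0) * g (Suc i) j)"
        by (intro sum.cong) auto
      finally show ?case using scale subring_setD[OF subring_Zp]
        by (intro exI[of _ "\<lambda>j. if j = l then a else 0"]) auto
    qed
    then obtain c' where c': "\<forall>j. c' j \<in> Zp v" "b = (\<Sum>j\<in>{dimk i..<n}. fps_const (c' j) * g (Suc i) j)" by blast
    define c'' where "c'' = (\<lambda>j. if j < dimk i then c j else c' j)"
    have split: "{..<n} = {..<dimk i} \<union> {dimk i..<n}" by (auto simp: n_def)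
    have "(\<Sum>j<n. fps_const (c'' j) * Bs (Suc i) j) =
        (\<Sum>j<dimk i. fps_const (c'' j) * Bs (Suc i) j) + (\<Sum>j\<in>{dimk i..<n}. fps_const (c'' j) * Bs (Suc i) j)"
      unfolding split by (rule sum.union_disjoint) auto
    also have "(\<Sum>j<dimk i. fps_const (c'' j) * Bs (Suc i) j) = EE * h"
      unfolding c(2) sum_distrib_left by (intro sum.cong refl) (simp add: c''_def mult_ac)
    also have "(\<Sum>j\<in>{dimk i..<n}. fps_const (c'' j) * Bs (Suc i) j) = b"
      unfolding c'(2) by (intro sum.cong refl) (simp add: c''_def)
    finally have "f = (\<Sum>j<n. fps_const (c'' j) * Bs (Suc i) j)" using hb(1) by simp
    moreover have "\<forall>j. c'' j \<in> Zp v" using c c' by (simp add: c''_def)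
    ultimately show "\<exists>c. (\<forall>j. c j \<in> Zp v) \<and> f = (\<Sum>j<n. fps_const (c j) * Bs (Suc i) j)" by blast
  qed
  have "dimk (Suc i) = n" using echelon_dim[OF e] by (simp add: dimk_def dim_modforms_def)
  then show ?thesis using e n_def by simp
qed

lemma echelon_Bs: "echelon (i * (p - 1)) (dimk i) (Bs i)"
proof (induction i)
  case 0
  then show ?case using echelon_0 unfolding dimk_0 mult_0 .
next
  case (Suc i)
  then show ?case using echelon_Suc by blast
qed

lemma dimk_mono: "i \<le> j \<Longrightarrow> dimk i \<le> dimk j"
  by (rule lift_Suc_mono_le) (use echelon_Suc[OF echelon_Bs] in auto)

lemma dimk_pos: "dimk i \<ge> 1"
  using dimk_mono[of 0 i] dimk_0 by simp

lemma modforms_echelon: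
  assumes "f \<in> modforms (i * (p - 1)) (Zp v)"
  obtains c where "\<And>j. c j \<in> Zp v" "f = (\<Sum>j<dimk i. fps_const (c j) * Bs i j)"
  using echelon_Bs[of i] assms unfolding echelon_def by blast

lemma Bs_props:
  assumes "j < dimk i"
  shows "Bs i j \<in> modforms (i * (p - 1)) (Zp v)" "fps_nth (Bs i j) j = 1" "\<And>m. m < j \<Longrightarrow> fps_nth (Bs i j) m = 0"
  using echelon_Bs[of i] assms by (auto simp: echelon_def)

lemma modforms_order_bound:
  assumes f: "f \<in> modforms (i * (p - 1)) (Zp v)" and z: "\<And>m. m < dimk i \<Longrightarrow> fps_nth f m = 0"
  shows "f = 0"
proof -
  obtain c where c: "\<And>j. c j \<in> Zp v" "f = (\<Sum>j<dimk i. fps_const (c j) * Bs i j)"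
    using modforms_echelon[OF f] by blast
  have "c j = 0" if "j < dimk i" for j
    using triangular_zero[of "dimk i" "Bs i" "dimk i" c j] z Bs_props that unfolding c(2) by blast
  then show ?thesis unfolding c(2) by (intro sum.neutral) auto
qed

text \<open>If all \<open>M\<^sub>i\<^sub>(\<^sub>p\<^sub>-\<^sub>1\<^sub>)\<close> with \<open>i \<le> 3\<close> were one-dimensional, then \<open>E\<^sub>2\<^sub>(\<^sub>p\<^sub>-\<^sub>1\<^sub>)\<close> and \<open>E\<^sub>3\<^sub>(\<^sub>p\<^sub>-\<^sub>1\<^sub>)\<close> would be powers
  of \<open>E\<^sub>p\<^sub>-\<^sub>1\<close>, and the first two coefficients would force \<open>(2\<^sup>p\<^sup>-\<^sup>1 - 1)\<^sup>2 = 0\<close>.\<close>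

lemma ex_dimk_ge_2: "\<exists>l. dimk l \<ge> 2"
proof (rule ccontr)
  assume "\<nexists>l. dimk l \<ge> 2"
  then have d1: "dimk l = 1" for l using dimk_pos[of l] by (metis Suc_1 le_antisym not_less_eq_eq One_nat_def)
  define a where "a = p - 1"
  define t :: 'a where "t = 2 ^ a"
  have a: "a > 0" using p_gt_1 by (simp add: a_def)
  define c :: "nat \<Rightarrow> 'a" where "c = (\<lambda>m. - (2 * of_nat (a * m) / bernoulli_number (a * m)))"
  define F :: "nat \<Rightarrow> 'a fps" where "F = (\<lambda>m. eisenstein (a * m))"
  have F0: "fps_nth (F m) 0 = 1" and F1: "fps_nth (F m) 1 = c m"
    and F2: "fps_nth (F m) 2 = c m * (1 + 2 ^ (a * m - 1))" for m
  proof -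
    have "d dvd 2 \<longleftrightarrow> d = 1 \<or> d = 2" for d :: nat
      using two_is_prime_nat prime_nat_iff[of 2] by auto
    then have "{d :: nat. d dvd 2} = {1, 2}" by auto
    then show "fps_nth (F m) 0 = 1" "fps_nth (F m) 1 = c m" "fps_nth (F m) 2 = c m * (1 + 2 ^ (a * m - 1))"
      by (simp_all add: F_def eisenstein_def c_def)
  qed
  \<comment> \<open>In a one-dimensional space a form is determined by its constant term.\<close>
  have eq: "F m = F 1 ^ m" if m: "m > 0" for m
  proof -
    have "F m \<in> modforms (m * (p - 1)) (Zp v)"
      using eisenstein_modforms(1)[of "a * m"] m a by (simp add: F_def a_def mult.commute)
    moreover have "F 1 ^ m \<in> modforms (m * (p - 1)) (Zp v)"
      using modforms_power[OF subring_Zp EE_props(1), of m] by (simp add: F_def a_def EE_def)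
    ultimately have "F m + fps_const (- 1) * F 1 ^ m \<in> modforms (m * (p - 1)) (Zp v)"
      using subring_setD[OF subring_Zp] by (intro modforms_add[OF subring_Zp] modforms_scale[OF subring_Zp]) auto
    moreover have "fps_nth (F 1 ^ m) 0 = 1" using F0 by (simp add: fps_power_zeroth)
    then have "fps_nth (F m + fps_const (- 1) * F 1 ^ m) j = 0" if "j < dimk m" for j
      using that d1[of m] F0[of m] by simp
    ultimately have "F m + fps_const (- 1) * F 1 ^ m = 0" by (rule modforms_order_bound)
    then show ?thesis by (simp add: fps_eq_iff)
  qed
  have n2: "fps_nth (f * h) 1 = fps_nth f 0 * fps_nth h 1 + fps_nth f 1 * fps_nth h 0"
    "fps_nth (f * h) 2 = fps_nth f 0 * fps_nth h 2 + fps_nth f 1 * fps_nth h 1 + fps_nth f 2 * fps_nth h 0" for f h :: "'a fps"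
    by (simp_all add: fps_mult_nth numeral_2_eq_2)
  have S0: "fps_nth (F 1 * F 1) 0 = 1" using F0[of 1] by simp
  have S1: "fps_nth (F 1 * F 1) 1 = 2 * c 1" using F0[of 1] F1[of 1] by (simp only: n2) simp
  have S2: "fps_nth (F 1 * F 1) 2 = 2 * (c 1 * (1 + 2 ^ (a * 1 - 1))) + c 1 * c 1"
    using F0[of 1] F1[of 1] F2[of 1] by (simp only: n2) simp
  have c2: "c 2 = 2 * c 1" using F1[of 2] eq[of 2] S1 by (simp add: power2_eq_square)
  have c3: "c 3 = 3 * c 1"
  proof -
    have "fps_nth (F 1 * (F 1 * F 1)) 1 = 3 * c 1"
      unfolding n2(1)[of "F 1"] S0 S1 F0 F1 by simp
    then show ?thesis using F1[of 3] eq[of 3] by (simp add: power3_eq_cube mult.assoc)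
  qed
  have e2: "c 2 * (1 + 2 ^ (a * 2 - 1)) = 2 * (c 1 * (1 + 2 ^ (a * 1 - 1))) + c 1 * c 1"
    using F2[of 2] eq[of 2] S2 by (simp add: power2_eq_square)
  have e3: "c 3 * (1 + 2 ^ (a * 3 - 1)) = 3 * (c 1 * (1 + 2 ^ (a * 1 - 1))) + 3 * (c 1 * c 1)"
  proof -
    have "fps_nth (F 1 * (F 1 * F 1)) 2 = 3 * (c 1 * (1 + 2 ^ (a * 1 - 1))) + 3 * (c 1 * c 1)"
      unfolding n2(2)[of "F 1"] S0 S1 S2 F0 F1 F2 by (simp add: algebra_simps)
    then show ?thesis using F2[of 3] eq[of 3] by (simp add: power3_eq_cube mult.assoc)
  qed
  have pw: "2 * 2 ^ (a * m - 1) = t ^ m" if "m > 0" for m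
  proof -
    have "Suc (a * m - 1) = a * m" using that a by simp
    then have "2 * 2 ^ (a * m - 1) = (2 :: 'a) ^ (a * m)" by (metis power_Suc)
    then show ?thesis by (simp add: t_def power_mult)
  qed
  have c1: "c 1 \<noteq> 0"
    using zeta_inv_pow_weight(1)[of a] a by (simp add: c_def a_def)
  have "c 1 * (2 + t ^ 2) = c 1 * (2 + t + c 1)"
  proof -
    have "c 1 * (2 + t ^ 2) = c 2 * (1 + 2 ^ (a * 2 - 1))"
      unfolding c2 pw[of 2, simplified, symmetric] by (simp add: algebra_simps)
    also have "\<dots> = c 1 * (2 + 2 * 2 ^ (a * 1 - 1) + c 1)" unfolding e2 by (simp add: algebra_simps)
    finally show ?thesis using pw[of 1] by simp
  qed
  then have x2: "c 1 = t ^ 2 - t" using c1 by simp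
  have "3 * c 1 * (2 + t ^ 3) = 3 * c 1 * (2 + t + 2 * c 1)"
  proof -
    have "3 * c 1 * (2 + t ^ 3) = 2 * (c 3 * (1 + 2 ^ (a * 3 - 1)))"
      unfolding c3 pw[of 3, simplified, symmetric] by (simp add: algebra_simps)
    also have "\<dots> = 3 * c 1 * (2 + 2 * 2 ^ (a * 1 - 1) + 2 * c 1)" unfolding e3 by (simp add: algebra_simps)
    finally show ?thesis using pw[of 1] by simp
  qed
  then have x3: "t ^ 3 = t + 2 * c 1" using c1 by simp
  have "t * (t - 1) * (t - 1) = t ^ 3 - t - 2 * (t ^ 2 - t)"
    by (simp add: algebra_simps power2_eq_square power3_eq_cube)
  also have "\<dots> = 0" using x2 x3 by simp
  finally have "t = 0 \<or> t = 1" by auto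
  moreover have "t = of_nat (2 ^ a)" by (simp add: t_def)
  ultimately have "(2 :: nat) ^ a = 0 \<or> (2 :: nat) ^ a = 1"
    by (metis of_nat_0 of_nat_1 of_nat_eq_iff)
  then show False using a by simp
qed

text \<open>Once some level contains a form q + ..., its j-th power has order exactly j, so it would
  have to vanish if the dimension at its level were at most j.\<close>

lemma ex_level: "\<exists>l. j < dimk l"
proof -
  obtain l where l: "dimk l \<ge> 2" using ex_dimk_ge_2 by blast
  define f where "f = Bs l 1"
  have f: "f \<in> modforms (l * (p - 1)) (Zp v)" "fps_nth f 1 = 1" "fps_nth f 0 = 0"
    using Bs_props[of 1 l] l by (auto simp: f_def)
  have fj: "fps_nth (f ^ j) j = 1" "\<And>m. m < j \<Longrightarrow> fps_nth (f ^ j) m = 0"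
    using f by (simp_all add: startsby_zero_power_nth_same startsby_zero_power_prefix)
  have "j < dimk (j * l)"
  proof (rule ccontr)
    assume "\<not> j < dimk (j * l)"
    moreover have "f ^ j \<in> modforms (j * l * (p - 1)) (Zp v)"
      using modforms_power[OF subring_Zp f(1), of j] by (simp add: mult.assoc)
    ultimately have "f ^ j = 0" using fj(2) by (intro modforms_order_bound[of _ "j * l"]) auto
    then have "fps_nth (f ^ j) j = 0" by (simp only: fps_zero_nth)
    then show False using fj(1) by simp
  qed
  then show ?thesis by blast
qed

section \<open>Levels and the coordinates of a q-expansion\<close>

definition lev :: "nat \<Rightarrow> nat" where
  "lev j = (LEAST l. j < dimk l)"

lemma lev_le_iff: "lev j \<le> l \<longleftrightarrow> j < dimk l"
proof
  assume "lev j \<le> l"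
  moreover have "j < dimk (lev j)" unfolding lev_def by (rule LeastI_ex[OF ex_level])
  ultimately show "j < dimk l" using dimk_mono by (meson less_le_trans)
next
  show "j < dimk l \<Longrightarrow> lev j \<le> l" unfolding lev_def by (rule Least_le)
qed

definition iE :: "'a fps" where "iE = inverse EE"

lemma EE_iE: "EE * iE = 1" "iE * EE = 1"
proof -
  show "iE * EE = 1" unfolding iE_def using EE_props(4) by (intro inverse_mult_eq_1) simp
  then show "EE * iE = 1" by (simp add: mult.commute)
qed

lemma EE_iE_power: "EE ^ n * iE ^ n = 1" "iE ^ n * EE ^ n = 1"
  by (simp_all add: EE_iE flip: power_mult_distrib)

lemma vf_iE: "vf 0 iE" unfolding iE_def by (intro vf_inverse EE_props)

lemma iE_0: "fps_nth iE 0 = 1" by (simp add: iE_def EE_props(4))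

definition ebas :: "nat \<Rightarrow> 'a fps" where
  "ebas j = Bs (lev j) j * iE ^ lev j"

text \<open>Raising the level multiplies numerator and denominator by E, so the quotient does not
  depend on the level at which it is formed.\<close>

lemma Bs_ebas:
  assumes "j < dimk i"
  shows "Bs i j * iE ^ i = ebas j"
proof -
  have "lev j \<le> i" using assms unfolding lev_le_iff .
  then show ?thesis
  proof (induction i rule: dec_induct)
    case (step i)
    then have "j < dimk i" using lev_le_iff by blast
    then have "Bs (Suc i) j * iE ^ Suc i = (EE * iE) * (Bs i j * iE ^ i)" by (simp add: mult_ac)
    then show ?case using step.IH by (simp only: EE_iE mult_1_left)
  qed (simp add: ebas_def)
qed

lemma ebas_props: "fps_nth (ebas j) j = 1" "m < j \<Longrightarrow> fps_nth (ebas j) m = 0" "vf 0 (ebas j)"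
proof -
  have j: "j < dimk (lev j)" using lev_le_iff by blast
  note B = Bs_props[OF j]
  have nth: "fps_nth (ebas j) m = (if m = j then 1 else 0)" if "m \<le> j" for m
  proof -
    have "fps_nth (iE ^ lev j * Bs (lev j) j) m = (\<Sum>i=0..m. fps_nth (iE ^ lev j) i * fps_nth (Bs (lev j) j) (m - i))" by (simp add: fps_mult_nth)
    also have "\<dots> = (\<Sum>i\<in>{0}. fps_nth (iE ^ lev j) i * fps_nth (Bs (lev j) j) (m - i))"
      by (rule sum.mono_neutral_right) (use B that in auto)
    finally show ?thesis using B that iE_0 by (auto simp: ebas_def mult.commute fps_power_zeroth)
  qed
  then show "fps_nth (ebas j) j = 1" "m < j \<Longrightarrow> fps_nth (ebas j) m = 0" by auto
  show "vf 0 (ebas j)" unfolding ebas_def by (intro vf_mult0 vf_modforms[OF B(1)] vf_power0 vf_iE)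
qed

fun coord :: "'a fps \<Rightarrow> nat \<Rightarrow> 'a" where
  "coord y j = fps_nth y j - (\<Sum>t<j. coord y t * fps_nth (ebas t) j)"

declare coord.simps [simp del]

lemma coord_expand:
  assumes "n \<le> J"
  shows "fps_nth y n = (\<Sum>t\<le>J. coord y t * fps_nth (ebas t) n)"
proof -
  have "(\<Sum>t\<le>J. coord y t * fps_nth (ebas t) n) = (\<Sum>t\<le>n. coord y t * fps_nth (ebas t) n)"
    by (rule sum.mono_neutral_right) (use assms ebas_props(2) in auto)
  also have "\<dots> = (\<Sum>t<n. coord y t * fps_nth (ebas t) n) + coord y n"
    by (simp add: lessThan_Suc_atMost [symmetric] ebas_props(1))
  finally show ?thesis by (simp add: coord.simps[of y n])
qed

lemma coord_unique:
  assumes "\<And>n. n \<le> J \<Longrightarrow> fps_nth y n = (\<Sum>t\<le>J. c t * fps_nth (ebas t) n)" "j \<le> J"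
  shows "coord y j = c j"
  using assms(2)
proof (induction j rule: less_induct)
  case (less j)
  have "fps_nth y j = (\<Sum>t\<le>J. c t * fps_nth (ebas t) j)" using assms(1) less.prems by simp
  also have "\<dots> = (\<Sum>t\<le>j. c t * fps_nth (ebas t) j)"
    by (rule sum.mono_neutral_right) (use less.prems ebas_props(2) in auto)
  also have "\<dots> = (\<Sum>t<j. c t * fps_nth (ebas t) j) + c j"
    by (simp add: lessThan_Suc_atMost [symmetric] ebas_props(1))
  also have "(\<Sum>t<j. c t * fps_nth (ebas t) j) = (\<Sum>t<j. coord y t * fps_nth (ebas t) j)"
    using less by (intro sum.cong) auto
  finally show ?case by (simp add: coord.simps[of y j])
qed

lemma coord_cong:
  assumes "\<And>n. n \<le> j \<Longrightarrow> fps_nth y n = fps_nth z n"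
  shows "coord y j = coord z j"
  by (rule coord_unique[of j]) (use assms coord_expand in auto)

lemma coord_add: "coord (y + z) j = coord y j + coord z j"
  by (rule coord_unique[of j]) (use coord_expand in \<open>auto simp: distrib_right sum.distrib\<close>)

lemma coord_scale: "coord (fps_const c * y) j = c * coord y j"
  by (rule coord_unique[of j]) (use coord_expand[of _ j y] in \<open>auto simp: sum_distrib_left mult.assoc\<close>)

lemma coord_0: "coord 0 j = 0"
  using coord_scale[of 0 0 j] by simp

lemma coord_diff: "coord (y - z) j = coord y j - coord z j"
  using coord_add[of y "fps_const (- 1) * z" j] coord_scale[of "- 1" z j] by (simp flip: fps_const_neg)

lemma coord_sum: "coord (sum f A) j = (\<Sum>i\<in>A. coord (f i) j)"
  by (induction A rule: infinite_finite_induct) (auto simp: coord_0 coord_add)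

lemma coord_vf:
  assumes "vf M y"
  shows "vge M (coord y j)"
proof (induction j rule: less_induct)
  case (less j)
  have "vge M (\<Sum>t<j. coord y t * fps_nth (ebas t) j)"
  proof (rule vge_sum)
    fix t assume "t \<in> {..<j}"
    then have "vge M (coord y t)" using less.IH[of t] by simp
    moreover have "vge 0 (fps_nth (ebas t) j)" using ebas_props(3) by (simp add: vf_def)
    ultimately show "vge M (coord y t * fps_nth (ebas t) j)" by (rule vge_mult0(1))
  qed
  moreover have "vge M (fps_nth y j)" using assms by (simp add: vf_def)
  ultimately show ?case unfolding coord.simps[of y j] by (rule vge_diff[rotated])
qed

lemma coord_ring:
  assumes R: "subring_set R" "Zp v \<subseteq> R" and y: "\<And>n. fps_nth y n \<in> R"
  shows "coord y j \<in> R"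
proof -
  have "fps_nth (ebas t) n \<in> Zp v" for t n
  proof -
    define S where "S = {f :: 'a fps. \<forall>n. fps_nth f n \<in> Zp v}"
    have S: "subring_set S" unfolding S_def by (rule subring_set_fps[OF subring_Zp])
    have "Bs (lev t) t \<in> S"
      using modforms_coeff[OF subring_Zp Bs_props(1)[of t "lev t"]] lev_le_iff[of t "lev t"] by (simp add: S_def)
    moreover have "iE \<in> S"
      using subring_set_fps_inverse[OF subring_Zp modforms_coeff[OF subring_Zp EE_props(1)] EE_props(4)]
      by (simp add: S_def iE_def)
    ultimately have "ebas t \<in> S"
      unfolding ebas_def by (intro subring_setD(6)[OF S] subring_set_power[OF S])
    then show ?thesis by (simp add: S_def)
  qed
  then have e: "fps_nth (ebas t) n \<in> R" for t n using R(2) by blast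
  show ?thesis
  proof (induction j rule: less_induct)
    case (less j)
    then show ?case
      unfolding coord.simps[of y j] using y e
      by (intro subring_setD[OF R(1)] subring_set_sum[OF R(1)]) auto
  qed
qed

lemma coord_ebas: "coord (ebas s) j = (if j = s then 1 else 0)"
proof (rule coord_unique[of "max s j"])
  fix n
  have "(\<Sum>t\<le>max s j. (if t = s then 1 else 0) * fps_nth (ebas t) n) = (\<Sum>t\<le>max s j. if t = s then fps_nth (ebas t) n else 0)"
    by (intro sum.cong) auto
  then show "fps_nth (ebas s) n = (\<Sum>t\<le>max s j. (if t = s then 1 else 0) * fps_nth (ebas t) n)" by simp
qed simp

lemma coord_modform:
  assumes f: "f \<in> modforms (i * (p - 1)) (Zp v)"
  shows "vge 0 (coord (f * iE ^ i) j)" "lev j > i \<Longrightarrow> coord (f * iE ^ i) j = 0"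
proof -
  show "vge 0 (coord (f * iE ^ i) j)"
    by (rule coord_vf[OF vf_mult0(1)[OF vf_modforms[OF f] vf_power0[OF vf_iE]]])
  assume "lev j > i"
  then have j: "\<not> j < dimk i" using lev_le_iff[of j i] by simp
  obtain c where c: "f = (\<Sum>j<dimk i. fps_const (c j) * Bs i j)"
    using modforms_echelon[OF f] by blast
  have "f * iE ^ i = (\<Sum>j<dimk i. fps_const (c j) * ebas j)"
    unfolding c sum_distrib_right by (intro sum.cong refl) (simp add: mult.assoc Bs_ebas)
  then show "coord (f * iE ^ i) j = 0"
    using j by (simp add: coord_sum coord_scale coord_ebas)
qed

end

section \<open>Overconvergence of Frobenius\<close>

context Katz
begin

definition ov :: "real \<Rightarrow> 'a fps \<Rightarrow> bool" where
  "ov \<rho> y \<longleftrightarrow> (\<forall>j. vge (\<rho> * real (lev j)) (coord y j))"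

lemma ov_mono: "ov \<rho> y \<Longrightarrow> \<rho>' \<le> \<rho> \<Longrightarrow> ov \<rho>' y"
  unfolding ov_def by (meson mult_right_mono of_nat_0_le_iff vge_mono)

lemma ov_add: "ov \<rho> y \<Longrightarrow> ov \<rho> z \<Longrightarrow> ov \<rho> (y + z)"
  unfolding ov_def coord_add by (blast intro: vge_add)

lemma ov_diff: "ov \<rho> y \<Longrightarrow> ov \<rho> z \<Longrightarrow> ov \<rho> (y - z)"
  unfolding ov_def coord_diff by (blast intro: vge_diff)

lemma ov_scale: "vge 0 c \<Longrightarrow> ov \<rho> y \<Longrightarrow> ov \<rho> (fps_const c * y)"
  unfolding ov_def coord_scale by (blast intro: vge_mult0)

lemma ov_0: "ov \<rho> 0"
  by (simp add: ov_def coord_0)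

lemma ov_sum: "(\<And>i. i \<in> A \<Longrightarrow> ov \<rho> (f i)) \<Longrightarrow> ov \<rho> (sum f A)"
  by (induction A rule: infinite_finite_induct) (auto intro: ov_0 ov_add)

lemma ebas_modform:
  "ebas s * ebas t = (Bs (lev s) s * Bs (lev t) t) * iE ^ (lev s + lev t)"
  "Bs (lev s) s * Bs (lev t) t \<in> modforms ((lev s + lev t) * (p - 1)) (Zp v)"
proof -
  show "ebas s * ebas t = (Bs (lev s) s * Bs (lev t) t) * iE ^ (lev s + lev t)"
    by (simp add: ebas_def power_add mult_ac)
  show "Bs (lev s) s * Bs (lev t) t \<in> modforms ((lev s + lev t) * (p - 1)) (Zp v)"
    unfolding distrib_right
    by (intro modforms_mult[OF subring_Zp] Bs_props(1)) (use lev_le_iff in auto)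
qed

definition trunc :: "nat \<Rightarrow> 'a fps \<Rightarrow> 'a fps" where
  "trunc j y = (\<Sum>s\<le>j. fps_const (coord y s) * ebas s)"

lemma trunc_nth: "n \<le> j \<Longrightarrow> fps_nth (trunc j y) n = fps_nth y n"
  unfolding trunc_def using coord_expand[of n j y] by (simp add: fps_sum_nth)

lemma coord_mult:
  "coord (y * z) j = (\<Sum>s\<le>j. \<Sum>t\<le>j. coord y s * (coord z t * coord (ebas s * ebas t) j))"
proof -
  have "coord (y * z) j = coord (trunc j y * trunc j z) j"
    by (rule coord_cong) (auto simp: fps_mult_nth trunc_nth intro!: sum.cong)
  also have "trunc j y * trunc j z = (\<Sum>s\<le>j. \<Sum>t\<le>j. fps_const (coord y s) * (fps_const (coord z t) * (ebas s * ebas t)))"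
    unfolding trunc_def sum_product by (intro sum.cong refl) (simp only: mult_ac)
  finally show ?thesis by (simp add: coord_sum coord_scale)
qed

text \<open>The product of basis functions of levels s and t is a form of level s + t over E^(s+t),
  so it has integral coordinates and none above s + t; the two rates add up exactly to what that
  level requires.\<close>

lemma ov_mult:
  assumes \<rho>: "\<rho> \<ge> 0" and y: "ov \<rho> y" and z: "ov \<rho> z"
  shows "ov \<rho> (y * z)"
  unfolding ov_def
proof
  fix j
  have trm: "vge (\<rho> * real (lev j)) (coord y s * (coord z t * coord (ebas s * ebas t) j))" for s t
  proof (cases "lev j > lev s + lev t")
    case True
    have "coord (ebas s * ebas t) j = 0"
      unfolding ebas_modform(1) by (rule coord_modform(2)[OF ebas_modform(2) True])
    then show ?thesis by simp
  next
    case False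
    have "vge 0 (coord (ebas s * ebas t) j)"
      unfolding ebas_modform(1) by (rule coord_modform(1)[OF ebas_modform(2)])
    then have "vge (\<rho> * real (lev s) + \<rho> * real (lev t)) (coord y s * (coord z t * coord (ebas s * ebas t) j))"
      using y z by (intro vge_mult vge_mult0(1)) (auto simp: ov_def)
    moreover have "\<rho> * real (lev j) \<le> \<rho> * real (lev s) + \<rho> * real (lev t)"
      using False \<rho> by (simp add: mult_left_mono flip: distrib_left of_nat_add)
    ultimately show ?thesis using vge_mono by blast
  qed
  show "vge (\<rho> * real (lev j)) (coord (y * z) j)"
    unfolding coord_mult[of y z j] by (intro vge_sum trm)
qed

lemma lev_0: "lev 0 = 0"
proof -
  have "lev 0 \<le> 0" unfolding lev_le_iff using dimk_pos[of 0] by simp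
  then show ?thesis by simp
qed

lemma ov_1: "ov \<rho> 1"
proof -
  have "ebas 0 = 1" by (simp add: ebas_def lev_0)
  then have "coord 1 j = (if j = 0 then 1 else 0)" for j using coord_ebas[of 0 j] by simp
  then show ?thesis by (auto simp: ov_def lev_0)
qed

lemma ov_power: "\<rho> \<ge> 0 \<Longrightarrow> ov \<rho> y \<Longrightarrow> ov \<rho> (y ^ n)"
  by (induction n) (auto intro: ov_1 ov_mult)

text \<open>For a fixed coordinate the required bound is a single number, which a sufficiently
  precise p-adic approximation meets.\<close>

lemma ov_approx:
  assumes "\<And>N :: nat. \<exists>z. ov \<rho> z \<and> vf (real N) (y - z)"
  shows "ov \<rho> y"
  unfolding ov_def
proof
  fix j
  obtain N :: nat where N: "\<rho> * real (lev j) \<le> real N" using real_arch_simple by blast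
  obtain z where z: "ov \<rho> z" "vf (real N) (y - z)" using assms by blast
  have "vge (\<rho> * real (lev j)) (coord (y - z) j)" using coord_vf[OF z(2)] N vge_mono by blast
  then have "vge (\<rho> * real (lev j)) (coord (y - z) j + coord z j)" using z(1) by (intro vge_add) (auto simp: ov_def)
  then show "vge (\<rho> * real (lev j)) (coord y j)" by (simp add: coord_diff)
qed

text \<open>The partial sums of the geometric series keep the rate because powers do, and they
  converge p-adically because y is 1 mod p.\<close>

lemma ov_inverse:
  assumes \<rho>: "\<rho> \<ge> 0" and y: "ov \<rho> y" "vf 1 (y - 1)" "fps_nth y 0 = 1"
  shows "ov \<rho> (inverse y)"
proof (rule ov_approx)
  fix N :: nat
  define z where "z = (\<Sum>r<N. (1 - y) ^ r)"
  have "ov \<rho> z" unfolding z_def using \<rho> y by (intro ov_sum ov_power ov_diff ov_1)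
  moreover have "vf (real N) (inverse y - z)"
  proof -
    have i: "inverse y * y = 1" using y(3) by (intro inverse_mult_eq_1) simp
    have "(1 - (1 - y)) * z = 1 - (1 - y) ^ N"
      unfolding z_def using one_diff_power_eq by metis
    then have "y * z = 1 - (1 - y) ^ N" by simp
    then have "inverse y * (y * z) = inverse y - inverse y * (1 - y) ^ N" by (simp add: right_diff_distrib)
    then have eq: "inverse y - z = inverse y * (1 - y) ^ N" using i by (simp add: mult.assoc [symmetric])
    have "vf 1 (1 - y)" using vf_uminus[OF y(2)] by simp
    then have "vf (real N) ((1 - y) ^ N)" using vf_power[of 1 "1 - y" N] by simp
    moreover have "vf 0 (y - 1 + 1)" using y(2) vf_mono by (intro vf_add vf_1) fastforce
    then have "vf 0 (inverse y)" using y(3) by (intro vf_inverse) simp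
    ultimately show ?thesis unfolding eq by (intro vf_mult0(2))
  qed
  ultimately show "\<exists>z. ov \<rho> z \<and> vf (real N) (inverse y - z)" by blast
qed

text \<open>The slope of the pole bound: a factor p^(p-1) in the trace compensates a shift by p
  levels.\<close>

definition theta :: real where "theta = (real p - 1) / real p"

lemma theta: "theta * real p = real p - 1" "0 < theta" "theta < 1"
  using p_gt_1 by (auto simp: theta_def)

definition xq :: "'a fps" where "xq = fps_V p EE * iE"

text \<open>Tracing \<open>V(h) (E - p\<^sup>p\<^sup>-\<^sup>1 V(E))\<^sup>N\<close> down to level one with larger and larger \<open>N\<close> bounds the
  poles of \<open>V(h) / E\<^sup>i\<close> modulo powers of \<open>p\<close>; the powers of \<open>1 - p\<^sup>p\<^sup>-\<^sup>1 V(E) / E\<close> are removed by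
  induction, because \<open>V(h) / E\<^sup>i \<cdot> (V(E) / E)\<^sup>r = V(h E\<^sup>r) / E\<^sup>i\<^sup>+\<^sup>r\<close>.\<close>

lemma frobenius_pole_bound_aux:
  assumes "h \<in> modforms (i * (p - 1)) (Zp v)"
  shows "vge (min (real n) (theta * (real (lev j) - real i * real p))) (coord (fps_V p h * iE ^ i) j)"
  using assms
proof (induction n arbitrary: h i j)
  case 0
  have "vge 0 (coord (fps_V p h * iE ^ i) j)"
    by (rule coord_vf[OF vf_mult0(1)[OF vf_V[OF vf_modforms[OF 0]] vf_power0[OF vf_iE]]])
  then show ?case by (rule vge_mono) simp
next
  case (Suc n)
  define a where "a = p - 1"
  define y where "y = fps_V p h * iE ^ i"
  define P :: 'a where "P = of_nat p ^ a"
  have ap: "real a = real p - 1" "a \<ge> 1" using p_gt_1 by (auto simp: a_def of_nat_diff)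
  show ?case
  \<comment> \<open>Up to this level the second entry of the minimum is at most n, so the induction
    hypothesis already gives the claim.\<close>
  proof (cases "lev j \<le> n + i * p")
    case True
    have "theta * (real (lev j) - real i * real p) \<le> real n"
    proof (cases "real (lev j) - real i * real p \<ge> 0")
      case nn: True
      then have "theta * (real (lev j) - real i * real p) \<le> 1 * (real (lev j) - real i * real p)"
        using theta by (intro mult_right_mono) auto
      also have "real (lev j) \<le> real (n + i * p)" using True by (simp only: of_nat_le_iff)
      finally show ?thesis by simp
    next
      case False
      then have "theta * (real (lev j) - real i * real p) \<le> 0"
        using theta by (simp add: mult_nonneg_nonpos)
      then show ?thesis by (rule order_trans) simp
    qed
    then show ?thesis using Suc.IH[OF Suc.prems, of j] by (auto elim!: vge_mono)
  next
    case False
    \<comment> \<open>N makes the trace error p^(n+1), since N + 1 - i (p - 1) = n + 1, while T has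
      level i + N = n + i p below \<open>lev j\<close> and therefore no coordinate there.\<close>
    define N where "N = n + i * a"
    have "i * a \<le> N + 1" by (simp add: N_def)
    then obtain T where T: "T \<in> modforms (i * (p - 1) + N * (p - 1)) (Zp v)"
      "vf (real (N + 1 - i * (p - 1))) (fps_V p h * (EE - fps_const P * fps_V p EE) ^ N - T)"
      using trace_padic[OF Suc.prems, of N] unfolding P_def a_def by blast
    define z where "z = y * (1 - fps_const P * xq) ^ N"
    have "fps_V p h * (EE - fps_const P * fps_V p EE) ^ N * iE ^ (i + N) = y * ((EE - fps_const P * fps_V p EE) * iE) ^ N"
      by (simp add: y_def power_add power_mult_distrib mult_ac)
    also have "(EE - fps_const P * fps_V p EE) * iE = 1 - fps_const P * xq"
      by (simp add: left_diff_distrib EE_iE xq_def mult.assoc)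
    finally have zT: "z - T * iE ^ (i + N) = (fps_V p h * (EE - fps_const P * fps_V p EE) ^ N - T) * iE ^ (i + N)"
      by (simp add: z_def left_diff_distrib)
    have "N + 1 - i * (p - 1) = Suc n" by (simp add: N_def a_def)
    then have "vf (real (Suc n)) (z - T * iE ^ (i + N))"
      unfolding zT using T(2) by (intro vf_mult0(1) vf_power0 vf_iE) simp
    then have "vge (real (Suc n)) (coord (z - T * iE ^ (i + N)) j)" by (rule coord_vf)
    moreover have "coord (T * iE ^ (i + N)) j = 0"
    proof (rule coord_modform(2))
      show "T \<in> modforms ((i + N) * (p - 1)) (Zp v)" using T(1) by (simp add: distrib_right)
      have "i * p = i + i * a" using p_gt_0 unfolding a_def by (cases p) auto
      then have "i + N = n + i * p" by (simp add: N_def)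
      then show "i + N < lev j" using False by simp
    qed
    ultimately have zj: "vge (real (Suc n)) (coord z j)" by (simp add: coord_diff)
    have yx: "y * xq ^ r = fps_V p (h * EE ^ r) * iE ^ (i + r)" for r
      using p_gt_0 by (simp add: y_def xq_def fps_V_mult fps_V_power power_mult_distrib power_add mult_ac)
    have "(1 - fps_const P * xq) ^ N = (\<Sum>r\<le>N. of_nat (N choose r) * (- (fps_const P * xq)) ^ r * 1 ^ (N - r))"
      using binomial_ring[of "- (fps_const P * xq)" 1 N] by (simp add: algebra_simps)
    also have "\<dots> = (\<Sum>r\<le>N. fps_const (of_nat (N choose r) * (- P) ^ r) * xq ^ r)"
    proof (rule sum.cong [OF refl])
      fix r
      have "- (fps_const P * xq) = fps_const (- P) * xq" by (simp flip: fps_const_neg)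
      then have "(- (fps_const P * xq)) ^ r = fps_const ((- P) ^ r) * xq ^ r"
        by (simp only: power_mult_distrib fps_const_power)
      then show "of_nat (N choose r) * (- (fps_const P * xq)) ^ r * 1 ^ (N - r) = fps_const (of_nat (N choose r) * (- P) ^ r) * xq ^ r"
        by (simp add: fps_of_nat [symmetric] mult.assoc [symmetric] del: fps_of_nat)
    qed
    finally have zs: "z = (\<Sum>r\<le>N. fps_const (of_nat (N choose r) * (- P) ^ r) * (y * xq ^ r))"
      unfolding z_def by (simp add: sum_distrib_left mult_ac)
    \<comment> \<open>The term r = 0 is y itself. Each other term has a factor P^r of valuation at
      least 1, which lifts the precision of the induction hypothesis from n to n + 1.\<close>
    have "{..N} = insert 0 {1..N}" by auto
    then have "z = y + (\<Sum>r\<in>{1..N}. fps_const (of_nat (N choose r) * (- P) ^ r) * (y * xq ^ r))"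
      unfolding zs by simp
    then have "coord y j = coord z j - (\<Sum>r\<in>{1..N}. of_nat (N choose r) * (- P) ^ r * coord (y * xq ^ r) j)"
      by (simp add: coord_add coord_sum coord_scale)
    moreover have "vge (min (real (Suc n)) (theta * (real (lev j) - real i * real p))) (coord z j)"
      using zj by (rule vge_mono) simp
    moreover have "vge (min (real (Suc n)) (theta * (real (lev j) - real i * real p)))
        (of_nat (N choose r) * (- P) ^ r * coord (y * xq ^ r) j)" if r: "r \<in> {1..N}" for r
    proof -
      have "h * EE ^ r \<in> modforms ((i + r) * (p - 1)) (Zp v)"
        unfolding distrib_right by (intro modforms_mult[OF subring_Zp Suc.prems] modforms_power[OF subring_Zp] EE_props)
      from Suc.IH[OF this, of j] have 1: "vge (min (real n) (theta * (real (lev j) - real (i + r) * real p))) (coord (y * xq ^ r) j)"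
        unfolding yx .
      have "vge (real (r * a)) (P ^ r)" unfolding P_def power_mult [symmetric]
        using vge_p_power[of "a * r"] by (simp add: mult.commute)
      then have 2: "vge (real (r * a)) (of_nat (N choose r) * (- P) ^ r)"
        by (intro vge_mult0(2) vge_of_nat) (metis power_minus vge_mult_unit v_power v_one v_uminus)
      have "vge (real (r * a) + min (real n) (theta * (real (lev j) - real (i + r) * real p))) (of_nat (N choose r) * (- P) ^ r * coord (y * xq ^ r) j)"
        by (rule vge_mult[OF 2 1])
      moreover have "min (real (Suc n)) (theta * (real (lev j) - real i * real p)) \<le> real (r * a) + min (real n) (theta * (real (lev j) - real (i + r) * real p))"
      proof -
        \<comment> \<open>Replacing i by i + r weakens the slope bound by r theta p = r (p - 1),
          exactly the valuation gained from P^r.\<close>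
        have "theta * (real (lev j) - real (i + r) * real p) = theta * (real (lev j) - real i * real p) - real r * (theta * real p)"
          by (simp add: algebra_simps)
        also have "\<dots> = theta * (real (lev j) - real i * real p) - real (r * a)"
          using theta ap by simp
        finally have e: "theta * (real (lev j) - real (i + r) * real p) = theta * (real (lev j) - real i * real p) - real (r * a)" .
        have "1 \<le> r * a" using r ap by simp
        then have "real (Suc n) \<le> real (r * a) + real n" by (metis add.commute of_nat_1 of_nat_add of_nat_mono plus_1_eq_Suc add_le_mono1)
        then show ?thesis unfolding e by (auto simp: min_def)
      qed
      ultimately show ?thesis using vge_mono by blast
    qed
    ultimately show ?thesis unfolding y_def[symmetric] by (simp only:) (intro vge_diff vge_sum, auto)
  qed
qed

lemma frobenius_pole_bound:
  assumes "h \<in> modforms (i * (p - 1)) (Zp v)"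
  shows "vge (theta * (real (lev j) - real i * real p)) (coord (fps_V p h * iE ^ i) j)"
    and "vge 0 (coord (fps_V p h * iE ^ i) j)"
proof -
  obtain n :: nat where n: "theta * (real (lev j) - real i * real p) \<le> real n" using real_arch_simple by blast
  show "vge (theta * (real (lev j) - real i * real p)) (coord (fps_V p h * iE ^ i) j)"
    using frobenius_pole_bound_aux[OF assms, of n j] n by (simp add: min_absorb2)
  show "vge 0 (coord (fps_V p h * iE ^ i) j)"
    by (rule coord_vf[OF vf_mult0(1)[OF vf_V[OF vf_modforms[OF assms]] vf_power0[OF vf_iE]]])
qed

text \<open>A rate that the two bounds of \<open>HH_coord\<close> support together. Frobenius
  multiplies pole orders by p, which leaves \<open>gam = sigma / p\<close>.\<close>

definition sigma :: real where "sigma = 2 * real p / (3 * (real p + 1))"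
definition gam :: real where "gam = 2 / (3 * (real p + 1))"

lemma gam: "0 < gam" "gam < theta" "sigma = gam * real p" "gam \<le> 1" "0 \<le> gam" "0 \<le> sigma"
proof -
  have p5: "real p \<ge> 5" using p_ge_5 by simp
  show g0: "0 < gam" "gam \<le> 1" "0 \<le> gam" using p5 by (auto simp: gam_def field_simps)
  show s: "sigma = gam * real p" by (simp add: sigma_def gam_def)
  then show "0 \<le> sigma" using g0 by simp
  have "gam \<le> 2 / 18" unfolding gam_def using p5 by (intro divide_left_mono) auto
  moreover have "theta \<ge> 4 / 5" using p5 by (simp add: theta_def field_simps)
  ultimately show "gam < theta" by simp
qed

lemma xq_0: "fps_nth xq 0 = 1"
  by (simp add: xq_def fps_V_nth EE_props(4) iE_0)

lemma vf_xq: "vf 1 (xq - 1)"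
proof -
  have "fps_V p (EE - 1) = fps_V p EE - 1" using p_gt_0 by (simp add: fps_V_diff)
  then have "vf 1 (fps_V p EE - 1)" using vf_V[OF EE_props(2)] by simp
  then have "vf 1 ((fps_V p EE - 1) - (EE - 1))" using EE_props(2) by (rule vf_diff)
  then have "vf 1 ((fps_V p EE - EE) * iE)" by (intro vf_mult0(1) vf_iE) simp
  then show ?thesis by (simp add: xq_def left_diff_distrib EE_iE)
qed

text \<open>The congruence of \<open>xq\<close> to 1 mod p settles the levels with
  \<open>gam\<close> l \<le> 1, that is up to 3/2 (p + 1). Beyond these the pole bound of slope
  \<open>theta\<close> is already stronger than the rate \<open>gam\<close>.\<close>

lemma ov_xq: "ov gam xq"
  unfolding ov_def
proof
  fix j
  define l where "l = real (lev j)"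
  have E: "EE \<in> modforms (1 * (p - 1)) (Zp v)" using EE_props(1) by simp
  have b: "vge (theta * (l - real p)) (coord xq j)" "vge 0 (coord xq j)"
    using frobenius_pole_bound[OF E, of j] by (simp_all add: xq_def l_def)
  show "vge (gam * real (lev j)) (coord xq j)"
  proof (cases "lev j = 0")
    case True
    then show ?thesis using b(2) by simp
  next
    case False
    have "j \<noteq> 0" using False lev_0 by metis
    have "ebas 0 = 1" by (simp add: ebas_def lev_0)
    then have "coord 1 j = 0" using coord_ebas[of 0 j] \<open>j \<noteq> 0\<close> by simp
    then have 1: "vge 1 (coord xq j)" using coord_vf[OF vf_xq, of j] by (simp add: coord_diff)
    show ?thesis
    proof (cases "gam * l \<le> 1")
      case True
      then show ?thesis using 1 vge_mono by (simp add: l_def)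
    next
      case big: False
      have p5: "real p \<ge> 5" using p_ge_5 by simp
      have l: "l > 3 / 2 * (real p + 1)"
        using big p5 by (simp add: gam_def field_simps)
      have "theta * (l - real p) \<ge> 4 / 5 * (l - real p)"
        using p5 l by (intro mult_right_mono) (auto simp: theta_def field_simps)
      moreover have "gam * l \<le> 1 / 9 * l"
        using p5 l by (intro mult_right_mono) (auto simp: gam_def field_simps)
      moreover have "1 / 9 * l \<le> 4 / 5 * (l - real p)" using l p5 by simp
      ultimately show ?thesis using b(1) vge_mono by (fastforce simp: l_def)
    qed
  qed
qed

definition xi :: "'a fps" where "xi = inverse xq"

lemma xq_xi: "xq * xi = 1" "xi * xq = 1"
proof -
  show "xi * xq = 1" unfolding xi_def using xq_0 by (intro inverse_mult_eq_1) simp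
  then show "xq * xi = 1" by (simp add: mult.commute)
qed

lemma ov_xi: "ov gam xi"
  unfolding xi_def by (intro ov_inverse ov_xq vf_xq xq_0) (use gam in auto)

lemma V_iE: "fps_V p iE = iE * xi"
proof -
  have "fps_V p EE * fps_V p iE = 1" using p_gt_0 by (simp add: EE_iE flip: fps_V_mult)
  moreover have "fps_V p EE = xq * EE" by (simp add: xq_def mult.assoc EE_iE)
  ultimately have "(xq * EE) * fps_V p iE = 1" by simp
  then have "(iE * xi) * ((xq * EE) * fps_V p iE) = iE * xi" by simp
  moreover have "(iE * xi) * ((xq * EE) * fps_V p iE) = (iE * EE) * ((xi * xq) * fps_V p iE)" by (simp add: mult_ac)
  ultimately show ?thesis using EE_iE xq_xi by simp
qed

text \<open>For a basis function of level i, the levels up to i p are paid for by its coordinate,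
  since \<open>sigma\<close> i = \<open>gam\<close> i p; above i p the pole bound grows with slope
  \<open>theta > gam\<close>. The powers of \<open>xi\<close> correct V(1/E) to 1/E.\<close>

lemma ov_V:
  assumes y: "ov sigma y"
  shows "ov gam (fps_V p y)"
proof -
  have "vge (gam * real (lev j)) (coord (fps_V p y) j)" for j
  proof -
    have "coord (fps_V p y) j = coord (fps_V p (trunc j y)) j"
      by (rule coord_cong) (auto simp: fps_V_nth trunc_nth intro!: trunc_nth [symmetric] order_trans[OF div_le_dividend])
    also have "fps_V p (trunc j y) = (\<Sum>s\<le>j. fps_const (coord y s) * fps_V p (ebas s))"
      unfolding trunc_def using p_gt_0
      by (induction j) (simp_all add: fps_V_add fps_V_mult)
    finally have eq: "coord (fps_V p y) j = coord (\<Sum>s\<le>j. fps_const (coord y s) * fps_V p (ebas s)) j" .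
    have "ov gam (fps_const (coord y s) * fps_V p (ebas s))" for s
    proof -
      define i where "i = lev s"
      have s: "s < dimk i" using lev_le_iff unfolding i_def by blast
      note B = Bs_props(1)[OF s]
      have "ov gam (fps_const (coord y s) * (fps_V p (Bs i s) * iE ^ i))"
        unfolding ov_def coord_scale
      proof
        fix k
        define c where "c = coord (fps_V p (Bs i s) * iE ^ i) k"
        have c: "vge (theta * (real (lev k) - real i * real p)) c" "vge 0 c"
          unfolding c_def by (rule frobenius_pole_bound[OF B])+
        have ys: "vge (sigma * real i) (coord y s)" using y by (simp add: ov_def i_def)
        show "vge (gam * real (lev k)) (coord y s * c)"
        proof (cases "real (lev k) \<le> real i * real p")
          case True
          then have "gam * real (lev k) \<le> gam * (real i * real p)" using gam by (intro mult_left_mono) auto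
          then have "gam * real (lev k) \<le> sigma * real i" using gam(3) by (simp add: mult_ac)
          then show ?thesis using vge_mult0(1)[OF ys c(2)] vge_mono by blast
        next
          case False
          then have "gam * (real (lev k) - real i * real p) \<le> theta * (real (lev k) - real i * real p)"
            using gam by (intro mult_right_mono) auto
          then have "gam * real (lev k) \<le> sigma * real i + theta * (real (lev k) - real i * real p)"
            using gam(3) by (simp add: algebra_simps)
          then show ?thesis using vge_mult[OF ys c(1)] vge_mono by blast
        qed
      qed
      then have "ov gam (fps_const (coord y s) * (fps_V p (Bs i s) * iE ^ i) * xi ^ i)"
        by (rule ov_mult[OF gam(5) _ ov_power[OF gam(5) ov_xi]])
      moreover have "fps_V p (ebas s) = fps_V p (Bs i s) * iE ^ i * xi ^ i"
        using p_gt_0 by (simp add: ebas_def i_def fps_V_mult fps_V_power V_iE power_mult_distrib mult.assoc)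
      ultimately show ?thesis by (simp add: mult.assoc)
    qed
    then have "ov gam (\<Sum>s\<le>j. fps_const (coord y s) * fps_V p (ebas s))" by (intro ov_sum)
    then show ?thesis unfolding eq by (simp add: ov_def)
  qed
  then show ?thesis by (simp add: ov_def)
qed

end

section \<open>The Eisenstein family\<close>

primrec fdiff :: "nat \<Rightarrow> (nat \<Rightarrow> 'b :: ab_group_add) \<Rightarrow> nat \<Rightarrow> 'b" where
  "fdiff 0 y = y"
| "fdiff (Suc n) y = fdiff n (\<lambda>x. y (Suc x) - y x)"

lemma fdiff_Suc': "fdiff (Suc n) y x = fdiff n y (Suc x) - fdiff n y x"
proof (induction n arbitrary: y x)
  case (Suc n)
  have "fdiff (Suc (Suc n)) y x = fdiff (Suc n) (\<lambda>x. y (Suc x) - y x) x" by simp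
  also have "\<dots> = fdiff n (\<lambda>x. y (Suc x) - y x) (Suc x) - fdiff n (\<lambda>x. y (Suc x) - y x) x" by (rule Suc.IH)
  finally show ?case by simp
qed auto

lemma fdiff_add: "fdiff n (\<lambda>x. y x + z x) x = fdiff n y x + fdiff n z x"
  by (induction n arbitrary: x) (simp_all add: fdiff_Suc' del: fdiff.simps(2))

lemma fdiff_newton:
  fixes y :: "nat \<Rightarrow> 'b :: comm_ring_1"
  shows "y (x + m) = (\<Sum>n\<le>m. of_nat (m choose n) * fdiff n y x)"
proof (induction m arbitrary: y)
  case (Suc m)
  have S1: "y (x + m) = (\<Sum>n\<le>m. of_nat (m choose n) * fdiff n y x)" by (rule Suc)
  have S2: "y (Suc (x + m)) - y (x + m) = (\<Sum>n\<le>m. of_nat (m choose n) * fdiff (Suc n) y x)"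
    using Suc[of "\<lambda>x. y (Suc x) - y x"] by simp
  have "(\<Sum>n\<le>m. of_nat (m choose n) * fdiff n y x) = (\<Sum>n\<le>Suc m. of_nat (m choose n) * fdiff n y x)" by (simp add: binomial_eq_0)
  also have "\<dots> = fdiff 0 y x + (\<Sum>n\<le>m. of_nat (m choose Suc n) * fdiff (Suc n) y x)"
    by (subst sum.atMost_Suc_shift) simp
  finally have S3: "(\<Sum>n\<le>m. of_nat (m choose n) * fdiff n y x) = fdiff 0 y x + (\<Sum>n\<le>m. of_nat (m choose Suc n) * fdiff (Suc n) y x)" .
  have "y (x + Suc m) = y (x + m) + (y (Suc (x + m)) - y (x + m))" by simp
  also have "\<dots> = fdiff 0 y x + (\<Sum>n\<le>m. of_nat (m choose Suc n) * fdiff (Suc n) y x) + (\<Sum>n\<le>m. of_nat (m choose n) * fdiff (Suc n) y x)"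
    unfolding S2 unfolding S1 unfolding S3 ..
  also have "\<dots> = fdiff 0 y x + (\<Sum>n\<le>m. of_nat (Suc m choose Suc n) * fdiff (Suc n) y x)"
    by (simp add: sum.distrib [symmetric] distrib_right [symmetric] add_ac del: fdiff.simps)
  also have "\<dots> = (\<Sum>n\<le>Suc m. of_nat (Suc m choose n) * fdiff n y x)"
    by (subst sum.atMost_Suc_shift) simp
  finally show ?case .
qed auto

context Katz
begin

text \<open>Modelled on u^m with u congruent to 1 mod p, where each difference gains a factor p. The
  offset a is there for the product rule.\<close>

definition dd :: "nat \<Rightarrow> (nat \<Rightarrow> 'a fps) \<Rightarrow> bool" where
  "dd a y \<longleftrightarrow> (\<forall>n x. vf (real (n + a)) (fdiff n y x))"

lemma dd_vf: "dd a y \<Longrightarrow> vf (real a) (y x)"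
  unfolding dd_def by (metis add_0 fdiff.simps(1))

lemma fdiff_shift: "fdiff n (\<lambda>x. y (Suc x)) x = fdiff n y (Suc x)"
  by (induction n arbitrary: y x) simp_all

lemma dd_shift: "dd a y \<Longrightarrow> dd a (\<lambda>x. y (Suc x))"
  unfolding dd_def fdiff_shift by blast

lemma dd_step: "dd a y \<Longrightarrow> dd (Suc a) (\<lambda>x. y (Suc x) - y x)"
  unfolding dd_def by (metis add_Suc_right add_Suc fdiff.simps(2))

text \<open>The Leibniz rule for differences. Differencing one factor raises its offset, which keeps
  the total n + a + b constant through the induction.\<close>

lemma dd_mult_aux: "dd a y \<Longrightarrow> dd b z \<Longrightarrow> vf (real (n + a + b)) (fdiff n (\<lambda>x. y x * z x) x)"
proof (induction n arbitrary: a b y z x)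
  case 0
  then show ?case using vf_mult[OF dd_vf dd_vf, of a y b z x x] by simp
next
  case (Suc n)
  have "(\<lambda>x. y (Suc x) * z (Suc x) - y x * z x) = (\<lambda>x. (y (Suc x) - y x) * z (Suc x) + y x * (z (Suc x) - z x))"
    by (simp add: algebra_simps)
  then have "fdiff (Suc n) (\<lambda>x. y x * z x) x =
      fdiff n (\<lambda>x. (y (Suc x) - y x) * z (Suc x)) x + fdiff n (\<lambda>x. y x * (z (Suc x) - z x)) x"
    by (simp add: fdiff_add)
  moreover have "vf (real (n + Suc a + b)) (fdiff n (\<lambda>x. (y (Suc x) - y x) * z (Suc x)) x)"
    by (rule Suc.IH[OF dd_step[OF Suc.prems(1)] dd_shift[OF Suc.prems(2)]])
  moreover have "vf (real (n + a + Suc b)) (fdiff n (\<lambda>x. y x * (z (Suc x) - z x)) x)"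
    by (rule Suc.IH[OF Suc.prems(1) dd_step[OF Suc.prems(2)]])
  ultimately show ?case using vf_add by simp
qed

lemma dd_mult: "dd 0 y \<Longrightarrow> dd 0 z \<Longrightarrow> dd 0 (\<lambda>x. y x * z x)"
  using dd_mult_aux[of 0 y 0 z] by (simp add: dd_def)

lemma dd_add: "dd 0 y \<Longrightarrow> dd 0 z \<Longrightarrow> dd 0 (\<lambda>x. y x + z x)"
  by (simp add: dd_def fdiff_add vf_add)

lemma dd_const: "vf 0 c \<Longrightarrow> dd 0 (\<lambda>x. c)"
proof -
  assume c: "vf 0 c"
  have "fdiff (Suc n) (\<lambda>x. c) x = 0" for n x
    by (induction n arbitrary: x) (simp_all add: fdiff_Suc' del: fdiff.simps(2))
  then have "vf (real n) (fdiff n (\<lambda>x. c) x)" for n x using c by (cases n) auto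
  then show ?thesis by (simp add: dd_def)
qed

lemma dd_power:
  assumes "vf 1 (u - 1)"
  shows "dd 0 (\<lambda>x. u ^ x)"
proof -
  have u: "vf 0 u" using vf_add[OF vf_mono[OF assms, of 0] vf_1] by simp
  have "fdiff n (\<lambda>x. u ^ x) x = (u - 1) ^ n * u ^ x" for n x
    by (induction n arbitrary: x) (simp_all add: fdiff_Suc' algebra_simps del: fdiff.simps(2))
  moreover have "vf (real n) ((u - 1) ^ n * u ^ x)" for n x
    using vf_power[OF assms, of n] u by (intro vf_mult0(1) vf_power0) simp_all
  ultimately show ?thesis by (simp add: dd_def)
qed

lemma fdiff_nth: "fps_nth (fdiff n y x) t = fdiff n (\<lambda>m. fps_nth (y m) t) x"
  by (induction n arbitrary: y x) simp_all

lemma fdiff_fps_const: "fdiff n (\<lambda>m. fps_const (s m)) x = fps_const (fdiff n s x)"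
  by (induction n arbitrary: s x) simp_all

lemma fdiff_vge:
  assumes "\<And>m. vge M (s m)"
  shows "vge M (fdiff n s x)"
  using assms
proof (induction n arbitrary: s x)
  case (Suc n)
  have "vge M (fdiff n (\<lambda>x. s (Suc x) - s x) x)"
    by (rule Suc.IH) (intro vge_diff Suc.prems)
  then show ?case by simp
qed simp

text \<open>Up to p^n a coefficient is an integral polynomial in u^m - 1 with u = (1 + p)^(p-1). As
  u is 1 mod p, the n-th difference of u^m gains p^n, and sums and products inherit this.\<close>

lemma dd_eis_family: "dd 0 (\<lambda>m. eis_family (pow_weight ((p - 1) * m)))"
proof -
  have "vge (real n) (fdiff n (\<lambda>m. fps_nth (eis_family (pow_weight ((p - 1) * m))) t) x)" for n x t
  proof -
    define s where "s = (\<lambda>m. fps_nth (eis_family (pow_weight ((p - 1) * m))) t)"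
    obtain Q where Q: "\<And>i. vge 0 (poly.coeff Q i)" "\<And>\<kappa>. \<kappa> \<in> weights_B p v \<Longrightarrow> vge (real n * mu \<kappa>) (fps_nth (eis_family \<kappa>) t - poly Q (weight_w p \<kappa>))"
      using iwasawa_eis_family[of t] unfolding iwasawa_def by meson
    define r where "r = (\<lambda>m. poly Q (weight_w p (pow_weight ((p - 1) * m))))"
    have "vge (real n) (s m - r m)" for m
      using Q(2)[OF pow_weight_in_B[of "(p - 1) * m"]] by (simp add: s_def r_def mu_pow_weight)
    then have 1: "vge (real n) (fdiff n (\<lambda>m. s m - r m) x)" by (rule fdiff_vge)
    define u :: 'a where "u = (1 + of_nat p) ^ (p - 1)"
    have "vge 1 (u - 1)" using vge_weight_w_pow[of "p - 1"] by (simp add: weight_w_pow u_def)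
    then have du: "dd 0 (\<lambda>m. fps_const u ^ m)" by (intro dd_power) (simp add: vf_def fps_eq_iff)
    have "dd 0 (\<lambda>m. fps_const (poly Q (u ^ m - 1)))"
      using Q(1)
    proof (induction Q)
      case 0
      then show ?case using dd_const[of 0] by simp
    next
      case (pCons a Q)
      have a: "vge 0 a" and Q: "\<And>i. vge 0 (poly.coeff Q i)" using pCons.prems[of 0] pCons.prems[of "Suc i" for i] by auto
      have "dd 0 (\<lambda>m. fps_const a + (fps_const u ^ m + fps_const (- 1)) * fps_const (poly Q (u ^ m - 1)))"
        using a by (intro dd_add dd_mult dd_const vf_const du pCons.IH Q) simp_all
      moreover have "fps_const a + (fps_const u ^ m + fps_const (- 1)) * fps_const (poly Q (u ^ m - 1)) = fps_const (poly (pCons a Q) (u ^ m - 1))" for m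
        by simp
      ultimately show ?case by (simp only:)
    qed
    moreover have "r m = poly Q (u ^ m - 1)" for m
      by (simp add: r_def weight_w_pow u_def power_mult)
    ultimately have "dd 0 (\<lambda>m. fps_const (r m))" by simp
    then have "vf (real n) (fps_const (fdiff n r x))" by (simp add: dd_def fdiff_fps_const)
    then have 2: "vge (real n) (fdiff n r x)" unfolding vf_def by (metis fps_nth_fps_const)
    have "fdiff n s x = fdiff n (\<lambda>m. s m - r m) x + fdiff n r x"
      by (simp flip: fdiff_add)
    then show ?thesis using vge_add[OF 1 2] by (simp add: s_def)
  qed
  then show ?thesis by (simp add: dd_def vf_def fdiff_nth)
qed

definition HH :: "nat \<Rightarrow> 'a fps" where
  "HH m = eis_family (pow_weight ((p - 1) * m)) * iE ^ m"

lemma HH_0: "HH 0 = 1"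
  by (simp add: HH_def eis_family_0)

lemma vf_iE_1: "vf 1 (iE - 1)"
proof -
  have "vf 1 (- (EE - 1) * iE)" by (intro vf_mult0(1) vf_uminus EE_props vf_iE)
  then show ?thesis by (simp add: left_diff_distrib EE_iE)
qed

lemma dd_HH: "dd 0 HH"
  unfolding HH_def [abs_def] by (intro dd_mult dd_eis_family dd_power vf_iE_1)

lemma vf_HH: "vf 1 (HH m - 1)"
proof (induction m)
  case (Suc m)
  have "vf (real (1 + 0)) (fdiff 1 HH m)" using dd_HH unfolding dd_def by blast
  then have "vf 1 (HH (Suc m) - HH m)" by simp
  then show ?case using vf_add[OF _ Suc] by fastforce
qed (simp add: HH_0)

lemma eis_family_nth_0: "fps_nth (eis_family \<kappa>) 0 = 1"
  by (simp add: eis_family_def)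

lemma HH_nth_0: "fps_nth (HH m) 0 = 1"
  by (simp add: HH_def eis_family_nth_0 iE_0 fps_power_zeroth)

text \<open>Above level j only p^(k-1) V(E_k) contributes, with k = (p - 1) j. The power of p alone
  gives p - 2. Combined with the pole bound it cancels the term theta j p = (p - 1) j, so the second
  estimate is independent of j.\<close>

lemma HH_coord:
  assumes j: "j \<ge> 1" and t: "lev t > j"
  shows "vge (real p - 2) (coord (HH j) t)" "vge (theta * real (lev t) - 1) (coord (HH j) t)"
proof -
  define k where "k = (p - 1) * j"
  define P :: 'a where "P = of_nat p ^ (k - 1)"
  have k: "(p - 1) dvd k" "k > 0" using j p_gt_1 by (auto simp: k_def)
  have "p - 1 \<le> k" using k by (intro dvd_imp_le)
  then have k1: "k - 1 \<ge> p - 2" using p_ge_5 by simp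
  have E: "eisenstein k \<in> modforms (j * (p - 1)) (Zp v)"
    using eisenstein_modforms(1)[OF k] by (simp add: k_def mult.commute)
  have vP: "vge (real (k - 1)) P" unfolding P_def by (rule vge_p_power)
  have "vge 1 (- P)" using vP k1 p_ge_5 vge_mono[of "real (k - 1)" P 1] by simp
  then have "v (1 + - P) = 0" by (intro v_add_unit[of 1 1]) auto
  then have u: "v (1 - P) = 0" by simp
  have "fps_const (1 - P) * HH j = eisenstein k * iE ^ j - fps_const P * (fps_V p (eisenstein k) * iE ^ j)"
    using eis_family_pow_weight[OF k] by (simp add: HH_def P_def k_def mult.assoc [symmetric] left_diff_distrib)
  then have "(1 - P) * coord (HH j) t = coord (eisenstein k * iE ^ j) t - P * coord (fps_V p (eisenstein k) * iE ^ j) t"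
    by (metis coord_scale coord_diff)
  moreover have "coord (eisenstein k * iE ^ j) t = 0" by (rule coord_modform(2)[OF E t])
  ultimately have eq: "(1 - P) * coord (HH j) t = - (P * coord (fps_V p (eisenstein k) * iE ^ j) t)" by simp
  have 1: "vge M (P * coord (fps_V p (eisenstein k) * iE ^ j) t) \<Longrightarrow> vge M (coord (HH j) t)" for M
    using eq vge_mult_unit[OF u, of M "coord (HH j) t"] by simp
  have rk: "real (k - 1) = (real p - 1) * real j - 1"
    using j p_gt_1 k by (simp add: k_def of_nat_diff)
  show "vge (real p - 2) (coord (HH j) t)"
  proof (rule 1, rule vge_mono)
    show "vge (real (k - 1)) (P * coord (fps_V p (eisenstein k) * iE ^ j) t)"
      by (rule vge_mult0(1)[OF vP frobenius_pole_bound(2)[OF E]])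
    show "real p - 2 \<le> real (k - 1)" using k1 p_ge_5 by linarith
  qed
  show "vge (theta * real (lev t) - 1) (coord (HH j) t)"
  proof (rule 1, rule vge_mono)
    show "vge (real (k - 1) + theta * (real (lev t) - real j * real p)) (P * coord (fps_V p (eisenstein k) * iE ^ j) t)"
      by (rule vge_mult[OF vP frobenius_pole_bound(1)[OF E]])
    have "theta * (real j * real p) = (theta * real p) * real j" by (simp only: mult_ac)
    then have "theta * (real (lev t) - real j * real p) = theta * real (lev t) - (real p - 1) * real j"
      by (simp only: right_diff_distrib theta(1))
    then show "theta * real (lev t) - 1 \<le> real (k - 1) + theta * (real (lev t) - real j * real p)"
      unfolding rk by linarith
  qed
qed

text \<open>Up to level p the entry p - 2 serves: sigma p \<le> p - 2 amounts to p^2 - 3 p - 6 \<ge>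
  0, which holds from p = 5 on. From level p + 1 on the other entry serves, because theta - sigma
  \<ge> 1 / (p + 1).\<close>

lemma sigma_bound:
  assumes "i \<ge> 1"
  shows "sigma * real i \<le> max (real p - 2) (theta * real i - 1)" "sigma \<le> 1"
proof -
  define q where "q = real p"
  have q: "q \<ge> 5" using p_ge_5 by (simp add: q_def)
  have s: "sigma * (3 * (q + 1)) = 2 * q" using q by (simp add: sigma_def q_def)
  show "sigma \<le> 1" using q by (simp add: sigma_def q_def[symmetric] field_simps)
  show "sigma * real i \<le> max (real p - 2) (theta * real i - 1)"
  proof (cases "i \<le> p")
    case True
    have "sigma * real i \<le> sigma * q" using True gam(6) by (intro mult_left_mono) (auto simp: q_def)
    also have "sigma * q \<le> q - 2"
    proof -
      have "q * q - 3 * q - 6 = (q - 5) * (q + 2) + 4" by (simp add: algebra_simps)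
      moreover have "0 \<le> (q - 5) * (q + 2)" using q by simp
      ultimately have "2 * q * q \<le> (q - 2) * (3 * (q + 1))" by (simp add: algebra_simps)
      then show ?thesis using q unfolding sigma_def q_def[symmetric] by (simp add: field_simps)
    qed
    finally show ?thesis by (simp add: q_def max_def)
  next
    case False
    then have "real (p + 1) \<le> real i" by (simp only: of_nat_le_iff)
    then have i: "real i \<ge> q + 1" by (simp add: q_def)
    have th: "theta - sigma = (q * q - 3) / (3 * q * (q + 1))"
      unfolding theta_def sigma_def q_def[symmetric] using q by (simp add: field_simps)
    have "q * q \<ge> 5 * q" using q by (intro mult_right_mono) auto
    then have b: "q * q - 3 \<ge> 3 * q" using q by linarith
    have pos: "0 < 3 * q * (q + 1)" using q by simp
    have "1 / (q + 1) = (3 * q) / (3 * q * (q + 1))" using q by simp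
    also have "\<dots> \<le> (q * q - 3) / (3 * q * (q + 1))" using b pos by (intro divide_right_mono) auto
    finally have d: "1 / (q + 1) \<le> theta - sigma" unfolding th .
    have "1 = (1 / (q + 1)) * (q + 1)" using q by simp
    also have "\<dots> \<le> (theta - sigma) * real i"
    proof (rule mult_mono[OF d i])
      have "0 \<le> 1 / (q + 1)" using q by simp
      then show "0 \<le> theta - sigma" using d by linarith
    qed (use q in simp)
    finally have "sigma * real i \<le> theta * real i - 1" by (simp add: algebra_simps)
    then show ?thesis by (rule max.coboundedI2)
  qed
qed

lemma coord_fdiff:
  assumes "\<And>j. j \<le> n \<Longrightarrow> vge M (coord (y (x + j)) t)"
  shows "vge M (coord (fdiff n y x) t)"
  using assms
proof (induction n arbitrary: x)
  case 0
  then show ?case using 0[of 0] by simp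
next
  case (Suc n)
  have "vge M (coord (fdiff n y (Suc x)) t)"
  proof (rule Suc.IH)
    fix j assume "j \<le> n"
    then show "vge M (coord (y (Suc x + j)) t)" using Suc.prems[of "Suc j"] by simp
  qed
  moreover have "vge M (coord (fdiff n y x) t)" using Suc.prems by (intro Suc.IH) auto
  ultimately show ?case by (simp add: fdiff_Suc' coord_diff vge_diff del: fdiff.simps(2))
qed

text \<open>Newton's formula at m = 0. At levels up to n the n-th difference is small because it is
  divisible by p^n and sigma \<le> 1; above n it only involves \<open>HH j\<close> with j \<le> n,
  for which \<open>HH_coord\<close> is uniform in j.\<close>

lemma ov_HH: "ov sigma (HH m)"
proof -
  have "ov sigma (fdiff n HH 0)" for n
    unfolding ov_def
  proof
    fix t
    define i where "i = lev t"
    have vn: "vf (real n) (fdiff n HH 0)" using dd_HH by (simp add: dd_def)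
    have 1: "vge (real n) (coord (fdiff n HH 0) t)" by (rule coord_vf[OF vn])
    show "vge (sigma * real (lev t)) (coord (fdiff n HH 0) t)"
    proof (cases "i \<le> n")
      case True
      have "sigma * real i \<le> 1 * real i"
        using sigma_bound(2)[of 1] by (intro mult_right_mono) auto
      then have "sigma * real i \<le> real n" using True by linarith
      then show ?thesis using 1 vge_mono by (simp add: i_def)
    next
      case False
      have "vge (max (real p - 2) (theta * real i - 1)) (coord (HH (0 + j)) t)" if "j \<le> n" for j
      proof (cases "j = 0")
        case True
        have "t \<noteq> 0" using False lev_0 by (metis i_def le0)
        have "ebas 0 = 1" by (simp add: ebas_def lev_0)
        then have "coord 1 t = 0" using coord_ebas[of 0 t] \<open>t \<noteq> 0\<close> by simp
        then show ?thesis using True by (simp add: HH_0)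
      next
        case nz: False
        then show ?thesis using HH_coord[of j t] that False by (auto simp: i_def max_def)
      qed
      then have "vge (max (real p - 2) (theta * real i - 1)) (coord (fdiff n HH 0) t)" by (rule coord_fdiff)
      then show ?thesis using sigma_bound(1)[of i] False vge_mono by (simp add: i_def)
    qed
  qed
  then have "ov sigma (\<Sum>n\<le>m. fps_const (of_nat (m choose n)) * fdiff n HH 0)"
    by (intro ov_sum ov_scale vge_of_nat)
  moreover have "HH m = (\<Sum>n\<le>m. fps_const (of_nat (m choose n)) * fdiff n HH 0)"
    using fdiff_newton[of HH 0 m] by (simp add: fps_of_nat)
  ultimately show ?thesis by simp
qed

section \<open>The quotient at classical weights and its interpolation\<close>

definition FF :: "('a \<Rightarrow> 'a) \<Rightarrow> 'a fps" where
  "FF \<kappa> = eis_family \<kappa> * inverse (fps_V p (eis_family \<kappa>))"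

text \<open>The powers of E cancel between numerator and denominator up to powers of V(E) / E.
  Products, powers and inverses of series congruent to 1 mod p keep the rate, so nothing is lost as
  m grows.\<close>

lemma ov_FF: "ov gam (FF (pow_weight ((p - 1) * m)))"
proof -
  define A where "A = eis_family (pow_weight ((p - 1) * m))"
  have A: "A = HH m * EE ^ m"
    by (simp add: A_def HH_def mult.assoc EE_iE_power)
  have VE: "fps_V p EE = xq * EE" by (simp add: xq_def mult.assoc EE_iE)
  have VA: "fps_V p A = fps_V p (HH m) * (xq ^ m * EE ^ m)"
    using p_gt_0 by (simp add: A fps_V_mult fps_V_power VE power_mult_distrib)
  define I where "I = inverse (fps_V p (HH m))"
  have V0: "fps_nth (fps_V p (HH m)) 0 = 1" by (simp add: fps_V_nth HH_nth_0)
  have I: "fps_V p (HH m) * I = 1"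
    unfolding I_def using inverse_mult_eq_1[of "fps_V p (HH m)"] V0 by (simp add: mult.commute)
  have "fps_V p (HH m - 1) = fps_V p (HH m) - 1" using p_gt_0 by (simp add: fps_V_diff)
  then have V1: "vf 1 (fps_V p (HH m) - 1)" using vf_V[OF vf_HH] by metis
  have x: "xq ^ m * xi ^ m = 1" by (simp add: xq_xi flip: power_mult_distrib)
  have "fps_V p A * (I * xi ^ m * iE ^ m) = (fps_V p (HH m) * I) * (xq ^ m * xi ^ m) * (EE ^ m * iE ^ m)"
    unfolding VA by (simp only: mult_ac)
  also have "\<dots> = 1" using I x EE_iE_power by simp
  finally have "inverse (fps_V p A) = I * xi ^ m * iE ^ m" by (rule fps_inverse_unique)
  then have "FF (pow_weight ((p - 1) * m)) = HH m * (I * xi ^ m) * (EE ^ m * iE ^ m)"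
    unfolding FF_def A_def[symmetric] A by (simp only: mult_ac)
  then have eq: "FF (pow_weight ((p - 1) * m)) = HH m * (I * xi ^ m)" using EE_iE_power by simp
  have "ov gam I" unfolding I_def using gam by (intro ov_inverse ov_V ov_HH V0 V1)
  moreover have "ov gam (HH m)"
    by (rule ov_mono[OF ov_HH]) (use gam p_gt_1 in \<open>auto simp: gam(3)\<close>)
  ultimately show ?thesis unfolding eq using gam by (intro ov_mult ov_power ov_xi) auto
qed

lemma iwasawa_fps_inverse:
  assumes "\<And>n. iwasawa (\<lambda>\<kappa>. fps_nth (Y \<kappa>) n)" "\<And>\<kappa>. fps_nth (Y \<kappa>) 0 = 1"
  shows "iwasawa (\<lambda>\<kappa>. fps_nth (inverse (Y \<kappa>)) n)"
proof (induction n rule: less_induct)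
  case (less n)
  have "fps_nth (inverse (Y \<kappa>)) n = fps_nth 1 n - (\<Sum>i<n. fps_nth (inverse (Y \<kappa>)) i * fps_nth (Y \<kappa>) (n - i))" for \<kappa>
  proof -
    have i: "inverse (Y \<kappa>) * Y \<kappa> = 1" using assms(2) by (intro inverse_mult_eq_1) simp
    have "fps_nth (inverse (Y \<kappa>) * Y \<kappa>) n = (\<Sum>i<n. fps_nth (inverse (Y \<kappa>)) i * fps_nth (Y \<kappa>) (n - i)) + fps_nth (inverse (Y \<kappa>)) n"
      using assms(2)[of \<kappa>] by (simp add: fps_mult_nth atLeast0AtMost lessThan_Suc_atMost [symmetric])
    then show ?thesis unfolding i by (simp add: algebra_simps)
  qed
  moreover have "iwasawa (\<lambda>\<kappa>. fps_nth 1 n - (\<Sum>i<n. fps_nth (inverse (Y \<kappa>)) i * fps_nth (Y \<kappa>) (n - i)))"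
    using less assms(1) by (intro iwasawa_diff iwasawa_const iwasawa_sum iwasawa_mult) auto
  ultimately show ?case by simp
qed

lemma iwasawa_FF: "iwasawa (\<lambda>\<kappa>. fps_nth (FF \<kappa>) n)"
proof -
  have "iwasawa (\<lambda>\<kappa>. fps_nth (fps_V p (eis_family \<kappa>)) n)" for n
    unfolding fps_V_nth using iwasawa_eis_family[of "n div p"] by (cases "p dvd n") (simp_all add: iwasawa_const)
  then have "iwasawa (\<lambda>\<kappa>. fps_nth (inverse (fps_V p (eis_family \<kappa>))) n)" for n
    by (intro iwasawa_fps_inverse) (auto simp: fps_V_nth eis_family_nth_0)
  then show ?thesis
    unfolding FF_def fps_mult_nth by (intro iwasawa_sum iwasawa_mult iwasawa_eis_family)
qed

lemma iwasawa_coord: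
  assumes "\<And>n. iwasawa (\<lambda>\<kappa>. fps_nth (Y \<kappa>) n)"
  shows "iwasawa (\<lambda>\<kappa>. coord (Y \<kappa>) j)"
proof (induction j rule: less_induct)
  case (less j)
  have "iwasawa (\<lambda>\<kappa>. fps_nth (Y \<kappa>) j - (\<Sum>t<j. coord (Y \<kappa>) t * fps_nth (ebas t) j))"
    using less assms ebas_props(3) by (intro iwasawa_diff iwasawa_sum iwasawa_mult iwasawa_const) (auto simp: vf_def)
  then show ?case by (simp add: coord.simps[of _ j])
qed

text \<open>c_p is \<open>gam\<close> times 1 - p / (p-1)^2, while interpolation costs only the
  factor 1 - 1/p; the latter is the larger one since (p-1)^2 \<le> p^2.\<close>

lemma c_const_bound: "0 < c_const p" "c_const p < 1" "c_const p \<le> gam * (real p - 1) / real p"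
proof -
  define q where "q = real p"
  have q: "q \<ge> 5" using p_ge_5 by (simp add: q_def)
  define s where "s = 1 - q / (q - 1)\<^sup>2"
  have c: "c_const p = gam * s"
    by (simp add: c_const_def gam_def s_def q_def)
  have "q * 5 \<le> q * q" using q by (intro mult_left_mono) auto
  moreover have "(q - 1)\<^sup>2 = q * q - 2 * q + 1" by (simp add: power2_eq_square algebra_simps)
  ultimately have sq: "q < (q - 1)\<^sup>2" using q by linarith
  then have s0: "0 < s" "s \<le> 1" using q by (auto simp: s_def)
  show "0 < c_const p" unfolding c using gam s0 by simp
  have "gam * s \<le> gam * 1" using gam s0 by (intro mult_left_mono) auto
  moreover have "gam < 1" using q unfolding gam_def q_def[symmetric] by simp
  ultimately show "c_const p < 1" unfolding c by linarith
  have "1 / q \<le> q / (q - 1)\<^sup>2"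
  proof -
    have "(q - 1)\<^sup>2 \<le> q\<^sup>2" using q by (intro power_mono) auto
    then show ?thesis using q sq by (simp add: field_simps power2_eq_square)
  qed
  then have "s \<le> (q - 1) / q" using q by (simp add: s_def diff_divide_distrib)
  then have "gam * s \<le> gam * ((q - 1) / q)" using gam by (intro mult_left_mono) auto
  then show "c_const p \<le> gam * (real p - 1) / real p" unfolding c by (simp add: q_def)
qed

lemma ov_FF_general:
  assumes K: "\<kappa> \<in> weights_B p v"
  shows "ov (c_const p * mu \<kappa>) (FF \<kappa>)"
  unfolding ov_def
proof
  fix j
  define l where "l = real (lev j)"
  have "vge (gam * l * (real p - 1) / real p * mu \<kappa>) (coord (FF \<kappa>) j)"
  proof (rule iwasawa_bound[OF iwasawa_coord[OF iwasawa_FF] _ _ K])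
    show "0 \<le> gam * l" using gam by (simp add: l_def)
    fix m :: nat
    show "vge (gam * l) (coord (FF (pow_weight ((p - 1) * m))) j)"
      using ov_FF[of m] by (simp add: ov_def l_def)
  qed
  moreover have "c_const p * mu \<kappa> * l \<le> gam * l * (real p - 1) / real p * mu \<kappa>"
  proof -
    have "c_const p * (mu \<kappa> * l) \<le> gam * (real p - 1) / real p * (mu \<kappa> * l)"
      using c_const_bound(3) mu_pos[OF K] by (intro mult_right_mono) (auto simp: l_def)
    then show ?thesis by (simp add: mult_ac)
  qed
  ultimately show "vge (c_const p * mu \<kappa> * real (lev j)) (coord (FF \<kappa>) j)"
    using vge_mono by (simp add: l_def)
qed

end

section \<open>Katz expansions\<close>

context Katz
begin

lemma is_subfield_value_field: "is_subfield (value_field v \<kappa>)"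
  unfolding is_subfield_def value_field_def by blast

lemma closed_value_field: "closed (value_field v \<kappa>)"
  unfolding value_field_def by (rule closed_Inter) blast

lemma Qp_subset_value_field: "Qp \<subseteq> value_field v \<kappa>"
  unfolding value_field_def by blast

lemma kappa_value_field: "x \<in> Zp_units v \<Longrightarrow> \<kappa> x \<in> value_field v \<kappa>"
  unfolding value_field_def by blast

lemma subring_value_field: "subring_set (value_field v \<kappa>)"
  using is_subfield_value_field by (auto simp: is_subfield_def subring_set_def)

lemma value_field_divide: "x \<in> value_field v \<kappa> \<Longrightarrow> y \<in> value_field v \<kappa> \<Longrightarrow> x / y \<in> value_field v \<kappa>"
  using is_subfield_value_field by (auto simp: is_subfield_def)

lemma of_nat_value_field: "of_nat n \<in> value_field v \<kappa>"
  using subring_set_of_int[OF subring_value_field, of "int n"] by simp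

lemma integers_of_iff: "x \<in> integers_of v K \<longleftrightarrow> x \<in> K \<and> vge 0 x"
  by (simp add: integers_of_def vge_def zero_ereal_def)

lemma subring_integers_of: "subring_set K \<Longrightarrow> subring_set (integers_of v K)"
  unfolding subring_set_def using vge_diff vge_mult0(1) by (auto simp: integers_of_iff)

text \<open>The field of values is closed by definition, so the limit of the Riemann sums stays in
  it.\<close>

lemma zeta_integral_value_field:
  assumes c: "coprime c p" and K: "\<kappa> \<in> weights_B p v"
  shows "zeta_integral p c \<kappa> \<in> value_field v \<kappa>"
proof (rule closed_sequentially[OF closed_value_field])
  show "msum c n (zeta_term \<kappa>) \<in> value_field v \<kappa>" for n
    unfolding msum_def
  proof (rule subring_set_sum[OF subring_value_field])
    fix a
    have "zeta_term \<kappa> a \<in> value_field v \<kappa>"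
      using subring_setD(1)[OF subring_value_field]
      by (auto simp: zeta_term_def intro!: value_field_divide kappa_value_field of_nat_Zp_units of_nat_value_field)
    moreover have "of_rat (bernoulli_measure p c n a) \<in> value_field v \<kappa>"
      using Qp_subset_value_field of_rat_Qp by blast
    ultimately show "zeta_term \<kappa> a * of_rat (bernoulli_measure p c n a) \<in> value_field v \<kappa>"
      by (rule subring_setD(6)[OF subring_value_field])
  qed
  show "(\<lambda>n. msum c n (zeta_term \<kappa>)) \<longlonglongrightarrow> zeta_integral p c \<kappa>"
    unfolding tendsto_iff_vge
  proof
    fix N :: nat
    obtain n0 :: nat where n0: "real N / mu \<kappa> \<le> real n0" using real_arch_simple by blast
    have "vge (real N) (msum c n (zeta_term \<kappa>) - zeta_integral p c \<kappa>)" if "n \<ge> n0" for n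
    proof -
      have "real N / mu \<kappa> \<le> real n" using n0 that by linarith
      then have "real N \<le> mu \<kappa> * real n" using mu_pos[OF K] by (simp add: field_simps)
      then have "vge (real N) (zeta_integral p c \<kappa> - msum c n (zeta_term \<kappa>))"
        using zeta_integral_limit[OF c K] vge_mono by blast
      then show ?thesis by (simp add: vge_diff_commute)
    qed
    then show "\<forall>\<^sub>F n in sequentially. vge (real N) (msum c n (zeta_term \<kappa>) - zeta_integral p c \<kappa>)"
      unfolding eventually_sequentially by blast
  qed
qed

lemma eis_family_value_field:
  assumes K: "\<kappa> \<in> weights_B p v"
  shows "fps_nth (eis_family \<kappa>) n \<in> value_field v \<kappa>"
proof (cases "n = 0")
  case False
  note R = subring_setD[OF subring_value_field]
  have w: "weight_w p \<kappa> \<in> value_field v \<kappa>"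
    unfolding weight_w_def by (intro R(5) kappa_value_field one_plus_p_Zp_units R(2))
  have "2 * weight_w p \<kappa> * inverse (zeta_integral p (1 + p) \<kappa>) \<in> value_field v \<kappa>"
    using w of_nat_value_field[of 2] unfolding divide_inverse [symmetric]
    by (intro value_field_divide zeta_integral_value_field coprime_Suc_p K R(6)) auto
  then have "zeta_inv \<kappa> \<in> value_field v \<kappa>" by (simp only: zeta_inv_def)
  moreover have "(\<Sum>d | d dvd n \<and> \<not> p dvd d. \<kappa> (of_nat d) / of_nat d) \<in> value_field v \<kappa>"
    by (intro subring_set_sum[OF subring_value_field] value_field_divide of_nat_value_field)
      (auto intro: kappa_value_field of_nat_Zp_units)
  ultimately have "zeta_inv \<kappa> * (\<Sum>d | d dvd n \<and> \<not> p dvd d. \<kappa> (of_nat d) / of_nat d) \<in> value_field v \<kappa>"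
    by (rule R(6))
  then show ?thesis using False by (simp add: eis_family_def)
qed (use subring_setD(2)[OF subring_value_field] in \<open>simp add: eis_family_def\<close>)

lemma FF_value_field:
  assumes K: "\<kappa> \<in> weights_B p v"
  shows "fps_nth (FF \<kappa>) n \<in> integers_of v (value_field v \<kappa>)"
proof -
  define S where "S = {f :: 'a fps. \<forall>n. fps_nth f n \<in> value_field v \<kappa>}"
  have S: "subring_set S" unfolding S_def by (rule subring_set_fps[OF subring_value_field])
  have e: "eis_family \<kappa> \<in> S" using eis_family_value_field[OF K] by (simp add: S_def)
  have "fps_nth (fps_V p (eis_family \<kappa>)) n \<in> value_field v \<kappa>" for n
    using eis_family_value_field[OF K] subring_setD(1)[OF subring_value_field] by (simp add: fps_V_nth)
  then have "inverse (fps_V p (eis_family \<kappa>)) \<in> S"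
    using subring_set_fps_inverse[OF subring_value_field, of "fps_V p (eis_family \<kappa>)"] eis_family_nth_0
    by (simp add: S_def fps_V_nth)
  then have "FF \<kappa> \<in> S" unfolding FF_def by (rule subring_setD(6)[OF S e])
  then show ?thesis
    using iwasawa_vge0[OF iwasawa_FF K] by (simp add: S_def integers_of_iff)
qed

lemma lev_eq_0_iff: "lev j = 0 \<longleftrightarrow> j = 0"
  using lev_le_iff[of j 0] unfolding dimk_0 by simp

lemma katz_indices_lev:
  assumes "i \<ge> 1"
  shows "katz_indices p i TYPE('a) = {j. lev j = i}"
proof (rule set_eqI)
  fix j
  have "j \<in> katz_indices p i TYPE('a) \<longleftrightarrow> \<not> lev j \<le> i - 1 \<and> lev j \<le> i"
    unfolding lev_le_iff by (auto simp: katz_indices_def dimk_def)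
  also have "\<dots> \<longleftrightarrow> lev j = i" using assms by linarith
  finally show "j \<in> katz_indices p i TYPE('a) \<longleftrightarrow> j \<in> {j. lev j = i}" by simp
qed

lemma Bs_lev: "i \<ge> 1 \<Longrightarrow> lev j = i \<Longrightarrow> Bs i j = g i j"
  using lev_le_iff[of j "i - 1"] by (cases i) auto

definition katz_part :: "'a fps \<Rightarrow> nat \<Rightarrow> 'a fps" where
  "katz_part y i = (\<Sum>j | lev j = i. fps_const (coord y j) * Bs i j)"

lemma katz_part_ring:
  assumes R: "subring_set R" "Zp v \<subseteq> R" and y: "\<And>n. fps_nth y n \<in> R"
  shows "katz_part y i \<in> katz_B p g R i" and "katz_part y i \<in> modforms (i * (p - 1)) R"
proof -
  note c = coord_ring[OF R y]
  show "katz_part y i \<in> katz_B p g R i"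
  proof (cases "i = 0")
    case True
    then show ?thesis using c by (simp add: katz_part_def katz_B_def lev_eq_0_iff)
  next
    case False
    have "fps_const (coord y j) * Bs i j \<in> span_over R (g i ` {j. lev j = i})" if "lev j = i" for j
      using that False c Bs_lev[of i j] by (intro span_over_scale_base[OF R(1)]) auto
    then have "katz_part y i \<in> span_over R (g i ` {j. lev j = i})"
      unfolding katz_part_def by (intro span_over_sum[OF R(1)]) auto
    then show ?thesis using False by (simp add: katz_B_def katz_indices_lev)
  qed
  show "katz_part y i \<in> modforms (i * (p - 1)) R"
    unfolding katz_part_def
  proof (intro modforms_sum[OF R(1)] modforms_scale[OF R(1)] c)
    fix j assume "j \<in> {j. lev j = i}"
    then have "j < dimk i" using lev_le_iff[of j i] by simp
    then show "Bs i j \<in> modforms (i * (p - 1)) R" using Bs_props(1) modforms_mono[OF R(2)] by blast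
  qed
qed

text \<open>Basis functions above the level of n have order larger than n, so for each coefficient
  the series is a finite sum, namely the coordinate expansion.\<close>

lemma katz_part_sums: "qexp_sums (\<lambda>i. katz_part y i * iE ^ i) y"
  unfolding qexp_sums_def
proof
  fix n
  define L where "L = lev n"
  have nth: "fps_nth (katz_part y i * iE ^ i) n = (\<Sum>j | lev j = i. coord y j * fps_nth (ebas j) n)" for i
  proof -
    have "katz_part y i * iE ^ i = (\<Sum>j | lev j = i. fps_const (coord y j) * (Bs i j * iE ^ i))"
      by (simp add: katz_part_def sum_distrib_right mult.assoc)
    also have "\<dots> = (\<Sum>j | lev j = i. fps_const (coord y j) * ebas j)"
      by (intro sum.cong refl) (simp add: ebas_def)
    finally show ?thesis by (simp add: fps_sum_nth)
  qed
  have z: "fps_nth (katz_part y i * iE ^ i) n = 0" if "i \<notin> {..L}" for i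
    unfolding nth
  proof (rule sum.neutral, rule ballI)
    fix j assume "j \<in> {j. lev j = i}"
    then have "\<not> lev j \<le> L" using that by auto
    then have "\<not> j < dimk L" unfolding lev_le_iff .
    moreover have "n < dimk L" using lev_le_iff[of n L] by (simp add: L_def)
    ultimately show "coord y j * fps_nth (ebas j) n = 0" using ebas_props(2) by simp
  qed
  have "(\<lambda>i. fps_nth (katz_part y i * iE ^ i) n) sums (\<Sum>i\<le>L. fps_nth (katz_part y i * iE ^ i) n)"
    by (rule sums_finite) (use z in auto)
  also have "(\<Sum>i\<le>L. fps_nth (katz_part y i * iE ^ i) n) =
      (\<Sum>i\<le>L. \<Sum>j | j \<in> {..<dimk L} \<and> lev j = i. coord y j * fps_nth (ebas j) n)"
    unfolding nth
  proof (rule sum.cong [OF refl])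
    fix i assume "i \<in> {..L}"
    then have "{j. lev j = i} = {j. j \<in> {..<dimk L} \<and> lev j = i}" by (auto simp flip: lev_le_iff)
    then show "(\<Sum>j | lev j = i. coord y j * fps_nth (ebas j) n) = (\<Sum>j | j \<in> {..<dimk L} \<and> lev j = i. coord y j * fps_nth (ebas j) n)"
      by (simp only:)
  qed
  also have "\<dots> = (\<Sum>j<dimk L. coord y j * fps_nth (ebas j) n)"
    by (rule sum.group) (auto simp: lev_le_iff)
  also have "{..<dimk L} = {..dimk L - 1}" using dimk_pos[of L] by auto
  also have "(\<Sum>j\<le>dimk L - 1. coord y j * fps_nth (ebas j) n) = fps_nth y n"
  proof (rule coord_expand [symmetric])
    have "n < dimk L" using lev_le_iff[of n L] by (simp add: L_def)
    then show "n \<le> dimk L - 1" by simp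
  qed
  finally show "(\<lambda>i. fps_nth (katz_part y i * iE ^ i) n) sums fps_nth y n" .
qed

lemma v_fps_katz_part:
  assumes "ov \<rho> y"
  shows "ereal (\<rho> * real i) \<le> v_fps v (katz_part y i)"
  unfolding vf_v_fps katz_part_def
proof (rule vf_sum)
  fix j assume j: "j \<in> {j. lev j = i}"
  then have "j < dimk i" using lev_le_iff[of j i] by simp
  then have "vf 0 (Bs i j)" using vf_modforms[OF Bs_props(1)] by blast
  moreover have "vge (\<rho> * real i) (coord y j)" using assms j by (auto simp: ov_def)
  ultimately show "vf (\<rho> * real i) (fps_const (coord y j) * Bs i j)" by (intro vf_mult0(1) vf_const)
qed

text \<open>The witness r = 1 suffices: its growth conditions reduce to integrality and convergence
  of the Katz coefficients to 0, which \<rho> > 0 provides, while the rate itself is carried by the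
  separate bound on these coefficients.\<close>

lemma overconvergent_ge_of_ov:
  assumes R: "subring_set R" "Zp v \<subseteq> R" and y: "\<And>n. fps_nth y n \<in> R" and \<rho>: "\<rho> > 0" "ov \<rho> y"
  shows "y \<in> overconvergent_ge p v g R (ereal \<rho>)"
proof -
  have E0: "fps_nth EE 0 \<noteq> 0" using EE_props(4) by simp
  have div: "katz_part y i / EE ^ i = katz_part y i * iE ^ i" for i
    using E0 by (simp add: fps_divide_unit iE_def fps_inverse_power fps_power_zeroth)
  have one: "fps_const 1 / EE = iE" using E0 by (simp add: fps_divide_unit iE_def)
  have lim: "(\<lambda>i. v_fps v (katz_part y i)) \<longlonglongrightarrow> \<infinity>"
    unfolding tendsto_PInfty
  proof
    fix r
    obtain n0 :: nat where n0: "r / \<rho> < real n0" using reals_Archimedean2 by blast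
    have "ereal r < v_fps v (katz_part y i)" if "i \<ge> n0" for i
    proof -
      have "r / \<rho> < real i" using n0 that by linarith
      then have "ereal r < ereal (\<rho> * real i)" using \<rho>(1) by (simp add: field_simps)
      then show ?thesis using v_fps_katz_part[OF \<rho>(2)] by (rule less_le_trans)
    qed
    then show "\<forall>\<^sub>F i in sequentially. ereal r < v_fps v (katz_part y i)"
      unfolding eventually_sequentially by blast
  qed
  have nn: "0 \<le> v_fps v (katz_part y i)" for i
  proof -
    have "0 \<le> ereal (\<rho> * real i)" using \<rho>(1) by simp
    then show ?thesis using v_fps_katz_part[OF \<rho>(2)] by (rule order_trans)
  qed
  have "katz_expansion p v g R 1 (katz_part y) y"
    unfolding katz_expansion_def EE_def [symmetric] div
    using katz_part_ring(1)[OF R y] nn lim katz_part_sums[of y] by simp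
  moreover have "y \<in> overconvergent p v R 1"
    unfolding overconvergent_def EE_def [symmetric] one
    using katz_part_ring(2)[OF R y] lim katz_part_sums[of y] by blast
  moreover have "ereal \<rho> * ereal (real i) \<le> v_fps v (katz_part y i)" for i
    using v_fps_katz_part[OF \<rho>(2), of i] by simp
  ultimately show ?thesis
    unfolding overconvergent_ge_def using subring_setD(2)[OF R(1)] by blast
qed

lemma eisenstein_star_quotient:
  assumes "\<kappa> \<in> weights_B p v" "\<kappa> \<noteq> trivial_weight v"
  shows "eisenstein_star p \<kappa> / frobenius_V p (eisenstein_star p \<kappa>) = FF \<kappa>"
proof -
  have V: "frobenius_V p f = fps_V p f" for f :: "'a fps"
    by (rule fps_ext) (use p_gt_0 in \<open>simp add: frobenius_V_def fps_V_nth fps_nth_compose_X_power\<close>)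
  have "fps_nth (fps_V p (eis_family \<kappa>)) 0 \<noteq> 0" by (simp add: fps_V_nth eis_family_nth_0)
  then show ?thesis
    unfolding eisenstein_star_eq_family[OF assms] V FF_def by (rule fps_divide_unit)
qed

lemma eisenstein_star_overconvergent:
  assumes K: "\<kappa> \<in> weights_B p v" "\<kappa> \<noteq> trivial_weight v"
  shows "eisenstein_star p \<kappa> / frobenius_V p (eisenstein_star p \<kappa>) \<in>
    overconvergent_ge p v g (integers_of v (value_field v \<kappa>)) (ereal (c_const p) * min 1 (v (weight_w p \<kappa>)))"
proof -
  have "FF \<kappa> \<in> overconvergent_ge p v g (integers_of v (value_field v \<kappa>)) (ereal (c_const p * mu \<kappa>))"
  proof (rule overconvergent_ge_of_ov)
    show "subring_set (integers_of v (value_field v \<kappa>))"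
      by (rule subring_integers_of[OF subring_value_field])
    show "Zp v \<subseteq> integers_of v (value_field v \<kappa>)"
      by (auto simp: Zp_iff integers_of_iff intro: subsetD[OF Qp_subset_value_field])
    show "0 < c_const p * mu \<kappa>" using c_const_bound(1) mu_pos[OF K(1)] by simp
  qed (rule FF_value_field[OF K(1)] ov_FF_general[OF K(1)])+
  then show ?thesis
    unfolding eisenstein_star_quotient[OF K] ereal_mu[OF K(1), symmetric] by simp
qed

end

theorem theoremA:
  fixes p :: nat
    and v :: "'a :: {alg_closed_field, field_char_0, complete_space} \<Rightarrow> ereal"
    and g :: "nat \<Rightarrow> nat \<Rightarrow> 'a fps"
    and \<kappa> :: "'a \<Rightarrow> 'a"
  assumes "prime p" and "p \<ge> 5"
    and "Cp p v"
    and "katz_splitting p v g"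
    and "\<kappa> \<in> weights_B p v - {trivial_weight v}"
  shows "0 < c_const p \<and> c_const p < 1 \<and>
    eisenstein_star p \<kappa> / frobenius_V p (eisenstein_star p \<kappa>) \<in>
      overconvergent_ge p v g (integers_of v (value_field v \<kappa>))
        (ereal (c_const p) * min 1 (v (weight_w p \<kappa>)))"
proof -
  interpret Cp p v by fact
  interpret Katz p v g using assms(2,4) by unfold_locales
  show ?thesis using assms(5) c_const_bound(1,2) eisenstein_star_overconvergent[of \<kappa>] by blast
qed

end
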